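(* Let $f$ be an admissible function and assume $\operatorname{supp}\widehat f\subseteq[-1,1]$. Then the variance of $W_f$ tends to $\sigma(f)^2=\int_{-1}^1|u|\,\widehat f(u)^2\,du$; that is, $$\lim_{q\to\infty}\left\langle\left(W_f-\langle W_f\rangle_q\right)^2\right\rangle_q=\int_{-1}^1|u|\,\widehat f(u)^2\,du,$$ where $q$ runs through odd primes.
   Context: The Fourier transform is $\widehat f(u)=\int_{-\infty}^\infty f(x)e^{-2\pi i xu}\,dx$. A function $f$ is admissible if it is a real, even function (on $\mathbb R$) whose Fourier transform $\widehat f$ is compactly supported and which satisfies $f(r)\ll(1+|r|)^{-1-\delta}$ for real $r$ and some $\delta>0$; such an $f$ extends to an entire function via $f(z)=\int\widehat f(u)e^{2\pi i zu}\,du$, so it may be evaluated at complex arguments. Let $q$ be an odd prime, $\chi$ a Dirichlet character modulo $q$, $\chi_0$ the trivial character modulo $q$, and $L(s,\chi)$ the Dirichlet $L$-function. For $\chi\ne\chi_0$ write the non-trivial zeros of $L(s,\chi)$ (with multiplicity) as $\tfrac12+i\gamma_{\chi,j}$; the Generalised Riemann Hypothesis is not assumed, so the $\gamma_{\chi,j}$ may be complex. Define $$W_f(\chi)=\sum_j f\left(\frac{\log q}{2\pi}\gamma_{\chi,j}\right),$$ the sum running over all non-trivial zeros of $L(s,\chi)$. For a function $X(\chi)$ of characters modulo $q$, $\langle X\rangle_q=\frac1{q-2}\sum_{\chi\ne\chi_0}X(\chi)$, the sum over all $q-2$ non-trivial characters modulo $q$. *)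

theory Defs
  imports "HOL-Complex_Analysis.Complex_Analysis" "HOL-Number_Theory.Number_Theory"
begin

definition fourier :: "(real \<Rightarrow> real) \<Rightarrow> real \<Rightarrow> complex" where
  "fourier f u = (\<integral>x. of_real (f x) * exp (- 2 * of_real pi * \<i> * of_real x * of_real u) \<partial>lborel)"

definition supp :: "(real \<Rightarrow> complex) \<Rightarrow> real set" where
  "supp g = closure {u. g u \<noteq> 0}"

text \<open>
  Integrability is what makes the Fourier transform meaningful; given the decay condition
  it only adds that \<open>f\<close> is measurable.
\<close>
definition admissible :: "(real \<Rightarrow> real) \<Rightarrow> bool" where
  "admissible f \<longleftrightarrow>
     integrable lborel f \<and>
     (\<forall>x. f (- x) = f x) \<and>
     compact (supp (fourier f)) \<and>
     (\<exists>\<delta>>0. \<exists>C. \<forall>r. \<bar>f r\<bar> \<le> C * (1 + \<bar>r\<bar>) powr (- 1 - \<delta>))"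

text \<open>The extension of an admissible function to an entire function, by Fourier inversion.\<close>
definition entire_extension :: "(real \<Rightarrow> real) \<Rightarrow> complex \<Rightarrow> complex" where
  "entire_extension f z = (\<integral>u. fourier f u * exp (2 * of_real pi * \<i> * z * of_real u) \<partial>lborel)"

text \<open>Characters of $(\mathbb{Z}/q\mathbb{Z})^\times$, extended by zero to all integers.\<close>
definition dirichlet_character :: "nat \<Rightarrow> (int \<Rightarrow> complex) \<Rightarrow> bool" where
  "dirichlet_character q chi \<longleftrightarrow>
     (\<forall>m n. chi (m * n) = chi m * chi n) \<and>
     (\<forall>n. chi (n + int q) = chi n) \<and>
     (\<forall>n. chi n \<noteq> 0 \<longleftrightarrow> coprime n (int q))"

definition trivial_character :: "nat \<Rightarrow> int \<Rightarrow> complex" where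
  "trivial_character q n = (if coprime n (int q) then 1 else 0)"

definition nontrivial_characters :: "nat \<Rightarrow> (int \<Rightarrow> complex) set" where
  "nontrivial_characters q = {chi. dirichlet_character q chi \<and> chi \<noteq> trivial_character q}"

text \<open>
  The analytic continuation of the Dirichlet series to the whole plane. This is meaningful only
  for non-trivial characters: for the trivial character there is a pole at 1, and hence no
  entire continuation.
\<close>
definition dirichlet_L :: "(int \<Rightarrow> complex) \<Rightarrow> complex \<Rightarrow> complex" where
  "dirichlet_L chi = (THE L. L holomorphic_on UNIV \<and>
     (\<forall>s. Re s > 1 \<longrightarrow> (\<lambda>n. chi (int (Suc n)) / of_nat (Suc n) powr s) sums L s))"

text \<open>The zeros in the open critical strip.\<close>
definition nontrivial_zeros :: "(int \<Rightarrow> complex) \<Rightarrow> complex set" where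
  "nontrivial_zeros chi = {\<rho>. dirichlet_L chi \<rho> = 0 \<and> 0 < Re \<rho> \<and> Re \<rho> < 1}"

text \<open>
  A zero is written \<open>\<rho> = 1/2 + \<i> \<gamma>\<close> with complex \<open>\<gamma>\<close>; it is counted with its multiplicity
  \<open>zorder (dirichlet_L chi) \<rho>\<close>.
\<close>
definition W_sum :: "(real \<Rightarrow> real) \<Rightarrow> nat \<Rightarrow> (int \<Rightarrow> complex) \<Rightarrow> complex" where
  "W_sum f q chi = (\<Sum>\<^sub>\<infinity>\<rho>\<in>nontrivial_zeros chi.
     of_int (zorder (dirichlet_L chi) \<rho>) *
     entire_extension f (of_real (ln (real q) / (2 * pi)) * ((\<rho> - 1 / 2) / \<i>)))"

definition character_mean :: "nat \<Rightarrow> ((int \<Rightarrow> complex) \<Rightarrow> complex) \<Rightarrow> complex" where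
  "character_mean q X = 1 / (of_nat q - 2) * (\<Sum>chi\<in>nontrivial_characters q. X chi)"

end

theory Submission
 imports Defs "HOL-Probability.Probability" "HOL-Real_Asymp.Real_Asymp"
begin

text \<open>
 The explicit formula, which needs no hypothesis on the zeros, turns the zero sum into a constant
 depending only on the parity of \<open>chi\<close> minus the real sum
 \<open>S chi = (1 / ln q) * (\<Sum>n < q. mangoldt n / sqrt n * h (ln n / ln q) * (chi n + cnj (chi n)))\<close>,
 where \<open>h = fourier f\<close>; here the support condition \<open>ln n / ln q \<le> 1\<close> cuts the sum at \<open>q\<close>.
 The constants of the two parities differ by \<open>O(1 / ln q)\<close>. By orthogonality of characters the mean
 of \<open>S\<close> is negligible, and the mean of its square consists of the diagonal \<open>n = m\<close>, which Mertens' theorem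
 evaluates as the claimed integral, and of the pairs with \<open>n * m = 1\<close> modulo \<open>q\<close>, which are negligible.
\<close>

text \<open>Three obstacles shape the proof. The decay of \<open>f\<close> is only of order
  \<open>- 1 - delta\<close>, so sums over zeros converge with little room: \<open>xi\<close> is
  bounded by \<open>exp (C * (1 + norm s) powr kappa)\<close> for every \<open>kappa > 1\<close>,
  which makes \<open>(1 + norm rho) powr (- 1 - eps)\<close> summable over its zeros for every
  \<open>eps > 0\<close>. No contour is threaded between zeros; the partial fractions of the
  logarithmic derivative of \<open>xi\<close> are integrated over the lines of real part 2 and -1,
  one zero at a time. That \<open>nontrivial_zeros\<close> comprises all zeros of \<open>xi\<close>
  rests on the non-vanishing of the L-function on the line of real part 1. Finally, the support may
  reach the ends of \<open>[-1, 1]\<close>. There absolute values only show that the inverse pairs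
  and the share of the trivial character in the mean square are bounded; continuity of
  \<open>h\<close> forces \<open>h 1 = 0\<close>, and this makes both tend to 0.\<close>

section \<open>Test functions\<close>

text \<open>Differentiation under the integral sign by dominated convergence; the difference quotients
 are dominated because Cauchy's inequality bounds the derivatives uniformly.\<close>
lemma holomorphic_lebesgue_integral:
 fixes f :: "complex \<Rightarrow> real \<Rightarrow> complex"
 assumes U: "open U"
  and hol: "\<And>t. (\<lambda>z. f z t) holomorphic_on U"
  and meas: "\<And>z. z \<in> U \<Longrightarrow> f z \<in> borel_measurable lborel"
  and dom: "\<And>w. w \<in> U \<Longrightarrow> \<exists>r>0. \<exists>g. cball w r \<subseteq> U \<and> integrable lborel g \<and> (\<forall>z\<in>cball w r. \<forall>t. norm (f z t) \<le> g t)"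
 shows "(\<lambda>z. LBINT t. f z t) holomorphic_on U"
proof (rule holomorphic_onI)
 fix w assume w: "w \<in> U"
 obtain r g where r: "r > 0" "cball w r \<subseteq> U" "integrable lborel g" "\<And>z t. z \<in> cball w r \<Longrightarrow> norm (f z t) \<le> g t"
  using dom[OF w] by blast
 have int: "integrable lborel (f z)" if "z \<in> cball w r" for z
  by (rule Bochner_Integration.integrable_bound[OF r(3)])
    (use that r meas in \<open>auto intro!: AE_I2 intro: order_trans[OF _ abs_ge_self]\<close>)
 define f' where "f' = (\<lambda>t. deriv (\<lambda>z. f z t) w)"
 have D: "((\<lambda>z. f z t) has_field_derivative deriv (\<lambda>z. f z t) z) (at z)" if "z \<in> U" for z t
  by (rule holomorphic_derivI[OF hol U that])
 have bd: "norm (deriv (\<lambda>z. f z t) z) \<le> 2 / r * g t" if z: "z \<in> cball w (r/2)" for z t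
 proof -
  have sub: "cball z (r/2) \<subseteq> cball w r"
  proof
   fix x assume "x \<in> cball z (r/2)" thus "x \<in> cball w r" using z dist_triangle[of w x z] by auto
  qed
  hence "cball z (r/2) \<subseteq> U" using r by blast
  have "norm ((deriv ^^ 1) (\<lambda>z. f z t) z) \<le> fact 1 * g t / (r/2) ^ 1"
  proof (rule Cauchy_inequality)
   show "(\<lambda>z. f z t) holomorphic_on ball z (r/2)" using hol \<open>cball z (r/2) \<subseteq> U\<close>
    by (meson ball_subset_cball holomorphic_on_subset subset_trans)
   show "continuous_on (cball z (r/2)) (\<lambda>z. f z t)" using hol \<open>cball z (r/2) \<subseteq> U\<close>
    by (meson holomorphic_on_imp_continuous_on continuous_on_subset)
   show "norm (f x t) \<le> g t" if "norm (z - x) = r/2" for x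
    using sub that by (intro r(4)) (auto simp: dist_norm subset_iff)
  qed (use r in auto)
  thus ?thesis by (simp add: field_simps)
 qed
 have "((\<lambda>z. LBINT t. f z t) has_field_derivative (LBINT t. f' t)) (at w)"
  unfolding DERIV_def tendsto_at_iff_sequentially comp_def
 proof (intro allI impI)
  fix X :: "nat \<Rightarrow> complex" assume X: "\<forall>i. X i \<in> UNIV - {0}" "X \<longlonglongrightarrow> 0"
  \<comment> \<open>Setting the quotient to 0 for large increments makes the domination hold for
    every index; the limit only sees small increments.\<close>
  let ?q = "\<lambda>h t. if norm h \<le> r/2 then (f (w + h) t - f w t) / h else 0"
  have sub: "w + h \<in> cball w r" if "norm h \<le> r/2" for h using that r(1) by (auto simp: dist_norm)
  have ev: "eventually (\<lambda>n. norm (X n) \<le> r / 2) sequentially"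
   using tendstoD[OF X(2), of "r/2"] r(1) by (auto elim!: eventually_mono)
  have qm: "?q (X n) \<in> borel_measurable lborel" for n
  proof (cases "norm (X n) \<le> r/2")
   case True
   have "w + X n \<in> U" using sub[OF True] r(2) by auto
   thus ?thesis using True meas[OF w] meas[of "w + X n"] by simp
  qed simp
  have ptw: "(\<lambda>n. ?q (X n) t) \<longlonglongrightarrow> f' t" for t
  proof -
   have "(\<lambda>n. (f (w + X n) t - f w t) / X n) \<longlonglongrightarrow> f' t"
    using D[OF w, of t] X unfolding DERIV_def tendsto_at_iff_sequentially comp_def f'_def by auto
   thus ?thesis
    by (rule Lim_transform_eventually) (use ev in \<open>auto elim!: eventually_mono\<close>)
  qed
  have f'm: "f' \<in> borel_measurable lborel"
   by (rule borel_measurable_LIMSEQ_metric[OF qm ptw])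
  have "(\<lambda>n. LBINT t. ?q (X n) t) \<longlonglongrightarrow> (LBINT t. f' t)"
  proof (rule integral_dominated_convergence[where w = "\<lambda>t. 2 / r * g t"])
   show "AE t in lborel. norm (?q (X n) t) \<le> 2 / r * g t" for n
   proof (rule AE_I2, cases "norm (X n) \<le> r/2")
    case True
    fix t
    have "norm (f (w + X n) t - f w t) \<le> 2 / r * g t * norm (w + X n - w)"
     by (rule field_differentiable_bound[of "cball w (r/2)" "\<lambda>z. f z t" "deriv (\<lambda>z. f z t)"])
       (use bd True r in \<open>auto intro!: has_field_derivative_at_within D simp: dist_norm subset_iff\<close>)
    thus "norm (?q (X n) t) \<le> 2 / r * g t" using True X(1) by (auto simp: norm_divide field_simps)
   next
    case False
    fix t
    have "0 \<le> g t" using order_trans[OF norm_ge_zero r(4)[of w t]] r(1) by auto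
    thus "norm (?q (X n) t) \<le> 2 / r * g t" using False r(1) by simp
   qed
  qed (use r f'm qm ptw in auto)
  moreover have "eventually (\<lambda>n. (LBINT t. ?q (X n) t) =
    ((LBINT t. f (w + X n) t) - (LBINT t. f w t)) / X n) sequentially"
   using ev
  proof eventually_elim
   case (elim n)
   thus ?case using int[OF sub[OF elim]] int[of w] r(1) by simp
  qed
  ultimately show "(\<lambda>n. ((LBINT t. f (w + X n) t) - (LBINT t. f w t)) / X n) \<longlonglongrightarrow> (LBINT t. f' t)"
   by (rule Lim_transform_eventually)
 qed
 thus "(\<lambda>z. LBINT t. f z t) field_differentiable (at w within U)"
  using field_differentiable_at_within field_differentiable_def by blast
qed

definition e2pi :: "complex \<Rightarrow> complex" where
 "e2pi z = exp (2 * of_real pi * \<i> * z)"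

lemma e2pi_add: "e2pi (z + w) = e2pi z * e2pi w"
 by (simp add: e2pi_def algebra_simps exp_add)

lemma norm_e2pi [simp]: "norm (e2pi z) = exp (- 2 * pi * Im z)"
 by (simp add: e2pi_def)

lemma norm_integral_bound:
 fixes f :: "'b \<Rightarrow> 'a::{banach, second_countable_topology}"
 assumes "integrable M g" "\<And>x. norm (f x) \<le> g x"
 shows "norm (\<integral>x. f x \<partial>M) \<le> (\<integral>x. g x \<partial>M)"
 using integral_norm_bound[of M f] integral_mono'[OF assms(1), of "\<lambda>x. norm (f x)"] assms(2)
 by (meson norm_ge_zero order_trans)

lemma cnj_e2pi: "cnj (e2pi z) = e2pi (- cnj z)"
 by (simp add: e2pi_def exp_cnj)

lemma e2pi_measurable [measurable]: "e2pi \<in> borel_measurable borel"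
 unfolding e2pi_def by (intro borel_measurable_continuous_onI continuous_intros)

lemma holomorphic_on_e2pi [holomorphic_intros]: "g holomorphic_on S \<Longrightarrow> (\<lambda>x. e2pi (g x)) holomorphic_on S"
 unfolding e2pi_def by (intro holomorphic_intros)

lemma fourier_e2pi: "fourier f u = (LBINT x. of_real (f x) * e2pi (of_real (- x * u)))"
 by (simp add: fourier_def e2pi_def mult_ac)

lemma entire_extension_e2pi: "entire_extension f z = (LBINT u. fourier f u * e2pi (z * of_real u))"
 by (simp add: entire_extension_def e2pi_def mult_ac)

text \<open>An integrable majorant of product form reduces the Fubini condition to two
  one-dimensional integrals; both later exchanges of integrals have such a majorant.\<close>

lemma integrable_lborel_prod_bound:
 fixes p :: "real \<times> real \<Rightarrow> complex"
 assumes a: "integrable lborel a" and b: "integrable lborel b"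
  and m: "p \<in> borel_measurable (lborel \<Otimes>\<^sub>M lborel)"
  and le: "\<And>x y. norm (p (x, y)) \<le> a x * b y"
 shows "integrable (lborel \<Otimes>\<^sub>M lborel) p"
proof (rule lborel_pair.Fubini_integrable[OF m])
 have meas2: "(\<lambda>y. p (x, y)) \<in> borel_measurable lborel" for x
  using m by (rule measurable_compose_Pair1[OF _ , rotated]) simp
 have i2: "integrable lborel (\<lambda>y. p (x, y))" for x
  by (rule Bochner_Integration.integrable_bound[OF integrable_mult_right[OF b, of "a x"]])
    (use le meas2 in \<open>auto intro!: AE_I2 intro: order_trans[OF _ abs_ge_self]\<close>)
 thus "AE x in lborel. integrable lborel (\<lambda>y. p (x, y))" by simp
 show "integrable lborel (\<lambda>x. LBINT y. norm (p (x, y)))"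
 proof (rule Bochner_Integration.integrable_bound[OF integrable_mult_left[OF a, of "LBINT y. b y"]])
  show "(\<lambda>x. LBINT y. norm (p (x, y))) \<in> borel_measurable lborel"
   using m by (intro lborel.borel_measurable_lebesgue_integral) (simp add: split_beta')
  show "AE x in lborel. norm (LBINT y. norm (p (x, y))) \<le> norm (a x * (LBINT y. b y))"
  proof (rule AE_I2)
   fix x
   have "(LBINT y. norm (p (x, y))) \<le> (LBINT y. a x * b y)"
    using i2[of x] b le by (intro integral_mono) auto
   thus "norm (LBINT y. norm (p (x, y))) \<le> norm (a x * (LBINT y. b y))"
    by (simp add: integral_nonneg)
  qed
 qed
qed

text \<open>The triangle function; its Fourier transform is a Fejer kernel. The difference of
  \<open>tent 2\<close> and \<open>tent 1\<close> is a trapezoid that equals 1 on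
  \<open>[-1, 1]\<close> and vanishes outside \<open>[-2, 2]\<close>.\<close>

definition tent :: "real \<Rightarrow> real \<Rightarrow> real" where
 "tent a u = max 0 (a - \<bar>u\<bar>)"

text \<open>Explicit primitives on either side of the kink at 0. The boundary terms of order
  \<open>1 / c\<close> cancel, as the tent is continuous and vanishes at its ends; the remaining
  \<open>1 / c\<^sup>2\<close> is the source of the quadratic decay of the transform.\<close>

lemma tent_has_integral:
 fixes c :: complex
 assumes a: "a \<ge> 0" and c: "c \<noteq> 0"
 shows "((\<lambda>u. of_real (tent a u) * exp (c * of_real u)) has_integral
      (exp (c * of_real a) + exp (- c * of_real a) - 2) / c\<^sup>2) {-a..a}"
proof -
 let ?f = "\<lambda>u. of_real (tent a u) * exp (c * of_real u)"
 let ?H1 = "\<lambda>u::real. of_real (a + u) * exp (c * of_real u) / c - exp (c * of_real u) / c\<^sup>2"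
 let ?H2 = "\<lambda>u::real. of_real (a - u) * exp (c * of_real u) / c + exp (c * of_real u) / c\<^sup>2"
 have 1: "(?f has_integral (?H1 0 - ?H1 (-a))) {-a..0}"
 proof (rule has_integral_eq[OF _ fundamental_theorem_of_calculus[of "-a" 0 ?H1 "\<lambda>u. of_real (a + u) * exp (c * of_real u)"]])
  fix u assume "u \<in> {-a..0}"
  show "(?H1 has_vector_derivative of_real (a + u) * exp (c * of_real u)) (at u within {-a..0})"
   using c by (auto intro!: derivative_eq_intros has_vector_derivative_real_field simp: power2_eq_square field_simps)
 qed (use a in \<open>auto simp: tent_def\<close>)
 have 2: "(?f has_integral (?H2 a - ?H2 0)) {0..a}"
 proof (rule has_integral_eq[OF _ fundamental_theorem_of_calculus[of 0 a ?H2 "\<lambda>u. of_real (a - u) * exp (c * of_real u)"]])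
  fix u assume "u \<in> {0..a}"
  show "(?H2 has_vector_derivative of_real (a - u) * exp (c * of_real u)) (at u within {0..a})"
   using c by (auto intro!: derivative_eq_intros has_vector_derivative_real_field simp: power2_eq_square field_simps)
 qed (use a in \<open>auto simp: tent_def\<close>)
 have "(?f has_integral (?H1 0 - ?H1 (-a)) + (?H2 a - ?H2 0)) {-a..a}"
  by (rule has_integral_combine[OF _ _ 1 2]) (use a in auto)
 also have "(?H1 0 - ?H1 (-a)) + (?H2 a - ?H2 0) = (exp (c * of_real a) + exp (- c * of_real a) - 2) / c\<^sup>2"
  using c by (simp add: field_simps power2_eq_square)
 finally show ?thesis .
qed

lemma continuous_on_tent [continuous_intros]: "continuous_on S (tent a)"
 unfolding tent_def by (intro continuous_intros)

lemma tent_measurable [measurable]: "tent a \<in> borel_measurable borel"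
 by (intro borel_measurable_continuous_onI continuous_intros)

lemma integrable_bounded_support:
 fixes g :: "real \<Rightarrow> 'a::{banach, second_countable_topology}"
 assumes "g \<in> borel_measurable borel" "\<And>u. u \<notin> {-a..a} \<Longrightarrow> g u = 0" "\<And>u. u \<in> {-a..a} \<Longrightarrow> norm (g u) \<le> B"
 shows "integrable lborel g"
proof (rule Bochner_Integration.integrable_bound)
 show "integrable lborel (\<lambda>u. indicator {-a..a} u * B :: real)"
  by (intro integrable_mult_left integrable_real_indicator) (auto simp: emeasure_lborel_Icc_eq)
 show "AE u in lborel. norm (g u) \<le> norm (indicator {-a..a} u * B)"
  using assms by (intro AE_I2) (auto simp: indicator_def intro: order_trans[OF _ abs_ge_self])
qed (use assms in auto)

lemma tent_exp_bound:
 assumes "\<bar>Im w\<bar> \<le> Y" "a \<ge> 0"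
 shows "norm (of_real (tent a u) * e2pi (w * of_real u)) \<le> a * exp (2 * pi * Y * a)"
proof (cases "\<bar>u\<bar> \<le> a")
 case True
 have "\<bar>Im w * u\<bar> \<le> Y * a" unfolding abs_mult using assms True by (intro mult_mono) auto
 hence "- (Im w * u) \<le> Y * a" by linarith
 hence "2 * pi * (- (Im w * u)) \<le> 2 * pi * (Y * a)" by (intro mult_left_mono) auto
 hence "exp (- 2 * pi * (Im w * u)) \<le> exp (2 * pi * Y * a)" by (simp add: mult_ac)
 moreover have "tent a u \<le> a" "tent a u \<ge> 0" using assms by (auto simp: tent_def)
 ultimately show ?thesis by (simp add: norm_mult norm_e2pi) (intro mult_mono, auto)
qed (use assms in \<open>auto simp: tent_def\<close>)

lemma tent_integrable:
 assumes "a \<ge> 0"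
 shows "integrable lborel (\<lambda>u. of_real (tent a u) * e2pi (w * of_real u))"
 by (rule integrable_bounded_support[of _ a "a * exp (2 * pi * \<bar>Im w\<bar> * a)"])
   (use tent_exp_bound[of w "\<bar>Im w\<bar>" a] assms in \<open>auto simp: tent_def\<close>)

text \<open>For small \<open>Re w\<close> the trivial estimate suffices, since then
  \<open>1 + (Re w)\<^sup>2\<close> is at most 2; for \<open>\<bar>Re w\<bar> \<ge> 1\<close> the
  closed form supplies \<open>1 / (norm c)\<^sup>2\<close>. The constant
  \<open>4 * a * a + 2\<close> covers both cases.\<close>

lemma tent_transform_bound:
 assumes Y: "\<bar>Im w\<bar> \<le> Y" and a: "a \<ge> 0"
 shows "norm (LBINT u. of_real (tent a u) * e2pi (w * of_real u)) \<le>
      (4 * a * a + 2) * exp (2 * pi * Y * a) / (1 + (Re w)\<^sup>2)"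
proof -
 let ?f = "\<lambda>u. of_real (tent a u) * e2pi (w * of_real u)"
 let ?E = "exp (2 * pi * Y * a)"
 have Y0: "Y \<ge> 0" using Y by linarith
 have E1: "?E \<ge> 1" using Y0 a by simp
 have z: "?f u = 0" if "u \<notin> {-a..a}" for u using that by (auto simp: tent_def)
 have "(LBINT u. ?f u) = (LBINT u:{-a..a}. ?f u)"
  unfolding set_lebesgue_integral_def
  by (intro Bochner_Integration.integral_cong) (auto simp: indicator_def tent_def)
 also have "\<dots> = integral {-a..a} ?f"
  by (rule set_borel_integral_eq_integral)
    (auto simp: set_integrable_def intro!: integrable_mult_indicator tent_integrable a)
 finally have eq: "(LBINT u. ?f u) = integral {-a..a} ?f" .
 have triv: "norm (LBINT u. ?f u) \<le> 2 * a * a * ?E"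
 proof -
  have "norm (LBINT u. ?f u) \<le> (LBINT u. indicator {-a..a} u * (a * ?E))"
  proof (rule norm_integral_bound)
   show "norm (?f u) \<le> indicator {-a..a} u * (a * ?E)" for u
    using tent_exp_bound[OF Y a, of u] z[of u] by (auto simp: indicator_def)
  qed (intro integrable_mult_left integrable_real_indicator, auto simp: emeasure_lborel_Icc_eq)
  also have "\<dots> = 2 * a * a * ?E" using a by simp
  finally show ?thesis .
 qed
 show ?thesis
 proof (cases "\<bar>Re w\<bar> \<ge> 1")
  case False
  hence "(Re w)\<^sup>2 \<le> 1" by (simp add: abs_square_le_1)
  hence "norm (LBINT u. ?f u) * (1 + (Re w)\<^sup>2) \<le> (2 * a * a * ?E) * 2"
   using triv a by (intro mult_mono) auto
  also have "\<dots> \<le> (4 * a * a + 2) * ?E" by (simp add: algebra_simps)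
  finally show ?thesis by (simp add: pos_le_divide_eq add_pos_nonneg)
 next
  case True
  define c where "c = 2 * of_real pi * \<i> * w"
  have c0: "c \<noteq> 0" using True by (auto simp: c_def)
  have "(?f has_integral (exp (c * of_real a) + exp (- c * of_real a) - 2) / c\<^sup>2) {-a..a}"
   using tent_has_integral[OF a c0] by (simp add: e2pi_def c_def mult_ac)
  hence "norm (LBINT u. ?f u) = norm (exp (c * of_real a) + exp (- c * of_real a) - 2) / (norm c)\<^sup>2"
   unfolding eq by (simp add: integral_unique norm_divide norm_power)
  also have "\<dots> \<le> (4 * ?E) / (2 * (1 + (Re w)\<^sup>2))"
  proof (intro frac_le)
   have "\<bar>Im w\<bar> * a \<le> Y * a" using Y a by (rule mult_right_mono)
   hence "2 * pi * (\<bar>Im w\<bar> * a) \<le> 2 * pi * (Y * a)" by (intro mult_left_mono) auto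
   hence b: "\<bar>2 * pi * (Im w * a)\<bar> \<le> 2 * pi * Y * a"
    using a by (simp add: abs_mult mult_ac)
   have "norm (exp (c * of_real a)) \<le> ?E" "norm (exp (- c * of_real a)) \<le> ?E"
    using b by (simp_all add: c_def abs_le_iff mult_ac)
   moreover have "norm (exp (c * of_real a) + exp (- c * of_real a) - 2) \<le>
     norm (exp (c * of_real a)) + norm (exp (- c * of_real a)) + 2"
    using norm_triangle_ineq4[of "exp (c * of_real a) + exp (- c * of_real a)" 2]
     norm_triangle_ineq[of "exp (c * of_real a)" "exp (- c * of_real a)"]
    unfolding norm_numeral by linarith
   ultimately show "norm (exp (c * of_real a) + exp (- c * of_real a) - 2) \<le> 4 * ?E"
    using E1 by linarith
   have "1 \<le> (Re w)\<^sup>2" using True by (metis one_le_power power2_abs)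
   moreover have "(Re w)\<^sup>2 \<le> (norm w)\<^sup>2" by (simp add: cmod_power2)
   ultimately have "2 * (1 + (Re w)\<^sup>2) \<le> 2\<^sup>2 * (norm w)\<^sup>2" by simp
   also have "\<dots> \<le> (2 * pi)\<^sup>2 * (norm w)\<^sup>2" using pi_gt3 by (intro mult_right_mono power_mono) auto
   also have "\<dots> = (norm c)\<^sup>2" by (simp add: c_def norm_mult power_mult_distrib)
   finally show "2 * (1 + (Re w)\<^sup>2) \<le> (norm c)\<^sup>2" .
  qed (auto simp: add_pos_nonneg)
  also have "\<dots> \<le> (2 * ((4 * a * a + 2) * ?E)) / (2 * (1 + (Re w)\<^sup>2))"
   using a by (intro divide_right_mono) (auto simp: algebra_simps)
  also have "\<dots> = (4 * a * a + 2) * ?E / (1 + (Re w)\<^sup>2)"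
   by (rule mult_divide_mult_cancel_left) simp
  finally show ?thesis .
 qed
qed

lemma integrable_inverse_1_plus_square_shift:
 "integrable lborel (\<lambda>t::real. 1 / (1 + (x - t)\<^sup>2))"
proof -
 have "integrable lborel (\<lambda>t::real. inverse (1 + t\<^sup>2))"
  using integrable_inverse_1_plus_square by (simp add: set_integrable_def)
 from lborel_integrable_real_affine[OF this, of "-1" x] show ?thesis
  by (simp add: inverse_eq_divide)
qed

lemma integral_inverse_1_plus_square_shift:
 fixes x :: real
 shows "(LBINT t. 1 / (1 + (x - t)\<^sup>2)) = (LBINT t. 1 / (1 + (t::real)\<^sup>2))"
 using lborel_integral_real_affine[of "-1" "\<lambda>t::real. 1 / (1 + t\<^sup>2)" x] by simp

lemma integrable_powr_decay:
 assumes "delta > (0::real)"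
 shows "integrable lborel (\<lambda>x::real. (1 + \<bar>x\<bar>) powr (- 1 - delta))"
proof -
 let ?p = "\<lambda>x::real. x powr (- 1 - delta)"
 have "?p absolutely_integrable_on {1..}"
  using has_integral_powr_to_inf[of "- 1 - delta" 1] assms
  by (intro nonnegative_absolutely_integrable_1) (auto simp: integrable_on_def)
 hence "integrable lebesgue (\<lambda>x. indicator {1..} x *\<^sub>R ?p x)" by (simp add: set_integrable_def)
 hence i: "integrable lborel (\<lambda>x. indicator {1..} x *\<^sub>R ?p x)"
  by (subst (asm) integrable_completion) auto
 show ?thesis
 proof (rule Bochner_Integration.integrable_bound)
  show "integrable lborel (\<lambda>x. indicator {1..} (1 + 1 * x) *\<^sub>R ?p (1 + 1 * x) + indicator {1..} (1 + (-1) * x) *\<^sub>R ?p (1 + (-1) * x))"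
   by (intro Bochner_Integration.integrable_add lborel_integrable_real_affine[OF i]) auto
 qed (auto intro!: AE_I2 simp: indicator_def)
qed

lemma gaussian_fourier:
 fixes s :: real
 shows "(LBINT y. of_real (std_normal_density y) * exp (\<i> * of_real (s * y))) = of_real (exp (- s\<^sup>2 / 2))"
proof -
 have "char std_normal_distribution s = (LBINT y. std_normal_density y *\<^sub>R exp (\<i> * of_real (s * y)))"
  unfolding char_def by (subst integral_density) auto
 thus ?thesis by (simp add: char_std_normal_distribution scaleR_conv_of_real)
qed

section \<open>Strip decay and Fourier inversion for an admissible function\<close>

locale test_function =
 fixes f :: "real \<Rightarrow> real"
 assumes adm: "admissible f" and supp_le: "supp (fourier f) \<subseteq> {-1..1}"
begin

abbreviation "h \<equiv> fourier f"
abbreviation "F \<equiv> entire_extension f"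

lemma f_integrable: "integrable lborel f"
 using adm by (simp add: admissible_def)

lemma f_measurable [measurable]: "f \<in> borel_measurable borel"
 using f_integrable by (simp add: borel_measurable_integrable)

lemma f_even: "f (- x) = f x"
 using adm by (simp add: admissible_def)

lemma isCont_h: "isCont h u"
 unfolding continuous_at_sequentially comp_def
proof (intro allI impI)
 fix X assume X: "X \<longlonglongrightarrow> u"
 show "(\<lambda>n. h (X n)) \<longlonglongrightarrow> h u"
  unfolding fourier_e2pi
 proof (rule integral_dominated_convergence[where w = "\<lambda>x. \<bar>f x\<bar>"])
  show "AE x in lborel. (\<lambda>n. of_real (f x) * e2pi (of_real (- x * X n))) \<longlonglongrightarrow> of_real (f x) * e2pi (of_real (- x * u))"
   unfolding e2pi_def by (intro AE_I2 tendsto_intros X)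
 qed (use f_integrable in \<open>auto simp: norm_mult\<close>)
qed

lemma continuous_on_h [continuous_intros]: "continuous_on S h"
 by (intro continuous_at_imp_continuous_on ballI isCont_h)

lemma h_measurable [measurable]: "h \<in> borel_measurable borel"
 by (intro borel_measurable_continuous_onI continuous_on_h)

lemma h_even: "h (- u) = h u"
 unfolding fourier_e2pi using lborel_integral_real_affine[of "-1" "\<lambda>x. of_real (f x) * e2pi (of_real (- x * u))" 0]
 by (simp add: f_even)

lemma h_real: "cnj (h u) = h u"
proof -
 have "cnj (h u) = (LBINT x. cnj (of_real (f x) * e2pi (of_real (- x * u))))"
  unfolding fourier_e2pi by (rule Bochner_Integration.integral_cnj[symmetric])
 also have "\<dots> = h (- u)"
  unfolding fourier_e2pi by (intro Bochner_Integration.integral_cong) (auto simp: cnj_e2pi)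
 finally show ?thesis by (simp add: h_even)
qed

lemma h_eq_Re: "h u = of_real (Re (h u))"
 using h_real[of u] by (metis Reals_cnj_iff of_real_Re)

text \<open>The support condition yields 0 only beyond the endpoints; at the endpoints the value is
  a limit of such zeros. This endpoint value is what later makes the terms with \<open>n\<close>
  close to \<open>q\<close> small.\<close>

lemma h_zero: "\<bar>u\<bar> \<ge> 1 \<Longrightarrow> h u = 0"
proof -
 have out: "h u = 0" if "\<bar>u\<bar> > 1" for u
 proof (rule ccontr)
  assume "h u \<noteq> 0"
  hence "u \<in> supp h" unfolding supp_def using closure_subset[of "{u. h u \<noteq> 0}"] by blast
  hence "u \<in> {-1..1}" using supp_le by (rule subsetD[rotated])
  thus False using that by auto
 qed
 have one: "h 1 = 0"
 proof -
  have "(\<lambda>n. h (1 + 1 / real (Suc n))) \<longlonglongrightarrow> h 1"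
  proof (rule isCont_tendsto_compose[OF isCont_h])
   show "(\<lambda>n. 1 + 1 / real (Suc n)) \<longlonglongrightarrow> 1" by real_asymp
  qed
  moreover have "(\<lambda>n. h (1 + 1 / real (Suc n))) = (\<lambda>n. 0)" by (intro ext out) auto
  ultimately show ?thesis by (simp add: LIMSEQ_const_iff)
 qed
 show "\<bar>u\<bar> \<ge> 1 \<Longrightarrow> h u = 0"
  using out[of u] one h_even[of 1] by (cases "\<bar>u\<bar> = 1") (auto simp: abs_if split: if_splits)
qed

definition "B0 = (LBINT x. \<bar>f x\<bar>)"

lemma B0_nonneg: "B0 \<ge> 0" unfolding B0_def by (rule Bochner_Integration.integral_nonneg) auto

lemma h_bound: "norm (h u) \<le> B0"
 unfolding fourier_e2pi B0_def
 by (rule norm_integral_bound) (use f_integrable in \<open>auto simp: norm_mult\<close>)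

lemma h_tent: "h u = h u * of_real (tent 2 u - tent 1 u)"
 using h_zero[of u] by (cases "\<bar>u\<bar> \<ge> 1") (auto simp: tent_def)

lemma h_integrable: "integrable lborel h"
 by (rule integrable_bounded_support[of _ 1 B0]) (use h_zero h_bound in auto)

lemma h_exp_bound: "norm (h u * e2pi (z * of_real u)) \<le> norm (h u) * exp (2 * pi * \<bar>Im z\<bar>)"
proof (cases "\<bar>u\<bar> \<le> 1")
 case True
 have "\<bar>Im z * u\<bar> \<le> \<bar>Im z\<bar> * 1" unfolding abs_mult using True by (intro mult_left_mono) auto
 hence "- (Im z * u) \<le> \<bar>Im z\<bar>" by linarith
 hence "2 * pi * (- (Im z * u)) \<le> 2 * pi * \<bar>Im z\<bar>" by (intro mult_left_mono) auto
 hence "exp (- 2 * pi * (Im z * u)) \<le> exp (2 * pi * \<bar>Im z\<bar>)" by (simp add: mult_ac)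
 thus ?thesis by (simp add: norm_mult mult_left_mono)
qed (use h_zero[of u] in auto)

lemma F_entire: "F holomorphic_on UNIV"
proof -
 have "(\<lambda>z. LBINT u. h u * e2pi (z * of_real u)) holomorphic_on UNIV"
 proof (rule holomorphic_lebesgue_integral)
  fix w :: complex
  let ?g = "\<lambda>u. norm (h u) * exp (2 * pi * (\<bar>Im w\<bar> + 1))"
  have "integrable lborel ?g" using h_integrable by auto
  moreover have "norm (h u * e2pi (z * of_real u)) \<le> ?g u" if "z \<in> cball w 1" for z u
  proof -
   have "\<bar>Im (w - z)\<bar> \<le> 1" using that abs_Im_le_cmod[of "w - z"] by (simp add: dist_norm)
   hence "\<bar>Im z\<bar> \<le> \<bar>Im w\<bar> + 1" by simp
   hence "norm (h u) * exp (2 * pi * \<bar>Im z\<bar>) \<le> ?g u" by (intro mult_left_mono) auto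
   with h_exp_bound[of u z] show ?thesis by linarith
  qed
  ultimately show "\<exists>r>0. \<exists>g. cball w r \<subseteq> UNIV \<and> integrable lborel g \<and>
    (\<forall>z\<in>cball w r. \<forall>t. norm (h t * e2pi (z * of_real t)) \<le> g t)"
   by (intro exI[of _ 1] conjI exI[of _ ?g]) auto
 qed (auto intro!: holomorphic_intros)
 thus ?thesis by (simp add: entire_extension_e2pi[abs_def])
qed

lemma F_even: "F (- z) = F z"
 unfolding entire_extension_e2pi
 using lborel_integral_real_affine[of "-1" "\<lambda>u. h u * e2pi (z * of_real u)" 0]
 by (simp add: h_even)

text \<open>The de la Vallee Poussin kernel, continued to complex arguments. Written as a difference
  of two tent transforms, it inherits the decay of \<open>tent_transform_bound\<close>.\<close>

definition kern :: "complex \<Rightarrow> complex" where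
 "kern w = (LBINT u. of_real (tent 2 u) * e2pi (w * of_real u)) - (LBINT u. of_real (tent 1 u) * e2pi (w * of_real u))"

lemma kern_eq: "kern w = (LBINT u. of_real (tent 2 u - tent 1 u) * e2pi (w * of_real u))"
 unfolding kern_def
 by (subst Bochner_Integration.integral_diff[symmetric]) (auto intro!: tent_integrable simp: left_diff_distrib)

lemma kern_bound:
 assumes Y: "\<bar>Im w\<bar> \<le> Y"
 shows "norm (kern w) \<le> 24 * exp (4 * pi * Y) / (1 + (Re w)\<^sup>2)"
proof -
 have Y0: "Y \<ge> 0" using Y by linarith
 have p: "1 + (Re w)\<^sup>2 > 0" by (simp add: add_pos_nonneg)
 have "norm (kern w) \<le> 18 * exp (4 * pi * Y) / (1 + (Re w)\<^sup>2) + 6 * exp (2 * pi * Y) / (1 + (Re w)\<^sup>2)"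
  unfolding kern_def
  using tent_transform_bound[OF Y, of 2] tent_transform_bound[OF Y, of 1]
  by (intro order_trans[OF norm_triangle_ineq4] add_mono) (auto simp: mult_ac)
 also have "\<dots> \<le> 18 * exp (4 * pi * Y) / (1 + (Re w)\<^sup>2) + 6 * exp (4 * pi * Y) / (1 + (Re w)\<^sup>2)"
  using Y0 p by (intro add_left_mono divide_right_mono mult_left_mono) auto
 finally show ?thesis by (simp add: field_simps)
qed

text \<open>The Fourier transform of the kernel is 1 on the support of \<open>h\<close>, so convolution with it
 reproduces \<open>F\<close>, transferring the decay of \<open>f\<close> to horizontal strips.\<close>
lemma F_eq_convolution: "F z = (LBINT t. of_real (f t) * kern (z - of_real t))"
proof -
 let ?p = "\<lambda>(t, u). of_real (f t) * (of_real (tent 2 u - tent 1 u) * e2pi ((z - of_real t) * of_real u))"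
 have int: "integrable (lborel \<Otimes>\<^sub>M lborel) ?p"
 proof (rule integrable_lborel_prod_bound)
  show "integrable lborel (\<lambda>t. \<bar>f t\<bar>)" using f_integrable by auto
  show "integrable lborel (\<lambda>u. norm (of_real (tent 2 u - tent 1 u) * e2pi (z * of_real u)))"
   using Bochner_Integration.integrable_diff[OF tent_integrable[of 2 z] tent_integrable[of 1 z]]
   by (intro integrable_norm) (auto simp: algebra_simps)
  show "?p \<in> borel_measurable (lborel \<Otimes>\<^sub>M lborel)" by measurable
  show "norm (?p (t, u)) \<le> \<bar>f t\<bar> * norm (of_real (tent 2 u - tent 1 u) * e2pi (z * of_real u))" for t u
   by (simp add: norm_mult norm_e2pi)
 qed
 have "F z = (LBINT u. (LBINT t. ?p (t, u)))"
  unfolding entire_extension_e2pi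
 proof (intro Bochner_Integration.integral_cong refl)
  fix u :: real
  have "h u * e2pi (z * of_real u) = h u * (of_real (tent 2 u - tent 1 u) * e2pi (z * of_real u))"
   using h_tent[of u] by (metis mult.assoc)
  also have "\<dots> = (LBINT t. of_real (f t) * e2pi (of_real (- t * u)) * (of_real (tent 2 u - tent 1 u) * e2pi (z * of_real u)))"
   unfolding fourier_e2pi by (rule integral_mult_left_zero[symmetric])
  also have "\<dots> = (LBINT t. ?p (t, u))"
   by (intro Bochner_Integration.integral_cong refl) (simp add: e2pi_add[symmetric] mult_ac algebra_simps)
  finally show "h u * e2pi (z * of_real u) = (LBINT t. ?p (t, u))" .
 qed
 also have "\<dots> = (LBINT t. (LBINT u. ?p (t, u)))"
  using lborel_pair.Fubini_integral[of "\<lambda>t u. ?p (t, u)"] int by simp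
 also have "\<dots> = (LBINT t. of_real (f t) * kern (z - of_real t))"
  by (simp add: kern_eq)
 finally show ?thesis .
qed

text \<open>In the convolution with \<open>kern (z - t)\<close>, either
  \<open>\<bar>t\<bar> \<ge> \<bar>Re z\<bar> / 2\<close> and \<open>f t\<close> is small, or
  \<open>t\<close> has distance at least \<open>\<bar>Re z\<bar> / 2\<close> from
  \<open>Re z\<close> and the kernel is small. The width \<open>Y\<close> of the strip affects the
  constant but not the exponent.\<close>

lemma F_strip_decay:
 obtains delta where "delta > 0" "delta \<le> 1"
  "\<And>Y. Y \<ge> 0 \<Longrightarrow> \<exists>C\<ge>0. \<forall>z. \<bar>Im z\<bar> \<le> Y \<longrightarrow> norm (F z) \<le> C * (1 + \<bar>Re z\<bar>) powr (- 1 - delta)"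
proof -
 obtain delta0 C0 where delta0: "delta0 > 0" "\<And>r. \<bar>f r\<bar> \<le> C0 * (1 + \<bar>r\<bar>) powr (- 1 - delta0)"
  using adm by (auto simp: admissible_def)
 \<comment> \<open>Capped at 1, so that the quadratic decay of the kernel is at least as strong as
   the decay claimed.\<close>
 define delta where "delta = min 1 delta0"
 have delta: "delta > 0" "delta \<le> 1" using delta0 by (auto simp: delta_def)
 have C0: "C0 \<ge> 0" using delta0(2)[of 0] by simp
 have fb: "\<bar>f r\<bar> \<le> C0 * (1 + \<bar>r\<bar>) powr (- 1 - delta)" for r
 proof -
  have "(1 + \<bar>r\<bar>) powr (- 1 - delta0) \<le> (1 + \<bar>r\<bar>) powr (- 1 - delta)"
   by (intro powr_mono) (auto simp: delta_def)
  thus ?thesis using delta0(2)[of r] C0 by (meson mult_left_mono order_trans)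
 qed
 define J where "J = (LBINT t. 1 / (1 + (t::real)\<^sup>2))"
 have J0: "J \<ge> 0" unfolding J_def by (intro Bochner_Integration.integral_nonneg) auto
 have main: "\<exists>C\<ge>0. \<forall>z. \<bar>Im z\<bar> \<le> Y \<longrightarrow> norm (F z) \<le> C * (1 + \<bar>Re z\<bar>) powr (- 1 - delta)" if Y: "Y \<ge> 0" for Y
 proof -
  define M where "M = 24 * exp (4 * pi * Y)"
  have M0: "M \<ge> 0" by (simp add: M_def)
  have bd: "norm (F z) \<le> (4 * C0 * M * J + 8 * M * B0) * (1 + \<bar>Re z\<bar>) powr (- 1 - delta)" if z: "\<bar>Im z\<bar> \<le> Y" for z
  proof -
   define x where "x = Re z"
   define D where "D = (1 + \<bar>x\<bar>) powr (- 1 - delta)"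
   have D0: "D \<ge> 0" by (simp add: D_def)
   have D1: "(1 + \<bar>x\<bar> / 2) powr (- 1 - delta) \<le> 4 * D"
   proof -
    have "(1 + \<bar>x\<bar> / 2) powr (- 1 - delta) \<le> ((1 + \<bar>x\<bar>) / 2) powr (- 1 - delta)"
     using delta by (intro powr_mono2') auto
    also have "\<dots> = 2 powr (1 + delta) * D"
     by (simp add: D_def powr_divide powr_diff powr_minus powr_add divide_simps)
    also have "2 powr (1 + delta) \<le> 2 powr (2::real)" using delta by (intro powr_mono) auto
    hence "2 powr (1 + delta) * D \<le> 4 * D" using D0 by (intro mult_right_mono) auto
    finally show ?thesis .
   qed
   have D2: "1 / (1 + x\<^sup>2 / 4) \<le> 8 * D"
   proof -
    have sq: "(1 + \<bar>x\<bar>)\<^sup>2 \<le> 8 * (1 + x\<^sup>2 / 4)"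
     using zero_le_power2[of "\<bar>x\<bar> - 1"] by (simp add: power2_eq_square algebra_simps)
    have "1 / (1 + x\<^sup>2 / 4) = 8 / (8 * (1 + x\<^sup>2 / 4))" by (simp add: divide_simps)
    also have "\<dots> \<le> 8 / (1 + \<bar>x\<bar>)\<^sup>2" using sq by (intro divide_left_mono) (auto simp: add_pos_nonneg)
    also have "\<dots> = 8 * (1 + \<bar>x\<bar>) powr (-2)" by (simp add: powr_minus powr_numeral divide_inverse)
    also have "\<dots> \<le> 8 * D" unfolding D_def using delta by (intro mult_left_mono powr_mono) auto
    finally show ?thesis .
   qed
   have pt: "norm (of_real (f t) * kern (z - of_real t)) \<le> 4 * C0 * M * D * (1 / (1 + (x - t)\<^sup>2)) + 8 * M * D * \<bar>f t\<bar>" for t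
   proof -
    have k: "norm (kern (z - of_real t)) \<le> M / (1 + (x - t)\<^sup>2)"
     using kern_bound[of "z - of_real t" Y] z by (simp add: M_def x_def)
    have p: "1 + (x - t)\<^sup>2 > 0" by (simp add: add_pos_nonneg)
    have n: "norm (of_real (f t) * kern (z - of_real t)) \<le> \<bar>f t\<bar> * (M / (1 + (x - t)\<^sup>2))"
     unfolding norm_mult norm_of_real by (intro mult_left_mono k) auto
    have nn: "0 \<le> 4 * C0 * M * D * (1 / (1 + (x - t)\<^sup>2))" "0 \<le> 8 * M * D * \<bar>f t\<bar>" using C0 M0 D0 by auto
    show ?thesis
    proof (cases "\<bar>t\<bar> \<ge> \<bar>x\<bar> / 2")
     case True
     have "\<bar>f t\<bar> \<le> C0 * (1 + \<bar>x\<bar> / 2) powr (- 1 - delta)"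
      by (rule order_trans[OF fb]) (use True delta C0 in \<open>auto intro!: mult_left_mono powr_mono2'\<close>)
     also have "\<dots> \<le> C0 * (4 * D)" by (intro mult_left_mono D1 C0)
     finally have "\<bar>f t\<bar> * (M / (1 + (x - t)\<^sup>2)) \<le> C0 * (4 * D) * (M / (1 + (x - t)\<^sup>2))"
      using M0 p by (intro mult_right_mono) auto
     thus ?thesis using n nn by (simp add: mult_ac)
    next
     case False
     hence "\<bar>x\<bar> / 2 \<le> \<bar>x - t\<bar>" by linarith
     hence "(\<bar>x\<bar> / 2)\<^sup>2 \<le> \<bar>x - t\<bar>\<^sup>2" by (intro power_mono) auto
     hence "1 + x\<^sup>2 / 4 \<le> 1 + (x - t)\<^sup>2" by (simp add: power_divide)
     hence "1 / (1 + (x - t)\<^sup>2) \<le> 1 / (1 + x\<^sup>2 / 4)" by (intro divide_left_mono) (auto simp: add_pos_nonneg)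
     hence "1 / (1 + (x - t)\<^sup>2) \<le> 8 * D" using D2 by linarith
     hence "\<bar>f t\<bar> * M * (1 / (1 + (x - t)\<^sup>2)) \<le> \<bar>f t\<bar> * M * (8 * D)" using M0 by (intro mult_left_mono) auto
     thus ?thesis using n nn by (simp add: mult_ac)
    qed
   qed
   have intb: "integrable lborel (\<lambda>t. 4 * C0 * M * D * (1 / (1 + (x - t)\<^sup>2)) + 8 * M * D * \<bar>f t\<bar>)"
    using f_integrable by (intro Bochner_Integration.integrable_add integrable_mult_right integrable_inverse_1_plus_square_shift) auto
   have "norm (F z) \<le> (LBINT t. 4 * C0 * M * D * (1 / (1 + (x - t)\<^sup>2)) + 8 * M * D * \<bar>f t\<bar>)"
    unfolding F_eq_convolution
    by (rule norm_integral_bound[OF intb pt])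
   also have "\<dots> = 4 * C0 * M * D * J + 8 * M * D * B0"
    using f_integrable
    by (subst Bochner_Integration.integral_add)
      (auto intro!: integrable_mult_right integrable_inverse_1_plus_square_shift
         simp del: times_divide_eq_right simp: integral_inverse_1_plus_square_shift J_def B0_def)
   also have "\<dots> = (4 * C0 * M * J + 8 * M * B0) * D" by (simp add: algebra_simps)
   finally show ?thesis by (simp add: D_def x_def)
  qed
  have "4 * C0 * M * J + 8 * M * B0 \<ge> 0" using C0 M0 J0 B0_nonneg by simp
  with bd show ?thesis by blast
 qed
 from delta main show ?thesis by (rule that)
qed

lemma F_continuous_real: "continuous_on S (\<lambda>x. F (of_real x))"
 by (rule continuous_on_compose2[OF holomorphic_on_imp_continuous_on[OF F_entire]]) (auto intro!: continuous_intros)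

lemma F_measurable_real [measurable]: "(\<lambda>x. F (of_real x)) \<in> borel_measurable borel"
 by (intro borel_measurable_continuous_onI F_continuous_real)

lemma F_integrable: "integrable lborel (\<lambda>x. F (of_real x))"
proof -
 obtain delta where delta: "delta > 0"
  "\<And>Y. Y \<ge> 0 \<Longrightarrow> \<exists>C\<ge>0. \<forall>z. \<bar>Im z\<bar> \<le> Y \<longrightarrow> norm (F z) \<le> C * (1 + \<bar>Re z\<bar>) powr (- 1 - delta)"
  using F_strip_decay by metis
 then obtain C where C: "\<And>z. \<bar>Im z\<bar> \<le> 0 \<Longrightarrow> norm (F z) \<le> C * (1 + \<bar>Re z\<bar>) powr (- 1 - delta)"
  by (meson order_refl)
 show ?thesis
  by (rule Bochner_Integration.integrable_bound[OF integrable_mult_right[OF integrable_powr_decay[OF delta(1)], of C]])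
    (use C[of "of_real x" for x] in \<open>auto intro!: AE_I2 intro: order_trans[OF _ abs_ge_self]\<close>)
qed

text \<open>The zeros are tested with \<open>F\<close>, so the transform of \<open>F\<close> itself
  is wanted. The Gaussian factor \<open>g (eps * x)\<close> makes the double integral absolutely
  convergent; after the exchange, \<open>I eps\<close> is the average of \<open>h\<close> against a
  normal density that concentrates at \<open>u\<close>. Both expressions pass to the limit
  \<open>eps = 0\<close> by dominated convergence.\<close>

theorem F_inversion: "(LBINT x. F (of_real x) * e2pi (of_real (- x * u))) = h u"
proof -
 define n where "n = std_normal_density"
 define g where "g = (\<lambda>y::real. exp (- y\<^sup>2 / 2))"
 have gn: "g y = sqrt (2 * pi) * n y" for y by (simp add: g_def n_def std_normal_density_def)
 have n_meas [measurable]: "n \<in> borel_measurable borel" by (simp add: n_def)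
 have g_meas [measurable]: "g \<in> borel_measurable borel" unfolding g_def by measurable
 have n_int: "integrable lborel n" by (simp add: n_def)
 have n_pos: "n y \<ge> 0" for y by (simp add: n_def)
 have n1: "(LBINT y. n y) = 1" by (simp add: n_def)
 have g01: "0 \<le> g y" "g y \<le> 1" for y by (auto simp: g_def)
 have g_int: "integrable lborel g" unfolding gn by (intro integrable_mult_right n_int)
 define I where "I = (\<lambda>eps. LBINT x. F (of_real x) * e2pi (of_real (- x * u)) * of_real (g (eps * x)))"
 have I_eq: "I eps = (LBINT w. h (u + eps / (2 * pi) * w) * of_real (n w))" if eps: "eps > 0" for eps
 proof -
  let ?p = "\<lambda>(x, v). h v * (e2pi (of_real (x * (v - u))) * of_real (g (eps * x)))"
  have int: "integrable (lborel \<Otimes>\<^sub>M lborel) ?p"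
  proof (rule integrable_lborel_prod_bound)
   show "integrable lborel (\<lambda>x. g (eps * x))"
    using lborel_integrable_real_affine[OF g_int, of eps 0] eps by simp
   show "integrable lborel (\<lambda>v. norm (h v))" using h_integrable by simp
   show "?p \<in> borel_measurable (lborel \<Otimes>\<^sub>M lborel)" by measurable
   show "norm (?p (x, v)) \<le> g (eps * x) * norm (h v)" for x v
    using g01 by (simp add: norm_mult)
  qed
  have "I eps = (LBINT x. (LBINT v. ?p (x, v)))"
   unfolding I_def
  proof (intro Bochner_Integration.integral_cong refl)
   fix x :: real
   have "F (of_real x) * e2pi (of_real (- x * u)) * of_real (g (eps * x))
     = (LBINT v. h v * e2pi (of_real x * of_real v) * (e2pi (of_real (- x * u)) * of_real (g (eps * x))))"
    unfolding entire_extension_e2pi mult.assoc[of "integral\<^sup>L _ _"] by (rule integral_mult_left_zero[symmetric])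
   also have "\<dots> = (LBINT v. ?p (x, v))"
   proof (intro Bochner_Integration.integral_cong refl)
    fix v :: real
    have "of_real (x * (v - u)) = of_real x * of_real v + (of_real (- x * u) :: complex)"
     by (simp add: algebra_simps)
    thus "h v * e2pi (of_real x * of_real v) * (e2pi (of_real (- x * u)) * of_real (g (eps * x))) = ?p (x, v)"
     by (simp only: e2pi_add prod.case mult_ac)
   qed
   finally show "F (of_real x) * e2pi (of_real (- x * u)) * of_real (g (eps * x)) = (LBINT v. ?p (x, v))" .
  qed
  also have "\<dots> = (LBINT v. (LBINT x. ?p (x, v)))"
   using lborel_pair.Fubini_integral[of "\<lambda>x v. ?p (x, v)"] int by simp
  also have "\<dots> = (LBINT v. h v * of_real (2 * pi / eps * n (2 * pi * (v - u) / eps)))"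
  proof (intro Bochner_Integration.integral_cong refl)
   fix v :: real
   define s where "s = 2 * pi * (v - u) / eps"
   have "(LBINT x. e2pi (of_real (x * (v - u))) * of_real (g (eps * x)))
     = (1 / eps) *\<^sub>R (LBINT y. e2pi (of_real ((1 / eps * y) * (v - u))) * of_real (g (eps * (1 / eps * y))))"
    using lborel_integral_real_affine[of "1 / eps" "\<lambda>x. e2pi (of_real (x * (v - u))) * of_real (g (eps * x))" 0] eps by simp
   also have "(LBINT y. e2pi (of_real ((1 / eps * y) * (v - u))) * of_real (g (eps * (1 / eps * y))))
     = (LBINT y. of_real (sqrt (2 * pi)) * (of_real (n y) * exp (\<i> * of_real (s * y))))"
    using eps by (intro Bochner_Integration.integral_cong refl) (simp add: gn e2pi_def s_def mult_ac)
   also have "\<dots> = of_real (sqrt (2 * pi)) * of_real (exp (- s\<^sup>2 / 2))"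
    unfolding n_def by (subst integral_mult_right_zero) (simp only: gaussian_fourier)
   also have "\<dots> = of_real (2 * pi * n s)"
    using gn[of s] unfolding g_def by (simp add: mult.assoc[symmetric] flip: of_real_mult)
   finally show "(LBINT x. ?p (x, v)) = h v * of_real (2 * pi / eps * n (2 * pi * (v - u) / eps))"
    by (simp add: s_def scaleR_conv_of_real)
  qed
  also have "\<dots> = (eps / (2 * pi)) *\<^sub>R (LBINT w. h (u + eps / (2 * pi) * w) * of_real (2 * pi / eps * n (2 * pi * (u + eps / (2 * pi) * w - u) / eps)))"
   using eps by (subst lborel_integral_real_affine[of "eps / (2 * pi)" _ u]) auto
  also have "\<dots> = (LBINT w. h (u + eps / (2 * pi) * w) * of_real (n w))"
   unfolding integral_scaleR_right[symmetric] using eps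
   by (intro Bochner_Integration.integral_cong refl) (simp add: scaleR_conv_of_real)
  finally show ?thesis .
 qed
 define eps where "eps = (\<lambda>k. 1 / real (Suc k))"
 have eps0: "eps \<longlonglongrightarrow> 0" unfolding eps_def by real_asymp
 have "(\<lambda>k. I (eps k)) \<longlonglongrightarrow> (LBINT x. F (of_real x) * e2pi (of_real (- x * u)) * of_real (g (0 * x)))"
  unfolding I_def
 proof (rule integral_dominated_convergence[where w = "\<lambda>x. norm (F (of_real x))"])
  show "AE x in lborel. (\<lambda>k. F (of_real x) * e2pi (of_real (- x * u)) * of_real (g (eps k * x)))
    \<longlonglongrightarrow> F (of_real x) * e2pi (of_real (- x * u)) * of_real (g (0 * x))"
   unfolding g_def by (intro AE_I2 tendsto_intros eps0) auto
  show "AE x in lborel. norm (F (of_real x) * e2pi (of_real (- x * u)) * of_real (g (eps k * x))) \<le> norm (F (of_real x))" for k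
   using g01 by (intro AE_I2) (simp add: norm_mult mult_left_le)
 qed (use F_integrable in auto)
 hence 1: "(\<lambda>k. I (eps k)) \<longlonglongrightarrow> (LBINT x. F (of_real x) * e2pi (of_real (- x * u)))"
  by (simp add: g_def)
 have "(\<lambda>k. LBINT w. h (u + eps k / (2 * pi) * w) * of_real (n w)) \<longlonglongrightarrow> (LBINT w. h (u + 0 / (2 * pi) * w) * of_real (n w))"
 proof (rule integral_dominated_convergence[where w = "\<lambda>w. B0 * n w"])
  show "AE w in lborel. (\<lambda>k. h (u + eps k / (2 * pi) * w) * of_real (n w)) \<longlonglongrightarrow> h (u + 0 / (2 * pi) * w) * of_real (n w)"
  proof (intro AE_I2 tendsto_mult isCont_tendsto_compose[OF isCont_h] tendsto_const)
   fix w
   have "(\<lambda>k. u + (w / (2 * pi)) * eps k) \<longlonglongrightarrow> u + (w / (2 * pi)) * 0"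
    by (intro tendsto_intros eps0)
   thus "(\<lambda>k. u + eps k / (2 * pi) * w) \<longlonglongrightarrow> u + 0 / (2 * pi) * w" by (simp add: mult.commute)
  qed
  show "AE w in lborel. norm (h (u + eps k / (2 * pi) * w) * of_real (n w)) \<le> B0 * n w" for k
   using n_pos by (intro AE_I2) (simp add: norm_mult mult_right_mono h_bound)
 qed (use n_int in auto)
 moreover have "(LBINT w. h (u + 0 / (2 * pi) * w) * of_real (n w)) = h u"
  using n1 by (simp add: n_int)
 moreover have "(\<lambda>k. I (eps k)) = (\<lambda>k. LBINT w. h (u + eps k / (2 * pi) * w) * of_real (n w))"
  by (intro ext I_eq) (simp add: eps_def)
 ultimately have "(\<lambda>k. I (eps k)) \<longlonglongrightarrow> h u" by (simp only:)
 with 1 show ?thesis using LIMSEQ_unique by blast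
qed

end

text \<open>Rectangles of growing height: the horizontal sides tend to 0 by \<open>B\<close>, the
  vertical ones to the two line integrals. The value \<open>v\<close> is the same for all large
  \<open>T\<close>, so it may carry the residue of a pole between the lines.\<close>

lemma strip_contour_limit:
 fixes K :: "complex \<Rightarrow> complex"
 assumes ab: "a < b"
  and ct: "\<And>T. T \<ge> T0 \<Longrightarrow> (K has_contour_integral v) (rectpath (Complex a (-T)) (Complex b T))"
  and ia: "integrable lborel (\<lambda>t. K (Complex a t))" and ib: "integrable lborel (\<lambda>t. K (Complex b t))"
  and bd: "\<And>x t. a \<le> x \<Longrightarrow> x \<le> b \<Longrightarrow> \<bar>t\<bar> \<ge> T0 \<Longrightarrow> norm (K (Complex x t)) \<le> B \<bar>t\<bar>"
  and B: "(B \<longlongrightarrow> 0) at_top"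
 shows "v = \<i> * ((LBINT t. K (Complex b t)) - (LBINT t. K (Complex a t)))"
proof -
 define T where "T = (\<lambda>n. max 1 T0 + real n)"
 have T: "T n \<ge> T0" "T n > 0" for n by (auto simp: T_def)
 have Tinf: "filterlim T at_top sequentially" unfolding T_def
  by (intro filterlim_tendsto_add_at_top[OF tendsto_const] filterlim_real_sequentially)
 let ?I = "\<lambda>c n. integral {- T n..T n} (\<lambda>t. K (Complex c t))"
 let ?H1 = "\<lambda>n. contour_integral (linepath (Complex a (- T n)) (Complex b (- T n))) K"
 let ?H2 = "\<lambda>n. contour_integral (linepath (Complex b (T n)) (Complex a (T n))) K"
 have lim: "?I c \<longlonglongrightarrow> (LBINT t. K (Complex c t))" if c: "integrable lborel (\<lambda>t. K (Complex c t))" for c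
 proof -
  have "?I c n = (LBINT t. indicator {- T n..T n} t *\<^sub>R K (Complex c t))" for n
   using set_borel_integral_eq_integral(2)[of "{- T n..T n}" "\<lambda>t. K (Complex c t)"] c
   by (simp add: set_lebesgue_integral_def set_integrable_def integrable_mult_indicator)
  moreover have "(\<lambda>n. LBINT t. indicator {- T n..T n} t *\<^sub>R K (Complex c t)) \<longlonglongrightarrow> (LBINT t. K (Complex c t))"
  proof (rule integral_dominated_convergence[where w = "\<lambda>t. norm (K (Complex c t))"])
   show "AE t in lborel. (\<lambda>n. indicator {- T n..T n} t *\<^sub>R K (Complex c t)) \<longlonglongrightarrow> K (Complex c t)"
   proof (rule AE_I2)
    fix t
    have "eventually (\<lambda>n. T n \<ge> \<bar>t\<bar>) sequentially" using Tinf by (simp add: filterlim_at_top)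
    hence "eventually (\<lambda>n. indicator {- T n..T n} t *\<^sub>R K (Complex c t) = K (Complex c t)) sequentially"
     by eventually_elim (auto simp: indicator_def)
    thus "(\<lambda>n. indicator {- T n..T n} t *\<^sub>R K (Complex c t)) \<longlonglongrightarrow> K (Complex c t)"
     by (rule tendsto_eventually)
   qed
  qed (use c in \<open>auto simp: indicator_def\<close>)
  ultimately show ?thesis by simp
 qed
 have parts: "v = ?H1 n + \<i> * ?I b n + ?H2 n - \<i> * ?I a n \<and> norm (?H1 n) \<le> B (T n) * (b - a) \<and> norm (?H2 n) \<le> B (T n) * (b - a)" for n
 proof -
  let ?z1 = "Complex a (- T n)" and ?z2 = "Complex b (- T n)" and ?z3 = "Complex b (T n)" and ?z4 = "Complex a (T n)"
  have c: "(K has_contour_integral v) (linepath ?z1 ?z2 +++ linepath ?z2 ?z3 +++ linepath ?z3 ?z4 +++ linepath ?z4 ?z1)"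
   using ct[OF T(1), of n] by (simp add: rectpath_def Let_def)
  hence ci: "K contour_integrable_on (linepath ?z1 ?z2 +++ linepath ?z2 ?z3 +++ linepath ?z3 ?z4 +++ linepath ?z4 ?z1)"
   by (auto simp: contour_integrable_on_def)
  hence i: "K contour_integrable_on linepath ?z1 ?z2" "K contour_integrable_on linepath ?z2 ?z3"
       "K contour_integrable_on linepath ?z3 ?z4" "K contour_integrable_on linepath ?z4 ?z1"
   by (auto simp: contour_integrable_join valid_path_join)
  have "v = ?H1 n + contour_integral (linepath ?z2 ?z3) K + ?H2 n + contour_integral (linepath ?z4 ?z1) K"
   using contour_integral_unique[OF c] i by (simp add: contour_integral_join valid_path_join add_ac)
  moreover have "contour_integral (linepath ?z4 ?z1) K = - contour_integral (linepath ?z1 ?z4) K"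
   using contour_integral_reversepath[of "linepath ?z1 ?z4" K] by simp
  moreover have "contour_integral (linepath ?z2 ?z3) K = \<i> * ?I b n"
   by (rule contour_integral_linepath_same_Re[where c = b and a = "- T n" and b = "T n"]) (use T(2)[of n] in auto)
  moreover have "contour_integral (linepath ?z1 ?z4) K = \<i> * ?I a n"
   by (rule contour_integral_linepath_same_Re[where c = a and a = "- T n" and b = "T n"]) (use T(2)[of n] in auto)
  moreover have "B (T n) \<ge> 0"
   using order_trans[OF norm_ge_zero bd[of a "T n"]] T[of n] ab by simp
  have "norm (?H1 n) \<le> B (T n) * norm (?z2 - ?z1)"
  proof (rule contour_integral_bound_linepath[OF i(1) \<open>B (T n) \<ge> 0\<close>])
   fix x assume "x \<in> closed_segment ?z1 ?z2"
   hence "Im x = - T n" "a \<le> Re x" "Re x \<le> b"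
    using ab closed_segment_same_Im[of ?z1 ?z2] by (auto simp: closed_segment_eq_real_ivl)
   thus "norm (K x) \<le> B (T n)" using bd[of "Re x" "- T n"] T[of n] by (metis abs_minus_cancel abs_of_pos complex.collapse)
  qed
  moreover have "norm (?H2 n) \<le> B (T n) * norm (?z4 - ?z3)"
  proof (rule contour_integral_bound_linepath[OF i(3) \<open>B (T n) \<ge> 0\<close>])
   fix x assume "x \<in> closed_segment ?z3 ?z4"
   hence "Im x = T n" "a \<le> Re x" "Re x \<le> b"
    using ab closed_segment_same_Im[of ?z3 ?z4] by (auto simp: closed_segment_eq_real_ivl)
   thus "norm (K x) \<le> B (T n)" using bd[of "Re x" "T n"] T[of n] by (metis abs_of_pos complex.collapse)
  qed
  moreover have "norm (?z2 - ?z1) = b - a" "norm (?z4 - ?z3) = b - a" using ab by (auto simp: cmod_def)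
  ultimately show ?thesis by simp
 qed
 have "(\<lambda>n. B (T n) * (b - a)) \<longlonglongrightarrow> 0 * (b - a)"
  by (intro tendsto_intros filterlim_compose[OF B Tinf])
 hence Bz: "(\<lambda>n. B (T n) * (b - a)) \<longlonglongrightarrow> 0" by simp
 have "?H1 \<longlonglongrightarrow> 0" "?H2 \<longlonglongrightarrow> 0"
  by (rule Lim_null_comparison[OF _ Bz]; use parts in auto)+
 hence "(\<lambda>n. ?H1 n + \<i> * ?I b n + ?H2 n - \<i> * ?I a n) \<longlonglongrightarrow>
   0 + \<i> * (LBINT t. K (Complex b t)) + 0 - \<i> * (LBINT t. K (Complex a t))"
  by (intro tendsto_intros lim ia ib)
 moreover have "(\<lambda>n. ?H1 n + \<i> * ?I b n + ?H2 n - \<i> * ?I a n) = (\<lambda>_. v)" using parts by (intro ext) metis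
 ultimately show ?thesis by (simp add: LIMSEQ_const_iff algebra_simps)
qed

section \<open>Zeros of entire functions of finite order\<close>

text \<open>Because \<open>Re l < A\<close>, the value of \<open>l\<close> lies closer to 0 than to
  \<open>2 * A\<close>. Hence \<open>l / (2 * A - l)\<close> maps the disc into the unit disc and
  fixes 0, and Schwarz's lemma bounds it by 1/2 on the half disc.\<close>

lemma Borel_Caratheodory_half:
 assumes l: "l holomorphic_on ball 0 R" "l 0 = 0" and A: "\<And>z. z \<in> ball 0 R \<Longrightarrow> Re (l z) < A"
  and R: "R > 0" and z: "norm z \<le> R / 2"
 shows "norm (l z) \<le> 2 * A"
proof -
 define \<phi> where "\<phi> = (\<lambda>w. l (of_real R * w) / (2 * of_real A - l (of_real R * w)))"
 have sub: "of_real R * w \<in> ball 0 R" if "norm w < 1" for w :: complex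
  using that R by (simp add: norm_mult)
 have A0: "A > 0" using A[of 0] l(2) R by simp
 have lt: "norm (l (of_real R * w)) < norm (2 * of_real A - l (of_real R * w))" if "norm w < 1" for w
 proof (rule power2_less_imp_less)
  show "(norm (l (of_real R * w)))\<^sup>2 < (norm (2 * of_real A - l (of_real R * w)))\<^sup>2"
   using A[OF sub[OF that]] A0 unfolding cmod_power2 by (simp add: power2_eq_square algebra_simps)
 qed auto
 have hol: "\<phi> holomorphic_on ball 0 1"
  unfolding \<phi>_def
 proof (intro holomorphic_intros)
  show "(\<lambda>w. l (of_real R * w)) holomorphic_on ball 0 1"
   by (rule holomorphic_on_compose_gen[OF _ l(1), unfolded o_def]) (use sub in \<open>auto intro!: holomorphic_intros\<close>)
  show "(\<lambda>w. l (of_real R * w)) holomorphic_on ball 0 1"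
   by (rule holomorphic_on_compose_gen[OF _ l(1), unfolded o_def]) (use sub in \<open>auto intro!: holomorphic_intros\<close>)
  show "2 * of_real A - l (of_real R * w) \<noteq> 0" if "w \<in> ball 0 1" for w
   using lt[of w] that by auto
 qed
 have lt1: "norm (\<phi> w) < 1" if "norm w < 1" for w
  unfolding \<phi>_def norm_divide using lt[OF that] by (subst divide_less_eq_1_pos) (auto intro: le_less_trans[OF norm_ge_zero])
 have "\<phi> 0 = 0" by (simp add: \<phi>_def l)
 from Schwarz_Lemma'[OF hol this lt1] have S: "norm w < 1 \<Longrightarrow> norm (\<phi> w) \<le> norm w" for w by blast
 define w where "w = z / of_real R"
 have w: "norm w \<le> 1/2" "of_real R * w = z" using z R by (auto simp: w_def norm_divide field_simps)
 have phi: "norm (\<phi> w) \<le> 1/2" using S[of w] w by simp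
 have "2 * of_real A - l z \<noteq> 0" using lt[of w] w by auto
 hence eq: "l z = \<phi> w * (2 * of_real A - l z)" by (simp add: \<phi>_def w)
 have "norm (l z) \<le> 1/2 * norm (2 * of_real A - l z)"
  by (subst eq, subst norm_mult) (intro mult_right_mono phi, simp)
 also have "\<dots> \<le> 1/2 * (norm (2 * of_real A :: complex) + norm (l z))"
  by (intro mult_left_mono norm_triangle_ineq4) auto
 finally show ?thesis using A0 by simp
qed

text \<open>Borel-Caratheodory bounds \<open>l\<close> by \<open>2 * A\<close> on the disc of radius
  \<open>R / 2\<close>; Cauchy's estimate on circles of radius \<open>R / 8\<close> bounds the
  second derivative by \<open>2 * (2 * A) * 64 / R\<^sup>2\<close>, and the mean value inequality
  from 0 to \<open>z\<close> does the rest.\<close>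

lemma deriv_diff_bound_of_Re:
 assumes l: "l holomorphic_on ball 0 R" "l 0 = 0" and A: "\<And>z. z \<in> ball 0 R \<Longrightarrow> Re (l z) < A"
  and R: "R > 0" and z: "norm z \<le> R / 4"
 shows "norm (deriv l z - deriv l 0) \<le> 256 * A / R\<^sup>2 * norm z"
proof -
 have A0: "A > 0" using A[of 0] l(2) R by simp
 have bd: "norm (l z) \<le> 2 * A" if "norm z \<le> R / 2" for z
  by (rule Borel_Caratheodory_half[OF l A R that])
 have d2: "norm (deriv (deriv l) u) \<le> 256 * A / R\<^sup>2" if "u \<in> cball 0 (R/4)" for u
 proof -
  have sub: "cball u (R/8) \<subseteq> cball 0 (R/2)"
  proof
   fix x assume "x \<in> cball u (R/8)"
   thus "x \<in> cball 0 (R/2)" using that R norm_triangle_ineq[of "x - u" u]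
    by (auto simp: dist_norm norm_minus_commute)
  qed
  also have "\<dots> \<subseteq> ball 0 R" using R by auto
  finally have sub': "cball u (R/8) \<subseteq> ball 0 R" .
  have "norm ((deriv ^^ 2) l u) \<le> fact 2 * (2 * A) / (R/8) ^ 2"
  proof (rule Cauchy_inequality)
   show "l holomorphic_on ball u (R/8)" using l(1) sub' by (meson ball_subset_cball holomorphic_on_subset subset_trans)
   show "continuous_on (cball u (R/8)) l"
    using l(1) sub' by (meson holomorphic_on_imp_continuous_on continuous_on_subset)
   show "norm (l x) \<le> 2 * A" if "norm (u - x) = R/8" for x
    using sub that by (intro bd) (auto simp: dist_norm subset_iff)
  qed (use R in auto)
  thus ?thesis by (simp add: numeral_2_eq_2 power_divide field_simps)
 qed
 have "norm (deriv l z - deriv l 0) \<le> 256 * A / R\<^sup>2 * norm (z - 0)"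
 proof (rule field_differentiable_bound[of "cball 0 (R/4)" "deriv l" "deriv (deriv l)"])
  fix u :: complex assume u: "u \<in> cball 0 (R/4)"
  have "deriv l holomorphic_on ball 0 R" by (intro holomorphic_deriv l) auto
  hence "(deriv l has_field_derivative deriv (deriv l) u) (at u)"
   by (rule holomorphic_derivI) (use u R in auto)
  thus "(deriv l has_field_derivative deriv (deriv l) u) (at u within cball 0 (R/4))"
   by (rule has_field_derivative_at_within)
 qed (use d2 R z in auto)
 thus ?thesis by simp
qed

lemma analytic_entire: "h holomorphic_on UNIV \<Longrightarrow> h analytic_on A"
 by (meson analytic_on_holomorphic open_UNIV subset_UNIV)

lemma finite_zeros_compact:
 assumes h: "h holomorphic_on UNIV" and nz: "h w \<noteq> (0::complex)" and K: "compact K"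
 shows "finite {z\<in>K. h z = 0}"
proof (rule ccontr)
 assume inf: "infinite {z\<in>K. h z = 0}"
 obtain x where x: "x \<in> K" "x islimpt {z\<in>K. h z = 0}"
  using K inf unfolding compact_eq_Bolzano_Weierstrass by (metis (no_types, lifting) mem_Collect_eq subsetI)
 have "h w = 0"
  by (rule analytic_continuation[OF h open_UNIV connected_UNIV _ _ x(2)]) auto
 with nz show False by simp
qed

lemma eventually_nonzero_entire:
 assumes h: "h holomorphic_on UNIV" and nz: "h w \<noteq> (0::complex)"
 shows "eventually (\<lambda>z. h z \<noteq> 0) (at r)"
 using non_zero_neighbour_alt[OF h open_UNIV connected_UNIV, of r w] nz by auto

lemma zorder_entire_pos:
 assumes h: "h holomorphic_on UNIV" and nz: "h w \<noteq> (0::complex)"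
 shows "zorder h r \<ge> 0" "zorder h r > 0 \<longleftrightarrow> h r = 0"
proof -
 have fr: "frequently (\<lambda>z. h z \<noteq> 0) (at r)"
  by (intro eventually_frequently eventually_nonzero_entire[OF h nz]) auto
 show "zorder h r > 0 \<longleftrightarrow> h r = 0"
  by (rule zorder_pos_iff'[OF analytic_entire[OF h] fr])
 show "zorder h r \<ge> 0"
  by (rule zorder_ge_0[OF analytic_entire[OF h] fr])
qed

lemma zorder_linear_prod:
 fixes m :: "complex \<Rightarrow> nat"
 assumes "finite S" "r \<in> S" "0 \<notin> S"
 shows "zorder (\<lambda>z. \<Prod>rho\<in>S. (1 - z / rho) ^ m rho) r = int (m r)"
proof -
 define g where "g = (\<lambda>z. (- 1 / r) ^ m r * (\<Prod>rho\<in>S - {r}. (1 - z / rho) ^ m rho))"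
 have r0: "r \<noteq> 0" using assms by auto
 show ?thesis
 proof (rule zorder_eqI[of UNIV r g])
  show "g holomorphic_on UNIV" unfolding g_def
   using assms by (intro holomorphic_intros) auto
  show "g r \<noteq> 0" using assms r0 by (auto simp: g_def field_simps)
  fix w
  have "(\<Prod>rho\<in>S. (1 - w / rho) ^ m rho) = (1 - w / r) ^ m r * (\<Prod>rho\<in>S - {r}. (1 - w / rho) ^ m rho)"
   using assms by (subst prod.remove[of S r]) auto
  also have "1 - w / r = - 1 / r * (w - r)" using r0 by (simp add: field_simps)
  finally show "(\<Prod>rho\<in>S. (1 - w / rho) ^ m rho) = g w * (w - r) powi int (m r)"
   unfolding g_def power_int_of_nat power_mult_distrib by (simp only: mult_ac)
 qed auto
qed

text \<open>Only the zeros with \<open>norm rho \<le> R\<close> are divided out. On the circle of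
  radius \<open>3 * R\<close> each of their factors \<open>1 - w / rho\<close> has modulus at least
  2, so the maximum principle gains a factor 2 per zero.\<close>

lemma entire_divide_zeros:
 fixes h :: "complex \<Rightarrow> complex"
 assumes h: "h holomorphic_on UNIV" and h0: "h 0 \<noteq> 0" and R: "R > 0"
  and M: "\<And>z. norm z = 3 * R \<Longrightarrow> norm (h z) \<le> M"
 defines "S \<equiv> {rho. h rho = 0 \<and> norm rho \<le> R}"
 defines "n \<equiv> (\<Sum>rho\<in>S. nat (zorder h rho))"
 obtains k where "k holomorphic_on ball 0 (4*R)"
  "\<And>z. z \<in> ball 0 (4*R) \<Longrightarrow> h z = k z * (\<Prod>rho\<in>S. (1 - z / rho) ^ nat (zorder h rho))"
  "\<And>z. norm z \<le> R \<Longrightarrow> k z \<noteq> 0" "\<And>z. norm z \<le> 3 * R \<Longrightarrow> norm (k z) \<le> M / 2 ^ n"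
proof -
 \<comment> \<open>The factorization theorem wants all zeros in the open disc of radius
   \<open>4 * R\<close>; the factors belonging to \<open>T - S\<close> are given back to
   \<open>k\<close> afterwards.\<close>
 define T where "T = {rho. h rho = 0 \<and> norm rho < 4 * R}"
 define m where "m = (\<lambda>rho. nat (zorder h rho))"
 have finT: "finite T"
  by (rule finite_subset[OF _ finite_zeros_compact[OF h h0, of "cball 0 (4*R)"]]) (auto simp: T_def)
 have ST: "S \<subseteq> T" using R by (auto simp: S_def T_def)
 have finS: "finite S" using finT ST finite_subset by blast
 have T0: "0 \<notin> T" using h0 by (auto simp: T_def)
 define P where "P = (\<lambda>A z. \<Prod>rho\<in>A. (1 - z / rho) ^ m rho)"
 have m_pos: "m rho > 0 \<longleftrightarrow> h rho = 0" for rho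
  using zorder_entire_pos[OF h h0, of rho] by (simp add: m_def)
 have P0: "P A z = 0 \<longleftrightarrow> z \<in> A" if "A \<subseteq> T" for A z
 proof -
  have "finite A" using that finT finite_subset by blast
  thus ?thesis using that T0 m_pos
   by (auto simp: P_def T_def subset_iff field_simps)
 qed
 obtain k0 where k0: "k0 holomorphic_on ball 0 (4*R)" "\<And>z. z \<in> ball 0 (4*R) \<Longrightarrow> k0 z \<noteq> 0"
   "\<And>z. z \<in> ball 0 (4*R) \<Longrightarrow> h z = k0 z * P T z"
 proof (rule holomorphic_zorder_factorization[of h "ball 0 (4*R)" "P T"])
  show "h holomorphic_on ball 0 (4*R)" using h by (rule holomorphic_on_subset) auto
  show "P T holomorphic_on ball 0 (4 * R)" unfolding P_def using T0 by (intro holomorphic_intros) auto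
  show "P T z = 0 \<longleftrightarrow> h z = 0" if "z \<in> ball 0 (4*R)" for z
   using that by (subst P0) (auto simp: T_def)
  show "zorder (P T) z = zorder h z" if "z \<in> ball 0 (4*R)" for z
  proof (cases "h z = 0")
   case True
   hence "z \<in> T" using that by (auto simp: T_def)
   thus ?thesis unfolding P_def using finT T0 zorder_entire_pos[OF h h0, of z]
    by (subst zorder_linear_prod) (auto simp: m_def)
  next
   case False
   hence "P T z \<noteq> 0" using that by (subst P0) (auto simp: T_def)
   moreover have "P T analytic_on {z}" unfolding P_def using T0
    by (intro analytic_entire holomorphic_intros) auto
   ultimately have "zorder (P T) z = 0" by (intro zorder_eq_0I) auto
   moreover have "zorder h z = 0" using False by (intro zorder_eq_0I analytic_entire h) auto
   ultimately show ?thesis by simp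
  qed
 qed auto
 define k where "k = (\<lambda>z. k0 z * P (T - S) z)"
 have split: "P T z = P (T - S) z * P S z" for z
  unfolding P_def using prod.subset_diff[OF ST finT] by simp
 have khol: "k holomorphic_on ball 0 (4*R)"
  unfolding k_def P_def using T0 by (intro holomorphic_intros k0) auto
 have hk: "h z = k z * P S z" if "z \<in> ball 0 (4*R)" for z
  using k0(3)[OF that] by (simp add: k_def split)
 have "k z \<noteq> 0" if "norm z \<le> R" for z
 proof -
  have "z \<notin> T - S" using that by (auto simp: T_def S_def)
  hence "P (T - S) z \<noteq> 0" by (subst P0) auto
  thus ?thesis using k0(2)[of z] that R by (auto simp: k_def)
 qed
 moreover have "norm (k z) \<le> M / 2 ^ n" if z: "norm z \<le> 3 * R" for z
 proof (rule maximum_modulus_frontier[of k "cball 0 (3*R)"])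
  show "k holomorphic_on interior (cball 0 (3*R))"
   using khol R by (auto intro: holomorphic_on_subset)
  show "continuous_on (closure (cball 0 (3*R))) k"
   using khol R by (auto intro!: holomorphic_on_imp_continuous_on intro: holomorphic_on_subset)
  show "z \<in> cball 0 (3*R)" using z by simp
  fix w :: complex assume "w \<in> frontier (cball 0 (3*R))"
  hence w: "norm w = 3 * R" using R by (simp add: frontier_cball)
  have "2 ^ n = (\<Prod>rho\<in>S. (2::real) ^ m rho)" by (simp add: n_def m_def power_sum)
  also have "\<dots> \<le> (\<Prod>rho\<in>S. norm ((1 - w / rho) ^ m rho))"
  proof (intro prod_mono conjI)
   fix rho assume "rho \<in> S"
   hence rho: "norm rho \<le> R" "rho \<noteq> 0" using h0 by (auto simp: S_def)
   have "3 \<le> norm (w / rho)" using w rho by (simp add: norm_divide field_simps)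
   also have "\<dots> \<le> norm (1 - w / rho) + 1"
    using norm_triangle_ineq4[of "1 :: complex" "1 - w / rho"] by simp
   finally show "2 ^ m rho \<le> norm ((1 - w / rho) ^ m rho)"
    unfolding norm_power by (intro power_mono) auto
  qed auto
  also have "\<dots> = norm (P S w)" by (simp add: P_def prod_norm)
  finally have P2: "2 ^ n \<le> norm (P S w)" .
  have "norm (k w) * 2 ^ n \<le> norm (k w) * norm (P S w)" by (intro mult_left_mono P2) auto
  also have "\<dots> = norm (h w)" using hk[of w] w R by (simp add: norm_mult)
  also have "\<dots> \<le> M" by (rule M[OF w])
  finally show "norm (k w) \<le> M / 2 ^ n" by (simp add: field_simps)
 qed auto
 ultimately show ?thesis
  using that[of k] khol hk unfolding P_def m_def by blast
qed

text \<open>The counting function n(R) of Jensen's formula.\<close>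

definition zero_sum :: "(complex \<Rightarrow> complex) \<Rightarrow> real \<Rightarrow> nat" where
 "zero_sum h R = (\<Sum>rho | h rho = 0 \<and> norm rho \<le> R. nat (zorder h rho))"

text \<open>A form of Jensen's inequality: all linear factors equal 1 at 0, so
  \<open>norm (h 0) * 2 ^ n \<le> M\<close>. The factor 2 in the bound comes from
  \<open>ln 2 \<ge> 1/2\<close>.\<close>

lemma zero_sum_le:
 assumes h: "h holomorphic_on UNIV" and h0: "h 0 \<noteq> 0" and R: "R > 0"
  and M: "\<And>z. norm z = 3 * R \<Longrightarrow> norm (h z) \<le> M"
 shows "real (zero_sum h R) \<le> 2 * ln (M / norm (h 0))"
proof -
 define n where "n = zero_sum h R"
 obtain k where k: "k holomorphic_on ball 0 (4*R)"
  "\<And>z. z \<in> ball 0 (4*R) \<Longrightarrow> h z = k z * (\<Prod>rho | h rho = 0 \<and> norm rho \<le> R. (1 - z / rho) ^ nat (zorder h rho))"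
  "\<And>z. norm z \<le> 3 * R \<Longrightarrow> norm (k z) \<le> M / 2 ^ n"
  by (rule entire_divide_zeros[OF h h0 R M]) (auto simp: n_def zero_sum_def)
 have "norm (h 0) * 2 ^ n \<le> M"
  using k(2)[of 0] k(3)[of 0] R by (simp add: field_simps)
 hence "2 ^ n \<le> M / norm (h 0)" using h0 by (simp add: field_simps)
 hence "ln (2 ^ n) \<le> ln (M / norm (h 0))" by (intro ln_mono) auto
 moreover have "ln (2 ^ n) = real n * ln 2" by (simp add: ln_realpow)
 moreover have "ln 2 \<ge> (1/2 :: real)" using ln2_ge_two_thirds by simp
 then have "real n * (1/2) \<le> real n * ln 2" by (intro mult_left_mono) auto
 ultimately show ?thesis by (simp add: n_def)
qed

lemma logderiv_prod_linear:
 fixes m :: "complex \<Rightarrow> nat"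
 assumes "finite S" "0 \<notin> S" "z \<notin> S"
 shows "((\<lambda>z. \<Prod>rho\<in>S. (1 - z / rho) ^ m rho) has_field_derivative
      (\<Sum>rho\<in>S. of_nat (m rho) / (z - rho)) * (\<Prod>rho\<in>S. (1 - z / rho) ^ m rho)) (at z)"
 using assms
proof (induction S rule: finite_induct)
 case (insert r S)
 have r: "r \<noteq> 0" "z \<noteq> r" "1 - z / r \<noteq> 0" using insert.prems by (auto simp: field_simps)
 have *: "((\<lambda>z. (1 - z / r) ^ m r) has_field_derivative of_nat (m r) / (z - r) * (1 - z / r) ^ m r) (at z)"
 proof (cases "m r")
  case (Suc j)
  have "of_nat (Suc j) * (- (1 / r)) * (1 - z / r) ^ j = of_nat (Suc j) / (z - r) * (1 - z / r) ^ Suc j"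
  proof -
   have "(1 - z / r) / (z - r) = - (1 / r)" using r by (simp add: field_simps)
   thus ?thesis by (metis (no_types, lifting) mult.assoc mult.commute power_Suc times_divide_eq_left times_divide_eq_right)
  qed
  moreover have "((\<lambda>z. (1 - z / r) ^ Suc j) has_field_derivative of_nat (Suc j) * (- (1 / r)) * (1 - z / r) ^ j) (at z)"
  proof -
   have "((\<lambda>z. 1 - z / r) has_field_derivative - (1 / r)) (at z)"
    using r by (auto intro!: derivative_eq_intros)
   from DERIV_power[OF this, of "Suc j"] show ?thesis by (simp add: mult_ac)
  qed
  ultimately show ?thesis by (simp add: Suc)
 qed auto
 show ?case
  using DERIV_mult[OF * insert.IH] insert by (simp add: algebra_simps)
qed auto

text \<open>Once the zeros are divided out, \<open>k\<close> has a logarithm on the disc whose real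
  part, normalised at 0, is at most \<open>ln (M / norm (h 0))\<close>. The left side is
  \<open>deriv l z - deriv l 0\<close>: subtracting the value at 0 introduces the terms
  \<open>1 / rho\<close> but gains a second factor \<open>1 / R\<close>, so that the error vanishes
  in the limit for growth of order below 2.\<close>

lemma logderiv_finite_zeros:
 assumes h: "h holomorphic_on UNIV" and h0: "h 0 \<noteq> 0" and R: "R > 0"
  and M: "\<And>z. norm z = 3 * R \<Longrightarrow> norm (h z) \<le> M" and z: "norm z \<le> R / 4" "h z \<noteq> 0"
 shows "norm (deriv h z / h z - deriv h 0 / h 0 -
      (\<Sum>rho | h rho = 0 \<and> norm rho \<le> R. of_nat (nat (zorder h rho)) * (1 / (z - rho) + 1 / rho)))
     \<le> 256 * (ln (M / norm (h 0)) + 1) / R\<^sup>2 * norm z"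
proof -
 define S where "S = {rho. h rho = 0 \<and> norm rho \<le> R}"
 define m where "m = (\<lambda>rho. nat (zorder h rho))"
 define P where "P = (\<lambda>z. \<Prod>rho\<in>S. (1 - z / rho) ^ m rho)"
 have finS: "finite S"
  by (rule finite_subset[OF _ finite_zeros_compact[OF h h0, of "cball 0 R"]]) (auto simp: S_def)
 have S0: "0 \<notin> S" using h0 by (auto simp: S_def)
 obtain k where k: "k holomorphic_on ball 0 (4*R)"
  "\<And>z. z \<in> ball 0 (4*R) \<Longrightarrow> h z = k z * P z"
  "\<And>z. norm z \<le> R \<Longrightarrow> k z \<noteq> 0"
  "\<And>z. norm z \<le> 3 * R \<Longrightarrow> norm (k z) \<le> M / 2 ^ sum m S"
  by (rule entire_divide_zeros[OF h h0 R M, folded S_def m_def, folded m_def, folded P_def]) (auto simp: P_def m_def)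
 have k0: "k 0 = h 0" using k(2)[of 0] R by (simp add: P_def)
 have kM: "norm (k z) \<le> M" if "norm z \<le> 3 * R" for z
 proof -
  have "norm (k z) * 1 \<le> norm (k z) * 2 ^ sum m S" by (intro mult_left_mono) auto
  also have "\<dots> \<le> M" using k(4)[OF that] by (simp add: field_simps)
  finally show ?thesis by simp
 qed
 have khol: "k holomorphic_on ball 0 R" using k(1) R by (auto intro: holomorphic_on_subset)
 obtain g where g: "g holomorphic_on ball 0 R" "\<And>x. x \<in> ball 0 R \<Longrightarrow> exp (g x) = k x"
  by (rule holomorphic_logarithm_exists[of "ball 0 R" k 0]) (use khol k(3) R in auto)
 define l where "l = (\<lambda>x. g x - g 0)"
 \<comment> \<open>The added 1 turns the bound on \<open>Re (l x)\<close> into a strict one.\<close>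
 define A where "A = ln (M / norm (h 0)) + 1"
 have lhol: "l holomorphic_on ball 0 R" unfolding l_def by (intro holomorphic_intros g)
 have ReA: "Re (l x) < A" if x: "x \<in> ball 0 R" for x
 proof -
  have "exp (Re (l x)) = norm (exp (l x))" by simp
  also have "exp (l x) = k x / h 0" using g(2)[OF x] g(2)[of 0] R k0 by (simp add: l_def exp_diff)
  also have "norm \<dots> \<le> M / norm (h 0)" using kM[of x] x R h0 by (auto simp: norm_divide divide_right_mono)
  finally have "exp (Re (l x)) \<le> M / norm (h 0)" .
  hence "ln (exp (Re (l x))) \<le> ln (M / norm (h 0))" by (intro ln_mono) auto
  thus ?thesis by (simp add: A_def)
 qed
 have kd: "(k has_field_derivative deriv l x * k x) (at x)" if x: "x \<in> ball 0 R" for x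
 proof -
  have dl: "(l has_field_derivative deriv l x) (at x)"
   by (rule holomorphic_derivI[OF lhol]) (use x in auto)
  have "((\<lambda>x. exp (l x) * k 0) has_field_derivative (exp (l x) * deriv l x * k 0)) (at x)"
   by (auto intro!: derivative_eq_intros dl)
  moreover have ex: "exp (l y) * k 0 = k y" if "y \<in> ball 0 R" for y
   using g(2)[OF that] g(2)[of 0] R k(3)[of 0] by (simp add: l_def exp_diff)
  ultimately have "((\<lambda>x. exp (l x) * k 0) has_field_derivative (deriv l x * k x)) (at x)"
   using x by (simp add: mult_ac flip: ex)
  thus ?thesis
   by (rule has_field_derivative_transform_within_open[of _ _ _ "ball 0 R"]) (use x ex in auto)
 qed
 have ld: "deriv h x / h x = deriv l x + (\<Sum>rho\<in>S. of_nat (m rho) / (x - rho))"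
  if x: "x \<in> ball 0 R" "h x \<noteq> 0" for x
 proof -
  have xS: "x \<notin> S" using x by (auto simp: S_def)
  have xR: "x \<in> ball 0 (4*R)" using x R by auto
  have "((\<lambda>x. k x * P x) has_field_derivative
    (deriv l x * k x * P x + (\<Sum>rho\<in>S. of_nat (m rho) / (x - rho)) * P x * k x)) (at x)"
   unfolding P_def by (rule DERIV_mult[OF kd[OF x(1)] logderiv_prod_linear[OF finS S0 xS]])
  hence "(h has_field_derivative
    (deriv l x * k x * P x + (\<Sum>rho\<in>S. of_nat (m rho) / (x - rho)) * P x * k x)) (at x)"
   by (rule has_field_derivative_transform_within_open[of _ _ _ "ball 0 (4*R)"]) (use xR k(2) in auto)
  hence "deriv h x = (deriv l x + (\<Sum>rho\<in>S. of_nat (m rho) / (x - rho))) * h x"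
   using k(2)[OF xR] by (simp add: DERIV_imp_deriv algebra_simps)
  thus ?thesis using x by simp
 qed
 have zR: "z \<in> ball 0 R" using z R by auto
 have "deriv h z / h z - deriv h 0 / h 0 - (\<Sum>rho\<in>S. of_nat (m rho) * (1 / (z - rho) + 1 / rho))
   = deriv l z - deriv l 0"
  using ld[OF zR z(2)] ld[of 0] h0 R by (simp add: ring_distribs sum.distrib sum_negf)
 moreover have "norm (deriv l z - deriv l 0) \<le> 256 * A / R\<^sup>2 * norm z"
  by (rule deriv_diff_bound_of_Re[OF lhol _ ReA R z(1)]) (auto simp: l_def)
 ultimately show ?thesis unfolding S_def m_def A_def by simp
qed

lemma zero_sum_growth:
 assumes h: "h holomorphic_on UNIV" and h0: "h 0 \<noteq> 0" and C: "C \<ge> 0" "kappa \<ge> 0"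
  and gr: "\<And>z. norm (h z) \<le> exp (C * (1 + norm z) powr kappa)"
 obtains K where "K \<ge> 0" "\<And>R. R \<ge> 1 \<Longrightarrow> ln (exp (C * (1 + 3 * R) powr kappa) / norm (h 0)) + 1 \<le> K * R powr kappa"
   "\<And>R. R \<ge> 1 \<Longrightarrow> real (zero_sum h R) \<le> K * R powr kappa"
proof -
 define K where "K = C * 4 powr kappa + 1 + \<bar>ln (norm (h 0))\<bar>"
 have K0: "K \<ge> 0" using C by (simp add: K_def)
 have 1: "ln (exp (C * (1 + 3 * R) powr kappa) / norm (h 0)) + 1 \<le> K * R powr kappa" if R: "R \<ge> 1" for R
 proof -
  have "C * (1 + 3 * R) powr kappa \<le> C * (4 * R) powr kappa"
   using R C by (intro mult_left_mono powr_mono2) auto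
  also have "\<dots> = C * 4 powr kappa * R powr kappa" using R by (simp add: powr_mult)
  finally have a: "C * (1 + 3 * R) powr kappa \<le> C * 4 powr kappa * R powr kappa" .
  have "1 \<le> R powr kappa" using R C by (intro ge_one_powr_ge_zero) auto
  hence "(1 + \<bar>ln (norm (h 0))\<bar>) * 1 \<le> (1 + \<bar>ln (norm (h 0))\<bar>) * R powr kappa"
   by (intro mult_left_mono) auto
  hence "1 - ln (norm (h 0)) \<le> (1 + \<bar>ln (norm (h 0))\<bar>) * R powr kappa"
   by (rule order_trans[rotated]) simp
  moreover have "ln (exp (C * (1 + 3 * R) powr kappa) / norm (h 0)) = C * (1 + 3 * R) powr kappa - ln (norm (h 0))"
   using h0 by (subst ln_div) auto
  ultimately show ?thesis using a by (simp add: K_def algebra_simps)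
 qed
 have 2: "real (zero_sum h R) \<le> 2 * K * R powr kappa" if R: "R \<ge> 1" for R
 proof -
  have "real (zero_sum h R) \<le> 2 * ln (exp (C * (1 + 3 * R) powr kappa) / norm (h 0))"
   using R gr by (intro zero_sum_le[OF h h0]) (auto, metis)
  with 1[OF R] show ?thesis by simp
 qed
 show ?thesis
 proof (rule that[of "2 * K"])
  fix R :: real assume R: "R \<ge> 1"
  show "real (zero_sum h R) \<le> 2 * K * R powr kappa" by (rule 2[OF R])
  have "K * R powr kappa \<ge> 0" using K0 by simp
  thus "ln (exp (C * (1 + 3 * R) powr kappa) / norm (h 0)) + 1 \<le> 2 * K * R powr kappa"
   using 1[OF R] by simp
 qed (use K0 in auto)
qed

lemma finite_zeros_cball:
 assumes h: "h holomorphic_on UNIV" and h0: "h w \<noteq> (0::complex)"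
 shows "finite {rho. h rho = 0 \<and> norm rho \<le> R}"
 by (rule finite_subset[OF _ finite_zeros_compact[OF h h0, of "cball 0 R"]]) auto

text \<open>Dyadic shells: about \<open>2 ^ j\<close> away from 0 there are at most
  \<open>K * (2 ^ Suc j) powr kappa\<close> zeros of weight at most
  \<open>(2 ^ j) powr (-\<beta>)\<close> each, which is a geometric series of ratio
  \<open>2 powr (kappa - \<beta>)\<close>.\<close>

lemma zeros_powr_summable:
 assumes h: "h holomorphic_on UNIV" and h0: "h 0 \<noteq> 0"
  and K: "K \<ge> 0" "\<And>R. R \<ge> 1 \<Longrightarrow> real (zero_sum h R) \<le> K * R powr kappa" and \<beta>: "\<beta> > kappa" "\<beta> > 0"
 shows "(\<lambda>rho. real (nat (zorder h rho)) * (1 + norm rho) powr (-\<beta>)) summable_on {rho. h rho = 0}"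
proof (rule nonneg_bdd_above_summable_on)
 let ?f = "\<lambda>rho. real (nat (zorder h rho)) * (1 + norm rho) powr (-\<beta>)"
 define x where "x = 2 powr (kappa - \<beta>)"
 have x: "x \<ge> 0" "x < 1" using \<beta> by (auto simp: x_def powr_less_one)
 define B where "B = K * 2 powr kappa / (1 - x)"
 show "bdd_above (sum ?f ` {F. F \<subseteq> {rho. h rho = 0} \<and> finite F})"
 proof (rule bdd_aboveI2[of _ _ B])
  fix F assume F: "F \<in> {F. F \<subseteq> {rho. h rho = 0} \<and> finite F}"
  define d where "d = (\<lambda>rho::complex. nat \<lfloor>log 2 (1 + norm rho)\<rfloor>)"
  have d: "2 ^ d rho \<le> 1 + norm rho" "1 + norm rho < 2 ^ Suc (d rho)" for rho
  proof -
   have p: "1 + norm rho \<ge> 1" by simp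
   have "real (d rho) = of_int \<lfloor>log 2 (1 + norm rho)\<rfloor>"
   proof -
    have "0 \<le> log 2 (1 + norm rho)" by (subst zero_le_log_cancel_iff) (use norm_ge_zero[of rho] in linarith)+
    hence "0 \<le> \<lfloor>log 2 (1 + norm rho)\<rfloor>" by linarith
    thus ?thesis unfolding d_def by simp
   qed
   hence "real (d rho) \<le> log 2 (1 + norm rho)" "log 2 (1 + norm rho) < real (d rho) + 1"
    by linarith+
   hence "2 powr real (d rho) \<le> 1 + norm rho" "1 + norm rho < 2 powr (real (Suc (d rho)))"
    using p by (simp_all add: le_log_iff log_less_iff add.commute)
   thus "2 ^ d rho \<le> 1 + norm rho" "1 + norm rho < 2 ^ Suc (d rho)"
    by (simp_all only: powr_realpow zero_less_numeral)
  qed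
  obtain N where N: "\<And>rho. rho \<in> F \<Longrightarrow> d rho < N"
   using F finite_nat_set_iff_bounded[of "d ` F"] by auto
  have shell: "sum ?f {rho\<in>F. d rho = j} \<le> K * 2 powr kappa * x ^ j" for j
  proof -
   have "sum ?f {rho\<in>F. d rho = j} \<le> (\<Sum>rho\<in>{rho\<in>F. d rho = j}. real (nat (zorder h rho)) * (2 ^ j) powr (-\<beta>))"
    using d(1) \<beta> by (intro sum_mono mult_left_mono powr_mono2') auto
   also have "\<dots> \<le> (\<Sum>rho | h rho = 0 \<and> norm rho \<le> 2 ^ Suc j. real (nat (zorder h rho)) * (2 ^ j) powr (-\<beta>))"
   proof (intro sum_mono2 finite_zeros_cball[OF h h0])
    show "{rho\<in>F. d rho = j} \<subseteq> {rho. h rho = 0 \<and> norm rho \<le> 2 ^ Suc j}"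
    proof
     fix rho assume "rho \<in> {rho\<in>F. d rho = j}"
     hence "h rho = 0" "d rho = j" using F by auto
     with d(2)[of rho] show "rho \<in> {rho. h rho = 0 \<and> norm rho \<le> 2 ^ Suc j}" by auto
    qed
   qed auto
   also have "\<dots> = real (zero_sum h (2 ^ Suc j)) * (2 ^ j) powr (-\<beta>)"
    by (simp add: zero_sum_def sum_distrib_right)
   also have "\<dots> \<le> K * (2 ^ Suc j) powr kappa * (2 ^ j) powr (-\<beta>)"
    by (intro mult_right_mono K(2) one_le_power) auto
   also have "\<dots> = K * 2 powr kappa * x ^ j"
    by (simp add: x_def powr_mult powr_power powr_add[symmetric] algebra_simps flip: powr_realpow)
      (simp add: powr_powr powr_add[symmetric] algebra_simps)
   finally show ?thesis .
  qed
  have "sum ?f F = (\<Sum>j<N. sum ?f {rho\<in>F. d rho = j})"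
   using F N by (subst sum.group) auto
  also have "\<dots> \<le> (\<Sum>j<N. K * 2 powr kappa * x ^ j)" by (intro sum_mono shell)
  also have "\<dots> = K * 2 powr kappa * (\<Sum>j<N. x ^ j)" by (simp add: sum_distrib_left)
  also have "(\<Sum>j<N. x ^ j) \<le> (\<Sum>j. x ^ j)" using x by (intro sum_le_suminf summable_geometric) auto
  hence "K * 2 powr kappa * (\<Sum>j<N. x ^ j) \<le> K * 2 powr kappa * (1 / (1 - x))"
   using K x by (intro mult_left_mono) (auto simp: suminf_geometric)
  finally show "sum ?f F \<le> B" by (simp add: B_def)
 qed
qed auto

text \<open>Hadamard's theorem for order below 2, in logarithmic-derivative form. Up to multiplicity
  the summands are \<open>z / ((z - rho) * rho)\<close> and hence absolutely summable; the sum is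
  then identified along the discs of integer radius, where \<open>logderiv_finite_zeros\<close>
  leaves an error of order \<open>n powr (kappa - 2)\<close>.\<close>

theorem logderiv_has_sum:
 assumes h: "h holomorphic_on UNIV" and h0: "h 0 \<noteq> 0" and C: "C \<ge> 0" "kappa \<ge> 0" "kappa < 2"
  and gr: "\<And>z. norm (h z) \<le> exp (C * (1 + norm z) powr kappa)" and z: "h z \<noteq> 0"
 shows "((\<lambda>rho. of_nat (nat (zorder h rho)) * (1 / (z - rho) + 1 / rho)) has_sum
      (deriv h z / h z - deriv h 0 / h 0)) {rho. h rho = 0}"
proof -
 let ?Z = "{rho. h rho = 0}"
 let ?f = "\<lambda>rho. of_nat (nat (zorder h rho)) * (1 / (z - rho) + 1 / rho)"
 let ?S = "\<lambda>R. {rho. h rho = 0 \<and> norm rho \<le> R}"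
 obtain K where K: "K \<ge> 0" "\<And>R. R \<ge> 1 \<Longrightarrow> ln (exp (C * (1 + 3 * R) powr kappa) / norm (h 0)) + 1 \<le> K * R powr kappa"
   "\<And>R. R \<ge> 1 \<Longrightarrow> real (zero_sum h R) \<le> K * R powr kappa"
  using zero_sum_growth[OF h h0 C(1,2) gr] by blast
 have sm: "(\<lambda>rho. real (nat (zorder h rho)) * (1 + norm rho) powr (-2)) summable_on ?Z"
  by (rule zeros_powr_summable[OF h h0 K(1,3)]) (use C in auto)
 obtain B where B: "B \<ge> 0" "\<And>rho. h rho = 0 \<Longrightarrow> norm (1 / (z - rho) + 1 / rho) \<le> B * (1 + norm rho) powr (-2)"
 proof -
  \<comment> \<open>Beyond this radius \<open>norm (z - rho) \<ge> norm rho / 2\<close>; the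
    finitely many zeros inside it are absorbed into the maximum \<open>D\<close>.\<close>
  define r where "r = 2 * norm z + 1"
  define D where "D = Max (insert 0 ((\<lambda>rho. norm (1 / (z - rho) + 1 / rho) * (1 + norm rho)\<^sup>2) ` ?S r))"
  have fin: "finite (insert 0 ((\<lambda>rho. norm (1 / (z - rho) + 1 / rho) * (1 + norm rho)\<^sup>2) ` ?S r))"
   using finite_zeros_cball[OF h h0] by auto
  have D0: "D \<ge> 0" unfolding D_def using fin by (intro Max_ge) auto
  have *: "norm (1 / (z - rho) + 1 / rho) * (1 + norm rho)\<^sup>2 \<le> D + 8 * norm z" if rho: "h rho = 0" for rho
  proof (cases "norm rho \<le> r")
   case True
   hence "norm (1 / (z - rho) + 1 / rho) * (1 + norm rho)\<^sup>2 \<le> D"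
    unfolding D_def using fin rho by (intro Max_ge) auto
   thus ?thesis by (smt (verit) norm_ge_zero)
  next
   case False
   hence n: "norm rho > 2 * norm z + 1" by (simp add: r_def)
   have nz: "rho \<noteq> 0" "z \<noteq> rho" using z rho h0 by auto
   have n1: "norm rho \<ge> 1" using n norm_ge_zero[of z] by linarith
   have a: "norm (z - rho) \<ge> norm rho / 2" using norm_triangle_ineq2[of rho z] n by (simp add: norm_minus_commute)
   have "1 / (z - rho) + 1 / rho = z / ((z - rho) * rho)" using nz by (simp add: field_simps)
   hence "norm (1 / (z - rho) + 1 / rho) * (1 + norm rho)\<^sup>2 = norm z * (1 + norm rho)\<^sup>2 / (norm (z - rho) * norm rho)"
    by (simp add: norm_divide norm_mult)
   also have "\<dots> \<le> norm z * (2 * norm rho)\<^sup>2 / (norm rho / 2 * norm rho)"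
    using n a nz n1 by (intro frac_le mult_left_mono power_mono mult_right_mono mult_pos_pos) auto
   also have "\<dots> = 8 * norm z" using nz by (simp add: power2_eq_square field_simps)
   finally show ?thesis using D0 by simp
  qed
  have "norm (1 / (z - rho) + 1 / rho) \<le> (D + 8 * norm z) * (1 + norm rho) powr (-2)" if "h rho = 0" for rho
  proof -
   have p: "1 + norm rho > 0" by (simp add: add_pos_nonneg)
   have "norm (1 / (z - rho) + 1 / rho) \<le> (D + 8 * norm z) / (1 + norm rho)\<^sup>2"
    using * [OF that] p by (subst pos_le_divide_eq) auto
   also have "\<dots> = (D + 8 * norm z) * (1 + norm rho) powr (-2)"
    using p by (simp add: powr_minus powr_numeral divide_inverse)
   finally show ?thesis .
  qed
  with D0 show ?thesis by (intro that[of "D + 8 * norm z"]) auto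
 qed
 have "(\<lambda>rho. norm (?f rho)) summable_on ?Z"
 proof (rule summable_on_comparison_test)
  show "(\<lambda>rho. B * (real (nat (zorder h rho)) * (1 + norm rho) powr (-2))) summable_on ?Z"
   by (intro summable_on_cmult_right sm)
  show "norm (?f rho) \<le> B * (real (nat (zorder h rho)) * (1 + norm rho) powr (-2))" if "rho \<in> ?Z" for rho
   using mult_left_mono[OF B(2), of rho "real (nat (zorder h rho))"] that by (simp add: norm_mult mult_ac)
 qed auto
 hence "?f summable_on ?Z" by (rule abs_summable_summable)
 hence hs: "(?f has_sum infsum ?f ?Z) ?Z" by simp
 have lim1: "(\<lambda>n. sum ?f (?S (real n))) \<longlonglongrightarrow> infsum ?f ?Z"
 proof -
  have "filterlim (\<lambda>n. ?S (real n)) (finite_subsets_at_top ?Z) sequentially"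
   unfolding filterlim_finite_subsets_at_top
  proof (intro allI impI)
   fix X assume X: "finite X \<and> X \<subseteq> ?Z"
   obtain N :: nat where N: "\<And>rho. rho \<in> X \<Longrightarrow> norm rho \<le> real N"
    using X finite_imp_bounded[of X] by (meson bounded_iff real_arch_simple order_trans)
   have "X \<subseteq> ?S (real n)" if "n \<ge> N" for n
    using X N that by (force intro: order_trans)
   thus "\<forall>\<^sub>F n in sequentially. finite (?S (real n)) \<and> X \<subseteq> ?S (real n) \<and> ?S (real n) \<subseteq> ?Z"
    using finite_zeros_cball[OF h h0] unfolding eventually_sequentially by (intro exI[of _ N]) blast
  qed
  thus ?thesis using hs unfolding has_sum_def by (rule filterlim_compose[rotated])
 qed
 have "(\<lambda>n. deriv h z / h z - deriv h 0 / h 0 - sum ?f (?S (real n))) \<longlonglongrightarrow> 0"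
 proof (rule Lim_null_comparison)
  show "(\<lambda>n. 256 * norm z * K * real n powr (kappa - 2)) \<longlonglongrightarrow> 0"
   using C by real_asymp
  obtain N :: nat where N: "real N \<ge> 4 * norm z" using real_arch_simple by blast
  show "\<forall>\<^sub>F n in sequentially. norm (deriv h z / h z - deriv h 0 / h 0 - sum ?f (?S (real n)))
       \<le> 256 * norm z * K * real n powr (kappa - 2)"
   using eventually_ge_at_top[of "max 1 N"]
  proof eventually_elim
   case (elim n)
   hence n: "real n \<ge> 1" "norm z \<le> real n / 4" using N by auto
   let ?M = "exp (C * (1 + 3 * real n) powr kappa)"
   have M: "norm (h w) \<le> ?M" if "norm w = 3 * real n" for w using gr[of w] that by simp
   have "norm (deriv h z / h z - deriv h 0 / h 0 - sum ?f (?S (real n)))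
     \<le> 256 * (ln (?M / norm (h 0)) + 1) / (real n)\<^sup>2 * norm z"
    using n by (intro logderiv_finite_zeros[OF h h0 _ M _ z]) auto
   also have "\<dots> \<le> 256 * (K * real n powr kappa) / (real n)\<^sup>2 * norm z"
    using K(2)[OF n(1)] by (intro mult_right_mono divide_right_mono mult_left_mono) auto
   also have "\<dots> = 256 * norm z * K * real n powr (kappa - 2)"
    using n by (simp add: powr_diff powr_numeral)
   finally show ?case .
  qed
 qed
 hence "(\<lambda>n. deriv h z / h z - deriv h 0 / h 0 - (deriv h z / h z - deriv h 0 / h 0 - sum ?f (?S (real n))))
      \<longlonglongrightarrow> deriv h z / h z - deriv h 0 / h 0 - 0"
  by (intro tendsto_intros)
 hence "(\<lambda>n. sum ?f (?S (real n))) \<longlonglongrightarrow> deriv h z / h z - deriv h 0 / h 0" by simp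
 hence "infsum ?f ?Z = deriv h z / h z - deriv h 0 / h 0"
  using lim1 LIMSEQ_unique by blast
 thus ?thesis using hs by simp
qed

section \<open>Sums over primes\<close>

abbreviation mang :: "nat \<Rightarrow> real" where "mang \<equiv> mangoldt"

lemma mangoldt_le_ln: "n > 0 \<Longrightarrow> mang n \<le> ln (real n)"
proof -
 assume n: "n > 0"
 have "mang n \<le> (\<Sum>d | d dvd n. mang d)"
  using n by (intro member_le_sum) (auto intro: mangoldt_nonneg)
 thus ?thesis using mangoldt_sum[of n, where ?'a = real] n by simp
qed

text \<open>Legendre's formula for \<open>ln (fact N)\<close>: each logarithm is a divisor sum of
  \<open>mang\<close>, and \<open>N div d\<close> counts the multiples of \<open>d\<close>.\<close>

lemma sum_ln_eq_mangoldt: "(\<Sum>n=1..N. ln (real n)) = (\<Sum>d=1..N. mang d * real (N div d))"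
proof -
 have "(\<Sum>n=1..N. ln (real n)) = (\<Sum>n=1..N. \<Sum>d=1..N. if d dvd n then mang d else 0)"
 proof (rule sum.cong[OF refl])
  fix n assume n: "n \<in> {1..N}"
  have "ln (real n) = (\<Sum>d | d dvd n. mang d)" using mangoldt_sum[of n, where ?'a = real] n by simp
  also have "{d. d dvd n} = {d \<in> {1..N}. d dvd n}"
  proof -
   have "1 \<le> d \<and> d \<le> n" if "d dvd n" for d
    using dvd_imp_le[OF that] dvd_pos_nat[OF _ that] n by auto
   thus ?thesis using n by force
  qed
  also have "(\<Sum>d\<in>\<dots>. mang d) = (\<Sum>d=1..N. if d dvd n then mang d else 0)"
   by (rule sum.inter_filter) auto
  finally show "ln (real n) = (\<Sum>d=1..N. if d dvd n then mang d else 0)" .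
 qed
 also have "\<dots> = (\<Sum>d=1..N. \<Sum>n=1..N. if d dvd n then mang d else 0)" by (rule sum.swap)
 also have "\<dots> = (\<Sum>d=1..N. mang d * real (N div d))"
 proof (rule sum.cong[OF refl])
  fix d assume d: "d \<in> {1..N}"
  have "{n\<in>{1..N}. d dvd n} = (\<lambda>k. d * k) ` {1..N div d}"
  proof (intro equalityI subsetI)
   fix n assume "n \<in> {n\<in>{1..N}. d dvd n}"
   then obtain k where "n = d * k" "1 \<le> n" "n \<le> N" by auto
   thus "n \<in> (\<lambda>k. d * k) ` {1..N div d}" using d
    by (auto simp: less_eq_div_iff_mult_less_eq mult.commute intro!: imageI Suc_leI)
  next
   fix n assume "n \<in> (\<lambda>k. d * k) ` {1..N div d}"
   thus "n \<in> {n\<in>{1..N}. d dvd n}" using d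
    by (auto simp: less_eq_div_iff_mult_less_eq mult.commute)
  qed
  hence "card {n\<in>{1..N}. d dvd n} = N div d" using d by (simp add: card_image inj_on_def)
  moreover have "(\<Sum>n=1..N. if d dvd n then mang d else 0) = (\<Sum>n\<in>{n\<in>{1..N}. d dvd n}. mang d)"
   by (rule sum.inter_filter[symmetric]) auto
  ultimately show "(\<Sum>n=1..N. if d dvd n then mang d else 0) = mang d * real (N div d)" by simp
 qed
 finally show ?thesis .
qed

lemma sum_ln_eq_ln_fact: "(\<Sum>n=1..N. ln (real n)) = ln (fact N)"
 by (induction N) (auto simp: ln_mult)

text \<open>Chebyshev's argument: \<open>(2*n) div d - 2 * (n div d)\<close> is never negative and
  is at least 1 for \<open>n < d \<le> 2*n\<close>, so the new terms are bounded by the logarithm of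
  the central binomial coefficient, which is at most \<open>2 * n * ln 2\<close>.\<close>

lemma mangoldt_double: "(\<Sum>d=1..2*n. mang d) \<le> (\<Sum>d=1..n. mang d) + 2 * real n"
proof -
 have c: "fact (2*n) = fact n * fact n * (real ((2*n) choose n))"
 proof -
  have "fact n * fact n * ((2*n) choose n) = (fact (2*n) :: nat)"
   using binomial_fact_lemma[of n "2*n"] by simp
  from arg_cong[OF this, of real] show ?thesis by simp
 qed
 have pos: "(2*n) choose n > 0" by simp
 have "ln (fact (2*n)) - 2 * ln (fact n) = ln (real ((2*n) choose n))"
  using pos by (subst c) (simp add: ln_mult)
 also have "\<dots> \<le> ln (2 ^ (2*n))"
 proof (rule ln_mono)
  have "(2*n) choose n \<le> (\<Sum>k\<le>2*n. (2*n) choose k)" by (intro member_le_sum) auto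
  also have "\<dots> = 2 ^ (2*n)" by (rule choose_row_sum)
  finally show "real ((2*n) choose n) \<le> 2 ^ (2*n)" by (metis of_nat_le_iff of_nat_numeral of_nat_power)
 qed (use pos in auto)
 also have "\<dots> = 2 * real n * ln 2" by (simp add: ln_realpow)
 also have "\<dots> \<le> 2 * real n * 1" using ln_2_less_1 by (intro mult_left_mono) auto
 finally have 1: "ln (fact (2*n)) - 2 * ln (fact n) \<le> 2 * real n" by simp
 have ext: "(\<Sum>d=1..n. mang d * real (n div d)) = (\<Sum>d=1..2*n. mang d * real (n div d))"
  by (intro sum.mono_neutral_left) auto
 have "(\<Sum>d=1..2*n. mang d) - (\<Sum>d=1..n. mang d) = (\<Sum>d=1..2*n. mang d * (if d > n then 1 else 0))"
 proof -
  have "(\<Sum>d=1..2*n. mang d) = (\<Sum>d=1..n. mang d) + (\<Sum>d=n+1..2*n. mang d)"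
   by (subst sum.union_disjoint[symmetric]) (auto intro!: sum.cong)
  moreover have "(\<Sum>d=n+1..2*n. mang d) = (\<Sum>d=1..2*n. mang d * (if d > n then 1 else 0))"
   by (intro sum.mono_neutral_cong_left) auto
  ultimately show ?thesis by simp
 qed
 also have "\<dots> \<le> (\<Sum>d=1..2*n. mang d * (real ((2*n) div d) - 2 * real (n div d)))"
 proof (intro sum_mono mult_left_mono mangoldt_nonneg)
  fix d assume d: "d \<in> {1..2*n}"
  have "2 * (n div d) \<le> (2 * n) div d"
   using d div_times_less_eq_dividend[of n d] by (auto simp: less_eq_div_iff_mult_less_eq mult.assoc)
  hence "2 * real (n div d) \<le> real ((2 * n) div d)" by linarith
  moreover have "(2*n) div d \<ge> 1 \<and> n div d = 0" if "d > n" using d that by (auto simp: Suc_le_eq div_greater_zero_iff)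
  hence "real ((2*n) div d) \<ge> 1 \<and> real (n div d) = 0" if "d > n" using that by force
  ultimately show "(if d > n then 1 else 0) \<le> real ((2*n) div d) - 2 * real (n div d)"
   by (cases "d > n") auto
 qed
 also have "\<dots> = ln (fact (2*n)) - 2 * ln (fact n)"
  unfolding sum_ln_eq_ln_fact[symmetric] sum_ln_eq_mangoldt ext
  by (simp add: sum_distrib_left sum_subtractf algebra_simps)
 finally show ?thesis using 1 by simp
qed

text \<open>Induction by halving: the doubling step gives \<open>4 * n + 2 * n\<close>, which leaves
  a slack of \<open>2 * n\<close>. For odd \<open>N\<close> this slack pays for the last term, at
  most \<open>ln (2 * n + 1)\<close>.\<close>

lemma Chebyshev_upper: "(\<Sum>d=1..N. mang d) \<le> 4 * real N"
proof (induction N rule: less_induct)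
 case (less N)
 show ?case
 proof (cases "N = 0")
  case False
  define n where "n = N div 2"
  have IH: "(\<Sum>d=1..n. mang d) \<le> 4 * real n" using less.IH[of n] False by (auto simp: n_def)
  have 2: "(\<Sum>d=1..2*n. mang d) \<le> 6 * real n" using mangoldt_double[of n] IH by simp
  show ?thesis
  proof (cases "even N")
   case True
   hence "N = 2 * n" by (simp add: n_def)
   thus ?thesis using 2 by simp
  next
   case False
   hence N: "N = Suc (2 * n)" by (simp add: n_def)
   have "mang N \<le> ln (real N)" using N by (intro mangoldt_le_ln) auto
   also have "ln (real N) \<le> 2 * real n" using ln_add_one_self_le_self[of "2 * real n"] N by simp
   finally show ?thesis using 2 N by simp
  qed
 qed auto
qed

lemma ln_fact_ge: "N \<ge> 1 \<Longrightarrow> real N * ln (real N) - real N \<le> ln (fact N)"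
proof (induction N rule: dec_induct)
 case (step N)
 have N: "real N > 0" using step by simp
 have "ln (real (Suc N)) - ln (real N) = ln (real (Suc N) / real N)"
  using N by (subst ln_div) auto
 also have "real (Suc N) / real N = 1 + 1 / real N" using N by (simp add: field_simps)
 also have "ln (1 + 1 / real N) \<le> 1 / real N" using N by (intro ln_add_one_self_le_self) auto
 finally have "real N * (ln (real (Suc N)) - ln (real N)) \<le> real N * (1 / real N)" using N by (intro mult_left_mono) auto
 hence "real N * (ln (real (Suc N)) - ln (real N)) \<le> 1" using N by simp
 moreover have "ln (fact (Suc N)) = ln (real (Suc N)) + ln (fact N)" using ln_mult[of "real (Suc N)" "fact N"] by simp
 ultimately show ?case using step.IH by (simp add: algebra_simps)
qed auto

text \<open>\<open>N * S - ln (fact N)\<close> is a sum of fractional parts of \<open>N / d\<close>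
  weighted by \<open>mang\<close>, hence between 0 and \<open>4 * N\<close> by Chebyshev, while
  \<open>ln (fact N)\<close> lies between \<open>N * ln N - N\<close> and
  \<open>N * ln N\<close>.\<close>

lemma Mertens_first:
 assumes N: "N \<ge> 1"
 shows "\<bar>(\<Sum>d=1..N. mang d / real d) - ln (real N)\<bar> \<le> 4"
proof -
 define S where "S = (\<Sum>d=1..N. mang d / real d)"
 have Np: "real N > 0" using N by simp
 have "real N * S - ln (fact N) = (\<Sum>d=1..N. mang d * (real N / real d - real (N div d)))"
  unfolding S_def sum_ln_eq_ln_fact[symmetric] sum_ln_eq_mangoldt
  by (simp add: sum_distrib_left sum_subtractf algebra_simps)
 moreover have "0 \<le> (\<Sum>d=1..N. mang d * (real N / real d - real (N div d)))"
 proof (intro sum_nonneg mult_nonneg_nonneg mangoldt_nonneg)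
  fix d assume d: "d \<in> {1..N}"
  have "real (N div d * d) \<le> real N" by (simp only: of_nat_le_iff div_times_less_eq_dividend)
  thus "0 \<le> real N / real d - real (N div d)" using d by (simp add: field_simps)
 qed
 moreover have "(\<Sum>d=1..N. mang d * (real N / real d - real (N div d))) \<le> (\<Sum>d=1..N. mang d * 1)"
 proof (intro sum_mono mult_left_mono mangoldt_nonneg)
  fix d
  show "real N / real d - real (N div d) \<le> 1"
   using floor_divide_of_nat_eq[of N d, where 'a = real] by linarith
 qed
 ultimately have 1: "0 \<le> real N * S - ln (fact N)" "real N * S - ln (fact N) \<le> 4 * real N"
  using Chebyshev_upper[of N] by auto
 have "ln (fact N) \<le> real N * ln (real N)"
 proof -
  have "ln (fact N) = (\<Sum>n=1..N. ln (real n))" by (rule sum_ln_eq_ln_fact[symmetric])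
  also have "\<dots> \<le> (\<Sum>n=1..N. ln (real N))" by (intro sum_mono) auto
  finally show ?thesis by simp
 qed
 with 1 ln_fact_ge[OF N] have "real N * (S - ln (real N)) \<le> real N * 4" "real N * (-1) \<le> real N * (S - ln (real N))"
  by (auto simp: algebra_simps)
 hence "S - ln (real N) \<le> 4" "-1 \<le> S - ln (real N)" by (simp_all only: mult_le_cancel_left_pos[OF Np])
 thus ?thesis unfolding S_def by auto
qed

text \<open>Enlarged to a sum over all \<open>m ^ k\<close> with \<open>m\<close> and
  \<open>k\<close> at least 2. By \<open>ln n \<le> 8 * n powr (1/8)\<close> a term is at most
  \<open>64 * n powr (-3/4)\<close>; for fixed \<open>m\<close> this is a geometric series of ratio
  at most 3/4 whose first term is of order \<open>m powr (-3/2)\<close>, which is summable in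
  \<open>m\<close>.\<close>

lemma prime_powers_ln_sum_bounded:
 obtains C :: real where "\<And>N. (\<Sum>n\<in>{n\<in>{1..N}. primepow n \<and> \<not> prime n}. (ln (real n))\<^sup>2 / real n) \<le> C"
proof -
 have sm: "summable (\<lambda>m. real m powr (-3/2))" by (subst summable_real_powr_iff) auto
 define Z where "Z = (\<Sum>m. real m powr (-3/2))"
 have g: "(ln (real n))\<^sup>2 / real n \<le> 64 * real n powr (-3/4)" if n: "n \<ge> 1" for n :: nat
 proof -
  have "ln (real n) \<le> real n powr (1/8) / (1/8)" using n by (intro ln_powr_bound) auto
  hence "(ln (real n))\<^sup>2 \<le> (8 * real n powr (1/8))\<^sup>2" using n by (intro power_mono) auto
  also have "\<dots> = 64 * real n powr (1/4)" using n by (simp add: power_mult_distrib powr_power)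
  finally have "(ln (real n))\<^sup>2 / real n \<le> 64 * real n powr (1/4) / real n powr 1"
   using n by (simp add: divide_right_mono)
  also have "\<dots> = 64 * real n powr (-3/4)" by (subst times_divide_eq_right[symmetric], subst powr_diff[symmetric]) simp
  finally show ?thesis .
 qed
 have inner: "(\<Sum>k=2..N. 64 * real (m ^ k) powr (-3/4)) \<le> 64 * 4 * real m powr (-3/2)" if m: "m \<ge> 2" for m N :: nat
 proof -
  define r where "r = real m powr (-3/4)"
  have r0: "r \<ge> 0" by (simp add: r_def)
  have "r \<le> 2 powr (-3/4)" unfolding r_def using m by (intro powr_mono2') auto
  also have "\<dots> \<le> 3/4"
  proof -
   have "(2 powr (-3/4)) ^ 4 = (2::real) powr (-3)" by (subst powr_power) auto
   also have "\<dots> = 1 / 8" by (subst powr_minus) (simp add: powr_numeral)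
   also have "\<dots> \<le> (3/4) ^ 4" by (simp add: power_divide)
   finally show ?thesis by (subst (asm) power_mono_iff) auto
  qed
  finally have r1: "r \<le> 3/4" .
  have "(\<Sum>k=2..N. 64 * real (m ^ k) powr (-3/4)) = 64 * (\<Sum>k=2..N. r ^ k)"
   using m by (simp add: sum_distrib_left r_def powr_power powr_powr flip: powr_realpow) (simp add: mult_ac)
  also have "(\<Sum>k=2..N. r ^ k) \<le> (\<Sum>k<Suc N. r ^ 2 * r ^ k)"
  proof -
   have "(\<Sum>k=2..N. r ^ k) = (\<Sum>k\<in>{2..N}. r ^ 2 * r ^ (k - 2))"
   proof (intro sum.cong refl)
    fix k assume "k \<in> {2..N}"
    thus "r ^ k = r ^ 2 * r ^ (k - 2)" by (metis atLeastAtMost_iff le_add_diff_inverse power_add)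
   qed
   also have "\<dots> = (\<Sum>k\<in>(\<lambda>k. k - 2) ` {2..N}. r ^ 2 * r ^ k)" by (subst sum.reindex) (auto simp: inj_on_def)
   also have "\<dots> \<le> (\<Sum>k<Suc N. r ^ 2 * r ^ k)" using r0 by (intro sum_mono2) auto
   finally show ?thesis .
  qed
  also have "\<dots> = r ^ 2 * (\<Sum>k<Suc N. r ^ k)" by (simp only: sum_distrib_left)
  also have "(\<Sum>k<Suc N. r ^ k) \<le> (\<Sum>k. r ^ k)" using r0 r1 by (intro sum_le_suminf summable_geometric) auto
  also have "\<dots> = 1 / (1 - r)" using r0 r1 by (intro suminf_geometric) auto
  also have "\<dots> \<le> 4" using r1 by (simp add: field_simps)
  finally have "(\<Sum>k=2..N. 64 * real (m ^ k) powr (-3/4)) \<le> 64 * (r ^ 2 * 4)" using r0 by (simp add: mult_left_mono)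
  also have "r ^ 2 = real m powr (-3/2)" using m by (simp add: r_def powr_power)
  finally show ?thesis by simp
 qed
 have "(\<Sum>n\<in>{n\<in>{1..N}. primepow n \<and> \<not> prime n}. (ln (real n))\<^sup>2 / real n) \<le> 256 * Z" for N
 proof -
  let ?A = "{n\<in>{1..N}. primepow n \<and> \<not> prime n}"
  let ?I = "{2..N} \<times> {2..N}"
  have sub: "?A \<subseteq> (\<lambda>(m, k). m ^ k) ` ?I"
  proof
   fix n assume n: "n \<in> ?A"
   then obtain p k where pk: "prime p" "k > 0" "n = p ^ k" by (auto simp: primepow_def)
   have "k \<noteq> 1" using n pk by auto
   hence k: "k \<ge> 2" using pk by simp
   have p: "p \<ge> 2" using pk prime_ge_2_nat by auto
   have "p ^ 1 \<le> p ^ k" using p pk by (intro power_increasing) auto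
   hence pN: "p \<le> N" using n pk by auto
   have "k < 2 ^ k" by (rule less_exp)
   also have "\<dots> \<le> p ^ k" using p by (intro power_mono) auto
   finally have "k \<le> N" using n pk by auto
   hence "(p, k) \<in> ?I" using p pN k by simp
   moreover have "n = (case (p, k) of (m, k) \<Rightarrow> m ^ k)" using pk by simp
   ultimately show "n \<in> (\<lambda>(m, k). m ^ k) ` ?I" by (rule rev_image_eqI)
  qed
  have "(\<Sum>n\<in>?A. (ln (real n))\<^sup>2 / real n) \<le> (\<Sum>n\<in>?A. 64 * real n powr (-3/4))"
   by (intro sum_mono g) auto
  also have "\<dots> \<le> (\<Sum>n\<in>(\<lambda>(m, k). m ^ k) ` ?I. 64 * real n powr (-3/4))"
   by (intro sum_mono2 sub) auto
  also have "\<dots> \<le> (\<Sum>x\<in>?I. 64 * real (case x of (m, k) \<Rightarrow> m ^ k) powr (-3/4))"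
   using sum_image_le[of ?I "\<lambda>n. 64 * real n powr (-3/4)" "\<lambda>(m, k). m ^ k"] by (simp add: o_def)
  also have "\<dots> = (\<Sum>m=2..N. \<Sum>k=2..N. 64 * real (m ^ k) powr (-3/4))"
   by (simp add: sum.cartesian_product split_beta)
  also have "\<dots> \<le> (\<Sum>m=2..N. 64 * 4 * real m powr (-3/2))" by (intro sum_mono inner) auto
  also have "\<dots> = 256 * (\<Sum>m=2..N. real m powr (-3/2))" by (simp add: sum_distrib_left)
  also have "(\<Sum>m=2..N. real m powr (-3/2)) \<le> Z" unfolding Z_def by (intro sum_le_suminf sm) auto
  finally show ?thesis by simp
 qed
 thus ?thesis by (rule that)
qed

text \<open>Weak convergence from convergence of distribution functions, here to the uniform law,
  for weights whose total mass only tends to 1. The test function is compared with a step function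
  of mesh \<open>1 / K\<close>, whose integral is a combination of differences of the distribution
  function.\<close>

lemma tendsto_integral_of_cdf:
 fixes w x :: "nat \<Rightarrow> nat \<Rightarrow> real" and A :: "nat \<Rightarrow> nat set"
 assumes fin: "\<And>q. finite (A q)" and w: "\<And>q n. n \<in> A q \<Longrightarrow> w q n \<ge> 0"
  and x: "\<And>q n. n \<in> A q \<Longrightarrow> 0 \<le> x q n \<and> x q n \<le> 1"
  and cdf: "\<And>t. 0 \<le> t \<Longrightarrow> t \<le> 1 \<Longrightarrow> (\<lambda>q. \<Sum>n\<in>{n\<in>A q. x q n \<le> t}. w q n) \<longlonglongrightarrow> t"
  and \<phi>: "continuous_on {0..1} \<phi>"
 shows "(\<lambda>q. \<Sum>n\<in>A q. w q n * \<phi> (x q n)) \<longlonglongrightarrow> integral {0..1} \<phi>"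
proof (rule LIMSEQ_I)
 fix e :: real assume e: "e > 0"
 have uc: "uniformly_continuous_on {0..1} \<phi>" by (rule compact_uniformly_continuous[OF \<phi>]) auto
 obtain d where d: "d > 0" "\<And>a b. a \<in> {0..1} \<Longrightarrow> b \<in> {0..1} \<Longrightarrow> \<bar>a - b\<bar> < d \<Longrightarrow> \<bar>\<phi> a - \<phi> b\<bar> < e / 8"
 proof -
  have "e / 8 > 0" using e by simp
  from uc[unfolded uniformly_continuous_on_def, rule_format, OF this] obtain d where "d > 0" "\<And>a b. a \<in> {0..1} \<Longrightarrow> b \<in> {0..1} \<Longrightarrow> dist b a < d \<Longrightarrow> dist (\<phi> b) (\<phi> a) < e / 8"
   by blast
  thus thesis by (intro that[of d]) (auto simp: dist_real_def)
 qed
 obtain K0 :: nat where "inverse (real (Suc K0)) < d" using reals_Archimedean[OF d(1)] by auto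
 then obtain K :: nat where K: "K > 0" "1 / real K < d" by (intro that[of "Suc K0"]) (auto simp: inverse_eq_divide)
 \<comment> \<open>Rounding up makes the cells closed on the right, as in the hypothesis
   \<open>cdf\<close>; cell 0 consists of the points at 0 and has vanishing mass.\<close>
 define c where "c = (\<lambda>u::real. nat \<lceil>real K * u\<rceil>)"
 have c_le: "c u \<le> j \<longleftrightarrow> u \<le> real j / real K" for u j
  unfolding c_def nat_le_iff ceiling_le_iff using K by (simp add: field_simps)
 have cK: "c u \<le> K" if "u \<le> 1" for u using c_le[of u K] that K by simp
 have c_near: "\<bar>u - real (c u) / real K\<bar> < d \<and> real (c u) / real K \<in> {0..1}" if u: "0 \<le> u" "u \<le> 1" for u
 proof -
  have 1: "u \<le> real (c u) / real K" using c_le[of u "c u"] by simp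
  have 2: "real (c u) / real K \<le> u + 1 / real K"
  proof -
   have "real (c u) = of_int \<lceil>real K * u\<rceil>" using u K by (simp add: c_def)
   also have "\<dots> \<le> real K * u + 1" by linarith
   finally show ?thesis using K by (simp add: field_simps)
  qed
  have "real (c u) \<le> real K" using cK[OF u(2)] by simp
  hence "real (c u) / real K \<le> 1" "0 \<le> real (c u) / real K" using K by auto
  moreover have "\<bar>u - real (c u) / real K\<bar> < d" using 1 2 K(2) by linarith
  ultimately show ?thesis by simp
 qed
 define s where "s = (\<lambda>u. \<phi> (real (c u) / real K))"
 have s_near: "\<bar>\<phi> u - s u\<bar> \<le> e / 8" if "0 \<le> u" "u \<le> 1" for u
  using d(2)[of u "real (c u) / real K"] c_near[OF that] that by (auto simp: s_def)
 define T where "T = (\<lambda>t q. \<Sum>n\<in>{n\<in>A q. x q n \<le> t}. w q n)"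
 define M where "M = (\<lambda>j q. \<Sum>n\<in>{n\<in>A q. c (x q n) = j}. w q n)"
 have M0: "M 0 q = T 0 q" for q
  unfolding M_def T_def by (intro sum.cong) (use c_le[of _ 0] in auto)
 have MS: "M (Suc j) q = T (real (Suc j) / real K) q - T (real j / real K) q" for j q
 proof -
  have T: "T (real i / real K) q = (\<Sum>n\<in>{n\<in>A q. c (x q n) \<le> i}. w q n)" for i
   unfolding T_def c_le ..
  have "{n\<in>A q. c (x q n) \<le> Suc j} = {n\<in>A q. c (x q n) \<le> j} \<union> {n\<in>A q. c (x q n) = Suc j}" by auto
  hence "T (real (Suc j) / real K) q = T (real j / real K) q + M (Suc j) q"
   unfolding T M_def using fin[of q] by (subst sum.union_disjoint[symmetric]) auto
  thus ?thesis by simp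
 qed
 have Tlim: "T t \<longlonglongrightarrow> t" if "0 \<le> t" "t \<le> 1" for t using cdf[OF that] by (simp add: T_def[abs_def])
 have Mlim0: "M 0 \<longlonglongrightarrow> 0" using Tlim[of 0] by (simp add: M0[abs_def])
 have MlimS: "M (Suc j) \<longlonglongrightarrow> 1 / real K" if "j < K" for j
 proof -
  have "(\<lambda>q. T (real (Suc j) / real K) q - T (real j / real K) q) \<longlonglongrightarrow> real (Suc j) / real K - real j / real K"
   using that K by (intro tendsto_diff Tlim) (auto simp: field_simps)
  moreover have "real (Suc j) / real K - real j / real K = 1 / real K" by (simp add: add_divide_distrib)
  moreover have "M (Suc j) = (\<lambda>q. T (real (Suc j) / real K) q - T (real j / real K) q)" by (rule ext) (rule MS)
  ultimately show ?thesis by (simp only:)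
 qed
 have step_sum: "(\<Sum>n\<in>A q. w q n * s (x q n)) = \<phi> 0 * M 0 q + (\<Sum>j<K. \<phi> (real (Suc j) / real K) * M (Suc j) q)" for q
 proof -
  have "(\<Sum>n\<in>A q. w q n * s (x q n)) = (\<Sum>j\<le>K. \<Sum>n\<in>{n\<in>A q. c (x q n) = j}. w q n * s (x q n))"
   by (rule sum.group[symmetric]) (use fin cK x in auto)
  also have "\<dots> = (\<Sum>j\<le>K. \<phi> (real j / real K) * M j q)"
   by (simp add: M_def s_def sum_distrib_left mult_ac)
  also have "\<dots> = \<phi> 0 * M 0 q + (\<Sum>j<K. \<phi> (real (Suc j) / real K) * M (Suc j) q)"
   by (subst sum.atMost_shift) simp
  finally show ?thesis .
 qed
 define R where "R = (\<Sum>j<K. \<phi> (real (Suc j) / real K) * (1 / real K))"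
 have step_lim: "(\<lambda>q. \<Sum>n\<in>A q. w q n * s (x q n)) \<longlonglongrightarrow> R"
 proof -
  have "(\<lambda>q. \<phi> 0 * M 0 q + (\<Sum>j<K. \<phi> (real (Suc j) / real K) * M (Suc j) q)) \<longlonglongrightarrow> \<phi> 0 * 0 + R"
   unfolding R_def by (intro tendsto_intros Mlim0 MlimS) auto
  thus ?thesis unfolding step_sum by simp
 qed
 have R_int: "\<bar>R - integral {0..1} \<phi>\<bar> \<le> e / 8"
 proof -
  have int: "\<phi> integrable_on {a..b}" if "0 \<le> a" "b \<le> 1" for a b
   by (rule integrable_continuous_real, rule continuous_on_subset[OF \<phi>]) (use that in auto)
  have piece: "\<bar>\<phi> (real (Suc j) / real K) * (1 / real K) - integral {real j / real K..real (Suc j) / real K} \<phi>\<bar> \<le> e / 8 * (1 / real K)"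
   if j: "j < K" for j
  proof -
   let ?a = "real j / real K" and ?b = "real (Suc j) / real K"
   have ab: "0 \<le> ?a" "?a \<le> ?b" "?b \<le> 1" using j K by (auto simp: field_simps)
   have len: "?b - ?a = 1 / real K" by (simp add: add_divide_distrib)
   have "norm (integral {?a..?b} (\<lambda>u. \<phi> ?b - \<phi> u)) \<le> e / 8 * (?b - ?a)"
   proof (rule integral_bound)
    show "continuous_on {?a..?b} (\<lambda>u. \<phi> ?b - \<phi> u)"
     by (intro continuous_intros continuous_on_subset[OF \<phi>]) (use ab in auto)
    fix u assume u: "u \<in> {?a..?b}"
    have u01: "0 \<le> u" "u \<le> 1" using u ab by (meson atLeastAtMost_iff order_trans)+
    have "\<bar>?b - u\<bar> < d" using u len K(2) by auto
    hence "\<bar>\<phi> ?b - \<phi> u\<bar> < e / 8" using u01 ab by (intro d(2)) auto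
    thus "norm (\<phi> ?b - \<phi> u) \<le> e / 8" by simp
   qed (use ab in auto)
   moreover have "integral {?a..?b} (\<lambda>u. \<phi> ?b - \<phi> u) = \<phi> ?b * (?b - ?a) - integral {?a..?b} \<phi>"
    using ab by (subst integral_diff) (auto intro: int)
   ultimately show ?thesis unfolding len by simp
  qed
  have "integral {0..real k / real K} \<phi> = (\<Sum>j<k. integral {real j / real K..real (Suc j) / real K} \<phi>)" if "k \<le> K" for k
   using that
  proof (induction k)
   case (Suc k)
   have comb: "integral {0..real k / real K} \<phi> + integral {real k / real K..real (Suc k) / real K} \<phi> = integral {0..real (Suc k) / real K} \<phi>"
   proof (intro Henstock_Kurzweil_Integration.integral_combine int)
    have "real (Suc k) \<le> real K" using Suc.prems by (simp only: of_nat_le_iff)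
    thus "real (Suc k) / real K \<le> 1" using K by (subst divide_le_eq_1_pos) auto
    show "real k / real K \<le> real (Suc k) / real K" by (intro divide_right_mono) auto
   qed auto
   show ?case unfolding sum.lessThan_Suc Suc.IH[OF Suc_leD[OF Suc.prems], symmetric] by (rule comb[symmetric])
  qed auto
  from this[of K] have "integral {0..1} \<phi> = (\<Sum>j<K. integral {real j / real K..real (Suc j) / real K} \<phi>)" using K by simp
  hence "R - integral {0..1} \<phi> = (\<Sum>j<K. \<phi> (real (Suc j) / real K) * (1 / real K) - integral {real j / real K..real (Suc j) / real K} \<phi>)"
   by (simp only: R_def sum_subtractf)
  also have "\<bar>\<dots>\<bar> \<le> (\<Sum>j<K. e / 8 * (1 / real K))"
   by (intro order_trans[OF sum_abs] sum_mono piece) auto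
  also have "\<dots> = e / 8" using K by simp
  finally show ?thesis .
 qed
 obtain N1 where N1: "\<And>q. q \<ge> N1 \<Longrightarrow> \<bar>(\<Sum>n\<in>A q. w q n * s (x q n)) - R\<bar> < e / 8"
  using LIMSEQ_D[OF step_lim, of "e/8"] e by auto
 obtain N2 where N2: "\<And>q. q \<ge> N2 \<Longrightarrow> \<bar>T 1 q - 1\<bar> < 1"
  using LIMSEQ_D[OF Tlim[of 1], of 1] by auto
 have "norm ((\<Sum>n\<in>A q. w q n * \<phi> (x q n)) - integral {0..1} \<phi>) < e" if q: "q \<ge> max N1 N2" for q
 proof -
  have T1: "T 1 q = (\<Sum>n\<in>A q. w q n)" unfolding T_def by (intro sum.cong) (use x in auto)
  have "\<bar>(\<Sum>n\<in>A q. w q n * \<phi> (x q n)) - (\<Sum>n\<in>A q. w q n * s (x q n))\<bar> = \<bar>\<Sum>n\<in>A q. w q n * (\<phi> (x q n) - s (x q n))\<bar>"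
   by (simp add: sum_subtractf right_diff_distrib)
  also have "\<dots> \<le> (\<Sum>n\<in>A q. w q n * (e / 8))"
  proof (intro order_trans[OF sum_abs] sum_mono)
   fix n assume "n \<in> A q"
   thus "\<bar>w q n * (\<phi> (x q n) - s (x q n))\<bar> \<le> w q n * (e / 8)"
    unfolding abs_mult using w[of n q] s_near[of "x q n"] x[of n q]
    by (simp only: abs_of_nonneg) (intro mult_left_mono, auto)
  qed
  also have "\<dots> = T 1 q * (e / 8)" by (simp add: T1 sum_distrib_right)
  also have "\<dots> \<le> 2 * (e / 8)" using N2[of q] q e by (intro mult_right_mono) auto
  finally show ?thesis using N1[of q] q R_int e unfolding real_norm_def by linarith
 qed
 thus "\<exists>N. \<forall>q\<ge>N. norm ((\<Sum>n\<in>A q. w q n * \<phi> (x q n)) - integral {0..1} \<phi>) < e" by blast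
qed

text \<open>The condition says \<open>n \<le> exp (t * ln q)\<close>. Mertens contributes an error
  of 4, and rounding this bound to an integer at most 1 more.\<close>

lemma Mertens_cdf:
 assumes t: "0 \<le> t" "t \<le> 1"
 shows "(\<lambda>q::nat. \<Sum>n\<in>{n\<in>{1..q}. ln (real n) / ln (real q) \<le> t}. mang n / real n / ln (real q)) \<longlonglongrightarrow> t"
proof -
 let ?S = "\<lambda>q. \<Sum>n\<in>{n\<in>{1..q}. ln (real n) / ln (real q) \<le> t}. mang n / real n / ln (real q)"
 have bd: "norm (?S q - t) \<le> 5 / ln (real q)" if q: "q \<ge> 2" for q
 proof -
  define L where "L = ln (real q)"
  have L: "L > 0" using q by (simp add: L_def)
  define N where "N = nat \<lfloor>exp (t * L)\<rfloor>"
  have e1: "exp (t * L) \<ge> 1" using t L by simp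
  have N: "real N \<le> exp (t * L)" "exp (t * L) < real N + 1" using e1 by (simp_all add: N_def)
  have N1: "N \<ge> 1" using e1 by (simp add: N_def le_nat_floor)
  have "exp (t * L) \<le> exp (1 * L)" using t L by (subst exp_le_cancel_iff) (intro mult_right_mono, auto)
  hence eq: "exp (t * L) \<le> real q" using q by (simp add: L_def)
  have set: "{n\<in>{1..q}. ln (real n) / L \<le> t} = {1..N}"
  proof -
   have "ln (real n) / L \<le> t \<longleftrightarrow> n \<le> N" if "n \<ge> 1" for n
   proof -
    have "ln (real n) / L \<le> t \<longleftrightarrow> ln (real n) \<le> t * L" using L by (simp add: pos_divide_le_eq)
    also have "\<dots> \<longleftrightarrow> real n \<le> exp (t * L)" using that by (subst ln_le_cancel_iff[of "real n" "exp (t * L)", symmetric]) auto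
    also have "\<dots> \<longleftrightarrow> n \<le> N"
    proof
     assume "n \<le> N"
     hence "real n \<le> real N" by simp
     with N(1) show "real n \<le> exp (t * L)" by linarith
    qed (simp add: N_def le_nat_floor)
    finally show ?thesis .
   qed
   moreover have "N \<le> q" using N(1) eq by linarith
   ultimately show ?thesis by auto
  qed
  have "?S q = (\<Sum>n=1..N. mang n / real n) / L"
   unfolding L_def[symmetric] set by (simp add: sum_divide_distrib)
  moreover have "\<bar>(\<Sum>n=1..N. mang n / real n) - t * L\<bar> \<le> 5"
  proof -
   have "t * L \<le> ln (real N + 1)" using N(2) by (subst ln_exp[symmetric]) (intro ln_mono, auto)
   also have "ln (real N + 1) = ln (real N) + ln (1 + 1 / real N)"
   proof -
    have "real N + 1 = real N * (1 + 1 / real N)" using N1 by (simp add: field_simps)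
    thus ?thesis using N1 by (simp only: ln_mult_pos add_pos_nonneg) (simp add: ln_mult_pos add_pos_nonneg)
   qed
   also have "ln (1 + 1 / real N) \<le> 1 / real N" by (intro ln_add_one_self_le_self) auto
   also have "1 / real N \<le> 1" using N1 by simp
   finally have a: "t * L \<le> ln (real N) + 1" by simp
   have b: "ln (real N) \<le> t * L" using N(1) N1 by (subst ln_exp[symmetric]) (intro ln_mono, auto)
   show ?thesis using Mertens_first[OF N1] a b by linarith
  qed
  hence "\<bar>(\<Sum>n=1..N. mang n / real n) - t * L\<bar> / L \<le> 5 / L" using L by (intro divide_right_mono) auto
  moreover have "\<bar>(\<Sum>n=1..N. mang n / real n) - t * L\<bar> / L = \<bar>(\<Sum>n=1..N. mang n / real n) / L - t\<bar>"
   using L by (simp add: diff_divide_distrib flip: abs_divide[of _ L, unfolded abs_of_pos[OF L]])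
  ultimately show ?thesis by (simp add: L_def)
 qed
 have "(\<lambda>q. ?S q - t) \<longlonglongrightarrow> 0"
 proof (rule Lim_null_comparison)
  show "\<forall>\<^sub>F q in sequentially. norm (?S q - t) \<le> 5 / ln (real q)"
   using eventually_ge_at_top[of 2] by eventually_elim (rule bd)
  show "(\<lambda>q. 5 / ln (real q)) \<longlonglongrightarrow> 0" by real_asymp
 qed
 thus ?thesis by (simp add: LIM_zero_iff)
qed

section \<open>Asymptotics of the coefficients of the prime sum\<close>

lemma sum_inverse_sqrt_le: "x \<ge> 0 \<Longrightarrow> (\<Sum>n\<in>{n\<in>{1..N}. real n \<le> x}. 1 / sqrt (real n)) \<le> 2 * sqrt x"
proof -
 assume x: "x \<ge> 0"
 have nat: "(\<Sum>n=1..M. 1 / sqrt (real n)) \<le> 2 * sqrt (real M)" for M :: nat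
 proof (induction M)
  case (Suc M)
  have p: "sqrt (real (Suc M)) > 0" by simp
  have sq: "sqrt (real M) * sqrt (real M) = real M" "sqrt (real (Suc M)) * sqrt (real (Suc M)) = real M + 1" by auto
  have "2 * sqrt (real M) * sqrt (real (Suc M)) \<le> real M + (real M + 1)"
   using sum_squares_bound[of "sqrt (real M)" "sqrt (real (Suc M))"] by simp
  hence "1 \<le> (2 * sqrt (real (Suc M)) - 2 * sqrt (real M)) * sqrt (real (Suc M))"
   using sq by (simp add: algebra_simps)
  hence "1 / sqrt (real (Suc M)) \<le> 2 * sqrt (real (Suc M)) - 2 * sqrt (real M)"
   using p by (simp only: pos_divide_le_eq)
  thus ?case using Suc by simp
 qed auto
 define M where "M = nat \<lfloor>x\<rfloor>"
 have M: "real M \<le> x" using x by (simp add: M_def)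
 have "(\<Sum>n\<in>{n\<in>{1..N}. real n \<le> x}. 1 / sqrt (real n)) \<le> (\<Sum>n=1..M. 1 / sqrt (real n))"
  by (intro sum_mono2) (auto simp: M_def le_nat_floor)
 also have "\<dots> \<le> 2 * sqrt (real M)" by (rule nat)
 also have "\<dots> \<le> 2 * sqrt x" using M by simp
 finally show ?thesis .
qed

text \<open>The coefficient of \<open>chi n\<close> in the prime sum. It is kept general in
  \<open>\<phi>\<close>, because the limits below rest on continuity on \<open>[0, 1]\<close> and on
  \<open>\<phi> 1 = 0\<close>; in the application \<open>\<phi>\<close> is the real part of
  \<open>fourier f\<close>.\<close>

definition pcoef :: "(real \<Rightarrow> real) \<Rightarrow> nat \<Rightarrow> nat \<Rightarrow> real" where
 "pcoef \<phi> q n = mang n / sqrt (real n) * \<phi> (ln (real n) / ln (real q)) / ln (real q)"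

lemma ln_ratio_in_01: "n \<in> {1..q} \<Longrightarrow> ln (real n) / ln (real q) \<in> {0..1}"
 by (auto intro!: divide_nonneg_nonneg simp: divide_le_eq_1)

lemma continuous_01_bound:
 fixes \<phi> :: "real \<Rightarrow> real"
 assumes "continuous_on {0..1} \<phi>"
 obtains B where "B > 0" "\<And>u. u \<in> {0..1} \<Longrightarrow> \<bar>\<phi> u\<bar> \<le> B"
proof -
 have "bounded (\<phi> ` {0..1})" by (intro compact_imp_bounded compact_continuous_image assms) auto
 then obtain B where "B > 0" "\<forall>x\<in>\<phi> ` {0..1}. norm x \<le> B" unfolding bounded_pos by blast
 thus ?thesis by (intro that[of B]) auto
qed

lemma continuous_01_edge:
 fixes \<phi> :: "real \<Rightarrow> real"
 assumes c: "continuous_on {0..1} \<phi>" and z: "\<phi> 1 = 0" and eta: "eta > 0"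
 obtains eps where "eps > 0" "eps < 1" "\<And>u. 1 - eps \<le> u \<Longrightarrow> u \<le> 1 \<Longrightarrow> \<bar>\<phi> u\<bar> \<le> eta"
proof -
 obtain d where d: "d > 0" "\<And>u. u \<in> {0..1} \<Longrightarrow> dist u 1 < d \<Longrightarrow> dist (\<phi> u) (\<phi> 1) < eta"
  using c[unfolded continuous_on_iff, rule_format, of 1 eta] eta by auto
 show ?thesis
 proof (rule that[of "min (d / 2) (1 / 2)"])
  fix u assume u: "1 - min (d / 2) (1 / 2) \<le> u" "u \<le> 1"
  have "dist (\<phi> u) (\<phi> 1) < eta" by (rule d(2)) (use u d in \<open>auto simp: dist_real_def\<close>)
  thus "\<bar>\<phi> u\<bar> \<le> eta" using z by (simp add: dist_real_def)
 qed (use d in auto)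
qed

text \<open>One factor \<open>mang n\<close> of the square is replaced by \<open>ln n\<close>, which
  produces the Mertens weight times \<open>u * (\<phi> u)\<^sup>2\<close> at
  \<open>u = ln n / ln q\<close>. The correction \<open>R\<close> lives on proper prime powers,
  where the sum of \<open>(ln n)\<^sup>2 / n\<close> is bounded, and carries the factor
  \<open>1 / (ln q)\<^sup>2\<close>.\<close>

lemma pcoef_square_sum_tendsto:
 assumes \<phi>: "continuous_on {0..1} \<phi>" and \<phi>1: "\<phi> 1 = 0"
 shows "(\<lambda>q. \<Sum>n\<in>{1..<q}. (pcoef \<phi> q n)\<^sup>2) \<longlonglongrightarrow> integral {0..1} (\<lambda>u. u * (\<phi> u)\<^sup>2)"
proof -
 let ?x = "\<lambda>q n. ln (real n) / ln (real q)"
 obtain B where B: "B > 0" "\<And>u. u \<in> {0..1} \<Longrightarrow> \<bar>\<phi> u\<bar> \<le> B" by (rule continuous_01_bound[OF \<phi>]) blast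
 obtain C where C: "\<And>N. (\<Sum>n\<in>{n\<in>{1..N}. primepow n \<and> \<not> prime n}. (ln (real n))\<^sup>2 / real n) \<le> C"
  by (rule prime_powers_ln_sum_bounded) blast
 define R where "R = (\<lambda>q. \<Sum>n=1..q. mang n * (ln (real n) - mang n) / real n * (\<phi> (?x q n))\<^sup>2 / (ln (real q))\<^sup>2)"
 have lim1: "(\<lambda>q. \<Sum>n=1..q. mang n / real n / ln (real q) * (?x q n * (\<phi> (?x q n))\<^sup>2)) \<longlonglongrightarrow> integral {0..1} (\<lambda>u. u * (\<phi> u)\<^sup>2)"
 proof (rule tendsto_integral_of_cdf[where \<phi> = "\<lambda>u. u * (\<phi> u)\<^sup>2"])
  show "0 \<le> mang n / real n / ln (real q)" if "n \<in> {1..q}" for q n using that by (auto intro!: divide_nonneg_nonneg mangoldt_nonneg)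
  show "0 \<le> ?x q n \<and> ?x q n \<le> 1" if "n \<in> {1..q}" for q n using ln_ratio_in_01[OF that] by simp
  show "continuous_on {0..1} (\<lambda>u. u * (\<phi> u)\<^sup>2)" by (intro continuous_intros \<phi>)
 qed (use Mertens_cdf in auto)
 have eq: "(\<Sum>n\<in>{1..<q}. (pcoef \<phi> q n)\<^sup>2) = (\<Sum>n=1..q. mang n / real n / ln (real q) * (?x q n * (\<phi> (?x q n))\<^sup>2)) - R q" if q: "q \<ge> 2" for q
 proof -
  have L: "ln (real q) > 0" using q by simp
  have "pcoef \<phi> q q = 0" using L \<phi>1 by (simp add: pcoef_def)
  hence "(\<Sum>n\<in>{1..<q}. (pcoef \<phi> q n)\<^sup>2) = (\<Sum>n=1..q. (pcoef \<phi> q n)\<^sup>2)"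
   by (intro sum.mono_neutral_left) (auto simp: not_less)
  also have "\<dots> = (\<Sum>n=1..q. mang n / real n / ln (real q) * (?x q n * (\<phi> (?x q n))\<^sup>2) -
    mang n * (ln (real n) - mang n) / real n * (\<phi> (?x q n))\<^sup>2 / (ln (real q))\<^sup>2)"
   using L by (intro sum.cong refl) (simp add: pcoef_def power_divide power_mult_distrib field_simps, simp add: power2_eq_square algebra_simps)
  finally show ?thesis by (simp add: R_def sum_subtractf)
 qed
 have Rb: "norm (R q) \<le> B\<^sup>2 * C / (ln (real q))\<^sup>2" if q: "q \<ge> 2" for q
 proof -
  have L: "ln (real q) > 0" using q by simp
  let ?A = "{n\<in>{1..q}. primepow n \<and> \<not> prime n}"
  have R_eq: "R q = (\<Sum>n\<in>?A. mang n * (ln (real n) - mang n) / real n * (\<phi> (?x q n))\<^sup>2 / (ln (real q))\<^sup>2)"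
   unfolding R_def
  proof (intro sum.mono_neutral_right ballI)
   fix n assume "n \<in> {1..q} - ?A"
   hence "mang n = 0 \<or> prime n" by (auto simp: mangoldt_def)
   thus "mang n * (ln (real n) - mang n) / real n * (\<phi> (?x q n))\<^sup>2 / (ln (real q))\<^sup>2 = 0" by auto
  qed auto
  have "norm (R q) \<le> (\<Sum>n\<in>?A. B\<^sup>2 / (ln (real q))\<^sup>2 * ((ln (real n))\<^sup>2 / real n))"
   unfolding R_eq
  proof (rule order_trans[OF norm_sum], rule sum_mono)
   fix n assume n: "n \<in> ?A"
   have m: "0 \<le> mang n" "mang n \<le> ln (real n)" using n mangoldt_le_ln[of n] by (auto intro: mangoldt_nonneg)
   have "mang n * (ln (real n) - mang n) \<le> ln (real n) * ln (real n)" using m by (intro mult_mono) auto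
   moreover have "(\<phi> (?x q n))\<^sup>2 \<le> B\<^sup>2" using B(2)[OF ln_ratio_in_01[of n q]] n by (metis (no_types, lifting) mem_Collect_eq power2_abs power_mono abs_ge_zero)
   ultimately have "mang n * (ln (real n) - mang n) * (\<phi> (?x q n))\<^sup>2 \<le> ln (real n) * ln (real n) * B\<^sup>2"
    using m by (intro mult_mono) auto
   hence "mang n * (ln (real n) - mang n) * (\<phi> (?x q n))\<^sup>2 / (real n * (ln (real q))\<^sup>2) \<le> ln (real n) * ln (real n) * B\<^sup>2 / (real n * (ln (real q))\<^sup>2)"
    by (intro divide_right_mono) auto
   moreover have "norm (mang n * (ln (real n) - mang n) / real n * (\<phi> (?x q n))\<^sup>2 / (ln (real q))\<^sup>2)
     = mang n * (ln (real n) - mang n) * (\<phi> (?x q n))\<^sup>2 / (real n * (ln (real q))\<^sup>2)"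
    using m by (simp add: abs_mult)
   moreover have "B\<^sup>2 / (ln (real q))\<^sup>2 * ((ln (real n))\<^sup>2 / real n) = ln (real n) * ln (real n) * B\<^sup>2 / (real n * (ln (real q))\<^sup>2)"
    by (simp add: power2_eq_square mult_ac)
   ultimately show "norm (mang n * (ln (real n) - mang n) / real n * (\<phi> (?x q n))\<^sup>2 / (ln (real q))\<^sup>2) \<le> B\<^sup>2 / (ln (real q))\<^sup>2 * ((ln (real n))\<^sup>2 / real n)"
    by (simp only:)
  qed
  also have "\<dots> = B\<^sup>2 / (ln (real q))\<^sup>2 * (\<Sum>n\<in>?A. (ln (real n))\<^sup>2 / real n)" by (rule sum_distrib_left[symmetric])
  also have "\<dots> \<le> B\<^sup>2 / (ln (real q))\<^sup>2 * C" by (intro mult_left_mono C) auto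
  finally show ?thesis by simp
 qed
 have "R \<longlonglongrightarrow> 0"
 proof (rule Lim_null_comparison)
  show "\<forall>\<^sub>F q in sequentially. norm (R q) \<le> B\<^sup>2 * C / (ln (real q))\<^sup>2"
   using eventually_ge_at_top[of 2] by eventually_elim (rule Rb)
  show "(\<lambda>q. B\<^sup>2 * C / (ln (real q))\<^sup>2) \<longlonglongrightarrow> 0" by real_asymp
 qed
 from tendsto_diff[OF lim1 this] have "(\<lambda>q. (\<Sum>n=1..q. mang n / real n / ln (real q) * (?x q n * (\<phi> (?x q n))\<^sup>2)) - R q) \<longlonglongrightarrow> integral {0..1} (\<lambda>u. u * (\<phi> u)\<^sup>2)"
  by simp
 thus ?thesis
  by (rule Lim_transform_eventually) (rule eventually_mono[OF eventually_ge_at_top[of 2] eq[symmetric]])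
qed

text \<open>Terms up to \<open>q powr (1 - eps)\<close> are few enough to save a power of
  \<open>q\<close>; those beyond carry the small value \<open>eta\<close>. In the applications
  \<open>B\<close> bounds the test function everywhere, or its square, and \<open>eta\<close> does
  so near the edge.\<close>

lemma sum_inverse_sqrt_split:
 assumes q: "q \<ge> 2" and eps: "eps > 0" "eps < 1" and B: "B \<ge> 0" "eta \<ge> 0"
 shows "(\<Sum>n\<in>{1..<q}. 1 / sqrt (real n) * (if real n \<le> real q powr (1 - eps) then B else eta)) / sqrt (real q) \<le> 2 * B * real q powr (- eps / 2) + 2 * eta"
proof -
 define y where "y = real q powr (1 - eps)"
 have y0: "y \<ge> 0" by (simp add: y_def)
 have "(\<Sum>n\<in>{1..<q}. 1 / sqrt (real n) * (if real n \<le> y then B else eta)) \<le>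
   (\<Sum>n\<in>{1..<q}. B * (if real n \<le> y then 1 / sqrt (real n) else 0) + eta * (1 / sqrt (real n)))"
  using B by (intro sum_mono) auto
 also have "\<dots> = B * (\<Sum>n\<in>{1..<q}. if real n \<le> y then 1 / sqrt (real n) else 0) + eta * (\<Sum>n\<in>{1..<q}. 1 / sqrt (real n))"
  by (simp only: sum.distrib sum_distrib_left)
 also have "(\<Sum>n\<in>{1..<q}. if real n \<le> y then 1 / sqrt (real n) else 0) = (\<Sum>n\<in>{n\<in>{1..<q}. real n \<le> y}. 1 / sqrt (real n))"
  by (rule sum.inter_filter[symmetric]) auto
 also have "B * \<dots> + eta * (\<Sum>n\<in>{1..<q}. 1 / sqrt (real n)) \<le> B * (2 * sqrt y) + eta * (2 * sqrt (real q))"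
 proof (intro add_mono mult_left_mono B)
  have "(\<Sum>n\<in>{n\<in>{1..<q}. real n \<le> y}. 1 / sqrt (real n)) \<le> (\<Sum>n\<in>{n\<in>{1..q}. real n \<le> y}. 1 / sqrt (real n))"
   by (intro sum_mono2) auto
  also have "\<dots> \<le> 2 * sqrt y" by (rule sum_inverse_sqrt_le[OF y0])
  finally show "(\<Sum>n\<in>{n\<in>{1..<q}. real n \<le> y}. 1 / sqrt (real n)) \<le> 2 * sqrt y" .
  have "(\<Sum>n\<in>{1..<q}. 1 / sqrt (real n)) \<le> (\<Sum>n\<in>{n\<in>{1..q}. real n \<le> real q}. 1 / sqrt (real n))"
   by (intro sum_mono2) auto
  also have "\<dots> \<le> 2 * sqrt (real q)" by (rule sum_inverse_sqrt_le) auto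
  finally show "(\<Sum>n\<in>{1..<q}. 1 / sqrt (real n)) \<le> 2 * sqrt (real q)" .
 qed
 finally have "(\<Sum>n\<in>{1..<q}. 1 / sqrt (real n) * (if real n \<le> y then B else eta)) / sqrt (real q) \<le> (B * (2 * sqrt y) + eta * (2 * sqrt (real q))) / sqrt (real q)"
  by (intro divide_right_mono) auto
 also have "\<dots> = 2 * B * (sqrt y / sqrt (real q)) + 2 * eta" using q by (simp add: add_divide_distrib)
 also have "sqrt y / sqrt (real q) = real q powr (- eps / 2)"
 proof -
  have "sqrt y = real q powr ((1 - eps) / 2)" by (simp add: y_def powr_half_sqrt[symmetric] powr_powr)
  moreover have "sqrt (real q) = real q powr (1/2)" by (simp add: powr_half_sqrt)
  ultimately have "sqrt y / sqrt (real q) = real q powr ((1 - eps) / 2 - 1/2)" by (simp add: powr_diff)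
  thus ?thesis by (simp add: diff_divide_distrib)
 qed
 finally show ?thesis by (simp add: y_def)
qed

lemma edge_ratio:
 assumes "q \<ge> 2" "real q powr (1 - eps) \<le> real n" "n \<ge> 1"
 shows "1 - eps \<le> ln (real n) / ln (real q)"
proof -
 have "ln (real q powr (1 - eps)) \<le> ln (real n)" using assms by (intro ln_mono) auto
 thus ?thesis using assms by (simp add: ln_powr pos_le_divide_eq)
qed

text \<open>The factor \<open>mang n / ln q\<close> is at most 1 and the inverse square roots sum to
  order \<open>sqrt q\<close>, so absolute values alone give mere boundedness. The gain comes from
  \<open>\<phi>\<close> being small near 1.\<close>

lemma pcoef_abs_sum_tendsto:
 assumes \<phi>: "continuous_on {0..1} \<phi>" and \<phi>1: "\<phi> 1 = 0"
 shows "(\<lambda>q. (\<Sum>n\<in>{1..<q}. \<bar>pcoef \<phi> q n\<bar>) / sqrt (real q)) \<longlonglongrightarrow> 0"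
proof (rule LIMSEQ_I)
 fix e :: real assume e: "e > 0"
 obtain B where B: "B > 0" "\<And>u. u \<in> {0..1} \<Longrightarrow> \<bar>\<phi> u\<bar> \<le> B" by (rule continuous_01_bound[OF \<phi>]) blast
 obtain eps where eps: "eps > 0" "eps < 1" "\<And>u. 1 - eps \<le> u \<Longrightarrow> u \<le> 1 \<Longrightarrow> \<bar>\<phi> u\<bar> \<le> e / 8"
  using continuous_01_edge[OF \<phi> \<phi>1, of "e/8"] e by auto
 have "(\<lambda>q. 2 * B * real q powr (- eps / 2)) \<longlonglongrightarrow> 0" using eps by real_asymp
 from LIMSEQ_D[OF this, of "e/2"] e B obtain N where N: "\<And>q. q \<ge> N \<Longrightarrow> 2 * B * real q powr (- eps / 2) < e / 2" by auto
 have "norm ((\<Sum>n\<in>{1..<q}. \<bar>pcoef \<phi> q n\<bar>) / sqrt (real q) - 0) < e" if q: "q \<ge> max 2 N" for q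
 proof -
  have q2: "q \<ge> 2" using q by simp
  have L: "ln (real q) > 0" using q2 by simp
  have "(\<Sum>n\<in>{1..<q}. \<bar>pcoef \<phi> q n\<bar>) \<le> (\<Sum>n\<in>{1..<q}. 1 / sqrt (real n) * (if real n \<le> real q powr (1 - eps) then B else e / 8))"
  proof (rule sum_mono)
   fix n assume n: "n \<in> {1..<q}"
   have m: "0 \<le> mang n" "mang n \<le> ln (real n)" "ln (real n) \<le> ln (real q)" using n mangoldt_le_ln[of n] by (auto intro: mangoldt_nonneg)
   have "\<bar>pcoef \<phi> q n\<bar> = mang n / ln (real q) * (1 / sqrt (real n) * \<bar>\<phi> (ln (real n) / ln (real q))\<bar>)"
    using L m by (simp add: pcoef_def abs_mult)
   also have "\<dots> \<le> 1 * (1 / sqrt (real n) * \<bar>\<phi> (ln (real n) / ln (real q))\<bar>)"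
    using m L by (intro mult_right_mono) auto
   also have "\<dots> \<le> 1 / sqrt (real n) * (if real n \<le> real q powr (1 - eps) then B else e / 8)"
   proof -
    have x: "ln (real n) / ln (real q) \<in> {0..1}" using n by (intro ln_ratio_in_01) auto
    have "\<bar>\<phi> (ln (real n) / ln (real q))\<bar> \<le> (if real n \<le> real q powr (1 - eps) then B else e / 8)"
     using B(2)[OF x] eps(3)[of "ln (real n) / ln (real q)"] edge_ratio[OF q2, of eps n] n x by simp
    thus ?thesis by (simp only: mult_1) (intro mult_left_mono, auto)
   qed
   finally show "\<bar>pcoef \<phi> q n\<bar> \<le> 1 / sqrt (real n) * (if real n \<le> real q powr (1 - eps) then B else e / 8)" .
  qed
  hence "(\<Sum>n\<in>{1..<q}. \<bar>pcoef \<phi> q n\<bar>) / sqrt (real q) \<le> (\<Sum>n\<in>{1..<q}. 1 / sqrt (real n) * (if real n \<le> real q powr (1 - eps) then B else e / 8)) / sqrt (real q)"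
   by (intro divide_right_mono) auto
  also have "\<dots> \<le> 2 * B * real q powr (- eps / 2) + 2 * (e / 8)"
   using B e by (intro sum_inverse_sqrt_split q2 eps) auto
  also have "\<dots> < e" using N[of q] q e by simp
  finally show ?thesis by (simp add: sum_nonneg)
 qed
 thus "\<exists>N. \<forall>q\<ge>N. norm ((\<Sum>n\<in>{1..<q}. \<bar>pcoef \<phi> q n\<bar>) / sqrt (real q) - 0) < e" by blast
qed

text \<open>For a fixed product \<open>N\<close> the second factor is at most \<open>ln N\<close>,
  and the first sums to \<open>ln N\<close> over the divisors; so no divisor-counting loss
  occurs.\<close>

lemma sum_mangoldt_pairs_le:
 assumes N: "N \<ge> 1" and P: "P \<subseteq> {(n, m). n * m = N}" "finite P"
 shows "(\<Sum>(n, m)\<in>P. mang n * mang m) \<le> (ln (real N))\<^sup>2"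
proof -
 have "(\<Sum>(n, m)\<in>P. mang n * mang m) \<le> (\<Sum>(n, m)\<in>P. mang n * ln (real N))"
 proof (intro sum_mono, clarify)
  fix n m assume "(n, m) \<in> P"
  hence nm: "n * m = N" using P by auto
  hence "m \<ge> 1" "m \<le> N" using N by (auto intro: Suc_leI Nat.gr0I)
  hence "mang m \<le> ln (real N)" using mangoldt_le_ln[of m] by (intro order_trans[OF _ ln_mono[of "real m" "real N"]]) auto
  thus "mang n * mang m \<le> mang n * ln (real N)" by (intro mult_left_mono mangoldt_nonneg)
 qed
 also have "\<dots> = (\<Sum>n\<in>fst ` P. mang n * ln (real N))"
 proof -
  have "inj_on fst P"
  proof (rule inj_onI)
   fix x y assume xy: "x \<in> P" "y \<in> P" "fst x = fst y"
   have "fst x * snd x = N" "fst y * snd y = N" using xy(1,2) P by auto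
   hence "snd x = snd y" using xy(3) N by auto
   thus "x = y" using xy(3) by (simp add: prod_eq_iff)
  qed
  thus ?thesis by (subst sum.reindex) (auto simp: split_beta)
 qed
 also have "\<dots> \<le> (\<Sum>n | n dvd N. mang n * ln (real N))"
  using P N by (intro sum_mono2) (auto intro!: mult_nonneg_nonneg mangoldt_nonneg)
 also have "\<dots> = (ln (real N))\<^sup>2"
  using mangoldt_sum[of N, where ?'a = real] N by (simp add: sum_distrib_right[symmetric] power2_eq_square)
 finally show ?thesis .
qed

text \<open>Pairs are grouped by \<open>n * m = k * q + 1\<close>. The group \<open>k = 0\<close> is
  \<open>n = m = 1\<close>, where \<open>mang\<close> vanishes. Any other group has total
  \<open>mang\<close>-weight at most \<open>(2 * ln q)\<^sup>2\<close>, and its pairs carry a factor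
  at most \<open>1 / sqrt (k * q)\<close>. The sum over \<open>k < q\<close> is thus bounded, and it
  is small because for large \<open>k\<close> both factors are close to \<open>q\<close> on the
  logarithmic scale, where \<open>\<phi>\<close> is small.\<close>

lemma pcoef_inverse_pairs_tendsto:
 assumes \<phi>: "continuous_on {0..1} \<phi>" and \<phi>1: "\<phi> 1 = 0"
 shows "(\<lambda>q. \<Sum>(n, m)\<in>{(n, m)\<in>{1..<q} \<times> {1..<q}. [n * m = 1] (mod q)}. \<bar>pcoef \<phi> q n\<bar> * \<bar>pcoef \<phi> q m\<bar>) \<longlonglongrightarrow> 0"
proof (rule LIMSEQ_I)
 fix e :: real assume e: "e > 0"
 obtain B where B: "B > 0" "\<And>u. u \<in> {0..1} \<Longrightarrow> \<bar>\<phi> u\<bar> \<le> B" by (rule continuous_01_bound[OF \<phi>]) blast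
 \<comment> \<open>Chosen so that the large \<open>k\<close> contribute at most
   \<open>4 * (2 * eta\<^sup>2) = e / 4\<close>.\<close>
 define eta where "eta = sqrt (e / 32)"
 have eta: "eta > 0" "eta\<^sup>2 = e / 32" using e by (auto simp: eta_def)
 obtain eps where eps: "eps > 0" "eps < 1" "\<And>u. 1 - eps \<le> u \<Longrightarrow> u \<le> 1 \<Longrightarrow> \<bar>\<phi> u\<bar> \<le> eta"
  using continuous_01_edge[OF \<phi> \<phi>1 eta(1)] by auto
 have "(\<lambda>q. 8 * B\<^sup>2 * real q powr (- eps / 2)) \<longlonglongrightarrow> 0" using eps by real_asymp
 from LIMSEQ_D[OF this, of "e/2"] e B obtain N where N: "\<And>q. q \<ge> N \<Longrightarrow> 8 * B\<^sup>2 * real q powr (- eps / 2) < e / 2" by auto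
 have "norm ((\<Sum>(n, m)\<in>{(n, m)\<in>{1..<q} \<times> {1..<q}. [n * m = 1] (mod q)}. \<bar>pcoef \<phi> q n\<bar> * \<bar>pcoef \<phi> q m\<bar>) - 0) < e" if q: "q \<ge> max 2 N" for q
 proof -
  have q2: "q \<ge> 2" using q by simp
  define L where "L = ln (real q)"
  have L: "L > 0" using q2 by (simp add: L_def)
  define P where "P = {(n, m)\<in>{1..<q} \<times> {1..<q}. [n * m = 1] (mod q)}"
  define g where "g = (\<lambda>(n, m). \<bar>pcoef \<phi> q n\<bar> * \<bar>pcoef \<phi> q m\<bar>)"
  define E where "E = (\<lambda>k::nat. if real k \<le> real q powr (1 - eps) then B\<^sup>2 else eta\<^sup>2)"
  have E0: "E k \<ge> 0" for k by (simp add: E_def)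
  have finP: "finite P" unfolding P_def by (rule finite_subset[of _ "{1..<q} \<times> {1..<q}"]) auto
  let ?Pk = "\<lambda>k. {x\<in>P. fst x * snd x div q = k}"
  have nm: "n * m = k * q + 1" if "(n, m) \<in> ?Pk k" for n m k
  proof -
   have "(n * m) mod q = 1" using that q2 by (auto simp: P_def cong_def)
   thus ?thesis using that div_mult_mod_eq[of "n * m" q] by auto
  qed
  have "sum g P = (\<Sum>k<q. sum g (?Pk k))"
  proof (rule sum.group[symmetric, OF finP])
   show "(\<lambda>x. fst x * snd x div q) ` P \<subseteq> {..<q}"
   proof (rule image_subsetI)
    fix x assume "x \<in> P"
    hence "fst x < q" "snd x < q" by (auto simp: P_def)
    hence "fst x * snd x < q * q" by (intro mult_strict_mono) auto
    hence "fst x * snd x div q < q" by (rule less_mult_imp_div_less)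
    thus "fst x * snd x div q \<in> {..<q}" by (rule lessThan_iff[THEN iffD2])
   qed
  qed auto
  also have "\<dots> = (\<Sum>k\<in>{1..<q}. sum g (?Pk k))"
  proof (intro sum.mono_neutral_right ballI)
   fix k assume "k \<in> {..<q} - {1..<q}"
   hence k: "k = 0" by auto
   show "sum g (?Pk k) = 0"
   proof (intro sum.neutral ballI)
    fix x assume "x \<in> ?Pk k"
    moreover obtain n m where x: "x = (n, m)" by (cases x)
    ultimately have "n * m = 1" using nm[of n m k] k by (simp only: mult_0 add_0)
    hence "n = 1" by simp
    thus "g x = 0" by (simp add: x g_def pcoef_def)
   qed
  qed auto
  also have "\<dots> \<le> (\<Sum>k\<in>{1..<q}. 4 / sqrt (real q) * (1 / sqrt (real k) * E k))"
  proof (rule sum_mono)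
   fix k assume k: "k \<in> {1..<q}"
   have kq: "sqrt (real k * real q) > 0" using k by simp
   have "sum g (?Pk k) \<le> (\<Sum>x\<in>?Pk k. mang (fst x) * mang (snd x) * (E k / (sqrt (real k * real q) * L\<^sup>2)))"
   proof (rule sum_mono)
    fix x assume x: "x \<in> ?Pk k"
    obtain n m where xnm: "x = (n, m)" by (cases x)
    have eq: "n * m = k * q + 1" by (rule nm) (use x in \<open>simp only: xnm\<close>)
    have x: "(n, m) \<in> P" using x by (simp only: xnm mem_Collect_eq)
    have n: "n \<in> {1..<q}" "m \<in> {1..<q}" using x by (auto simp: P_def)
    let ?u = "ln (real n) / ln (real q)" and ?v = "ln (real m) / ln (real q)"
    have uv: "?u \<in> {0..1}" "?v \<in> {0..1}" using n by (auto intro!: ln_ratio_in_01)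
    have bE: "\<bar>\<phi> ?u\<bar> * \<bar>\<phi> ?v\<bar> \<le> E k"
    proof (cases "real k \<le> real q powr (1 - eps)")
     case True
     have "\<bar>\<phi> ?u\<bar> * \<bar>\<phi> ?v\<bar> \<le> B * B" using B uv by (intro mult_mono) auto
     thus ?thesis using True by (simp add: E_def power2_eq_square)
    next
     case False
     \<comment> \<open>From \<open>a * b > k * q\<close> and \<open>b < q\<close> it follows that
       \<open>a > k\<close>; both factors therefore inherit the lower bound on
       \<open>k\<close>.\<close>
     have big: "real q powr (1 - eps) \<le> real a" if "a * b = k * q + 1" "b < q" for a b
     proof (rule ccontr)
      assume c: "\<not> ?thesis"
      have "real a * real b \<le> real k * real q" using c False that(2) by (intro mult_mono) auto
      hence "a * b \<le> k * q" by (metis of_nat_le_iff of_nat_mult)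
      thus False using that(1) by simp
     qed
     have "\<bar>\<phi> ?u\<bar> * \<bar>\<phi> ?v\<bar> \<le> eta * eta"
      using uv n eq eta(1) by (intro mult_mono eps(3) edge_ratio[OF q2] big[of n m] big[of m n]) (auto simp: mult.commute)
     thus ?thesis using False by (simp add: E_def power2_eq_square)
    qed
    have "g (n, m) = mang n * mang m * (\<bar>\<phi> ?u\<bar> * \<bar>\<phi> ?v\<bar> / (sqrt (real n * real m) * L\<^sup>2))"
     using L by (simp add: g_def pcoef_def abs_mult L_def real_sqrt_mult power2_eq_square mult_ac)
    also have "\<dots> \<le> mang n * mang m * (E k / (sqrt (real k * real q) * L\<^sup>2))"
    proof (intro mult_left_mono frac_le bE E0 mult_right_mono)
     have "real n * real m = real k * real q + 1" using eq by (metis of_nat_1 of_nat_add of_nat_mult)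
     thus "sqrt (real k * real q) \<le> sqrt (real n * real m)" by simp
    qed (use kq L in \<open>auto intro!: mult_nonneg_nonneg mangoldt_nonneg\<close>)
    finally show "g x \<le> mang (fst x) * mang (snd x) * (E k / (sqrt (real k * real q) * L\<^sup>2))" by (simp add: xnm)
   qed
   also have "\<dots> = (\<Sum>(n, m)\<in>?Pk k. mang n * mang m) * (E k / (sqrt (real k * real q) * L\<^sup>2))"
    unfolding split_beta by (rule sum_distrib_right[symmetric])
   finally have s1: "sum g (?Pk k) \<le> (\<Sum>(n, m)\<in>?Pk k. mang n * mang m) * (E k / (sqrt (real k * real q) * L\<^sup>2))" .
   have s2: "(\<Sum>(n, m)\<in>?Pk k. mang n * mang m) \<le> (ln (real (k * q + 1)))\<^sup>2"
   proof (rule sum_mangoldt_pairs_le)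
    show "?Pk k \<subseteq> {(n, m). n * m = k * q + 1}"
    proof
     fix x assume x: "x \<in> ?Pk k"
     obtain n m where xnm: "x = (n, m)" by (cases x)
     have "n * m = k * q + 1" by (rule nm) (use x in \<open>simp only: xnm\<close>)
     thus "x \<in> {(n, m). n * m = k * q + 1}" by (simp only: xnm mem_Collect_eq prod.case)
    qed
   qed (use finP in auto)
   have "ln (real (k * q + 1)) \<le> 2 * L"
   proof -
    have "k * q + 1 \<le> (k + 1) * q" using q2 by simp
    also have "\<dots> \<le> q * q" using k by (intro mult_right_mono) auto
    finally have "real (k * q + 1) \<le> real (q * q)" by (simp only: of_nat_le_iff)
    hence "ln (real (k * q + 1)) \<le> ln (real (q * q))" by (intro ln_mono) (auto intro: add_pos_nonneg)
    also have "\<dots> = 2 * L" using q2 by (simp add: L_def ln_mult)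
    finally show ?thesis .
   qed
   hence "(ln (real (k * q + 1)))\<^sup>2 \<le> (2 * L)\<^sup>2" by (intro power_mono) auto
   with s2 have "(\<Sum>(n, m)\<in>?Pk k. mang n * mang m) \<le> (2 * L)\<^sup>2" by (rule order_trans)
   hence "(\<Sum>(n, m)\<in>?Pk k. mang n * mang m) * (E k / (sqrt (real k * real q) * L\<^sup>2)) \<le> (2 * L)\<^sup>2 * (E k / (sqrt (real k * real q) * L\<^sup>2))"
    using E0 by (intro mult_right_mono) auto
   also have "\<dots> = 4 / sqrt (real q) * (1 / sqrt (real k) * E k)"
    using L by (simp add: power_mult_distrib real_sqrt_mult)
   finally show "sum g (?Pk k) \<le> 4 / sqrt (real q) * (1 / sqrt (real k) * E k)"
    using s1 by (rule order_trans[rotated])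
  qed
  also have "\<dots> = 4 * ((\<Sum>k\<in>{1..<q}. 1 / sqrt (real k) * E k) / sqrt (real q))"
   by (simp add: sum_distrib_left sum_divide_distrib mult_ac)
  also have "\<dots> \<le> 4 * (2 * B\<^sup>2 * real q powr (- eps / 2) + 2 * eta\<^sup>2)"
   unfolding E_def using B eta by (intro mult_left_mono sum_inverse_sqrt_split q2 eps) auto
  also have "\<dots> < e" using N[of q] q e eta by simp
  finally have "sum g P < e" .
  moreover have "sum g P \<ge> 0" by (intro sum_nonneg) (auto simp: g_def)
  ultimately show ?thesis by (simp add: P_def g_def)
 qed
 thus "\<exists>N. \<forall>q\<ge>N. norm ((\<Sum>(n, m)\<in>{(n, m)\<in>{1..<q} \<times> {1..<q}. [n * m = 1] (mod q)}. \<bar>pcoef \<phi> q n\<bar> * \<bar>pcoef \<phi> q m\<bar>) - 0) < e" by blast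
qed

section \<open>Dirichlet characters modulo a prime\<close>

definition dchars :: "nat \<Rightarrow> (int \<Rightarrow> complex) set" where
 "dchars q = {chi. dirichlet_character q chi}"

context
 fixes q :: nat and chi :: "int \<Rightarrow> complex"
 assumes q: "prime q" and chi: "dirichlet_character q chi"
begin

lemma dchar_mult: "chi (m * n) = chi m * chi n"
 using chi by (simp add: dirichlet_character_def)

lemma dchar_eq_0_iff: "chi n = 0 \<longleftrightarrow> \<not> coprime n (int q)"
 using chi by (auto simp: dirichlet_character_def)

lemma dchar_1: "chi 1 = 1"
proof -
 have "chi 1 * chi 1 = chi 1" using dchar_mult[of 1 1] by simp
 moreover have "chi 1 \<noteq> 0" by (simp add: dchar_eq_0_iff)
 ultimately show ?thesis by simp
qed

lemma dchar_periodic_nat: "chi (n + int q * int k) = chi n"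
proof (induction k)
 case (Suc k)
 have "chi (n + int q * int (Suc k)) = chi (n + int q * int k + int q)" by (simp add: algebra_simps)
 also have "\<dots> = chi (n + int q * int k)" using chi by (simp add: dirichlet_character_def)
 finally show ?case using Suc by simp
qed auto

lemma dchar_periodic: "chi (n + int q * k) = chi n"
proof (cases "k \<ge> 0")
 case True
 thus ?thesis using dchar_periodic_nat[of n "nat k"] by simp
next
 case False
 thus ?thesis using dchar_periodic_nat[of "n + int q * k" "nat (- k)"] by simp
qed

lemma dchar_mod: "chi (n mod int q) = chi n"
proof -
 have "n = n mod int q + int q * (n div int q)" by simp
 thus ?thesis using dchar_periodic[of "n mod int q" "n div int q"] by simp
qed

lemma dchar_cong: "[m = n] (mod int q) \<Longrightarrow> chi m = chi n"
 using dchar_mod[of m] dchar_mod[of n] by (simp add: cong_def)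

lemma dchar_power: "chi (n ^ k) = chi n ^ k"
 by (induction k) (auto simp: dchar_1 dchar_mult)

lemma coprime_dchar_iff: "coprime n (int q) \<longleftrightarrow> \<not> int q dvd n"
proof
 assume c: "coprime n (int q)"
 show "\<not> int q dvd n"
 proof
  assume "int q dvd n"
  hence "is_unit (int q)" using c by (meson coprime_common_divisor dvd_refl)
  thus False using prime_gt_1_nat[OF q] by simp
 qed
next
 assume "\<not> int q dvd n"
 hence "coprime (int q) n" using q by (intro prime_imp_coprime) auto
 thus "coprime n (int q)" by (subst coprime_commute)
qed

lemma dchar_root_of_unity:
 assumes "coprime n (int q)"
 shows "chi n ^ (q - 1) = 1"
proof -
 define a where "a = nat (n mod int q)"
 have q0: "int q > 0" using q prime_gt_0_nat by simp
 have a: "int a = n mod int q" using q0 by (simp add: a_def)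
 have "\<not> int q dvd int a" using assms a q0 by (simp add: coprime_dchar_iff dvd_eq_mod_eq_0)
 hence "\<not> q dvd a" by simp
 hence "[a ^ (q - 1) = 1] (mod q)" by (rule fermat_theorem[OF q])
 hence "[int a ^ (q - 1) = 1] (mod int q)" by (simp flip: cong_int_iff)
 hence "chi (int a ^ (q - 1)) = chi 1" by (rule dchar_cong)
 thus ?thesis by (simp add: dchar_power dchar_1 a dchar_mod)
qed

lemma norm_dchar: "coprime n (int q) \<Longrightarrow> norm (chi n) = 1"
proof -
 assume c: "coprime n (int q)"
 have "norm (chi n) ^ (q - 1) = 1" using arg_cong[OF dchar_root_of_unity[OF c], of norm] by (simp add: norm_power)
 moreover have "q - 1 > 0" using prime_gt_1_nat[OF q] by simp
 ultimately show ?thesis using power_eq_imp_eq_base[of "norm (chi n)" "q - 1" 1] by simp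
qed

lemma norm_dchar_le: "norm (chi n) \<le> 1"
proof (cases "coprime n (int q)")
 case True
 thus ?thesis using norm_dchar[OF True] by simp
next
 case False
 hence "chi n = 0" using dchar_eq_0_iff[of n] by simp
 thus ?thesis by simp
qed

lemma dchar_cnj_mult: "coprime n (int q) \<Longrightarrow> chi n * cnj (chi n) = 1"
proof -
 assume "coprime n (int q)"
 hence "norm (chi n) = 1" by (rule norm_dchar)
 thus ?thesis using complex_norm_square[of "chi n"] by simp
qed

lemma dchar_minus_1: "chi (- 1) = 1 \<or> chi (- 1) = - 1"
proof -
 have "(chi (- 1))\<^sup>2 = 1" using dchar_mult[of "-1" "-1"] dchar_1 by (simp add: power2_eq_square)
 thus ?thesis by (simp only: power2_eq_1_iff)
qed

lemma dchar_minus: "chi (- n) = chi (- 1) * chi n"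
 using dchar_mult[of "-1" n] by simp

end

lemma dirichlet_character_cnj:
 assumes chi: "dirichlet_character q chi"
 shows "dirichlet_character q (\<lambda>n. cnj (chi n))"
 unfolding dirichlet_character_def
proof (intro conjI allI)
 fix m n
 have "chi (m * n) = chi m * chi n" "chi (n + int q) = chi n" "chi n \<noteq> 0 \<longleftrightarrow> coprime n (int q)"
  using chi unfolding dirichlet_character_def by blast+
 thus "cnj (chi (m * n)) = cnj (chi m) * cnj (chi n)" "cnj (chi (n + int q)) = cnj (chi n)"
  "cnj (chi n) \<noteq> 0 \<longleftrightarrow> coprime n (int q)" by (simp_all only: complex_cnj_mult complex_cnj_zero_iff)
qed

lemma trivial_character_dchar: "dirichlet_character q (trivial_character q)"
 unfolding dirichlet_character_def
proof (intro conjI allI)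
 fix m n
 show "trivial_character q (m * n) = trivial_character q m * trivial_character q n"
  by (simp add: trivial_character_def)
 have "gcd (n + int q) (int q) = gcd n (int q)" by (rule gcd_add1)
 hence "coprime (n + int q) (int q) \<longleftrightarrow> coprime n (int q)" by (simp only: coprime_iff_gcd_eq_1)
 thus "trivial_character q (n + int q) = trivial_character q n" by (simp only: trivial_character_def)
 show "trivial_character q n \<noteq> 0 \<longleftrightarrow> coprime n (int q)"
  by (simp add: trivial_character_def)
qed

lemma coprime_add_modulus: "coprime (n + int q) (int q) \<longleftrightarrow> coprime n (int q)"
proof -
 have "gcd (n + int q) (int q) = gcd n (int q)" by (rule gcd_add1)
 thus ?thesis by (simp only: coprime_iff_gcd_eq_1)
qed

section \<open>Primitive roots and orthogonality of characters\<close>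

context
 fixes q :: nat
 assumes q: "prime q"
begin

lemma primitive_root_index:
 obtains g :: nat where "coprime q g" "ord q g = q - 1"
  "\<And>n. coprime n (int q) \<Longrightarrow> \<exists>i. [n = int g ^ i] (mod int q)"
proof -
 obtain g where g: "residue_primroot q g" using prime_primitive_root_exists[OF prime_gt_1_nat[OF q] q] by blast
 have cop: "coprime q g" and ord: "ord q g = q - 1"
  using g q by (auto simp: residue_primroot_def totient_prime)
 have "\<exists>i. [n = int g ^ i] (mod int q)" if n: "coprime n (int q)" for n
 proof -
  define a where "a = nat (n mod int q)"
  have q1: "q > 1" using q prime_gt_1_nat by simp
  have a: "int a = n mod int q" using q1 by (simp add: a_def)
  have cop_a: "coprime a q"
  proof -
   have "coprime (int a) (int q)" unfolding a using n q1 by (subst coprime_mod_left_iff) auto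
   thus ?thesis by simp
  qed
  have lt: "a < q" using q1 by (simp add: a_def nat_less_iff)
  have "a > 0" using cop_a q1 by (intro Nat.gr0I) auto
  hence "a \<in> totatives q" using cop_a lt by (auto simp: in_totatives_iff)
  also have "totatives q = (\<lambda>i. g ^ i mod q) ` {..<totient q}"
   using residue_primroot_is_generator[OF q1 g] by (simp add: bij_betw_def)
  finally obtain i where "a = g ^ i mod q" by auto
  hence "int a = int g ^ i mod int q" by (simp add: of_nat_mod)
  hence "[n = int g ^ i] (mod int q)" using a by (simp add: cong_def)
  thus ?thesis by blast
 qed
 with cop ord show ?thesis by (intro that[of g]) auto
qed

end

context fixes q :: nat assumes q: "prime q" begin
text \<open>Multiplication by a primitive \<open>n\<close>-th root \<open>w\<close> permutes the
  roots and multiplies the sum by \<open>w ^ i\<close>.\<close>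

lemma sum_roots_of_unity_power:
 assumes "n > 0"
 shows "(\<Sum>z | z ^ n = (1::complex). z ^ i) = (if n dvd i then of_nat n else 0)"
proof (cases "n dvd i")
 case True
 then obtain k where k: "i = n * k" by auto
 have "(\<Sum>z | z ^ n = (1::complex). z ^ i) = (\<Sum>z | z ^ n = (1::complex). 1)"
  by (intro sum.cong) (auto simp: k power_mult)
 thus ?thesis using True assms by (simp add: card_roots_unity_eq)
next
 case False
 define w where "w = exp (2 * of_real pi * \<i> / of_nat n)"
 have w1: "w ^ n = 1"
  using assms by (simp add: w_def exp_of_nat_mult[symmetric])
 have wi: "w ^ i \<noteq> 1"
 proof
  assume "w ^ i = 1"
  hence "exp (2 * of_real pi * \<i> * of_nat i / of_nat n) = 1"
   by (simp add: w_def exp_of_nat_mult[symmetric] mult_ac)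
  then obtain k :: int where k: "Im (2 * of_real pi * \<i> * of_nat i / of_nat n) = of_int (2 * k) * pi"
   by (auto simp: exp_eq_1)
  hence "(2 * pi) * (real i / real n) = (2 * pi) * of_int k" by (simp add: mult_ac)
  hence "real i / real n = of_int k" by (subst (asm) mult_cancel_left) simp
  hence "real i = of_int k * real n" using assms by (simp add: field_simps)
  hence "int i = k * int n" by (metis of_int_eq_iff of_int_mult of_int_of_nat_eq)
  hence "int n dvd int i" by simp
  with False show False by simp
 qed
 have bij: "bij_betw (\<lambda>z. w * z) {z. z ^ n = 1} {z. z ^ n = 1}"
 proof (rule bij_betwI[where g = "\<lambda>z. z / w"])
  have "w \<noteq> 0" by (simp add: w_def)
  thus "w * z / w = z" "w * (z / w) = z" for z by auto
 qed (auto simp: power_mult_distrib power_divide w1)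
 have "(\<Sum>z | z ^ n = (1::complex). z ^ i) = (\<Sum>z | z ^ n = (1::complex). (w * z) ^ i)"
  by (rule sum.reindex_bij_betw[OF bij, symmetric])
 also have "\<dots> = w ^ i * (\<Sum>z | z ^ n = (1::complex). z ^ i)" by (simp add: power_mult_distrib sum_distrib_left)
 finally show ?thesis using wi False by (simp add: mult_cancel_right1)
qed

text \<open>Characters correspond to \<open>(q-1)\<close>-th roots of unity via their value at a primitive root.\<close>
lemma dchars_bij_roots:
 obtains g :: nat where "coprime q g" "ord q g = q - 1"
  "\<And>n. coprime n (int q) \<Longrightarrow> \<exists>i. [n = int g ^ i] (mod int q)"
  "bij_betw (\<lambda>chi. chi (int g)) (dchars q) {z. z ^ (q - 1) = 1}"
proof -
 obtain g where g: "coprime q g" "ord q g = q - 1"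
  "\<And>n. coprime n (int q) \<Longrightarrow> \<exists>i. [n = int g ^ i] (mod int q)" by (rule primitive_root_index[OF q]) blast
 have gq: "coprime (int g) (int q)" using g(1) by (simp add: coprime_commute)
 have q1: "q > 1" using q prime_gt_1_nat by simp
 \<comment> \<open>A discrete logarithm. It is determined only modulo \<open>q - 1\<close>, which is
   harmless because it serves as an exponent of \<open>(q-1)\<close>-th roots of unity.\<close>
 define ind where "ind = (\<lambda>n. SOME i. [n = int g ^ i] (mod int q))"
 have ind: "[n = int g ^ ind n] (mod int q)" if "coprime n (int q)" for n
  unfolding ind_def by (rule someI_ex[OF g(3)[OF that]])
 have expo: "[int g ^ i = int g ^ j] (mod int q) \<longleftrightarrow> [i = j] (mod (q - 1))" for i j
  using order_divides_expdiff[OF g(1), of i j] g(2) by (simp flip: cong_int_iff of_nat_power)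
 have pow_eq: "z ^ i = z ^ j" if "z ^ (q - 1) = (1::complex)" "[i = j] (mod (q - 1))" for z i j
 proof -
  have "z ^ i = z ^ (i mod (q - 1))" for i
   using that(1) by (metis div_mult_mod_eq mult.commute power_add power_mult power_one mult_1)
  thus ?thesis using that(2) by (metis cong_def)
 qed
 have "bij_betw (\<lambda>chi. chi (int g)) (dchars q) {z. z ^ (q - 1) = 1}"
  unfolding bij_betw_def
 proof
  show "inj_on (\<lambda>chi. chi (int g)) (dchars q)"
  proof (rule inj_onI)
   fix chi psi assume c: "chi \<in> dchars q" "psi \<in> dchars q" "chi (int g) = psi (int g)"
   have c': "dirichlet_character q chi" "dirichlet_character q psi" using c by (auto simp: dchars_def)
   show "chi = psi"
   proof
    fix n
    show "chi n = psi n"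
    proof (cases "coprime n (int q)")
     case True
     have "chi n = chi (int g) ^ ind n" "psi n = psi (int g) ^ ind n"
      using dchar_cong[OF q c'(1) ind[OF True]] dchar_cong[OF q c'(2) ind[OF True]]
      by (simp_all add: dchar_power[OF q c'(1)] dchar_power[OF q c'(2)])
     thus ?thesis using c(3) by simp
    next
     case False
     thus ?thesis using dchar_eq_0_iff[OF q c'(1), of n] dchar_eq_0_iff[OF q c'(2), of n] by simp
    qed
   qed
  qed
  show "(\<lambda>chi. chi (int g)) ` dchars q = {z. z ^ (q - 1) = 1}"
  proof (intro equalityI subsetI)
   fix z assume "z \<in> (\<lambda>chi. chi (int g)) ` dchars q"
   thus "z \<in> {z. z ^ (q - 1) = 1}" using dchar_root_of_unity[OF q _ gq] by (auto simp: dchars_def)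
  next
   fix z :: complex assume z: "z \<in> {z. z ^ (q - 1) = 1}"
   hence z1: "z ^ (q - 1) = 1" by simp
   have z0: "z \<noteq> 0" using z1 q1 by (auto simp: power_0_left split: if_splits)
   define chi where "chi = (\<lambda>n. if coprime n (int q) then z ^ ind n else 0)"
   have "dirichlet_character q chi"
    unfolding dirichlet_character_def
   proof (intro conjI allI)
    fix m n
    show "chi (m * n) = chi m * chi n"
    proof (cases "coprime m (int q) \<and> coprime n (int q)")
     case True
     hence mn: "coprime (m * n) (int q)" by simp
     have "[int g ^ ind (m * n) = int g ^ ind m * int g ^ ind n] (mod int q)"
      using cong_trans[OF cong_sym[OF ind[OF mn]] cong_mult[OF ind ind]] True by blast
     hence "[ind (m * n) = ind m + ind n] (mod (q - 1))"
      by (simp only: expo power_add[symmetric])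
     hence "z ^ ind (m * n) = z ^ ind m * z ^ ind n" using pow_eq[OF z1] by (simp add: power_add[symmetric])
     thus ?thesis using True mn by (simp add: chi_def)
    next
     case False
     thus ?thesis by (auto simp: chi_def coprime_mult_left_iff)
    qed
   next
    fix n
    show "chi (n + int q) = chi n"
    proof (cases "coprime n (int q)")
     case True
     hence c: "coprime (n + int q) (int q)" by (simp only: coprime_add_modulus)
     have "[n + int q = n] (mod int q)" by (simp add: cong_def)
     hence "[int g ^ ind (n + int q) = int g ^ ind n] (mod int q)"
      using cong_trans[OF cong_trans[OF cong_sym[OF ind[OF c]]] ind[OF True]] by blast
     thus ?thesis using True c pow_eq[OF z1] by (simp add: chi_def expo)
    next
     case False
     hence "\<not> coprime (n + int q) (int q)" by (simp only: coprime_add_modulus not_False_eq_True)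
     thus ?thesis using False by (simp add: chi_def)
    qed
    show "(chi n \<noteq> 0) = coprime n (int q)" using z0 by (simp add: chi_def)
   qed
   moreover have "chi (int g) = z"
   proof -
    have "[int g ^ 1 = int g ^ ind (int g)] (mod int q)" using ind[OF gq] by simp
    hence "[1 = ind (int g)] (mod (q - 1))" by (simp only: expo)
    hence "z ^ 1 = z ^ ind (int g)" by (rule pow_eq[OF z1])
    thus ?thesis using gq by (simp add: chi_def)
   qed
   ultimately show "z \<in> (\<lambda>chi. chi (int g)) ` dchars q" by (auto simp: dchars_def)
  qed
 qed
 with g show ?thesis by (rule that)
qed

text \<open>Everything is transported along \<open>dchars_bij_roots\<close>: at
  \<open>n = g ^ i\<close> the character sum becomes the \<open>i\<close>-th power sum of the
  \<open>(q-1)\<close>-th roots of unity, and \<open>q - 1\<close> divides \<open>i\<close> exactly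
  when \<open>n\<close> is congruent to 1.\<close>

lemma finite_dchars: "finite (dchars q)" and sum_dchars:
 "coprime n (int q) \<Longrightarrow> (\<Sum>chi\<in>dchars q. chi n) = (if [n = 1] (mod int q) then of_nat (q - 1) else 0)"
 and card_dchars: "card (dchars q) = q - 1"
proof -
 have q1: "q - 1 > 0" using q prime_gt_1_nat by force
 obtain g where g: "coprime q g" "ord q g = q - 1"
  "\<And>n. coprime n (int q) \<Longrightarrow> \<exists>i. [n = int g ^ i] (mod int q)"
  "bij_betw (\<lambda>chi. chi (int g)) (dchars q) {z. z ^ (q - 1) = 1}" by (rule dchars_bij_roots) blast
 have fin: "finite {z::complex. z ^ (q - 1) = 1}" using q1 by (intro finite_roots_unity) auto
 show "finite (dchars q)" using bij_betw_finite[OF g(4)] fin by simp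
 show "card (dchars q) = q - 1" using bij_betw_same_card[OF g(4)] q1 by (simp add: card_roots_unity_eq)
 assume n: "coprime n (int q)"
 obtain i where i: "[n = int g ^ i] (mod int q)" using g(3)[OF n] by blast
 have "(\<Sum>chi\<in>dchars q. chi n) = (\<Sum>chi\<in>dchars q. chi (int g) ^ i)"
 proof (rule sum.cong[OF refl])
  fix chi assume "chi \<in> dchars q"
  hence c: "dirichlet_character q chi" by (simp add: dchars_def)
  show "chi n = chi (int g) ^ i" using dchar_cong[OF q c i] by (simp add: dchar_power[OF q c])
 qed
 also have "\<dots> = (\<Sum>z | z ^ (q - 1) = 1. z ^ i)" by (rule sum.reindex_bij_betw[OF g(4)])
 also have "\<dots> = (if q - 1 dvd i then of_nat (q - 1) else 0)" by (rule sum_roots_of_unity_power[OF q1])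
 also have "q - 1 dvd i \<longleftrightarrow> [g ^ i = g ^ 0] (mod q)"
  using order_divides_expdiff[OF g(1), of i 0] g(2) by (simp add: cong_0_iff)
 also have "\<dots> \<longleftrightarrow> [int g ^ i = 1] (mod int q)" by (simp flip: cong_int_iff)
 also have "\<dots> \<longleftrightarrow> [n = 1] (mod int q)" using i cong_trans cong_sym by blast
 finally show "(\<Sum>chi\<in>dchars q. chi n) = (if [n = 1] (mod int q) then of_nat (q - 1) else 0)" .
qed

end

section \<open>Gauss sums\<close>

definition gauss_sum :: "nat \<Rightarrow> (int \<Rightarrow> complex) \<Rightarrow> int \<Rightarrow> complex" where
 "gauss_sum q chi k = (\<Sum>b\<in>{0..<int q}. chi b * exp (2 * of_real pi * \<i> * of_int (k * b) / of_nat q))"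

lemma exp_2pi_cong:
 assumes "[a = b] (mod int q)" "q > 0"
 shows "exp (2 * of_real pi * \<i> * of_int a / of_nat q) = exp (2 * of_real pi * \<i> * of_int b / of_nat q)"
proof -
 obtain k where k: "a = b + int q * k" using cong_sym[OF assms(1)] unfolding cong_iff_lin by blast
 have "of_int a / of_nat q = of_int b / of_nat q + (of_int k :: complex)"
  using assms(2) by (simp add: k add_divide_distrib)
 hence "2 * of_real pi * \<i> * (of_int a / of_nat q) = 2 * of_real pi * \<i> * (of_int b / of_nat q) + 2 * of_real pi * \<i> * of_int k"
  by (simp only: distrib_left)
 moreover have "exp (2 * of_real pi * \<i> * of_int k) = (1 :: complex)"
  using exp_integer_2pi[of "of_int k"] by (simp add: mult_ac)
 ultimately show ?thesis by (simp only: times_divide_eq_right[symmetric] exp_add mult_1_right)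
qed

context
 fixes q :: nat and chi :: "int \<Rightarrow> complex"
 assumes q: "prime q" and chi: "chi \<in> nontrivial_characters q"
begin

lemma nontriv_dchar: "dirichlet_character q chi"
 using chi by (simp add: nontrivial_characters_def)

lemma mult_bij_residues:
 assumes "coprime k (int q)"
 shows "bij_betw (\<lambda>b. k * b mod int q) {0..<int q} {0..<int q}"
proof -
 have q0: "int q > 0" using q prime_gt_0_nat by simp
 have inj: "inj_on (\<lambda>b. k * b mod int q) {0..<int q}"
 proof (rule inj_onI)
  fix a b assume ab: "a \<in> {0..<int q}" "b \<in> {0..<int q}" "k * a mod int q = k * b mod int q"
  hence "[k * a = k * b] (mod int q)" by (simp add: cong_def)
  hence "[a = b] (mod int q)" using assms by (simp add: cong_mult_lcancel)
  thus "a = b" using ab by (auto simp: cong_def)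
 qed
 have sub: "(\<lambda>b. k * b mod int q) ` {0..<int q} \<subseteq> {0..<int q}" using q0 by auto
 have "(\<lambda>b. k * b mod int q) ` {0..<int q} = {0..<int q}"
  by (rule endo_inj_surj[OF _ sub inj]) auto
 with inj show ?thesis by (simp add: bij_betw_def)
qed

lemma sum_dchar_residues: "(\<Sum>b\<in>{0..<int q}. chi b) = 0"
proof -
 obtain k where k: "chi k \<noteq> trivial_character q k" using chi by (auto simp: nontrivial_characters_def)
 have kc: "coprime k (int q)"
  using k dchar_eq_0_iff[OF q nontriv_dchar, of k] by (auto simp: trivial_character_def split: if_splits)
 have k1: "chi k \<noteq> 1" using k kc by (simp add: trivial_character_def)
 have "(\<Sum>b\<in>{0..<int q}. chi b) = (\<Sum>b\<in>{0..<int q}. chi (k * b mod int q))"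
  by (rule sum.reindex_bij_betw[OF mult_bij_residues[OF kc], symmetric])
 also have "\<dots> = chi k * (\<Sum>b\<in>{0..<int q}. chi b)"
  by (simp add: dchar_mod[OF q nontriv_dchar] dchar_mult[OF q nontriv_dchar] sum_distrib_left)
 finally show ?thesis using k1 by (simp add: mult_cancel_right1)
qed

text \<open>For \<open>k\<close> prime to \<open>q\<close>, substituting \<open>k * b\<close> for
  \<open>b\<close> pulls out \<open>chi k\<close>. For \<open>q\<close> dividing \<open>k\<close>
  both sides are 0, the left one as a full sum of a nontrivial character. Primality of
  \<open>q\<close> leaves no third case: every nontrivial character is primitive.\<close>

lemma gauss_sum_eq: "gauss_sum q chi k = cnj (chi k) * gauss_sum q chi 1"
proof (cases "coprime k (int q)")
 case True
 have q0: "q > 0" using q prime_gt_0_nat by simp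
 have "chi k * gauss_sum q chi k = (\<Sum>b\<in>{0..<int q}. chi (k * b mod int q) * exp (2 * of_real pi * \<i> * of_int (k * b mod int q) / of_nat q))"
  unfolding gauss_sum_def sum_distrib_left
 proof (rule sum.cong[OF refl])
  fix b
  have "exp (2 * of_real pi * \<i> * of_int (k * b) / of_nat q) = exp (2 * of_real pi * \<i> * of_int (k * b mod int q) / of_nat q)"
   by (rule exp_2pi_cong[OF _ q0]) (simp add: cong_def)
  thus "chi k * (chi b * exp (2 * of_real pi * \<i> * of_int (k * b) / of_nat q)) = chi (k * b mod int q) * exp (2 * of_real pi * \<i> * of_int (k * b mod int q) / of_nat q)"
   by (simp only: dchar_mod[OF q nontriv_dchar] dchar_mult[OF q nontriv_dchar] mult.assoc)
 qed
 also have "\<dots> = (\<Sum>b\<in>{0..<int q}. chi b * exp (2 * of_real pi * \<i> * of_int b / of_nat q))"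
  by (rule sum.reindex_bij_betw[OF mult_bij_residues[OF True], of "\<lambda>b. chi b * exp (2 * of_real pi * \<i> * of_int b / of_nat q)"])
 also have "\<dots> = gauss_sum q chi 1" by (simp add: gauss_sum_def)
 finally have "cnj (chi k) * (chi k * gauss_sum q chi k) = cnj (chi k) * gauss_sum q chi 1" by simp
 thus ?thesis using dchar_cnj_mult[OF q nontriv_dchar True] by (simp add: mult.assoc[symmetric] mult.commute[of "cnj _"])
next
 case False
 have q0: "q > 0" using q prime_gt_0_nat by simp
 have "int q dvd k" using False by (simp add: coprime_dchar_iff[OF q nontriv_dchar])
 hence "[k * b = 0] (mod int q)" for b by (simp add: cong_0_iff)
 from exp_2pi_cong[OF this q0] have "gauss_sum q chi k = (\<Sum>b\<in>{0..<int q}. chi b)"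
  unfolding gauss_sum_def by (intro sum.cong refl) simp
 moreover have "chi k = 0" using False by (simp add: dchar_eq_0_iff[OF q nontriv_dchar])
 ultimately show ?thesis by (simp add: sum_dchar_residues)
qed

lemma nontriv_cnj: "(\<lambda>n. cnj (chi n)) \<in> nontrivial_characters q"
 unfolding nontrivial_characters_def mem_Collect_eq
proof (rule conjI)
 show "dirichlet_character q (\<lambda>n. cnj (chi n))" by (rule dirichlet_character_cnj) (rule nontriv_dchar)
 show "(\<lambda>n. cnj (chi n)) \<noteq> trivial_character q"
 proof (rule notI)
  assume a: "(\<lambda>n. cnj (chi n)) = trivial_character q"
  have "chi = trivial_character q"
  proof (rule ext)
   fix n
   have "cnj (chi n) = trivial_character q n" by (rule fun_cong[OF a])
   hence "cnj (cnj (chi n)) = cnj (trivial_character q n)" by (simp only:)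
   also have "cnj (trivial_character q n) = trivial_character q n" unfolding trivial_character_def by auto
   finally show "chi n = trivial_character q n" unfolding complex_cnj_cnj .
  qed
  moreover have "chi \<noteq> trivial_character q" using chi unfolding nontrivial_characters_def mem_Collect_eq by (rule conjunct2)
  ultimately show False by (rule notE[rotated])
 qed
qed

end

section \<open>Poisson summation\<close>

text \<open>Bessel's inequality for the exponentials on \<open>[0,1]\<close>: if all coefficients with
 \<open>n \<in> S\<close> equal \<open>c\<close>, then \<open>c\<close> has to be small.\<close>
definition fcoef :: "(real \<Rightarrow> complex) \<Rightarrow> int \<Rightarrow> complex" where
 "fcoef g n = integral {0..1} (\<lambda>t. g t * exp (- 2 * of_real pi * \<i> * of_int n * of_real t))"

lemma exp_integral_01:
 "integral {0..1} (\<lambda>t. exp (2 * of_real pi * \<i> * of_int n * of_real t)) = (if n = 0 then 1 else (0::complex))"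
proof (cases "n = 0")
 case False
 let ?c = "2 * of_real pi * \<i> * of_int n :: complex"
 have c: "?c \<noteq> 0" using False by simp
 have "((\<lambda>t. exp (?c * of_real t)) has_integral (exp (?c * of_real 1) / ?c - exp (?c * of_real 0) / ?c)) {0..1}"
  by (rule fundamental_theorem_of_calculus)
    (use c in \<open>auto intro!: derivative_eq_intros has_vector_derivative_real_field\<close>)
 moreover have "exp ?c = 1" using exp_integer_2pi[of "of_int n"] by (simp add: mult_ac)
 ultimately show ?thesis using False by (simp add: integral_unique)
qed auto

lemma Bessel_inequality_01:
 fixes g :: "real \<Rightarrow> complex"
 assumes g: "continuous_on {0..1} g" and S: "finite S"
 shows "(\<Sum>n\<in>S. (norm (fcoef g n))\<^sup>2) \<le> integral {0..1} (\<lambda>t. (norm (g t))\<^sup>2)"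
proof -
 define e where "e = (\<lambda>n t. exp (2 * of_real pi * \<i> * of_int n * of_real t) :: complex)"
 have cnj_e: "cnj (e n t) = exp (- 2 * of_real pi * \<i> * of_int n * of_real t)" for n t
  by (simp add: e_def exp_cnj)
 have e_cont: "continuous_on A (e n)" for n A unfolding e_def by (intro continuous_intros)
 define P where "P = (\<lambda>t. \<Sum>n\<in>S. fcoef g n * e n t)"
 have P_cont: "continuous_on A P" for A unfolding P_def by (intro continuous_intros e_cont)
 have int1: "integral {0..1} (\<lambda>t. g t * cnj (e n t)) = fcoef g n" for n
  unfolding fcoef_def cnj_e ..
 have int2: "integral {0..1} (\<lambda>t. e n t * cnj (e m t)) = (if n = m then 1 else 0)" for n m
 proof -
  have "e n t * cnj (e m t) = exp (2 * of_real pi * \<i> * of_int (n - m) * of_real t)" for t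
   unfolding cnj_e by (simp add: e_def exp_add[symmetric] algebra_simps)
  thus ?thesis using exp_integral_01[of "n - m"] by simp
 qed
 have gP: "integral {0..1} (\<lambda>t. g t * cnj (P t)) = of_real (\<Sum>n\<in>S. (norm (fcoef g n))\<^sup>2)"
 proof -
  have "integral {0..1} (\<lambda>t. g t * cnj (P t)) = integral {0..1} (\<lambda>t. \<Sum>n\<in>S. cnj (fcoef g n) * (g t * cnj (e n t)))"
   by (simp add: P_def sum_distrib_left mult_ac)
  also have "\<dots> = (\<Sum>n\<in>S. integral {0..1} (\<lambda>t. cnj (fcoef g n) * (g t * cnj (e n t))))"
   by (intro integral_sum integrable_continuous_real continuous_intros g e_cont S)
  also have "\<dots> = (\<Sum>n\<in>S. cnj (fcoef g n) * fcoef g n)" by (simp add: int1)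
  finally show ?thesis unfolding of_real_sum complex_norm_square by (simp add: mult.commute)
 qed
 have PP: "integral {0..1} (\<lambda>t. P t * cnj (P t)) = of_real (\<Sum>n\<in>S. (norm (fcoef g n))\<^sup>2)"
 proof -
  have "integral {0..1} (\<lambda>t. P t * cnj (P t)) = integral {0..1} (\<lambda>t. \<Sum>n\<in>S. \<Sum>m\<in>S. fcoef g n * cnj (fcoef g m) * (e n t * cnj (e m t)))"
   by (simp add: P_def sum_product mult_ac)
  also have "\<dots> = (\<Sum>n\<in>S. \<Sum>m\<in>S. integral {0..1} (\<lambda>t. fcoef g n * cnj (fcoef g m) * (e n t * cnj (e m t))))"
  proof -
   have "integral {0..1} (\<lambda>t. \<Sum>m\<in>S. fcoef g n * cnj (fcoef g m) * (e n t * cnj (e m t))) =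
     (\<Sum>m\<in>S. integral {0..1} (\<lambda>t. fcoef g n * cnj (fcoef g m) * (e n t * cnj (e m t))))" for n
    by (intro integral_sum integrable_continuous_real continuous_intros e_cont S)
   moreover have "integral {0..1} (\<lambda>t. \<Sum>n\<in>S. \<Sum>m\<in>S. fcoef g n * cnj (fcoef g m) * (e n t * cnj (e m t))) =
     (\<Sum>n\<in>S. integral {0..1} (\<lambda>t. \<Sum>m\<in>S. fcoef g n * cnj (fcoef g m) * (e n t * cnj (e m t))))"
    by (intro integral_sum integrable_continuous_real continuous_intros e_cont S)
   ultimately show ?thesis by (simp only:)
  qed
  also have "\<dots> = (\<Sum>n\<in>S. \<Sum>m\<in>S. fcoef g n * cnj (fcoef g m) * (if n = m then 1 else 0))" by (simp add: int2)
  also have "\<dots> = (\<Sum>n\<in>S. fcoef g n * cnj (fcoef g n))" using S by (simp add: if_distrib[of "\<lambda>x. _ * x"] cong: if_cong)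
  finally show ?thesis unfolding of_real_sum complex_norm_square .
 qed
 have Re_int: "integral {0..1} (\<lambda>t. Re (\<phi> t)) = Re (integral {0..1} \<phi>)" if "continuous_on {0..1} \<phi>" for \<phi> :: "real \<Rightarrow> complex"
  using integral_linear[OF integrable_continuous_real[OF that] bounded_linear_Re] by (simp add: o_def)
 have pt: "(norm (g t - P t))\<^sup>2 = (norm (g t))\<^sup>2 - 2 * Re (g t * cnj (P t)) + Re (P t * cnj (P t))" for t
  unfolding cmod_power2 by (simp add: power2_eq_square algebra_simps)
 have cR: "continuous_on {0..1} (\<lambda>t. Re (g t * cnj (P t)))" "continuous_on {0..1} (\<lambda>t. Re (P t * cnj (P t)))"
   "continuous_on {0..1} (\<lambda>t. (norm (g t))\<^sup>2)"
  by (intro continuous_on_Re continuous_on_mult continuous_on_cnj continuous_on_power continuous_on_norm g P_cont)+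
 have "0 \<le> integral {0..1} (\<lambda>t. (norm (g t - P t))\<^sup>2)"
  by (intro integral_nonneg integrable_continuous_real continuous_on_power continuous_on_norm continuous_on_diff g P_cont) auto
 also have "\<dots> = integral {0..1} (\<lambda>t. (norm (g t))\<^sup>2) - 2 * integral {0..1} (\<lambda>t. Re (g t * cnj (P t))) + integral {0..1} (\<lambda>t. Re (P t * cnj (P t)))"
  unfolding pt
  by (intro integral_unique has_integral_add has_integral_diff has_integral_mult_right
     integrable_integral integrable_continuous_real cR)
 also have "\<dots> = integral {0..1} (\<lambda>t. (norm (g t))\<^sup>2) - 2 * Re (integral {0..1} (\<lambda>t. g t * cnj (P t))) + Re (integral {0..1} (\<lambda>t. P t * cnj (P t)))"
 proof -
  have "integral {0..1} (\<lambda>t. Re (g t * cnj (P t))) = Re (integral {0..1} (\<lambda>t. g t * cnj (P t)))"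
   by (intro Re_int continuous_on_mult continuous_on_cnj g P_cont)
  moreover have "integral {0..1} (\<lambda>t. Re (P t * cnj (P t))) = Re (integral {0..1} (\<lambda>t. P t * cnj (P t)))"
   by (intro Re_int continuous_on_mult continuous_on_cnj P_cont)
  ultimately show ?thesis by (simp only:)
 qed
 finally show ?thesis unfolding gP PP by simp
qed

lemma has_vector_derivative_quotient:
 fixes f :: "real \<Rightarrow> 'a::real_normed_vector"
 assumes "(f has_vector_derivative D) (at x within S)"
 shows "((\<lambda>t. (f t - f x) /\<^sub>R (t - x)) \<longlongrightarrow> D) (at x within S)"
proof -
 have "((\<lambda>t. (1 / norm (t - x)) *\<^sub>R (f t - (f x + (t - x) *\<^sub>R D))) \<longlongrightarrow> 0) (at x within S)"
  using assms unfolding has_vector_derivative_def has_derivative_within by (rule conjunct2)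
 hence "((\<lambda>t. norm ((1 / norm (t - x)) *\<^sub>R (f t - (f x + (t - x) *\<^sub>R D)))) \<longlongrightarrow> 0) (at x within S)"
  by (rule tendsto_norm_zero)
 hence "((\<lambda>t. norm ((f t - f x) /\<^sub>R (t - x) - D)) \<longlongrightarrow> 0) (at x within S)"
 proof (rule Lim_transform_eventually)
  have "norm ((1 / norm (t - x)) *\<^sub>R (f t - (f x + (t - x) *\<^sub>R D))) = norm ((f t - f x) /\<^sub>R (t - x) - D)" if "t \<noteq> x" for t
  proof -
   have "f t - (f x + (t - x) *\<^sub>R D) = (t - x) *\<^sub>R ((f t - f x) /\<^sub>R (t - x) - D)"
    using that by (simp add: scaleR_diff_right)
   thus ?thesis using that by simp
  qed
  thus "\<forall>\<^sub>F t in at x within S. norm ((1 / norm (t - x)) *\<^sub>R (f t - (f x + (t - x) *\<^sub>R D))) = norm ((f t - f x) /\<^sub>R (t - x) - D)"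
   unfolding eventually_at_filter by (intro always_eventually) blast
 qed
 hence "((\<lambda>t. (f t - f x) /\<^sub>R (t - x) - D) \<longlongrightarrow> 0) (at x within S)" by (rule tendsto_norm_zero_cancel)
 thus ?thesis by (rule LIM_zero_cancel)
qed

text \<open>Chernoff's proof of pointwise convergence: dividing \<open>g - g 0\<close> by \<open>e(t) - 1\<close> turns the
 Fourier coefficients of \<open>g\<close> into telescoping differences.\<close>
lemma fourier_uniqueness_at_0:
 fixes g :: "real \<Rightarrow> complex"
 assumes g: "continuous_on {0..1} g" and per: "g 1 = g 0"
  and d0: "(g has_vector_derivative D) (at 0 within {0..1})"
  and d1: "(g has_vector_derivative D) (at 1 within {0..1})"
  and coef: "\<And>n. fcoef g n = 0"
 shows "g 0 = 0"
proof -
 define e where "e = (\<lambda>t::real. exp (2 * of_real pi * \<i> * of_real t) :: complex)"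
 have e1: "e t \<noteq> 1" if "0 < t" "t < 1" for t
 proof
  assume "e t = 1"
  then obtain k :: int where k: "Im (2 * of_real pi * \<i> * of_real t) = of_int (2 * k) * pi"
   by (auto simp: e_def exp_eq_1)
  hence "pi * (2 * t) = pi * (2 * of_int k)" by (simp add: mult_ac)
  hence "t = of_int k" by (subst (asm) mult_cancel_left) simp
  thus False using that by auto
 qed
 have ed: "(e has_vector_derivative 2 * of_real pi * \<i>) (at x within S)" if "x = 0 \<or> x = 1" for x S
 proof -
  have "(e has_vector_derivative 2 * of_real pi * \<i> * exp (2 * of_real pi * \<i> * of_real x)) (at x within S)"
   unfolding e_def by (auto intro!: derivative_eq_intros has_vector_derivative_real_field)
  moreover have "exp (2 * of_real pi * \<i> * of_real x) = 1"
   using that exp_integer_2pi[of 1] by (auto simp: mult_ac)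
  ultimately show ?thesis by simp
 qed
 have e01: "e 0 = 1" "e 1 = 1" using exp_integer_2pi[of 1] by (auto simp: e_def mult_ac)
 \<comment> \<open>The endpoint values are the limits of the quotient, by differentiability of
   \<open>g\<close> at both ends; this makes \<open>G\<close> continuous on the closed
   interval.\<close>
 define G where "G = (\<lambda>t. if t = 0 \<or> t = 1 then D / (2 * of_real pi * \<i>) else (g t - g 0) / (e t - 1))"
 have quot: "((\<lambda>t. (g t - g 0) / (e t - 1)) \<longlongrightarrow> D / (2 * of_real pi * \<i>)) (at x within {0..1})"
  if x: "x = 0 \<or> x = 1" for x
 proof -
  have gx: "(g has_vector_derivative D) (at x within {0..1})" using x d0 d1 by auto
  have 1: "((\<lambda>t. (g t - g x) /\<^sub>R (t - x)) \<longlongrightarrow> D) (at x within {0..1})"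
   by (rule has_vector_derivative_quotient[OF gx])
  have 2: "((\<lambda>t. (e t - e x) /\<^sub>R (t - x)) \<longlongrightarrow> 2 * of_real pi * \<i>) (at x within {0..1})"
   by (rule has_vector_derivative_quotient[OF ed[OF x]])
  have "((\<lambda>t. ((g t - g x) /\<^sub>R (t - x)) / ((e t - e x) /\<^sub>R (t - x))) \<longlongrightarrow> D / (2 * of_real pi * \<i>)) (at x within {0..1})"
   by (intro tendsto_divide 1 2) auto
  thus ?thesis
  proof (rule Lim_transform_eventually)
   show "\<forall>\<^sub>F t in at x within {0..1}. ((g t - g x) /\<^sub>R (t - x)) / ((e t - e x) /\<^sub>R (t - x)) = (g t - g 0) / (e t - 1)"
   proof -
    have "((g t - g x) /\<^sub>R (t - x)) / ((e t - e x) /\<^sub>R (t - x)) = (g t - g 0) / (e t - 1)" if "t \<noteq> x" for t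
    proof -
     have "g x = g 0" "e x = 1" using x per e01 by auto
     moreover have "(complex_of_real (inverse (t - x)) * (g t - g x)) / (complex_of_real (inverse (t - x)) * (e t - e x)) = (g t - g x) / (e t - e x)"
      using that by (intro mult_divide_mult_cancel_left) simp
     ultimately show ?thesis by (simp only: scaleR_conv_of_real)
    qed
    thus ?thesis unfolding eventually_at_filter by (intro always_eventually) blast
   qed
  qed
 qed
 have Gc: "continuous_on {0..1} G"
  unfolding continuous_on_def
 proof
  fix x :: real assume x: "x \<in> {0..1}"
  show "(G \<longlongrightarrow> G x) (at x within {0..1})"
  proof (cases "x = 0 \<or> x = 1")
   case True
   have "((\<lambda>t. (g t - g 0) / (e t - 1)) \<longlongrightarrow> G x) (at x within {0..1})"
    using quot[OF True] True by (simp add: G_def)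
   moreover have "\<forall>\<^sub>F t in at x within {0..1}. (g t - g 0) / (e t - 1) = G t"
   proof -
    have "\<forall>\<^sub>F t in at x within {0..1}. t \<noteq> x \<and> t \<noteq> 1 - x"
    proof (rule eventually_conj)
     show "\<forall>\<^sub>F t in at x within {0..1}. t \<noteq> x" by (simp add: eventually_at_filter)
     have "x \<noteq> 1 - x" using True by auto
     thus "\<forall>\<^sub>F t in at x within {0..1}. t \<noteq> 1 - x"
      unfolding eventually_at_filter by (rule eventually_mono[OF t1_space_nhds]) simp
    qed
    thus ?thesis by eventually_elim (use True in \<open>auto simp: G_def\<close>)
   qed
   ultimately show ?thesis by (rule Lim_transform_eventually)
  next
   case False
   hence x01: "0 < x" "x < 1" using x by auto
   have "continuous_on {0<..<1} (\<lambda>t. (g t - g 0) / (e t - 1))"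
   proof (intro continuous_intros ballI)
    show "continuous_on {0<..<1} g" by (rule continuous_on_subset[OF g]) auto
    show "continuous_on {0<..<1} e" unfolding e_def by (intro continuous_intros)
    show "e t - 1 \<noteq> 0" if "t \<in> {0<..<1}" for t using e1[of t] that by auto
   qed
   hence "continuous_on {0<..<1} G"
    by (rule continuous_on_eq) (auto simp: G_def)
   hence "isCont G x" using x01 by (auto simp: continuous_on_eq_continuous_at)
   thus ?thesis unfolding isCont_def by (rule tendsto_within_subset) simp
  qed
 qed
 have Geq: "g t - g 0 = G t * (e t - 1)" if "t \<in> {0..1}" for t
 proof (cases "t = 0 \<or> t = 1")
  case True
  thus ?thesis using e01 per by auto
 next
  case False
  hence "e t - 1 \<noteq> 0" using e1[of t] that by simp
  thus ?thesis using False by (simp add: G_def)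
 qed
 have key: "fcoef G (n - 1) - fcoef G n = (if n = 0 then - g 0 else 0)" for n
 proof -
  let ?E = "\<lambda>n::int. \<lambda>t::real. exp (- 2 * of_real pi * \<i> * of_int n * of_real t) :: complex"
  have "fcoef G (n - 1) - fcoef G n = integral {0..1} (\<lambda>t. G t * ?E (n - 1) t - G t * ?E n t)"
   unfolding fcoef_def by (intro integral_diff[symmetric] integrable_continuous_real continuous_intros Gc)
  also have "\<dots> = integral {0..1} (\<lambda>t. g t * ?E n t - g 0 * ?E n t)"
  proof (rule integral_cong)
   fix t :: real assume t: "t \<in> {0..1}"
   have "?E (n - 1) t = ?E n t * e t" by (simp add: e_def exp_add[symmetric] algebra_simps)
   hence "G t * ?E (n - 1) t - G t * ?E n t = G t * (e t - 1) * ?E n t" by (simp add: algebra_simps)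
   also have "\<dots> = (g t - g 0) * ?E n t" using Geq[OF t] by simp
   finally show "G t * ?E (n - 1) t - G t * ?E n t = g t * ?E n t - g 0 * ?E n t" by (simp add: algebra_simps)
  qed
  also have "\<dots> = fcoef g n - g 0 * integral {0..1} (?E n)"
   unfolding fcoef_def by (subst integral_diff) (auto intro!: integrable_continuous_real continuous_intros g)
  also have "integral {0..1} (?E n) = (if n = 0 then 1 else 0)"
   using exp_integral_01[of "- n"] by simp
  finally show ?thesis using coef by simp
 qed
 define J where "J = integral {0..1} (\<lambda>t. (norm (G t))\<^sup>2)"
 \<comment> \<open>By \<open>key\<close> the coefficients of \<open>G\<close> are constant on the
   nonnegative and on the negative indices and differ by \<open>g 0\<close> between the two ranges;
   Bessel's inequality forces both constants to be 0.\<close>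
 have const_zero: "c = 0" if "\<And>k::nat. fcoef G (\<sigma> k) = c" "inj \<sigma>" for c and \<sigma> :: "nat \<Rightarrow> int"
 proof (rule ccontr)
  assume c: "c \<noteq> 0"
  obtain N :: nat where N: "J / (norm c)\<^sup>2 < real N" using reals_Archimedean2 by blast
  have "(\<Sum>n\<in>\<sigma> ` {..<N}. (norm (fcoef G n))\<^sup>2) \<le> J"
   unfolding J_def by (rule Bessel_inequality_01[OF Gc]) auto
  also have "(\<Sum>n\<in>\<sigma> ` {..<N}. (norm (fcoef G n))\<^sup>2) = real N * (norm c)\<^sup>2"
   using that by (subst sum.reindex) (auto intro: inj_on_subset)
  finally show False using N c by (simp add: pos_divide_less_eq)
 qed
 have "fcoef G (int k) = fcoef G 0" for k
 proof (induction k)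
  case (Suc k) thus ?case using key[of "int (Suc k)"] by simp
 qed auto
 hence z1: "fcoef G 0 = 0" by (rule const_zero) (auto intro: injI)
 have "fcoef G (- 1 - int k) = fcoef G (- 1)" for k
 proof (induction k)
  case (Suc k) thus ?case using key[of "- 1 - int k"] by (simp add: algebra_simps)
 qed auto
 hence z2: "fcoef G (- 1) = 0" by (rule const_zero) (auto intro: injI)
 show ?thesis using key[of 0] z1 z2 by simp
qed

lemma summable_on_exp_int: "(\<lambda>n::int. exp (- \<bar>real_of_int n\<bar>)) summable_on UNIV"
proof -
 have s: "summable (\<lambda>n. exp (- 1 :: real) ^ n)" by (intro summable_geometric) auto
 have n: "(\<lambda>n::nat. exp (- real n)) summable_on UNIV"
  using s by (intro summable_nonneg_imp_summable_on) (auto simp: exp_of_nat_mult[symmetric])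
 have 1: "(\<lambda>n::int. exp (- \<bar>real_of_int n\<bar>)) summable_on range int"
  by (subst summable_on_reindex) (use n in \<open>auto simp: o_def\<close>)
 have 2: "(\<lambda>n::int. exp (- \<bar>real_of_int n\<bar>)) summable_on range (\<lambda>n. - int n)"
  by (subst summable_on_reindex) (use n in \<open>auto simp: o_def inj_on_def\<close>)
 have "(\<lambda>n::int. exp (- \<bar>real_of_int n\<bar>)) summable_on range int \<union> (range (\<lambda>n. - int n) - range int)"
  by (intro summable_on_Un_disjoint 1 summable_on_subset_banach[OF 2]) auto
 also have "range int \<union> (range (\<lambda>n. - int n) - range int) = UNIV"
  by (auto simp: image_iff) (metis int_cases2)
 finally show ?thesis .
qed

lemma integral_unit_intervals:
 fixes \<phi> :: "real \<Rightarrow> complex"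
 assumes c: "\<And>A. continuous_on A \<phi>"
 shows "(\<Sum>n\<in>{-int N..int N}. integral {0..1} (\<lambda>t. \<phi> (t + of_int n))) = integral {- real N..real N + 1} \<phi>"
proof -
 have sh: "integral {0..1} (\<lambda>t. \<phi> (t + of_int n)) = integral {of_int n..of_int n + 1} \<phi>" for n :: int
  using integral_shift[where f = \<phi> and a = 0 and b = 1 and c = "of_int n"] c by (simp add: add.commute o_def)
 have comb: "integral {a..b} \<phi> + integral {b..d} \<phi> = integral {a..d} \<phi>" if "a \<le> b" "b \<le> d" for a b d
  using that by (intro Henstock_Kurzweil_Integration.integral_combine integrable_continuous_real c)
 show ?thesis
 proof (induction N)
  case (Suc N)
  have "{-int (Suc N)..int (Suc N)} = insert (- int (Suc N)) (insert (int (Suc N)) {-int N..int N})" by auto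
  hence "(\<Sum>n\<in>{-int (Suc N)..int (Suc N)}. integral {0..1} (\<lambda>t. \<phi> (t + of_int n))) =
    integral {- real (Suc N)..- real N} \<phi> + (integral {- real N..real N + 1} \<phi> + integral {real N + 1..real N + 2} \<phi>)"
   using Suc sh[of "- int (Suc N)"] sh[of "int (Suc N)"] by (simp add: add_ac)
  also have "\<dots> = integral {- real (Suc N)..real (Suc N) + 1} \<phi>"
   using comb[of "- real N" "real N + 1" "real N + 2"] comb[of "- real (Suc N)" "- real N" "real N + 2"] by (simp add: add_ac)
  finally show ?case .
 qed (use sh[of 0] in simp)
qed

lemma integral_expanding_intervals:
 fixes g :: "real \<Rightarrow> complex"
 assumes g: "integrable lborel g"
 shows "(\<lambda>N. integral {- real N..real N + 1} g) \<longlonglongrightarrow> (LBINT t. g t)"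
proof -
 have "integral {- real N..real N + 1} g = (LBINT t. indicator {- real N..real N + 1} t *\<^sub>R g t)" for N
  using set_borel_integral_eq_integral(2)[of "{- real N..real N + 1}" g] g
  by (simp add: set_lebesgue_integral_def set_integrable_def integrable_mult_indicator)
 moreover have "(\<lambda>N. LBINT t. indicator {- real N..real N + 1} t *\<^sub>R g t) \<longlonglongrightarrow> (LBINT t. g t)"
 proof (rule integral_dominated_convergence[where w = "\<lambda>t. norm (g t)"])
  show "AE t in lborel. (\<lambda>N. indicator {- real N..real N + 1} t *\<^sub>R g t) \<longlonglongrightarrow> g t"
  proof (rule AE_I2)
   fix t
   obtain M :: nat where M: "\<bar>t\<bar> \<le> real M" using real_arch_simple by blast
   have "eventually (\<lambda>N. indicator {- real N..real N + 1} t *\<^sub>R g t = g t) sequentially"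
    using eventually_ge_at_top[of M] by eventually_elim (use M in \<open>auto simp: indicator_def\<close>)
   thus "(\<lambda>N. indicator {- real N..real N + 1} t *\<^sub>R g t) \<longlonglongrightarrow> g t" by (rule tendsto_eventually)
  qed
 qed (use g in \<open>auto simp: indicator_def\<close>)
 ultimately show ?thesis by simp
qed

text \<open>The difference \<open>H\<close> of the periodised function and its Fourier series is
  1-periodic with vanishing Fourier coefficients, so \<open>fourier_uniqueness_at_0\<close> gives
  \<open>H 0 = 0\<close>. The differentiability required there comes from working in the complex
  plane, where locally uniform limits of entire functions are entire; hence the bounds on discs of
  every radius.\<close>

theorem Poisson_summation_entire:
 fixes \<phi> :: "complex \<Rightarrow> complex" and c :: "int \<Rightarrow> complex"
 assumes \<phi>: "\<phi> holomorphic_on UNIV"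
  and \<phi>_bd: "\<And>R. \<exists>K. \<forall>z n. norm z \<le> R \<longrightarrow> norm (\<phi> (z + of_int n)) \<le> K * exp (- \<bar>real_of_int n\<bar>)"
  and c_bd: "\<And>R. \<exists>K. \<forall>n. norm (c n) * exp (2 * pi * R * \<bar>real_of_int n\<bar>) \<le> K * exp (- \<bar>real_of_int n\<bar>)"
  and ft_int: "integrable lborel (\<lambda>t. \<phi> (of_real t))"
  and ft: "\<And>n. (LBINT t. \<phi> (of_real t) * exp (- 2 * of_real pi * \<i> * of_int n * of_real t)) = c n"
 shows "(\<lambda>n. \<phi> (of_int n)) summable_on UNIV" "c summable_on UNIV" "(\<Sum>\<^sub>\<infinity>n. \<phi> (of_int n)) = (\<Sum>\<^sub>\<infinity>n. c n)"
proof -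
 define e where "e = (\<lambda>n z. exp (2 * of_real pi * \<i> * of_int n * z) :: complex)"
 have dominated: "f summable_on UNIV" if "\<And>n::int. norm (f n :: complex) \<le> K * exp (- \<bar>real_of_int n\<bar>)" for f K
  by (rule abs_summable_summable, rule summable_on_comparison_test[OF summable_on_cmult_right[OF summable_on_exp_int, of K]])
    (use that in auto)
 have ce_bd: "\<exists>K. \<forall>z n. norm z \<le> R \<longrightarrow> norm (c n * e n z) \<le> K * exp (- \<bar>real_of_int n\<bar>)" for R
 proof -
  obtain K where K: "\<And>n. norm (c n) * exp (2 * pi * R * \<bar>real_of_int n\<bar>) \<le> K * exp (- \<bar>real_of_int n\<bar>)"
   using c_bd[of R] by blast
  have "norm (c n * e n z) \<le> K * exp (- \<bar>real_of_int n\<bar>)" if z: "norm z \<le> R" for z n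
  proof -
   have "\<bar>real_of_int n * Im z\<bar> \<le> \<bar>real_of_int n\<bar> * R"
    unfolding abs_mult by (intro mult_left_mono order_trans[OF abs_Im_le_cmod z]) auto
   hence "2 * pi * (- (real_of_int n * Im z)) \<le> 2 * pi * (\<bar>real_of_int n\<bar> * R)" by (intro mult_left_mono) auto
   hence "norm (e n z) \<le> exp (2 * pi * R * \<bar>real_of_int n\<bar>)" by (simp add: e_def mult_ac)
   hence "norm (c n * e n z) \<le> norm (c n) * exp (2 * pi * R * \<bar>real_of_int n\<bar>)"
    unfolding norm_mult by (intro mult_left_mono) auto
   with K[of n] show ?thesis by (rule order_trans[rotated])
  qed
  thus ?thesis by blast
 qed
 have s1: "(\<lambda>n. \<phi> (z + of_int n)) summable_on UNIV" for z
 proof -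
  obtain K where "\<And>w n. norm w \<le> norm z \<Longrightarrow> norm (\<phi> (w + of_int n)) \<le> K * exp (- \<bar>real_of_int n\<bar>)"
   using \<phi>_bd[of "norm z"] by blast
  thus ?thesis by (intro dominated[of _ K]) auto
 qed
 have s2: "(\<lambda>n. c n * e n z) summable_on UNIV" for z
 proof -
  obtain K where "\<And>w n. norm w \<le> norm z \<Longrightarrow> norm (c n * e n w) \<le> K * exp (- \<bar>real_of_int n\<bar>)"
   using ce_bd[of "norm z"] by blast
  thus ?thesis by (intro dominated[of _ K]) auto
 qed
 show "(\<lambda>n. \<phi> (of_int n)) summable_on UNIV" using s1[of 0] by simp
 show "c summable_on UNIV" using s2[of 0] by (simp add: e_def)
 define f where "f = (\<lambda>n z. \<phi> (z + of_int n) - c n * e n z)"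
 define H where "H = (\<lambda>z. \<Sum>\<^sub>\<infinity>n. f n z)"
 define HN where "HN = (\<lambda>N z. \<Sum>n\<in>{-int N..int N}. f n z)"
 have filt: "filterlim (\<lambda>N. {-int N..int N}) (finite_subsets_at_top UNIV) sequentially"
  unfolding filterlim_finite_subsets_at_top
 proof (intro allI impI)
  fix X :: "int set" assume X: "finite X \<and> X \<subseteq> UNIV"
  obtain M where M: "\<And>x. x \<in> X \<Longrightarrow> \<bar>x\<bar> \<le> M"
  proof (rule that[of "\<Sum>x\<in>X. \<bar>x\<bar>"])
   show "\<bar>x\<bar> \<le> (\<Sum>x\<in>X. \<bar>x\<bar>)" if "x \<in> X" for x
    using X that by (intro member_le_sum) auto
  qed
  show "\<forall>\<^sub>F N in sequentially. finite {-int N..int N} \<and> X \<subseteq> {-int N..int N} \<and> {-int N..int N} \<subseteq> UNIV"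
   using eventually_ge_at_top[of "nat M"] by eventually_elim (use M in \<open>force simp: abs_le_iff nat_le_iff\<close>)
 qed
 have unif: "uniform_limit (cball 0 R) HN H sequentially" for R
 proof -
  obtain K1 where K1: "\<And>w n. norm w \<le> R \<Longrightarrow> norm (\<phi> (w + of_int n)) \<le> K1 * exp (- \<bar>real_of_int n\<bar>)"
   using \<phi>_bd[of R] by blast
  obtain K2 where K2: "\<And>w n. norm w \<le> R \<Longrightarrow> norm (c n * e n w) \<le> K2 * exp (- \<bar>real_of_int n\<bar>)"
   using ce_bd[of R] by blast
  have "norm (f n z) \<le> (K1 + K2) * exp (- \<bar>real_of_int n\<bar>)" if "z \<in> cball 0 R" for n z
   unfolding f_def using K1[of z n] K2[of z n] that
   by (intro order_trans[OF norm_triangle_ineq4]) (auto simp: distrib_right)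
  hence "uniform_limit (cball 0 R) (\<lambda>X z. \<Sum>n\<in>X. f n z) (\<lambda>z. \<Sum>\<^sub>\<infinity>n. f n z) (finite_subsets_at_top UNIV)"
   by (intro Weierstrass_m_test_general[where M = "\<lambda>n. (K1 + K2) * exp (- \<bar>real_of_int n\<bar>)"]
      summable_on_cmult_right summable_on_exp_int) auto
  thus ?thesis unfolding HN_def H_def uniform_limit_iff
   using filt unfolding filterlim_iff by blast
 qed
 have fhol: "f n holomorphic_on UNIV" for n
  unfolding f_def e_def
  by (intro holomorphic_intros holomorphic_on_compose_gen[OF _ \<phi>, unfolded o_def]) auto
 have Hhol: "H holomorphic_on UNIV"
 proof (rule holomorphic_uniform_sequence[OF open_UNIV, of HN])
  show "HN n holomorphic_on UNIV" for n unfolding HN_def by (intro holomorphic_intros fhol)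
  fix x :: complex
  have "cball x 1 \<subseteq> cball 0 (norm x + 1)"
  proof
   fix y assume "y \<in> cball x 1"
   hence "norm (y - x) \<le> 1" by (simp add: dist_norm norm_minus_commute)
   thus "y \<in> cball 0 (norm x + 1)" using norm_triangle_sub[of y x] by simp
  qed
  hence "uniform_limit (cball x 1) HN H sequentially" by (rule uniform_limit_on_subset[OF unif[of "norm x + 1"]])
  thus "\<exists>d>0. cball x d \<subseteq> UNIV \<and> uniform_limit (cball x d) HN H sequentially"
   by (intro exI[of _ 1]) auto
 qed
 have H_split: "H z = (\<Sum>\<^sub>\<infinity>n. \<phi> (z + of_int n)) - (\<Sum>\<^sub>\<infinity>n. c n * e n z)" for z
 proof -
  have "((\<lambda>n. - (c n * e n z)) has_sum - (\<Sum>\<^sub>\<infinity>n. c n * e n z)) UNIV"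
   unfolding has_sum_uminus minus_minus by (rule has_sum_infsum[OF s2])
  from has_sum_add[OF has_sum_infsum[OF s1[of z]] this] show ?thesis
   unfolding H_def f_def diff_conv_add_uminus by (rule infsumI)
 qed
 have H_per: "H (z + 1) = H z" for z
 proof -
  have b: "bij_betw (\<lambda>n::int. n + 1) UNIV UNIV" by (rule bij_betwI[of _ _ _ "\<lambda>n. n - 1"]) auto
  have "(\<Sum>\<^sub>\<infinity>n. \<phi> (z + 1 + of_int n)) = (\<Sum>\<^sub>\<infinity>n::int. \<phi> (z + of_int (n + 1)))" by (simp add: add_ac)
  also have "\<dots> = (\<Sum>\<^sub>\<infinity>n::int. \<phi> (z + of_int n))" by (rule infsum_reindex_bij_betw[OF b, of "\<lambda>n. \<phi> (z + of_int n)"])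
  finally have 1: "(\<Sum>\<^sub>\<infinity>n. \<phi> (z + 1 + of_int n)) = (\<Sum>\<^sub>\<infinity>n::int. \<phi> (z + of_int n))" .
  have "e n (z + 1) = e n z" for n
  proof -
   have "exp (2 * of_real pi * \<i> * of_int n) = (1 :: complex)"
    using exp_integer_2pi[of "of_int n"] by (simp add: mult_ac)
   thus ?thesis by (simp add: e_def distrib_left exp_add)
  qed
  thus ?thesis unfolding H_split 1 by simp
 qed
 define g where "g = (\<lambda>t::real. H (of_real t))"
 have fcont: "continuous_on A (\<lambda>t. f n (of_real t))" for n A
  by (rule continuous_on_compose2[OF holomorphic_on_imp_continuous_on[OF fhol]]) (auto intro!: continuous_intros)
 have \<phi>cont: "continuous_on A (\<lambda>t. \<phi> (of_real t))" for A
  by (rule continuous_on_compose2[OF holomorphic_on_imp_continuous_on[OF \<phi>]]) (auto intro!: continuous_intros)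
 have "g 0 = 0"
 proof (rule fourier_uniqueness_at_0)
  show "continuous_on {0..1} g" unfolding g_def
   by (rule continuous_on_compose2[OF holomorphic_on_imp_continuous_on[OF Hhol]]) (auto intro!: continuous_intros)
  show "g 1 = g 0" using H_per[of 0] by (simp add: g_def)
  have d0: "(H has_field_derivative deriv H 0) (at 0)" by (rule holomorphic_derivI[OF Hhol]) auto
  have "(H has_field_derivative deriv H 0) (at 1)"
  proof -
   have "((\<lambda>z. H (z + (-1))) has_field_derivative deriv H 0) (at 1)"
    using d0 by (subst DERIV_shift[symmetric]) simp
   moreover have "(\<lambda>z. H (z + (-1))) = H" using H_per[of "_ - 1"] by (intro ext) simp
   ultimately show ?thesis by simp
  qed
  thus "(g has_vector_derivative deriv H 0) (at 1 within {0..1})"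
   unfolding g_def by (intro has_vector_derivative_real_field) simp
  show "(g has_vector_derivative deriv H 0) (at 0 within {0..1})"
   unfolding g_def by (intro has_vector_derivative_real_field) (use d0 in simp)
 next
  fix k :: int
  define E where "E = (\<lambda>t::real. exp (- 2 * of_real pi * \<i> * of_int k * of_real t) :: complex)"
  have Econt: "continuous_on A E" for A unfolding E_def by (intro continuous_intros)
  have Eper: "E (t + of_int n) = E t" for t and n :: int
  proof -
   have "exp (2 * of_real pi * \<i> * of_int (- k * n)) = (1 :: complex)"
    using exp_integer_2pi[of "of_int (- k * n)"] by (simp add: mult_ac)
   moreover have "- 2 * of_real pi * \<i> * of_int k * of_real (t + of_int n) = - 2 * of_real pi * \<i> * of_int k * of_real t + 2 * of_real pi * \<i> * of_int (- k * n)"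
    by (simp add: algebra_simps)
   ultimately show ?thesis by (simp only: E_def exp_add mult_1_right)
  qed
  define J where "J = (\<lambda>N. integral {0..1} (\<lambda>t. HN N (of_real t) * E t))"
  have "uniform_limit (cbox 0 1) (\<lambda>N t. HN N (of_real t) * E t) (\<lambda>t. g t * E t) sequentially"
  proof (rule uniform_lim_mult)
   show "uniform_limit (cbox 0 1) (\<lambda>N t. HN N (of_real t)) g sequentially"
    unfolding uniform_limit_iff
   proof (intro allI impI)
    fix eps :: real assume "eps > 0"
    with unif[of 1] have "\<forall>\<^sub>F N in sequentially. \<forall>z\<in>cball 0 1. dist (HN N z) (H z) < eps"
     unfolding uniform_limit_iff by blast
    thus "\<forall>\<^sub>F N in sequentially. \<forall>t\<in>cbox 0 1. dist (HN N (of_real t)) (g t) < eps"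
     by eventually_elim (auto simp: g_def)
   qed
   show "bounded (g ` cbox 0 1)" unfolding g_def
    by (intro compact_imp_bounded compact_continuous_image continuous_on_compose2[OF holomorphic_on_imp_continuous_on[OF Hhol]])
      (auto intro!: continuous_intros)
   show "bounded (E ` cbox 0 1)" by (intro compact_imp_bounded compact_continuous_image Econt) auto
  qed (rule uniform_limit_const)
  moreover have "continuous_on (cbox 0 1) (\<lambda>t. HN N (of_real t) * E t)" for N
   unfolding HN_def by (intro continuous_intros fcont Econt)
  ultimately obtain I J' where IJ: "\<And>N. ((\<lambda>t. HN N (of_real t) * E t) has_integral I N) (cbox 0 1)"
    "((\<lambda>t. g t * E t) has_integral J') (cbox 0 1)" "I \<longlonglongrightarrow> J'"
   by (rule uniform_limit_integral_cbox) auto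
  have "I = J"
  proof
   fix N show "I N = J N" unfolding J_def using integral_unique[OF IJ(1)[of N]] by simp
  qed
  have J': "J' = fcoef g k" using IJ(2) by (simp add: fcoef_def E_def integral_unique)
  have int_e: "integral {0..1} (\<lambda>t. e n (of_real t) * E t) = (if n = k then 1 else 0)" for n
  proof -
   have "e n (of_real t) * E t = exp (2 * of_real pi * \<i> * of_int (n - k) * of_real t)" for t
    by (simp add: e_def E_def exp_add[symmetric] algebra_simps)
   thus ?thesis using exp_integral_01[of "n - k"] by simp
  qed
  have J_eq: "J N = integral {- real N..real N + 1} (\<lambda>t. \<phi> (of_real t) * E t) - c k" if N: "int N \<ge> \<bar>k\<bar>" for N
  proof -
   have "J N = integral {0..1} (\<lambda>t. \<Sum>n\<in>{-int N..int N}. (\<phi> (of_real (t + of_int n)) * E (t + of_int n) - c n * (e n (of_real t) * E t)))"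
    unfolding J_def HN_def f_def Eper
   proof (rule integral_cong)
    fix t
    show "(\<Sum>n\<in>{-int N..int N}. \<phi> (of_real t + of_int n) - c n * e n (of_real t)) * E t =
       (\<Sum>n\<in>{-int N..int N}. \<phi> (of_real (t + of_int n)) * E t - c n * (e n (of_real t) * E t))"
     unfolding sum_distrib_right by (intro sum.cong refl) (simp add: left_diff_distrib mult.assoc)
   qed
   also have "\<dots> = (\<Sum>n\<in>{-int N..int N}. integral {0..1} (\<lambda>t. \<phi> (of_real (t + of_int n)) * E (t + of_int n) - c n * (e n (of_real t) * E t)))"
    unfolding Eper e_def
    by (intro integral_sum integrable_continuous_real continuous_intros Econt
       continuous_on_compose2[OF \<phi>cont[of UNIV]]) auto
   also have "\<dots> = (\<Sum>n\<in>{-int N..int N}. integral {0..1} (\<lambda>t. \<phi> (of_real (t + of_int n)) * E (t + of_int n)) - c n * (if n = k then 1 else 0))"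
   proof (rule sum.cong[OF refl])
    fix n
    show "integral {0..1} (\<lambda>t. \<phi> (of_real (t + of_int n)) * E (t + of_int n) - c n * (e n (of_real t) * E t)) =
       integral {0..1} (\<lambda>t. \<phi> (of_real (t + of_int n)) * E (t + of_int n)) - c n * (if n = k then 1 else 0)"
     unfolding int_e[symmetric] integral_mult_right[symmetric] Eper e_def
     by (intro integral_diff integrable_continuous_real continuous_intros Econt continuous_on_compose2[OF \<phi>cont[of UNIV]]) auto
   qed
   also have "\<dots> = integral {- real N..real N + 1} (\<lambda>t. \<phi> (of_real t) * E t) - (\<Sum>n\<in>{-int N..int N}. c n * (if n = k then 1 else 0))"
    unfolding sum_subtractf
    by (subst integral_unit_intervals[of "\<lambda>t. \<phi> (of_real t) * E t", symmetric]) (intro continuous_intros \<phi>cont Econt refl)+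
   also have "(\<Sum>n\<in>{-int N..int N}. c n * (if n = k then 1 else 0)) = c k"
    using N by (simp add: if_distrib[of "\<lambda>x. _ * x"] abs_le_iff cong: if_cong)
   finally show ?thesis .
  qed
  have "integrable lborel (\<lambda>t. \<phi> (of_real t) * E t)"
  proof (rule Bochner_Integration.integrable_bound[OF ft_int])
   show "(\<lambda>t. \<phi> (of_real t) * E t) \<in> borel_measurable lborel"
    using borel_measurable_continuous_onI[of "\<lambda>t. \<phi> (of_real t) * E t"] continuous_on_mult[OF \<phi>cont Econt] by simp
   have "norm (E t) = 1" for t by (simp add: E_def)
   thus "AE t in lborel. norm (\<phi> (of_real t) * E t) \<le> norm (\<phi> (of_real t))" by (simp add: norm_mult)
  qed
  from integral_expanding_intervals[OF this]
  have "(\<lambda>N. integral {- real N..real N + 1} (\<lambda>t. \<phi> (of_real t) * E t) - c k) \<longlonglongrightarrow> c k - c k"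
   using ft[of k] by (intro tendsto_intros) (simp add: E_def)
  hence "J \<longlonglongrightarrow> c k - c k"
  proof (rule Lim_transform_eventually)
   show "\<forall>\<^sub>F N in sequentially. integral {- real N..real N + 1} (\<lambda>t. \<phi> (of_real t) * E t) - c k = J N"
    using eventually_ge_at_top[of "nat \<bar>k\<bar>"] by eventually_elim (rule J_eq[symmetric], simp)
  qed
  thus "fcoef g k = 0" using IJ(3) J' \<open>I = J\<close> LIMSEQ_unique by auto
 qed
 thus "(\<Sum>\<^sub>\<infinity>n. \<phi> (of_int n)) = (\<Sum>\<^sub>\<infinity>n. c n)"
  using H_split[of 0] by (simp add: g_def e_def)
qed

section \<open>Theta series and the functional equation\<close>

text \<open>The power \<open>w ^ a\<close> gives the weight the parity of the character, so that
  opposite integers do not cancel in the theta series.\<close>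

definition gw :: "nat \<Rightarrow> real \<Rightarrow> complex \<Rightarrow> complex" where
 "gw a X w = w ^ a * exp (- of_real (pi * X) * w\<^sup>2)"

lemma gw_holomorphic [holomorphic_intros]: "g holomorphic_on S \<Longrightarrow> (\<lambda>z. gw a X (g z)) holomorphic_on S"
 unfolding gw_def by (intro holomorphic_intros)

text \<open>Completing the square replaces the quadratic exponent by a linear one of slope 2; one
  half pays for the polynomial factor, the other remains as
  \<open>exp (- \<bar>n\<bar>)\<close>.\<close>

lemma gw_bound:
 assumes X: "X > 0" and a: "a \<le> 1" and r: "norm \<zeta> \<le> R"
 shows "norm (gw a X (\<zeta> + of_int n)) \<le> (R + 1) * exp (pi * X * (R\<^sup>2 + 2 * R / (pi * X) + 1 / (pi * X)\<^sup>2)) * exp (- \<bar>real_of_int n\<bar>)"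
proof -
 define c where "c = pi * X"
 have c: "c > 0" using X by (simp add: c_def)
 have R0: "R \<ge> 0" using r norm_ge_zero order_trans by blast
 define N where "N = \<bar>real_of_int n\<bar>"
 have n1: "norm (\<zeta> + of_int n) \<le> R + N" using norm_triangle_ineq[of \<zeta> "of_int n"] r by (simp add: N_def)
 have "norm ((\<zeta> + of_int n) ^ a) \<le> 1 + norm (\<zeta> + of_int n)"
  using a by (cases a) (auto simp: norm_power)
 also have "\<dots> \<le> (R + 1) * exp N"
 proof -
  have "1 + N \<le> exp N" using exp_ge_add_one_self[of N] by simp
  hence "(R + 1) * (1 + N) \<le> (R + 1) * exp N" using R0 by (intro mult_left_mono) auto
  moreover have "1 + (R + N) \<le> (R + 1) * (1 + N)" using R0 by (simp add: algebra_simps N_def)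
  ultimately show ?thesis using n1 by linarith
 qed
 finally have p: "norm ((\<zeta> + of_int n) ^ a) \<le> (R + 1) * exp N" .
 have re: "Re ((\<zeta> + of_int n)\<^sup>2) = (Re \<zeta> + of_int n)\<^sup>2 - (Im \<zeta>)\<^sup>2" by (simp add: power2_eq_square)
 have im: "(Im \<zeta>)\<^sup>2 \<le> R\<^sup>2" using abs_Im_le_cmod[of \<zeta>] r by (metis abs_ge_zero order_trans power2_abs power_mono)
 have "N - R \<le> \<bar>Re \<zeta> + of_int n\<bar>" using abs_Re_le_cmod[of \<zeta>] r by (simp add: N_def)
 moreover have "(Re \<zeta> + of_int n)\<^sup>2 \<ge> 2 / c * \<bar>Re \<zeta> + of_int n\<bar> - 1 / c\<^sup>2"
  using zero_le_power2[of "\<bar>Re \<zeta> + of_int n\<bar> - 1 / c"] by (simp add: power2_diff power_divide)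
 moreover have "2 / c * (N - R) \<le> 2 / c * \<bar>Re \<zeta> + of_int n\<bar>" if "N - R \<le> \<bar>Re \<zeta> + of_int n\<bar>"
  using that c by (intro mult_left_mono) auto
 ultimately have "Re ((\<zeta> + of_int n)\<^sup>2) \<ge> 2 / c * (N - R) - 1 / c\<^sup>2 - R\<^sup>2" unfolding re using im by linarith
 hence "c * Re ((\<zeta> + of_int n)\<^sup>2) \<ge> c * (2 / c * (N - R) - 1 / c\<^sup>2 - R\<^sup>2)" using c by (intro mult_left_mono) auto
 also have "c * (2 / c * (N - R) - 1 / c\<^sup>2 - R\<^sup>2) = 2 * N - c * (R\<^sup>2 + 2 * R / c + 1 / c\<^sup>2)"
  using c by (simp add: field_simps power2_eq_square)
 finally have "- (c * Re ((\<zeta> + of_int n)\<^sup>2)) \<le> c * (R\<^sup>2 + 2 * R / c + 1 / c\<^sup>2) - 2 * N" by linarith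
 hence e: "norm (exp (- of_real c * (\<zeta> + of_int n)\<^sup>2)) \<le> exp (c * (R\<^sup>2 + 2 * R / c + 1 / c\<^sup>2) - 2 * N)"
  by simp
 have "norm (gw a X (\<zeta> + of_int n)) \<le> ((R + 1) * exp N) * exp (c * (R\<^sup>2 + 2 * R / c + 1 / c\<^sup>2) - 2 * N)"
  unfolding gw_def norm_mult c_def[symmetric] using R0 by (intro mult_mono p e) auto
 also have "\<dots> = (R + 1) * exp (c * (R\<^sup>2 + 2 * R / c + 1 / c\<^sup>2)) * exp (- N)"
 proof -
  have "exp N * exp (c * (R\<^sup>2 + 2 * R / c + 1 / c\<^sup>2) - 2 * N) = exp (c * (R\<^sup>2 + 2 * R / c + 1 / c\<^sup>2)) * exp (- N)"
   by (simp only: exp_add[symmetric]) simp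
  thus ?thesis by (simp only: mult.assoc)
 qed
 finally show ?thesis by (simp only: c_def N_def)
qed

lemma gw_dual_bound:
 assumes X: "X > 0" and a: "a \<le> 1"
 obtains K where "\<And>n::int. norm (of_int n ^ a * exp (- of_real (pi / X) * (of_int n)\<^sup>2) :: complex) * exp (2 * pi * R * \<bar>real_of_int n\<bar>) \<le> K * exp (- \<bar>real_of_int n\<bar>)"
proof -
 \<comment> \<open>The centre of the completed square: its linear coefficient
   \<open>2 * b * pi / X = 2 * (pi * \<bar>R\<bar> + 1)\<close> absorbs
   \<open>exp (2 * pi * R * \<bar>n\<bar>)\<close> and the polynomial factor and still leaves
   \<open>exp (- \<bar>n\<bar>)\<close>.\<close>
 define b where "b = X * (pi * \<bar>R\<bar> + 1) / pi"
 define K where "K = exp (pi / X * b\<^sup>2)"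
 have "norm (of_int n ^ a * exp (- of_real (pi / X) * (of_int n)\<^sup>2) :: complex) * exp (2 * pi * R * \<bar>real_of_int n\<bar>) \<le> K * exp (- \<bar>real_of_int n\<bar>)" for n :: int
 proof -
  define N where "N = \<bar>real_of_int n\<bar>"
  have N0: "N \<ge> 0" by (simp add: N_def)
  have "norm (of_int n ^ a :: complex) \<le> 1 + N" using a by (cases a) (auto simp: norm_power N_def)
  also have "\<dots> \<le> exp N" by (rule exp_ge_add_one_self)
  finally have p: "norm (of_int n ^ a :: complex) \<le> exp N" .
  have nn: "(of_int n :: complex)\<^sup>2 = of_real (N\<^sup>2)" by (simp add: N_def)
  have "norm (exp (- of_real (pi / X) * (of_int n)\<^sup>2) :: complex) = exp (- (pi / X) * N\<^sup>2)"
   unfolding nn norm_exp_eq_Re by simp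
  moreover have "norm (of_int n ^ a * exp (- of_real (pi / X) * (of_int n)\<^sup>2) :: complex) * exp (2 * pi * R * N) \<le> exp N * exp (- (pi / X) * N\<^sup>2) * exp (2 * pi * R * N)"
   unfolding norm_mult using p calculation by (intro mult_right_mono mult_mono) auto
  moreover have "exp N * exp (- (pi / X) * N\<^sup>2) * exp (2 * pi * R * N) \<le> K * exp (- N)"
  proof -
   have "N\<^sup>2 \<ge> 2 * b * N - b\<^sup>2" using zero_le_power2[of "N - b"] by (simp add: power2_diff mult_ac)
   hence "pi / X * N\<^sup>2 \<ge> pi / X * (2 * b * N - b\<^sup>2)" using X by (intro mult_left_mono) auto
   also have "pi / X * (2 * b * N - b\<^sup>2) = 2 * (pi * \<bar>R\<bar> + 1) * N - pi / X * b\<^sup>2"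
    using X by (simp add: b_def right_diff_distrib)
   finally have 1: "- (pi / X * N\<^sup>2) \<le> pi / X * b\<^sup>2 - 2 * (pi * \<bar>R\<bar> + 1) * N" by linarith
   have "(2 * pi * N) * R \<le> (2 * pi * N) * \<bar>R\<bar>" using N0 by (intro mult_left_mono) auto
   hence "N + - (pi / X * N\<^sup>2) + 2 * pi * R * N \<le> pi / X * b\<^sup>2 + (- N)" using 1 by (simp add: algebra_simps)
   hence "exp (N + - (pi / X * N\<^sup>2) + 2 * pi * R * N) \<le> exp (pi / X * b\<^sup>2 + (- N))" by (simp only: exp_le_cancel_iff)
   thus ?thesis by (simp only: exp_add K_def mult_minus_left)
  qed
  ultimately show ?thesis unfolding N_def by linarith
 qed
 thus ?thesis by (rule that)
qed

lemma gauss_integrable: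
 assumes c: "c > (0::real)"
 shows "integrable lborel (\<lambda>t::real. exp (- c * t\<^sup>2))"
proof -
 define s where "s = sqrt (2 * c)"
 have s: "s > 0" "s\<^sup>2 = 2 * c" using c by (auto simp: s_def)
 have "integrable lborel std_normal_density" by simp
 from lborel_integrable_real_affine[OF this, of s 0] s have "integrable lborel (\<lambda>t. std_normal_density (s * t))" by simp
 hence "integrable lborel (\<lambda>t. sqrt (2 * pi) * std_normal_density (s * t))" by (rule integrable_mult_right)
 thus ?thesis using s(2) by (simp add: std_normal_density_def power_mult_distrib)
qed

lemma gauss_fourier_scaled:
 assumes X: "X > 0"
 shows "(LBINT t. exp (- of_real (pi * X) * (of_real t)\<^sup>2) * exp (- 2 * of_real pi * \<i> * of_int n * of_real t)) =
   of_real (X powr (-1/2)) * exp (- of_real (pi / X) * (of_int n)\<^sup>2)"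
proof -
 define s where "s = sqrt (2 * pi * X)"
 have s: "s > 0" "s\<^sup>2 = 2 * pi * X" using X by (auto simp: s_def)
 let ?f = "\<lambda>t. exp (- of_real (pi * X) * (of_real t)\<^sup>2) * exp (- 2 * of_real pi * \<i> * of_int n * of_real t) :: complex"
 have "(LBINT t. ?f t) = (1 / s) *\<^sub>R (LBINT y. ?f (0 + 1 / s * y))"
  using lborel_integral_real_affine[of "1 / s" ?f 0] s by simp
 also have "(LBINT y. ?f (0 + 1 / s * y)) = (LBINT y. of_real (sqrt (2 * pi)) * (of_real (std_normal_density y) * exp (\<i> * of_real ((- 2 * pi * of_int n / s) * y))))"
 proof (intro Bochner_Integration.integral_cong refl)
  fix y
  have "(pi * X) * (1 / s * y)\<^sup>2 = y\<^sup>2 / 2" using X by (simp add: power_mult_distrib power_divide s(2))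
  hence "complex_of_real (- ((pi * X) * (1 / s * y)\<^sup>2)) = of_real (- y\<^sup>2 / 2)" by (simp only: minus_divide_left)
  moreover have "complex_of_real (- ((pi * X) * (1 / s * y)\<^sup>2)) = - of_real (pi * X) * (of_real (0 + 1 / s * y))\<^sup>2" by simp
  ultimately have eq1: "- of_real (pi * X) * (of_real (0 + 1 / s * y))\<^sup>2 = (of_real (- y\<^sup>2 / 2) :: complex)" by (simp only:)
  have "sqrt (2 * pi) * std_normal_density y = exp (- y\<^sup>2 / 2)" by (simp add: std_normal_density_def)
  hence eq2: "of_real (sqrt (2 * pi)) * of_real (std_normal_density y) = (exp (of_real (- y\<^sup>2 / 2)) :: complex)"
   by (metis exp_of_real of_real_mult)
  show "?f (0 + 1 / s * y) = of_real (sqrt (2 * pi)) * (of_real (std_normal_density y) * exp (\<i> * of_real ((- 2 * pi * of_int n / s) * y)))"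
   unfolding eq1 eq2[symmetric] by (simp add: mult_ac)
 qed
 also have "\<dots> = of_real (sqrt (2 * pi)) * of_real (exp (- (- 2 * pi * of_int n / s)\<^sup>2 / 2))"
  by (subst integral_mult_right_zero) (simp only: gaussian_fourier)
 also have "- (- 2 * pi * of_int n / s)\<^sup>2 / 2 = - (pi / X) * (of_int n)\<^sup>2"
  using X by (simp add: power_divide power_mult_distrib s(2)) (simp add: power2_eq_square)
 also have "(1 / s) *\<^sub>R (of_real (sqrt (2 * pi)) * of_real (exp (- (pi / X) * (of_int n)\<^sup>2)) :: complex) = of_real (sqrt (2 * pi) / s) * of_real (exp (- (pi / X) * (of_int n)\<^sup>2))"
  by (simp add: scaleR_conv_of_real)
 also have "sqrt (2 * pi) / s = X powr (-1/2)"
 proof -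
  have "X powr (- (1/2)) = 1 / sqrt X" using X by (simp only: powr_minus_divide powr_half_sqrt less_imp_le)
  moreover have "s = sqrt (2 * pi) * sqrt X" by (simp only: s_def real_sqrt_mult)
  moreover have "sqrt (2 * pi) \<noteq> 0" by simp
  ultimately show ?thesis by simp
 qed
 finally show ?thesis by (simp add: exp_of_real[symmetric])
qed

lemma gauss_linear_integrable:
 assumes c: "c > (0::real)"
 shows "integrable lborel (\<lambda>t::real. t * exp (- c * t\<^sup>2))"
proof (rule Bochner_Integration.integrable_bound)
 show "integrable lborel (\<lambda>t::real. (1 + 2 / c) * exp (- (c / 2) * t\<^sup>2))"
  using gauss_integrable[of "c / 2"] c by (intro integrable_mult_right) auto
 show "AE t in lborel. norm (t * exp (- c * t\<^sup>2)) \<le> norm ((1 + 2 / c) * exp (- (c / 2) * t\<^sup>2))"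
 proof (rule AE_I2)
  fix t :: real
  have "\<bar>t\<bar> \<le> 1 + t\<^sup>2" using zero_le_power2[of "\<bar>t\<bar> - 1"] by (simp add: power2_diff)
  also have "\<dots> \<le> (1 + 2 / c) * exp (c / 2 * t\<^sup>2)"
  proof -
   have "1 + c / 2 * t\<^sup>2 \<le> exp (c / 2 * t\<^sup>2)" by (rule exp_ge_add_one_self)
   hence "(1 + 2 / c) * (1 + c / 2 * t\<^sup>2) \<le> (1 + 2 / c) * exp (c / 2 * t\<^sup>2)" using c by (intro mult_left_mono) auto
   moreover have "(1 + 2 / c) * (1 + c / 2 * t\<^sup>2) = 1 + 2 / c + c / 2 * t\<^sup>2 + t\<^sup>2" using c by (simp add: field_simps)
   moreover have "2 / c > 0" "c / 2 * t\<^sup>2 \<ge> 0" using c by auto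
   ultimately show ?thesis by linarith
  qed
  finally have "\<bar>t\<bar> * exp (- c * t\<^sup>2) \<le> (1 + 2 / c) * exp (c / 2 * t\<^sup>2) * exp (- c * t\<^sup>2)" by (intro mult_right_mono) auto
  also have "\<dots> = (1 + 2 / c) * exp (- (c / 2) * t\<^sup>2)"
   unfolding mult.assoc exp_add[symmetric] by (simp add: algebra_simps)
  finally show "norm (t * exp (- c * t\<^sup>2)) \<le> norm ((1 + 2 / c) * exp (- (c / 2) * t\<^sup>2))"
   using c by (simp add: abs_mult)
 qed
qed simp

lemma gw_integrable:
 assumes X: "X > 0" and a: "a \<le> 1"
 shows "integrable lborel (\<lambda>t. gw a X (of_real t))"
proof -
 have c: "pi * X > 0" using X by simp
 have "integrable lborel (\<lambda>t. t ^ a * exp (- (pi * X) * t\<^sup>2))"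
  using gauss_integrable[OF c] gauss_linear_integrable[OF c] a by (cases a) auto
 hence "integrable lborel (\<lambda>t. complex_of_real (t ^ a * exp (- (pi * X) * t\<^sup>2)))" by (rule integrable_of_real)
 thus ?thesis by (simp add: gw_def exp_of_real[symmetric])
qed

text \<open>For \<open>a = 1\<close> the derivative of the Gaussian times the exponential is
  integrated over the line: the total is 0, which expresses the moment \<open>I1\<close> through
  \<open>I0\<close>.\<close>

lemma gw_fourier:
 assumes X: "X > 0" and a: "a \<le> 1"
 shows "(LBINT t. gw a X (of_real t) * exp (- 2 * of_real pi * \<i> * of_int n * of_real t)) =
   (-\<i>) ^ a * of_real (X powr (- 1/2 - real a)) * (of_int n ^ a * exp (- of_real (pi / X) * (of_int n)\<^sup>2))"
proof (cases "a = 0")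
 case True
 thus ?thesis using gauss_fourier_scaled[OF X, of n] by (simp add: gw_def)
next
 case False
 hence a1: "a = 1" using a by simp
 define H where "H = (\<lambda>t::real. exp (- of_real (pi * X) * (of_real t)\<^sup>2) * exp (- 2 * of_real pi * \<i> * of_int n * of_real t) :: complex)"
 define I0 where "I0 = (LBINT t. H t)"
 define I1 where "I1 = (LBINT t. of_real t * H t)"
 have nH: "norm (H t) = exp (- (pi * X) * t\<^sup>2)" for t
  by (simp add: H_def norm_mult flip: of_real_power)
 have c: "pi * X > 0" using X by simp
 have Hm [measurable]: "H \<in> borel_measurable borel" unfolding H_def by (intro borel_measurable_continuous_onI continuous_intros)
 have i0: "integrable lborel H"
  by (rule Bochner_Integration.integrable_bound[OF gauss_integrable[OF c]]) (auto simp: nH)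
 have i1: "integrable lborel (\<lambda>t. of_real t * H t)"
  by (rule Bochner_Integration.integrable_bound[OF gauss_linear_integrable[OF c]]) (auto simp: nH norm_mult)
 define H' where "H' = (\<lambda>t. - 2 * of_real (pi * X) * (of_real t * H t) - 2 * of_real pi * \<i> * of_int n * H t)"
 have iH': "integrable lborel H'" unfolding H'_def
  by (intro Bochner_Integration.integrable_diff integrable_mult_right i0 i1)
 have dH: "(H has_vector_derivative H' t) (at t)" for t
 proof -
  have "((\<lambda>z. exp (- of_real (pi * X) * z\<^sup>2) * exp (- 2 * of_real pi * \<i> * of_int n * z)) has_field_derivative H' t) (at (of_real t))"
   unfolding H'_def H_def by (auto intro!: derivative_eq_intros simp: algebra_simps)
  thus ?thesis unfolding H_def by (rule has_vector_derivative_real_field)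
 qed
 have "((\<lambda>t. exp (- b * t\<^sup>2)) \<longlongrightarrow> 0) at_top" "((\<lambda>t. exp (- b * t\<^sup>2)) \<longlongrightarrow> 0) at_bot" if "b > 0" for b :: real
 proof -
  have top: "((\<lambda>t. exp (- b * t\<^sup>2)) \<longlongrightarrow> 0) at_top"
  proof (rule filterlim_compose[OF exp_at_bot])
   have "filterlim (\<lambda>t::real. b * t\<^sup>2) at_top at_top"
    by (intro filterlim_tendsto_pos_mult_at_top[OF tendsto_const that] filterlim_pow_at_top filterlim_ident) auto
   thus "filterlim (\<lambda>t::real. - b * t\<^sup>2) at_bot at_top" by (simp add: filterlim_uminus_at_bot)
  qed
  show "((\<lambda>t. exp (- b * t\<^sup>2)) \<longlongrightarrow> 0) at_top" by (rule top)
  show "((\<lambda>t. exp (- b * t\<^sup>2)) \<longlongrightarrow> 0) at_bot"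
   unfolding filterlim_at_bot_mirror using top by simp
 qed
 note lim0 = this[OF c]
 have lims: "(H \<longlongrightarrow> 0) at_top" "(H \<longlongrightarrow> 0) at_bot"
  by (rule tendsto_norm_zero_cancel, simp only: nH lim0)+
 have "(LBINT t=-\<infinity>..\<infinity>. H' t) = 0 - 0"
 proof (rule interval_integral_FTC_integrable)
  show "(H has_vector_derivative H' x) (at x)" for x by (rule dH)
  show "isCont H' x" for x
  proof -
   have "continuous_on UNIV H'" unfolding H'_def H_def by (intro continuous_intros)
   thus ?thesis by (simp add: continuous_on_eq_continuous_at)
  qed
  show "set_integrable lborel (einterval (-\<infinity>) \<infinity>) H'" using iH' by (simp add: set_integrable_def)
  show "((H \<circ> real_of_ereal) \<longlongrightarrow> 0) (at_right (-\<infinity>))" "((H \<circ> real_of_ereal) \<longlongrightarrow> 0) (at_left \<infinity>)"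
   by (simp_all only: ereal_tendsto_simps lims)
 qed auto
 hence "(LBINT t. H' t) = 0"
  by (simp add: interval_lebesgue_integral_def set_lebesgue_integral_def)
 moreover have "(LBINT t. H' t) = - 2 * of_real (pi * X) * I1 - 2 * of_real pi * \<i> * of_int n * I0"
  unfolding H'_def I1_def I0_def using i0 i1 by simp
 ultimately have "- 2 * of_real (pi * X) * I1 - 2 * of_real pi * \<i> * of_int n * I0 = 0" by (simp only:)
 hence "- 2 * of_real (pi * X) * I1 = 2 * of_real pi * \<i> * of_int n * I0" by (simp only: right_minus_eq)
 hence "- (- 2 * of_real (pi * X) * I1) = - (2 * of_real pi * \<i> * of_int n * I0)" by (simp only:)
 hence "of_real (2 * pi * X) * I1 = of_real (2 * pi) * (- \<i> * of_int n * I0)" by (simp add: mult_ac)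
 hence "of_real (2 * pi) * (of_real X * I1) = of_real (2 * pi) * (- \<i> * of_int n * I0)" by simp
 hence "of_real X * I1 = - \<i> * of_int n * I0" by (subst (asm) mult_cancel_left) simp
 hence I1: "I1 = - \<i> * of_int n * I0 / of_real X" using X by (simp add: field_simps)
 have I0: "I0 = of_real (X powr (-1/2)) * exp (- of_real (pi / X) * (of_int n)\<^sup>2)"
  unfolding I0_def H_def by (rule gauss_fourier_scaled[OF X])
 have pw: "X powr (- 1/2 - 1) = X powr (-1/2) / X" using X by (simp only: powr_diff powr_one)
 have "(LBINT t. gw a X (of_real t) * exp (- 2 * of_real pi * \<i> * of_int n * of_real t)) = I1"
  unfolding I1_def H_def by (simp add: a1 gw_def mult.assoc)
 also have "\<dots> = - \<i> * of_real (X powr (- 1/2 - 1)) * (of_int n * exp (- of_real (pi / X) * (of_int n)\<^sup>2))"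
  unfolding I1 I0 pw by simp
 finally show ?thesis by (simp add: a1)
qed

text \<open>The shift \<open>z\<close> serves residue classes: after scaling,
  \<open>b + q * m\<close> becomes \<open>m + b / q\<close>.\<close>

lemma gw_poisson_shift:
 fixes z :: real
 assumes X: "X > 0" and a: "a \<le> 1"
 shows "(\<lambda>n. gw a X (of_int n + of_real z)) summable_on UNIV"
  "(\<lambda>n. exp (2 * of_real pi * \<i> * of_int n * of_real z) * (of_int n ^ a * exp (- of_real (pi / X) * (of_int n)\<^sup>2))) summable_on UNIV"
  "(\<Sum>\<^sub>\<infinity>n. gw a X (of_int n + of_real z)) = (-\<i>) ^ a * of_real (X powr (- 1/2 - real a)) *
    (\<Sum>\<^sub>\<infinity>n. exp (2 * of_real pi * \<i> * of_int n * of_real z) * (of_int n ^ a * exp (- of_real (pi / X) * (of_int n)\<^sup>2)))"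
proof -
 define C where "C = (-\<i>) ^ a * complex_of_real (X powr (- 1/2 - real a))"
 have C0: "C \<noteq> 0" using X by (simp add: C_def)
 define d where "d = (\<lambda>n::int. of_int n ^ a * exp (- of_real (pi / X) * (of_int n)\<^sup>2) :: complex)"
 define e where "e = (\<lambda>n::int. exp (2 * of_real pi * \<i> * of_int n * of_real z) :: complex)"
 have ne: "norm (e n) = 1" for n by (simp add: e_def)
 define \<phi> where "\<phi> = (\<lambda>w. gw a X (w + of_real z))"
 define c where "c = (\<lambda>n. C * (e n * d n))"
 have 1: "\<phi> holomorphic_on UNIV" unfolding \<phi>_def by (intro holomorphic_intros)
 have 2: "\<exists>K. \<forall>w n. norm w \<le> R \<longrightarrow> norm (\<phi> (w + of_int n)) \<le> K * exp (- \<bar>real_of_int n\<bar>)" for R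
 proof -
  have "norm (\<phi> (w + of_int n)) \<le> (R + \<bar>z\<bar> + 1) * exp (pi * X * ((R + \<bar>z\<bar>)\<^sup>2 + 2 * (R + \<bar>z\<bar>) / (pi * X) + 1 / (pi * X)\<^sup>2)) * exp (- \<bar>real_of_int n\<bar>)"
   if "norm w \<le> R" for w n
  proof -
   have "norm (w + of_real z) \<le> R + \<bar>z\<bar>" using that norm_triangle_ineq[of w "of_real z"] by simp
   from gw_bound[OF X a this, of n] show ?thesis by (simp add: \<phi>_def add_ac)
  qed
  thus ?thesis by blast
 qed
 have 3: "\<exists>K. \<forall>n. norm (c n) * exp (2 * pi * R * \<bar>real_of_int n\<bar>) \<le> K * exp (- \<bar>real_of_int n\<bar>)" for R
 proof -
  obtain K where K: "\<And>n::int. norm (d n) * exp (2 * pi * R * \<bar>real_of_int n\<bar>) \<le> K * exp (- \<bar>real_of_int n\<bar>)"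
   unfolding d_def by (rule gw_dual_bound[OF X a, of R]) blast
  have "norm (c n) * exp (2 * pi * R * \<bar>real_of_int n\<bar>) \<le> (norm C * K) * exp (- \<bar>real_of_int n\<bar>)" for n
   using mult_left_mono[OF K[of n], of "norm C"] by (simp add: c_def norm_mult ne mult_ac)
  thus ?thesis by blast
 qed
 have 4: "integrable lborel (\<lambda>t. \<phi> (of_real t))"
  using lborel_integrable_real_affine[OF gw_integrable[OF X a], of 1 z] by (simp add: \<phi>_def add_ac)
 have 5: "(LBINT t. \<phi> (of_real t) * exp (- 2 * of_real pi * \<i> * of_int n * of_real t)) = c n" for n
 proof -
  let ?E = "\<lambda>t. exp (- 2 * of_real pi * \<i> * of_int n * of_real t) :: complex"
  have "(LBINT t. \<phi> (of_real t) * ?E t) = (LBINT t. \<phi> (of_real (- z + 1 * t)) * ?E (- z + 1 * t))"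
   using lborel_integral_real_affine[of 1 "\<lambda>t. \<phi> (of_real t) * ?E t" "- z"] by simp
  also have "\<dots> = (LBINT t. e n * (gw a X (of_real t) * ?E t))"
  proof (intro Bochner_Integration.integral_cong refl)
   fix t
   have "?E (- z + 1 * t) = e n * ?E t" by (simp add: e_def exp_add[symmetric] algebra_simps)
   thus "\<phi> (of_real (- z + 1 * t)) * ?E (- z + 1 * t) = e n * (gw a X (of_real t) * ?E t)"
    by (simp add: \<phi>_def mult_ac)
  qed
  also have "\<dots> = e n * (C * d n)"
   by (subst integral_mult_right_zero) (simp only: gw_fourier[OF X a] C_def d_def)
  finally show ?thesis by (simp add: c_def mult_ac)
 qed
 note P = Poisson_summation_entire[OF 1 2 3 4 5]
 show "(\<lambda>n. gw a X (of_int n + of_real z)) summable_on UNIV" using P(1) by (simp add: \<phi>_def)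
 have s: "(\<lambda>n. e n * d n) summable_on UNIV" using P(2) C0 unfolding c_def by (subst (asm) summable_on_cmult_right') auto
 thus "(\<lambda>n. exp (2 * of_real pi * \<i> * of_int n * of_real z) * (of_int n ^ a * exp (- of_real (pi / X) * (of_int n)\<^sup>2))) summable_on UNIV"
  by (simp add: e_def d_def)
 show "(\<Sum>\<^sub>\<infinity>n. gw a X (of_int n + of_real z)) = (-\<i>) ^ a * of_real (X powr (- 1/2 - real a)) *
    (\<Sum>\<^sub>\<infinity>n. exp (2 * of_real pi * \<i> * of_int n * of_real z) * (of_int n ^ a * exp (- of_real (pi / X) * (of_int n)\<^sup>2)))"
  using P(3) unfolding c_def \<phi>_def infsum_cmult_right' by (simp only: C_def e_def d_def)
qed

lemma has_sum_sum_finite: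
 fixes f :: "'b \<Rightarrow> 'a \<Rightarrow> 'c::topological_comm_monoid_add"
 assumes "finite B" "\<And>b. b \<in> B \<Longrightarrow> (f b has_sum s b) A"
 shows "((\<lambda>x. \<Sum>b\<in>B. f b x) has_sum (\<Sum>b\<in>B. s b)) A"
 using assms by (induction B rule: finite_induct) (auto intro: has_sum_add)

lemma infsum_int_residues:
 fixes f :: "int \<Rightarrow> complex"
 assumes q: "q > (0::nat)" and f: "f summable_on UNIV"
 shows "(\<Sum>\<^sub>\<infinity>n. f n) = (\<Sum>b\<in>{0..<int q}. \<Sum>\<^sub>\<infinity>m. f (b + int q * m))"
proof -
 define g where "g = (\<lambda>(b, m). b + int q * m)"
 have bij: "bij_betw g ({0..<int q} \<times> UNIV) UNIV"
 proof (rule bij_betwI[where g = "\<lambda>n. (n mod int q, n div int q)"])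
  show "(\<lambda>n. (n mod int q, n div int q)) \<in> UNIV \<rightarrow> {0..<int q} \<times> UNIV" using q by simp
  show "g (y mod int q, y div int q) = y" for y by (simp add: g_def)
  fix x assume "x \<in> {0..<int q} \<times> (UNIV :: int set)"
  then obtain b m where x: "x = (b, m)" "0 \<le> b" "b < int q" by auto
  hence "g x mod int q = b" "g x div int q = m" using q by (simp_all add: g_def)
  thus "(g x mod int q, g x div int q) = x" using x by simp
 qed auto
 have s: "(\<lambda>x. f (g x)) summable_on ({0..<int q} \<times> UNIV)"
  using f by (subst summable_on_reindex_bij_betw[OF bij])
 have "(\<Sum>\<^sub>\<infinity>n. f n) = (\<Sum>\<^sub>\<infinity>x\<in>{0..<int q} \<times> UNIV. f (g x))"
  by (rule infsum_reindex_bij_betw[OF bij, symmetric])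
 also have "\<dots> = (\<Sum>\<^sub>\<infinity>b\<in>{0..<int q}. \<Sum>\<^sub>\<infinity>m. f (g (b, m)))"
  by (rule infsum_Sigma_banach[OF s, symmetric])
 also have "\<dots> = (\<Sum>b\<in>{0..<int q}. \<Sum>\<^sub>\<infinity>m. f (b + int q * m))"
  by (simp add: g_def)
 finally show ?thesis .
qed

text \<open>The sum runs over all integers, which is twice the usual series over the positive ones
  when \<open>a\<close> is the parity of \<open>chi\<close>. Scaling by \<open>q\<close> makes the
  functional equation take \<open>x\<close> to \<open>1 / x\<close>.\<close>

definition theta_chi :: "nat \<Rightarrow> nat \<Rightarrow> (int \<Rightarrow> complex) \<Rightarrow> real \<Rightarrow> complex" where
 "theta_chi a q chi x = (\<Sum>\<^sub>\<infinity>n. chi n * gw a (x / real q) (of_int n))"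

context
 fixes q a :: nat and chi :: "int \<Rightarrow> complex"
 assumes q: "prime q" and chi: "chi \<in> nontrivial_characters q" and a: "a \<le> 1"
begin

lemma theta_summable:
 assumes x: "x > 0"
 shows "(\<lambda>n. chi n * gw a (x / real q) (of_int n)) summable_on UNIV"
proof -
 have X: "x / real q > 0" using x prime_gt_0_nat[OF q] by simp
 define K where "K = exp (pi * (x / real q) * (1 / (pi * (x / real q))\<^sup>2))"
 have b: "norm (gw a (x / real q) (of_int n)) \<le> K * exp (- \<bar>real_of_int n\<bar>)" for n
  using gw_bound[OF X a, of 0 0 n] by (simp add: K_def)
 have bd: "norm (chi n * gw a (x / real q) (of_int n)) \<le> K * exp (- \<bar>real_of_int n\<bar>)" for n
  unfolding norm_mult using norm_dchar_le[OF q nontriv_dchar[OF q chi], of n] b[of n]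
  by (meson mult_left_le_one_le norm_ge_zero order_trans)
 show ?thesis
  by (rule abs_summable_summable, rule summable_on_comparison_test[OF summable_on_cmult_right[OF summable_on_exp_int, of K]])
    (use bd in auto)
qed

text \<open>Poisson summation on each residue class modulo \<open>q\<close>; summing the resulting
  exponentials against \<open>chi b\<close> gives Gauss sums, which \<open>gauss_sum_eq\<close>
  turns into values of the conjugate character.\<close>

lemma theta_functional_equation:
 assumes x: "x > 0"
 shows "theta_chi a q chi x = (-\<i>) ^ a * gauss_sum q chi 1 / of_real (sqrt (real q)) * of_real (x powr (- 1/2 - real a)) *
      theta_chi a q (\<lambda>n. cnj (chi n)) (1 / x)"
proof -
 have q0: "q > 0" using prime_gt_0_nat[OF q] .
 define X where "X = x * real q"
 have X: "X > 0" using x q0 by (simp add: X_def)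
 define C where "C = (-\<i>) ^ a * complex_of_real (X powr (- 1/2 - real a))"
 define d where "d = (\<lambda>k::int. of_int k ^ a * exp (- of_real (pi / X) * (of_int k)\<^sup>2) :: complex)"
 define e where "e = (\<lambda>k b::int. exp (2 * of_real pi * \<i> * of_int (k * b) / of_nat q) :: complex)"
 have scale: "gw a (x / real q) (of_int (b + int q * m)) = of_nat q ^ a * gw a X (of_int m + of_real (real_of_int b / real q))" for b m
 proof -
  have 1: "(of_int (b + int q * m) :: complex) = of_nat q * (of_int m + of_real (real_of_int b / real q))"
   using q0 by (simp add: field_simps)
  have 2: "complex_of_real (pi * (x / real q)) * (of_nat q * w)\<^sup>2 = of_real (pi * X) * w\<^sup>2" for w
   using q0 by (simp add: X_def power2_eq_square)
  show ?thesis unfolding gw_def 1 mult_minus_left 2 by (simp add: power_mult_distrib mult.assoc)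
 qed
 have dual: "exp (2 * of_real pi * \<i> * of_int k * of_real (real_of_int b / real q)) = e k b" for k b
  by (simp add: e_def mult.assoc)
 have P: "(\<Sum>\<^sub>\<infinity>m. gw a X (of_int m + of_real (real_of_int b / real q))) = C * (\<Sum>\<^sub>\<infinity>k. e k b * d k)"
   "(\<lambda>k. e k b * d k) summable_on UNIV" for b
  using gw_poisson_shift(2,3)[OF X a, of "real_of_int b / real q"] unfolding dual C_def d_def by simp_all
 have "theta_chi a q chi x = (\<Sum>b\<in>{0..<int q}. \<Sum>\<^sub>\<infinity>m. chi (b + int q * m) * gw a (x / real q) (of_int (b + int q * m)))"
  unfolding theta_chi_def by (rule infsum_int_residues[OF q0 theta_summable[OF x]])
 also have "\<dots> = (\<Sum>b\<in>{0..<int q}. chi b * of_nat q ^ a * (C * (\<Sum>\<^sub>\<infinity>k. e k b * d k)))"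
 proof (rule sum.cong[OF refl])
  fix b
  have "(\<Sum>\<^sub>\<infinity>m. chi (b + int q * m) * gw a (x / real q) (of_int (b + int q * m))) =
     (\<Sum>\<^sub>\<infinity>m. (chi b * of_nat q ^ a) * gw a X (of_int m + of_real (real_of_int b / real q)))"
   unfolding scale dchar_periodic[OF q nontriv_dchar[OF q chi]] by (simp only: mult.assoc)
  thus "(\<Sum>\<^sub>\<infinity>m. chi (b + int q * m) * gw a (x / real q) (of_int (b + int q * m))) = chi b * of_nat q ^ a * (C * (\<Sum>\<^sub>\<infinity>k. e k b * d k))"
   unfolding infsum_cmult_right' P(1) .
 qed
 also have "\<dots> = of_nat q ^ a * C * (\<Sum>b\<in>{0..<int q}. \<Sum>\<^sub>\<infinity>k. chi b * (e k b * d k))"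
  unfolding infsum_cmult_right' by (simp add: sum_distrib_left mult_ac)
 also have "(\<Sum>b\<in>{0..<int q}. \<Sum>\<^sub>\<infinity>k. chi b * (e k b * d k)) = (\<Sum>\<^sub>\<infinity>k. \<Sum>b\<in>{0..<int q}. chi b * (e k b * d k))"
  by (intro infsumI[symmetric] has_sum_sum_finite has_sum_infsum summable_on_cmult_right P(2)) auto
 also have "\<dots> = (\<Sum>\<^sub>\<infinity>k. gauss_sum q chi 1 * (cnj (chi k) * gw a (1 / x / real q) (of_int k)))"
 proof (rule infsum_cong)
  fix k
  have s1: "(\<Sum>b\<in>{0..<int q}. chi b * (e k b * d k)) = gauss_sum q chi k * d k"
   unfolding gauss_sum_def e_def by (simp add: sum_distrib_right mult.assoc)
  have s2: "d k = gw a (1 / x / real q) (of_int k)"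
   unfolding d_def gw_def X_def by (simp add: divide_divide_eq_left mult.commute)
  show "(\<Sum>b\<in>{0..<int q}. chi b * (e k b * d k)) = gauss_sum q chi 1 * (cnj (chi k) * gw a (1 / x / real q) (of_int k))"
   unfolding s1 unfolding s2 gauss_sum_eq[OF q chi, of k] by (simp only: mult_ac)
 qed
 also have "\<dots> = gauss_sum q chi 1 * theta_chi a q (\<lambda>n. cnj (chi n)) (1 / x)"
  unfolding infsum_cmult_right' theta_chi_def ..
 finally have main: "theta_chi a q chi x = of_nat q ^ a * C * (gauss_sum q chi 1 * theta_chi a q (\<lambda>n. cnj (chi n)) (1 / x))" .
 have "real q ^ a * X powr (- 1/2 - real a) = x powr (- 1/2 - real a) / sqrt (real q)"
 proof -
  have "real q ^ a = real q powr real a" using powr_realpow[of "real q" a] q0 by simp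
  hence "real q ^ a * X powr (- 1/2 - real a) = x powr (- 1/2 - real a) * (real q powr real a * real q powr (- 1/2 - real a))"
   using x q0 by (simp add: X_def powr_mult)
  also have "real q powr real a * real q powr (- 1/2 - real a) = real q powr (real a + (- 1/2 - real a))"
   by (rule powr_add[symmetric])
  also have "real a + (- 1/2 - real a) = - (1/2)" by simp
  also have "real q powr (- (1/2)) = 1 / sqrt (real q)"
   by (simp only: powr_minus_divide powr_half_sqrt of_nat_0_le_iff)
  finally show ?thesis by simp
 qed
 hence "complex_of_real (real q ^ a * X powr (- 1/2 - real a)) = of_real (x powr (- 1/2 - real a) / sqrt (real q))" by (simp only:)
 hence "of_nat q ^ a * complex_of_real (X powr (- 1/2 - real a)) = of_real (x powr (- 1/2 - real a)) / of_real (sqrt (real q))"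
  by (simp only: of_real_divide of_real_mult of_real_of_nat_eq of_real_power)
 hence "of_nat q ^ a * C = (-\<i>) ^ a * (of_real (x powr (- 1/2 - real a)) / of_real (sqrt (real q)))"
  unfolding C_def by (simp only: mult.left_commute)
 thus ?thesis unfolding main by (simp add: mult_ac)
qed

end

section \<open>The completed L-function and its growth\<close>

lemma integrable_exp_minus_abs: "integrable lborel (\<lambda>u::real. exp (- \<bar>u\<bar>))"
proof (rule Bochner_Integration.integrable_bound)
 show "integrable lborel (\<lambda>u::real. 2 * (1 / (1 + (0 - u)\<^sup>2)))"
  by (intro integrable_mult_right integrable_inverse_1_plus_square_shift)
 show "AE u in lborel. norm (exp (- \<bar>u\<bar>)) \<le> norm (2 * (1 / (1 + (0 - u)\<^sup>2)) :: real)"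
 proof (rule AE_I2)
  fix u :: real
  have "1 + \<bar>u\<bar> + \<bar>u\<bar>\<^sup>2 / 2 \<le> exp \<bar>u\<bar>" by (rule exp_lower_Taylor_quadratic) simp
  hence "1 + u\<^sup>2 \<le> 2 * exp \<bar>u\<bar>" by simp
  hence "(1 + u\<^sup>2) * exp (- \<bar>u\<bar>) \<le> 2 * exp \<bar>u\<bar> * exp (- \<bar>u\<bar>)" by (intro mult_right_mono) auto
  also have "\<dots> = 2" by (simp add: exp_minus)
  finally have "exp (- \<bar>u\<bar>) \<le> 2 / (1 + u\<^sup>2)" by (simp add: pos_le_divide_eq add_pos_nonneg mult.commute)
  thus "norm (exp (- \<bar>u\<bar>)) \<le> norm (2 * (1 / (1 + (0 - u)\<^sup>2)))" by simp
 qed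
qed simp

text \<open>The tangent line bound \<open>1 + z \<le> exp z\<close>, taken at the maximum of
  \<open>(r + 1) * y - c * exp y\<close>; the surplus \<open>- y\<close> keeps the resulting
  majorant integrable.\<close>

lemma double_exp_bound:
 fixes c r y :: real
 assumes c: "c > 0" and r: "r \<ge> 0"
 shows "r * y - c * exp y \<le> (r + 1) * (ln ((r + 1) / c) - 1) - y"
proof -
 define z where "z = y - ln ((r + 1) / c)"
 have "c * exp y = (r + 1) * exp z" using c r by (simp add: z_def exp_diff)
 moreover have "(r + 1) * (1 + z) \<le> (r + 1) * exp z" using r by (intro mult_left_mono exp_ge_add_one_self) auto
 ultimately show ?thesis by (simp add: z_def algebra_simps)
qed

text \<open>Euler's integral after \<open>t = exp u\<close>. On the full line the functional
  equation becomes the reflection of \<open>u\<close>.\<close>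

lemma Gamma_integral_exp:
 assumes z: "Re z > 0"
 shows "integrable lborel (\<lambda>u. exp (of_real u * z) * exp (- of_real (exp u)))"
  "(LBINT u. exp (of_real u * z) * exp (- of_real (exp u))) = Gamma z"
proof -
 let ?f = "\<lambda>t. complex_of_real t powr (z - 1) / of_real (exp t)"
 let ?g = "\<lambda>u. exp (of_real u * z) * exp (- of_real (exp u)) :: complex"
 have im: "exp ` (UNIV :: real set) = {0<..}"
 proof
  show "{0<..} \<subseteq> exp ` (UNIV :: real set)"
  proof
   fix x :: real assume "x \<in> {0<..}"
   hence "x = exp (ln x)" by simp
   thus "x \<in> exp ` UNIV" by blast
  qed
 qed auto
 have eq: "\<bar>exp u\<bar> *\<^sub>R ?f (exp u) = ?g u" for u :: real
 proof -
  have "complex_of_real (exp u) powr (z - 1) = exp (of_real u * (z - 1))"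
   by (simp add: powr_def exp_of_real[symmetric] mult.commute Ln_of_real del: of_real_exp)
  thus ?thesis by (simp add: scaleR_conv_of_real exp_minus divide_inverse exp_of_real[symmetric] algebra_simps exp_diff)
 qed
 have "?f absolutely_integrable_on {0<..} \<and> integral {0<..} ?f = Gamma z"
  using absolutely_integrable_Gamma_integral'[OF z] Gamma_integral_complex'[OF z] by (auto intro: integral_unique)
 hence "(\<lambda>u. \<bar>exp u\<bar> *\<^sub>R ?f (exp u)) absolutely_integrable_on UNIV \<and> integral UNIV (\<lambda>u. \<bar>exp u\<bar> *\<^sub>R ?f (exp u)) = Gamma z"
  by (subst has_absolute_integral_change_of_variables_real[where g = exp and h = exp and S = UNIV])
    (auto simp: im intro!: derivative_eq_intros inj_onI)
 hence 1: "?g absolutely_integrable_on UNIV" "integral UNIV ?g = Gamma z" unfolding eq by auto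
 have m: "?g \<in> borel_measurable borel" by (intro borel_measurable_continuous_onI continuous_intros)
 have "integrable lebesgue ?g" using 1(1) by (simp add: set_integrable_def)
 thus i: "integrable lborel ?g" by (subst (asm) integrable_completion) (use m in auto)
 have "set_lebesgue_integral lborel UNIV ?g = integral UNIV ?g"
  by (rule set_borel_integral_eq_integral(2)) (use i in \<open>simp add: set_integrable_def\<close>)
 thus "(LBINT u. ?g u) = Gamma z" using 1(2) by (simp add: set_lebesgue_integral_def)
qed

lemma Gamma_integral_exp_scaled:
 assumes z: "Re z > 0" and c: "c > 0"
 shows "integrable lborel (\<lambda>u. exp (of_real u * z) * exp (- of_real (c * exp u)))"
  "(LBINT u. exp (of_real u * z) * exp (- of_real (c * exp u))) = exp (- of_real (ln c) * z) * Gamma z"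
proof -
 let ?g = "\<lambda>u. exp (of_real u * z) * exp (- of_real (exp u)) :: complex"
 have eq: "exp (of_real u * z) * exp (- of_real (c * exp u)) = exp (- of_real (ln c) * z) * ?g (ln c + 1 * u)" for u
 proof -
  have "exp (of_real (ln c + 1 * u) * z) = exp (of_real (ln c) * z) * exp (of_real u * z)"
   by (simp add: distrib_right exp_add)
  moreover have "exp (ln c + 1 * u) = c * exp u" using c by (simp add: exp_add)
  moreover have "exp (- of_real (ln c) * z) * exp (of_real (ln c) * z) = 1" by (simp add: exp_add[symmetric])
  ultimately show ?thesis by (simp add: mult.assoc[symmetric])
 qed
 show "integrable lborel (\<lambda>u. exp (of_real u * z) * exp (- of_real (c * exp u)))"
  unfolding eq by (intro integrable_mult_right lborel_integrable_real_affine Gamma_integral_exp z) auto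
 show "(LBINT u. exp (of_real u * z) * exp (- of_real (c * exp u))) = exp (- of_real (ln c) * z) * Gamma z"
  unfolding eq integral_mult_right_zero
  using lborel_integral_real_affine[of 1 ?g "ln c"] Gamma_integral_exp(2)[OF z] by simp
qed

locale parity_character =
 fixes q a :: nat and chi :: "int \<Rightarrow> complex"
 assumes q: "prime q" and chi: "chi \<in> nontrivial_characters q" and a: "a \<le> 1"
  and parity: "chi (- 1) = (- 1) ^ a"
begin

lemma q0: "q > 0" using prime_gt_0_nat[OF q] .

lemma parity_character_cnj: "parity_character q a (\<lambda>n. cnj (chi n))"
 by unfold_locales (use q a nontriv_cnj[OF q chi] parity in auto)

definition tterm :: "nat \<Rightarrow> real \<Rightarrow> complex" where
 "tterm n x = chi (int (Suc n)) * gw a (x / real q) (of_nat (Suc n))"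

lemma tterm_summable_bound:
 assumes x: "x > 0"
 obtains K where "\<And>n. norm (tterm n x) \<le> K * exp (- 1) ^ n"
proof -
 have X: "x / real q > 0" using x q0 by simp
 define K where "K = exp (pi * (x / real q) * (1 / (pi * (x / real q))\<^sup>2))"
 have "norm (tterm n x) \<le> K * exp (- 1) ^ n" for n
 proof -
  have "norm (tterm n x) \<le> 1 * norm (gw a (x / real q) (0 + of_int (int (Suc n))))"
   unfolding tterm_def norm_mult using norm_dchar_le[OF q nontriv_dchar[OF q chi]] by (intro mult_mono) auto
  also have "\<dots> \<le> K * exp (- \<bar>real_of_int (int (Suc n))\<bar>)"
   using gw_bound[OF X a, of 0 0 "int (Suc n)"] by (simp add: K_def)
  also have "\<dots> \<le> K * exp (- real n)" by (intro mult_left_mono) (auto simp: K_def)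
  also have "exp (- real n) = exp (- 1) ^ n" by (simp add: exp_of_nat_mult[symmetric])
  finally show ?thesis .
 qed
 thus ?thesis by (rule that)
qed

lemma tterm_norm_summable: "x > 0 \<Longrightarrow> summable (\<lambda>n. norm (tterm n x))"
proof -
 assume "x > 0"
 then obtain K where K: "\<And>n. norm (tterm n x) \<le> K * exp (- 1) ^ n" by (rule tterm_summable_bound) blast
 show ?thesis
  by (rule summable_comparison_test'[where N = 0 and g = "\<lambda>n. K * exp (- 1) ^ n"])
    (use K in \<open>auto intro!: summable_mult summable_geometric\<close>)
qed

text \<open>Character and weight both change by \<open>(- 1) ^ a\<close> under negation of
  \<open>n\<close>, so negative and positive indices contribute equally, and the term at 0
  vanishes.\<close>

lemma theta_half_sums:
 assumes x: "x > 0"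
 shows "(\<lambda>n. tterm n x) sums (theta_chi a q chi x / 2)"
proof -
 define f where "f = (\<lambda>n. chi n * gw a (x / real q) (of_int n))"
 have fs: "f summable_on UNIV" unfolding f_def by (rule theta_summable[OF q chi a x])
 have f0: "f 0 = 0"
  using dchar_eq_0_iff[OF q nontriv_dchar[OF q chi], of 0] prime_gt_1_nat[OF q] by (simp add: f_def)
 have f_even: "f (- n) = f n" for n
 proof -
  have "chi (- n) = (- 1) ^ a * chi n" using dchar_minus[OF q nontriv_dchar[OF q chi], of n] parity by simp
  moreover have "gw a (x / real q) (of_int (- n)) = (- 1) ^ a * gw a (x / real q) (of_int n)"
   by (simp add: gw_def power_minus[of "of_int n"])
  moreover have "(- 1) ^ a * (- 1) ^ a = (1 :: complex)" by (simp add: power_add[symmetric] flip: mult_2)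
  ultimately show ?thesis by (simp add: f_def mult_ac)
 qed
 define P where "P = range (\<lambda>n. int (Suc n))"
 define M where "M = range (\<lambda>n. - int (Suc n))"
 have t: "f (int (Suc n)) = tterm n x" for n by (simp add: f_def tterm_def)
 have sP: "(\<lambda>n. tterm n x) summable_on UNIV"
 proof -
  have "f summable_on P" by (rule summable_on_subset_banach[OF fs]) simp
  hence "(f \<circ> (\<lambda>n. int (Suc n))) summable_on UNIV"
   unfolding P_def by (subst (asm) summable_on_reindex) (auto simp: inj_on_def)
  thus ?thesis unfolding o_def t .
 qed
 have S: "((\<lambda>n. tterm n x) has_sum (\<Sum>\<^sub>\<infinity>n. tterm n x)) UNIV" by (rule has_sum_infsum[OF sP])
 have hP: "(f has_sum (\<Sum>\<^sub>\<infinity>n. tterm n x)) P"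
  unfolding P_def
 proof (subst has_sum_reindex)
  show "(f \<circ> (\<lambda>n. int (Suc n)) has_sum (\<Sum>\<^sub>\<infinity>n. tterm n x)) UNIV" using S unfolding o_def t .
 qed (auto simp: inj_on_def)
 have hM: "(f has_sum (\<Sum>\<^sub>\<infinity>n. tterm n x)) M"
  unfolding M_def
 proof (subst has_sum_reindex)
  have "(f \<circ> (\<lambda>n. - int (Suc n))) = (\<lambda>n. tterm n x)" unfolding o_def f_even t ..
  thus "(f \<circ> (\<lambda>n. - int (Suc n)) has_sum (\<Sum>\<^sub>\<infinity>n. tterm n x)) UNIV" using S by (simp only:)
 qed (auto simp: inj_on_def)
 have h0: "(f has_sum 0) {0}" using has_sum_finite[of "{0}" f] f0 by simp
 have hPM: "(f has_sum ((\<Sum>\<^sub>\<infinity>n. tterm n x) + (\<Sum>\<^sub>\<infinity>n. tterm n x))) (P \<union> M)"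
  by (rule has_sum_Un_disjoint[OF hP hM]) (auto simp: P_def M_def)
 have disj: "(P \<union> M) \<inter> {0} = {}" unfolding P_def M_def by auto
 have h: "(f has_sum ((\<Sum>\<^sub>\<infinity>n. tterm n x) + (\<Sum>\<^sub>\<infinity>n. tterm n x) + 0)) (P \<union> M \<union> {0})"
  by (rule has_sum_Un_disjoint[OF hPM h0 disj])
 have U: "P \<union> M \<union> {0} = UNIV"
 proof -
  have "k \<in> P \<union> M \<union> {0}" for k
  proof (cases k rule: int_cases3)
   case zero
   thus ?thesis by blast
  next
   case (pos n)
   then obtain m where "k = int (Suc m)" by (cases n) auto
   thus ?thesis unfolding P_def by blast
  next
   case (neg n)
   then obtain m where "k = - int (Suc m)" by (cases n) auto
   thus ?thesis unfolding M_def by blast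
  qed
  thus ?thesis by blast
 qed
 have "theta_chi a q chi x = infsum f UNIV" unfolding theta_chi_def f_def ..
 also have "\<dots> = (\<Sum>\<^sub>\<infinity>n. tterm n x) + (\<Sum>\<^sub>\<infinity>n. tterm n x) + 0" using infsumI[OF h] unfolding U .
 finally have "theta_chi a q chi x = 2 * (\<Sum>\<^sub>\<infinity>n. tterm n x)" by simp
 thus ?thesis using has_sum_imp_sums[OF S] by simp
qed

text \<open>The root number of the functional equation.\<close>

definition wconst :: complex where
 "wconst = (-\<i>) ^ a * gauss_sum q chi 1 / of_real (sqrt (real q))"

text \<open>The theta function in the variable \<open>u = ln x\<close>. The exponential weight is
  chosen so that the factor \<open>x powr (- 1/2 - a)\<close> of the functional equation disappears
  in \<open>Kfun_reflect\<close>.\<close>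

definition Kfun :: "real \<Rightarrow> complex" where
 "Kfun u = of_real (exp (u * (real a / 2 + 1 / 4))) * (theta_chi a q chi (exp u) / 2)"

text \<open>The completed L-function, which for \<open>Re s > 1\<close> is
  \<open>(q / pi) powr ((s + a) / 2) * Gamma ((s + a) / 2)\<close> times the L-series. The integral
  converges for every \<open>s\<close>, because the kernel decays doubly exponentially at both
  ends.\<close>

definition xi :: "complex \<Rightarrow> complex" where
 "xi s = (LBINT u. exp (of_real u * (s - 1 / 2) / 2) * Kfun u)"

lemma Kfun_reflect: "Kfun (- u) = wconst * parity_character.Kfun q a (\<lambda>n. cnj (chi n)) u"
proof -
 interpret c: parity_character q a "\<lambda>n. cnj (chi n)" by (rule parity_character_cnj)
 have e: "exp (- u) powr (- 1/2 - real a) = exp (u * (1/2 + real a))"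
  by (simp add: powr_def algebra_simps)
 have "exp (- u * (real a / 2 + 1 / 4)) * exp (u * (1/2 + real a)) = exp (u * (real a / 2 + 1 / 4))"
  by (simp add: exp_add[symmetric] algebra_simps)
 hence "complex_of_real (exp (- u * (real a / 2 + 1 / 4))) * of_real (exp (u * (1/2 + real a))) = of_real (exp (u * (real a / 2 + 1 / 4)))"
  by (simp only: of_real_mult[symmetric])
 moreover have "theta_chi a q chi (exp (- u)) = wconst * of_real (exp (u * (1/2 + real a))) * theta_chi a q (\<lambda>n. cnj (chi n)) (exp u)"
  using theta_functional_equation[OF q chi a, of "exp (- u)"] unfolding e wconst_def by (simp add: exp_minus inverse_eq_divide)
 ultimately show ?thesis unfolding Kfun_def c.Kfun_def by (simp add: mult_ac)
qed

lemma Kfun_bound_pos: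
 obtains C c where "c > 0" "C \<ge> 0" "\<And>u. u \<ge> 0 \<Longrightarrow> norm (Kfun u) \<le> C * exp (- c * exp u)"
proof -
 \<comment> \<open>By \<open>m\<^sup>2 * x \<ge> (m\<^sup>2 + x) / 2\<close> the exponent is shared:
   one half, through \<open>X\<close>, makes the series converge, the other, through
   \<open>c\<close>, gives the decay in \<open>x\<close>.\<close>
 define c where "c = pi / (2 * real q)"
 have c: "c > 0" using q0 by (simp add: c_def)
 define X where "X = 1 / (2 * real q)"
 have X: "X > 0" using q0 by (simp add: X_def)
 define g where "g = (\<lambda>n. norm (gw a X (of_nat (Suc n))))"
 define K where "K = exp (pi * X * (1 / (pi * X)\<^sup>2))"
 have gs: "summable g"
 proof (rule summable_comparison_test'[where N = 0 and g = "\<lambda>n. K * exp (- 1) ^ n"])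
  fix n
  have "norm (gw a X (0 + of_int (int (Suc n)))) \<le> K * exp (- \<bar>real_of_int (int (Suc n))\<bar>)"
   using gw_bound[OF X a, of 0 0 "int (Suc n)"] by (simp add: K_def)
  also have "\<dots> \<le> K * exp (- real n)" by (intro mult_left_mono) (auto simp: K_def)
  also have "exp (- real n) = exp (- 1) ^ n" by (simp add: exp_of_nat_mult[symmetric])
  finally show "norm (g n) \<le> K * exp (- 1) ^ n" by (simp add: g_def)
 qed (intro summable_mult summable_geometric, auto)
 define C1 where "C1 = suminf g"
 have C1: "C1 \<ge> 0" unfolding C1_def by (intro suminf_nonneg gs) (simp add: g_def)
 have tb: "norm (tterm n x) \<le> g n * exp (- c * x)" if x: "x \<ge> 1" for n x
 proof -
  define m where "m = real (Suc n)"
  have m: "m \<ge> 1" by (simp add: m_def)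
  have sq: "(of_nat (Suc n) :: complex)\<^sup>2 = of_real (m\<^sup>2)" by (simp add: m_def)
  have ng: "norm (gw a Y (of_nat (Suc n))) = m ^ a * exp (- (pi * Y) * m\<^sup>2)" for Y
   unfolding gw_def norm_mult norm_exp_eq_Re sq by (simp add: norm_power m_def del: of_nat_Suc)
  have "m\<^sup>2 \<ge> 1" using m by (simp add: one_le_power)
  hence "m\<^sup>2 \<le> m\<^sup>2 * x" "x \<le> m\<^sup>2 * x" using x by (auto simp: mult_le_cancel_left1 mult_le_cancel_right1)
  hence "m\<^sup>2 + x \<le> m\<^sup>2 * x + m\<^sup>2 * x" by (rule add_mono)
  hence "(m\<^sup>2 + x) / 2 \<le> m\<^sup>2 * x" by (simp add: mult_ac)
  hence "(pi / real q) * ((m\<^sup>2 + x) / 2) \<le> (pi / real q) * (m\<^sup>2 * x)" by (intro mult_left_mono) auto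
  hence "- (pi * (x / real q)) * m\<^sup>2 \<le> - (pi * X) * m\<^sup>2 + - c * x"
   by (simp add: X_def c_def add_divide_distrib distrib_left mult_ac)
  hence "exp (- (pi * (x / real q)) * m\<^sup>2) \<le> exp (- (pi * X) * m\<^sup>2) * exp (- c * x)"
   by (simp only: exp_add[symmetric] exp_le_cancel_iff)
  hence "m ^ a * exp (- (pi * (x / real q)) * m\<^sup>2) \<le> m ^ a * (exp (- (pi * X) * m\<^sup>2) * exp (- c * x))"
   using m by (intro mult_left_mono) auto
  moreover have "norm (tterm n x) \<le> 1 * norm (gw a (x / real q) (of_nat (Suc n)))"
   unfolding tterm_def norm_mult using norm_dchar_le[OF q nontriv_dchar[OF q chi]] by (intro mult_mono) auto
  ultimately show ?thesis unfolding g_def ng by (simp add: mult.assoc)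
 qed
 have thb: "norm (theta_chi a q chi x / 2) \<le> C1 * exp (- c * x)" if x: "x \<ge> 1" for x
 proof -
  have x0: "x > 0" using x by simp
  have "norm (theta_chi a q chi x / 2) = norm (\<Sum>n. tterm n x)" using sums_unique[OF theta_half_sums[OF x0]] by simp
  also have "\<dots> \<le> (\<Sum>n. norm (tterm n x))" by (rule summable_norm[OF tterm_norm_summable[OF x0]])
  also have "\<dots> \<le> (\<Sum>n. g n * exp (- c * x))"
   by (intro suminf_le tb x tterm_norm_summable x0 summable_mult2 gs)
  also have "\<dots> = C1 * exp (- c * x)" unfolding C1_def by (rule suminf_mult2[OF gs, symmetric])
  finally show ?thesis .
 qed
 show ?thesis
 proof (rule that[of "c / 2" "C1 * (2 / c)"])
  fix u :: real assume u: "u \<ge> 0"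
  have e: "exp (u * (real a / 2 + 1 / 4)) \<le> exp u"
  proof -
   have "u * (real a / 2 + 1 / 4) \<le> u * 1" using u a by (intro mult_left_mono) auto
   thus ?thesis by simp
  qed
  have "c / 2 * exp u \<le> exp (c / 2 * exp u)" using exp_ge_add_one_self[of "c / 2 * exp u"] by linarith
  hence e2: "exp u \<le> 2 / c * exp (c / 2 * exp u)" using c by (simp add: field_simps)
  have "norm (Kfun u) \<le> exp u * (C1 * exp (- c * exp u))"
   unfolding Kfun_def norm_mult using e thb[of "exp u"] u C1 by (intro mult_mono) auto
  also have "\<dots> \<le> (2 / c * exp (c / 2 * exp u)) * (C1 * exp (- c * exp u))"
   using e2 C1 by (intro mult_right_mono) auto
  also have "\<dots> = C1 * (2 / c) * (exp (c / 2 * exp u) * exp (- c * exp u))" by simp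
  also have "exp (c / 2 * exp u) * exp (- c * exp u) = exp (- (c / 2) * exp u)"
   by (simp only: exp_add[symmetric]) simp
  finally show "norm (Kfun u) \<le> C1 * (2 / c) * exp (- (c / 2) * exp u)" .
 qed (use c C1 in auto)
qed

lemma Kfun_bound:
 obtains C c where "c > 0" "C \<ge> 0" "\<And>u. norm (Kfun u) \<le> C * exp (- c * exp \<bar>u\<bar>)"
proof -
 interpret c: parity_character q a "\<lambda>n. cnj (chi n)" by (rule parity_character_cnj)
 obtain C1 c1 where 1: "c1 > 0" "C1 \<ge> 0" "\<And>u. u \<ge> 0 \<Longrightarrow> norm (Kfun u) \<le> C1 * exp (- c1 * exp u)"
  by (rule Kfun_bound_pos) blast
 obtain C2 c2 where 2: "c2 > 0" "C2 \<ge> 0" "\<And>u. u \<ge> 0 \<Longrightarrow> norm (c.Kfun u) \<le> C2 * exp (- c2 * exp u)"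
  by (rule c.Kfun_bound_pos) blast
 define c0 where "c0 = min c1 c2"
 define C where "C = C1 + norm wconst * C2"
 have "norm (Kfun u) \<le> C * exp (- c0 * exp \<bar>u\<bar>)" for u
 proof (cases "u \<ge> 0")
  case True
  have "norm (Kfun u) \<le> C1 * exp (- c1 * exp u)" by (rule 1(3)[OF True])
  also have "\<dots> \<le> C * exp (- c0 * exp \<bar>u\<bar>)" using 1 2 True by (intro mult_mono) (auto simp: C_def c0_def)
  finally show ?thesis .
 next
  case False
  have "norm (Kfun u) = norm wconst * norm (c.Kfun (- u))" using Kfun_reflect[of "- u"] by (simp add: norm_mult)
  also have "\<dots> \<le> norm wconst * (C2 * exp (- c2 * exp (- u)))" using 2(3)[of "- u"] False by (intro mult_left_mono) auto
  also have "\<dots> = (norm wconst * C2) * exp (- c2 * exp (- u))" by simp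
  also have "\<dots> \<le> C * exp (- c0 * exp \<bar>u\<bar>)" using 1 2 False by (intro mult_mono) (auto simp: C_def c0_def)
  finally show ?thesis .
 qed
 thus ?thesis using 1 2 by (intro that[of c0 C]) (auto simp: c0_def C_def)
qed

lemma Kfun_measurable [measurable]: "Kfun \<in> borel_measurable borel"
proof (rule borel_measurable_LIMSEQ_metric)
 let ?F = "\<lambda>i u. of_real (exp (u * (real a / 2 + 1 / 4))) * (\<Sum>n<i. tterm n (exp u))"
 show "?F i \<in> borel_measurable borel" for i
  unfolding tterm_def gw_def using q0 by (intro borel_measurable_continuous_onI continuous_intros) auto
 show "(\<lambda>i. ?F i u) \<longlonglongrightarrow> Kfun u" for u
  unfolding Kfun_def using theta_half_sums[of "exp u"] unfolding sums_def by (intro tendsto_intros) auto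
qed

lemma xi_integrand_bound:
 assumes K: "c > 0" "C \<ge> 0" "\<And>u. norm (Kfun u) \<le> C * exp (- c * exp \<bar>u\<bar>)" and r: "norm (s - 1 / 2) / 2 \<le> r"
 shows "norm (exp (of_real u * (s - 1 / 2) / 2) * Kfun u) \<le> C * exp ((r + 1) * (ln ((r + 1) / c) - 1)) * exp (- \<bar>u\<bar>)"
proof -
 have r0: "r \<ge> 0" using r norm_ge_zero[of "s - 1/2"] by linarith
 have "Re (of_real u * (s - 1 / 2) / 2) \<le> norm (of_real u * (s - 1 / 2) / 2)" by (rule complex_Re_le_cmod)
 also have "\<dots> = \<bar>u\<bar> * (norm (s - 1 / 2) / 2)" by (simp add: norm_mult)
 also have "\<dots> \<le> \<bar>u\<bar> * r" by (intro mult_left_mono r) auto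
 finally have "norm (exp (of_real u * (s - 1 / 2) / 2)) \<le> exp (r * \<bar>u\<bar>)" by (simp add: mult.commute)
 hence "norm (exp (of_real u * (s - 1 / 2) / 2) * Kfun u) \<le> exp (r * \<bar>u\<bar>) * (C * exp (- c * exp \<bar>u\<bar>))"
  unfolding norm_mult by (intro mult_mono K(3)) auto
 also have "\<dots> = C * exp (r * \<bar>u\<bar> - c * exp \<bar>u\<bar>)" by (simp add: exp_diff exp_minus divide_inverse)
 also have "\<dots> \<le> C * exp ((r + 1) * (ln ((r + 1) / c) - 1) - \<bar>u\<bar>)"
  using double_exp_bound[OF K(1) r0, of "\<bar>u\<bar>"] K(2) by (intro mult_left_mono) auto
 also have "\<dots> = C * exp ((r + 1) * (ln ((r + 1) / c) - 1)) * exp (- \<bar>u\<bar>)" by (simp add: exp_diff exp_minus divide_inverse)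
 finally show ?thesis .
qed

lemma xi_entire: "xi holomorphic_on UNIV"
proof -
 obtain C c where K: "c > 0" "C \<ge> 0" "\<And>u. norm (Kfun u) \<le> C * exp (- c * exp \<bar>u\<bar>)" by (rule Kfun_bound) blast
 have "(\<lambda>s. LBINT u. exp (of_real u * (s - 1 / 2) / 2) * Kfun u) holomorphic_on UNIV"
 proof (rule holomorphic_lebesgue_integral)
  fix w :: complex
  define r where "r = (norm (w - 1 / 2) + 1) / 2"
  let ?g = "\<lambda>u. C * exp ((r + 1) * (ln ((r + 1) / c) - 1)) * exp (- \<bar>u\<bar>)"
  have "norm (exp (of_real u * (s - 1 / 2) / 2) * Kfun u) \<le> ?g u" if "s \<in> cball w 1" for s u
  proof (rule xi_integrand_bound[OF K])
   have "norm (s - 1/2) \<le> norm (w - 1/2) + norm (s - w)" using norm_triangle_ineq[of "w - 1/2" "s - w"] by simp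
   thus "norm (s - 1 / 2) / 2 \<le> r" using that by (simp add: r_def dist_norm norm_minus_commute)
  qed
  moreover have "integrable lborel ?g" by (intro integrable_mult_right integrable_exp_minus_abs)
  ultimately show "\<exists>r>0. \<exists>g. cball w r \<subseteq> UNIV \<and> integrable lborel g \<and>
    (\<forall>s\<in>cball w r. \<forall>t. norm (exp (of_real t * (s - 1 / 2) / 2) * Kfun t) \<le> g t)"
   by (intro exI[of _ 1] conjI exI[of _ ?g]) auto
 qed (auto intro!: holomorphic_intros)
 thus ?thesis by (simp add: xi_def[abs_def])
qed

text \<open>The integral estimate gives growth of type \<open>exp (C * r * ln r)\<close>; the
  logarithm is absorbed into an arbitrarily small power.\<close>

lemma xi_growth:
 assumes kappa: "kappa > 1"
 obtains C where "C \<ge> 0" "\<And>s. norm (xi s) \<le> exp (C * (1 + norm s) powr kappa)"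
proof -
 obtain C c where K: "c > 0" "C \<ge> 0" "\<And>u. norm (Kfun u) \<le> C * exp (- c * exp \<bar>u\<bar>)" by (rule Kfun_bound) blast
 define J where "J = (LBINT u. exp (- \<bar>u::real\<bar>))"
 have J: "J \<ge> 0" unfolding J_def by (intro Bochner_Integration.integral_nonneg) auto
 define eta where "eta = kappa - 1"
 have eta: "eta > 0" using kappa by (simp add: eta_def)
 define B where "B = 1 / eta + \<bar>ln c\<bar>"
 have B: "B \<ge> 0" using eta by (simp add: B_def)
 define D where "D = C * J + B * 2 powr kappa"
 have D: "D \<ge> 0" using K J B by (simp add: D_def)
 have "norm (xi s) \<le> exp (D * (1 + norm s) powr kappa)" for s
 proof -
  define R where "R = 1 + norm s"
  have R: "R \<ge> 1" by (simp add: R_def)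
  have Rk: "R powr kappa \<ge> 1" using R kappa by (intro ge_one_powr_ge_zero) auto
  define r where "r = norm (s - 1 / 2) / 2"
  have r0: "r \<ge> 0" by (simp add: r_def)
  have "norm (s - 1/2) \<le> norm s + 1/2" using norm_triangle_ineq4[of s "1/2"] by simp
  hence r2: "r + 1 \<le> 2 * R"
  proof -
   have "norm (s - 1 / 2) + 2 \<le> 4 * (1 + norm s)"
    using order_trans[OF \<open>norm (s - 1/2) \<le> norm s + 1/2\<close>, of "4 * norm s + 2"] norm_ge_zero[of s] by simp
   thus ?thesis unfolding r_def R_def by simp
  qed
  define E where "E = (r + 1) * (ln ((r + 1) / c) - 1)"
  have "ln (r + 1) \<le> (r + 1) powr eta / eta" using r0 eta by (intro ln_powr_bound) auto
  moreover have "1 \<le> (r + 1) powr eta" using r0 eta by (intro ge_one_powr_ge_zero) auto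
  hence "\<bar>ln c\<bar> * 1 \<le> \<bar>ln c\<bar> * (r + 1) powr eta" by (intro mult_left_mono) auto
  moreover have "ln ((r + 1) / c) = ln (r + 1) - ln c" using r0 K(1) by (simp add: ln_div)
  ultimately have "ln ((r + 1) / c) - 1 \<le> B * (r + 1) powr eta" by (simp add: B_def distrib_right)
  hence "E \<le> (r + 1) * (B * (r + 1) powr eta)" unfolding E_def using r0 by (intro mult_left_mono) auto
  also have "\<dots> = B * (r + 1) powr kappa" using r0 by (simp add: eta_def powr_diff)
  also have "\<dots> \<le> B * (2 * R) powr kappa" using B r0 r2 kappa by (intro mult_left_mono powr_mono2) auto
  also have "\<dots> = B * 2 powr kappa * R powr kappa" using R by (simp add: powr_mult)
  finally have E: "E \<le> B * 2 powr kappa * R powr kappa" .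
  have pt: "norm (exp (of_real u * (s - 1 / 2) / 2) * Kfun u) \<le> C * exp E * exp (- \<bar>u\<bar>)" for u
   unfolding E_def by (rule xi_integrand_bound[OF K]) (simp add: r_def)
  have int: "integrable lborel (\<lambda>u. C * exp E * exp (- \<bar>u\<bar>))" by (intro integrable_mult_right integrable_exp_minus_abs)
  have "norm (xi s) \<le> (LBINT u. norm (exp (of_real u * (s - 1 / 2) / 2) * Kfun u))"
   unfolding xi_def by (rule integral_norm_bound)
  also have "\<dots> \<le> (LBINT u. C * exp E * exp (- \<bar>u\<bar>))"
   using K(2) by (intro integral_mono'[OF int pt]) simp
  also have "\<dots> = C * J * exp E" by (simp add: J_def)
  also have "\<dots> \<le> exp (C * J) * exp E"
   using exp_ge_add_one_self[of "C * J"] by (intro mult_right_mono) (linarith, simp)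
  also have "\<dots> = exp (C * J * 1 + E)" by (simp add: exp_add)
  also have "\<dots> \<le> exp (D * R powr kappa)"
  proof -
   have "C * J * 1 \<le> C * J * R powr kappa" using K J Rk by (intro mult_left_mono) auto
   thus ?thesis using E by (simp add: D_def distrib_right)
  qed
  finally show ?thesis by (simp add: R_def)
 qed
 with D show ?thesis by (rule that)
qed

lemma xi_functional_equation: "xi (1 - s) = wconst * parity_character.xi q a (\<lambda>n. cnj (chi n)) s"
proof -
 interpret c: parity_character q a "\<lambda>n. cnj (chi n)" by (rule parity_character_cnj)
 have "xi (1 - s) = (LBINT u. exp (of_real (0 + (-1) * u) * ((1 - s) - 1 / 2) / 2) * Kfun (0 + (-1) * u))"
  unfolding xi_def using lborel_integral_real_affine[of "-1" "\<lambda>u. exp (of_real u * ((1 - s) - 1 / 2) / 2) * Kfun u" 0] by simp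
 also have "\<dots> = (LBINT u. wconst * (exp (of_real u * (s - 1 / 2) / 2) * c.Kfun u))"
 proof (intro Bochner_Integration.integral_cong refl)
  fix u
  have "exp (of_real (0 + (-1) * u) * ((1 - s) - 1 / 2) / 2) = exp (of_real u * (s - 1 / 2) / 2)"
   by (rule arg_cong[of _ _ exp]) (simp add: field_simps)
  thus "exp (of_real (0 + (-1) * u) * ((1 - s) - 1 / 2) / 2) * Kfun (0 + (-1) * u) = wconst * (exp (of_real u * (s - 1 / 2) / 2) * c.Kfun u)"
   using Kfun_reflect[of u] by (simp add: mult_ac)
 qed
 also have "\<dots> = wconst * c.xi s" unfolding c.xi_def by (rule integral_mult_right_zero)
 finally show ?thesis .
qed

end

section \<open>Continuation of the L-series through \<open>xi\<close>\<close>

context parity_character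
begin

text \<open>Termwise integration of the theta series. The norms of \<open>E n z u\<close> are again
  of the form \<open>E\<close> with \<open>Re z\<close> in place of \<open>z\<close>, so the same
  Gamma integral bounds the integrals of the norms by a constant times
  \<open>(Suc n) powr (- Re s)\<close>.\<close>

lemma xi_eq_series:
 assumes s: "Re s > 1"
 shows "(\<lambda>n. exp (of_real (ln (real q / pi)) * ((s + of_nat a) / 2)) * Gamma ((s + of_nat a) / 2) *
      (chi (int (Suc n)) / of_nat (Suc n) powr s)) sums xi s"
proof -
 define z where "z = (s + of_nat a) / 2"
 define c where "c = (\<lambda>n. pi * (real (Suc n))\<^sup>2 / real q)"
 define E where "E = (\<lambda>n w u. exp (complex_of_real u * w) * exp (- of_real (c n * exp u)))"
 define g where "g = (\<lambda>n u. exp (of_real u * (s - 1 / 2) / 2) * (of_real (exp (u * (real a / 2 + 1 / 4))) * tterm n (exp u)))"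
 have c: "c n > 0" for n using q0 by (simp add: c_def)
 have z: "Re z > 0" using s by (simp add: z_def)
 have Rz: "Re (complex_of_real (Re z)) > 0" using z by simp
 have g_eq: "g n u = chi (int (Suc n)) * of_nat (Suc n) ^ a * E n z u" for n u
 proof -
  have "exp (of_real u * (s - 1 / 2) / 2) * of_real (exp (u * (real a / 2 + 1 / 4))) = exp (of_real u * z)"
   by (simp only: exp_of_real[symmetric] exp_add[symmetric], rule arg_cong[of _ _ exp])
     (simp add: z_def field_simps)
  moreover have "gw a (exp u / real q) (of_nat (Suc n)) = of_nat (Suc n) ^ a * exp (- of_real (c n * exp u))"
   unfolding gw_def c_def by (simp add: mult_ac del: of_nat_Suc)
  moreover have "g n u = (exp (of_real u * (s - 1 / 2) / 2) * of_real (exp (u * (real a / 2 + 1 / 4)))) *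
    (chi (int (Suc n)) * gw a (exp u / real q) (of_nat (Suc n)))"
   unfolding g_def tterm_def by (simp only: mult.assoc)
  ultimately show ?thesis unfolding E_def by (simp only: mult_ac)
 qed
 have E_int: "integrable lborel (E n w)" "integral\<^sup>L lborel (E n w) = exp (- of_real (ln (c n)) * w) * Gamma w" if "Re w > 0" for n w
  using Gamma_integral_exp_scaled[OF that c[of n]] unfolding E_def .
 have g_int: "integrable lborel (g n)" for n
  unfolding g_eq by (intro integrable_mult_right E_int z)
 have lnc: "ln (c n) = - ln (real q / pi) + 2 * ln (real (Suc n))" for n
  using q0 by (simp add: c_def ln_div ln_mult ln_realpow del: of_nat_Suc)
 have pw: "of_nat (Suc n) ^ a * exp (- of_real (ln (c n)) * ((w + of_nat a) / 2)) =
   exp (of_real (ln (real q / pi)) * ((w + of_nat a) / 2)) * (1 / of_nat (Suc n) powr w)" for n and w :: complex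
 proof -
  have l: "complex_of_real (ln (real (Suc n))) = Ln (of_nat (Suc n))"
   using Ln_of_real[of "real (Suc n)"] by (simp only: of_nat_0_less_iff zero_less_Suc of_real_of_nat_eq)
  have m: "of_nat (Suc n) ^ a = exp (of_nat a * Ln (of_nat (Suc n)) :: complex)"
   using exp_Ln[of "of_nat (Suc n) :: complex"] by (simp add: exp_of_nat_mult del: of_nat_Suc)
  have p: "1 / of_nat (Suc n) powr w = exp (- w * Ln (of_nat (Suc n)) :: complex)"
   by (simp add: powr_def exp_minus divide_inverse del: of_nat_Suc)
  have alg: "b * l + - (- y + 2 * l) * ((w + b) / 2) = y * ((w + b) / 2) + - w * l" for b l y :: complex
   by (simp add: field_simps)
  show ?thesis
   unfolding lnc m p exp_add[symmetric] of_real_add of_real_minus of_real_mult of_real_numeral l alg ..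
 qed
 have g_val: "integral\<^sup>L lborel (g n) = exp (of_real (ln (real q / pi)) * z) * Gamma z * (chi (int (Suc n)) / of_nat (Suc n) powr s)" for n
 proof -
  have "integral\<^sup>L lborel (g n) = chi (int (Suc n)) * Gamma z * (of_nat (Suc n) ^ a * exp (- of_real (ln (c n)) * z))"
   unfolding g_eq integral_mult_right_zero E_int(2)[OF z] by (simp only: mult_ac)
  thus ?thesis unfolding z_def pw by (simp only: mult_ac divide_inverse mult_1)
 qed
 have En: "complex_of_real (norm (E n z u)) = E n (of_real (Re z)) u" for n u
  unfolding E_def by (simp add: norm_mult exp_of_real[symmetric])
 have g_norm: "(LBINT u. norm (g n u)) \<le> norm (exp (of_real (ln (real q / pi)) * of_real (Re z)) * Gamma (complex_of_real (Re z))) * real (Suc n) powr (- Re s)" for n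
 proof -
  have np: "norm (of_nat (Suc n) powr of_real (Re s) :: complex) = real (Suc n) powr Re s"
   using norm_powr_real_powr[of "of_nat (Suc n)" "of_real (Re s)"] by (simp del: of_nat_Suc)
  have "(LBINT u. norm (g n u)) = norm (chi (int (Suc n))) * (real (Suc n) ^ a * (LBINT u. norm (E n z u)))"
   unfolding g_eq norm_mult norm_power by (simp del: of_nat_Suc)
  also have "\<dots> \<le> 1 * (real (Suc n) ^ a * (LBINT u. norm (E n z u)))"
   by (intro mult_right_mono norm_dchar_le[OF q nontriv_dchar[OF q chi]] mult_nonneg_nonneg Bochner_Integration.integral_nonneg) auto
  also have "\<dots> = norm (of_nat (Suc n) ^ a * complex_of_real (LBINT u. norm (E n z u)))"
   by (simp add: norm_mult norm_power Bochner_Integration.integral_nonneg del: of_nat_Suc)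
  also have "complex_of_real (LBINT u. norm (E n z u)) = exp (- of_real (ln (c n)) * of_real (Re z)) * Gamma (of_real (Re z))"
   unfolding integral_complex_of_real[symmetric] En E_int(2)[OF Rz] ..
  also have "of_nat (Suc n) ^ a * (exp (- of_real (ln (c n)) * of_real (Re z)) * Gamma (of_real (Re z))) =
    exp (of_real (ln (real q / pi)) * of_real (Re z)) * Gamma (complex_of_real (Re z)) * (1 / of_nat (Suc n) powr of_real (Re s))"
  proof -
   have e: "complex_of_real (Re z) = (of_real (Re s) + of_nat a) / 2" by (simp add: z_def)
   have "(of_nat (Suc n) ^ a * exp (- of_real (ln (c n)) * of_real (Re z))) * Gamma (of_real (Re z)) =
     (exp (of_real (ln (real q / pi)) * of_real (Re z)) * (1 / of_nat (Suc n) powr of_real (Re s))) * Gamma (complex_of_real (Re z))"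
    unfolding e pw ..
   thus ?thesis by (simp only: mult_ac)
  qed
  finally show ?thesis
   unfolding norm_mult norm_divide np powr_minus by (simp add: divide_inverse del: of_nat_Suc)
 qed
 have "(\<lambda>n. integral\<^sup>L lborel (g n)) sums (LBINT u. (\<Sum>n. g n u))"
 proof (rule sums_integral)
  show "integrable lborel (g n)" for n by (rule g_int)
  show "AE u in lborel. summable (\<lambda>n. norm (g n u))"
  proof (rule AE_I2)
   fix u :: real
   have "summable (\<lambda>n. norm (exp (of_real u * (s - 1 / 2) / 2) * of_real (exp (u * (real a / 2 + 1 / 4)))) * norm (tterm n (exp u)))"
    by (intro summable_mult tterm_norm_summable) simp
   thus "summable (\<lambda>n. norm (g n u))" unfolding g_def norm_mult by (simp add: mult_ac)
  qed
  show "summable (\<lambda>n. LBINT u. norm (g n u))"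
  proof (rule summable_comparison_test')
   have "summable (\<lambda>n. real n powr (- Re s))" using s by (simp add: summable_real_powr_iff)
   hence "summable (\<lambda>n. real (Suc n) powr (- Re s))" by (subst summable_Suc_iff)
   thus "summable (\<lambda>n. norm (exp (of_real (ln (real q / pi)) * of_real (Re z)) * Gamma (complex_of_real (Re z))) * real (Suc n) powr (- Re s))"
    by (rule summable_mult)
   show "norm (LBINT u. norm (g n u)) \<le> norm (exp (of_real (ln (real q / pi)) * of_real (Re z)) * Gamma (complex_of_real (Re z))) * real (Suc n) powr (- Re s)" for n
    using g_norm[of n] by (simp add: Bochner_Integration.integral_nonneg)
  qed
 qed
 moreover have "(\<Sum>n. g n u) = exp (of_real u * (s - 1 / 2) / 2) * Kfun u" for u
 proof -
  have "(\<lambda>n. g n u) sums (exp (of_real u * (s - 1 / 2) / 2) * (of_real (exp (u * (real a / 2 + 1 / 4))) * (theta_chi a q chi (exp u) / 2)))"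
   unfolding g_def by (intro sums_mult theta_half_sums) simp
  thus ?thesis unfolding Kfun_def by (simp add: sums_iff)
 qed
 ultimately show ?thesis unfolding g_val xi_def z_def by simp
qed

text \<open>The reciprocal of the factor by which \<open>xi\<close> completes the L-series. Through
  \<open>rGamma\<close> it is entire, so \<open>xi s * gamma_factor s\<close> continues the series
  to the whole plane at once.\<close>

definition gamma_factor :: "complex \<Rightarrow> complex" where
 "gamma_factor s = exp (- of_real (ln (real q / pi)) * ((s + of_nat a) / 2)) * rGamma ((s + of_nat a) / 2)"

lemma gamma_factor_holomorphic: "gamma_factor holomorphic_on S"
 unfolding gamma_factor_def by (intro holomorphic_intros) auto

lemma gamma_factor_nonzero: "Re s > 0 \<Longrightarrow> gamma_factor s \<noteq> 0"
proof -
 assume s: "Re s > 0"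
 have "(s + of_nat a) / 2 \<notin> \<int>\<^sub>\<le>\<^sub>0"
 proof
  assume "(s + of_nat a) / 2 \<in> \<int>\<^sub>\<le>\<^sub>0"
  then obtain n where "(s + of_nat a) / 2 = - of_nat n" by (rule nonpos_Ints_cases')
  from arg_cong[OF this, of Re] s show False by simp
 qed
 thus ?thesis unfolding gamma_factor_def by (simp add: rGamma_eq_zero_iff)
qed

text \<open>By the identity theorem two entire functions that agree on \<open>Re s > 1\<close>
  coincide, so the definite description denotes.\<close>

lemma dirichlet_L_unique:
 assumes "L holomorphic_on UNIV" "\<And>s. Re s > 1 \<Longrightarrow> (\<lambda>n. chi (int (Suc n)) / of_nat (Suc n) powr s) sums L s"
 shows "dirichlet_L chi = L"
 unfolding dirichlet_L_def
proof (rule the_equality)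
 show "L holomorphic_on UNIV \<and> (\<forall>s. Re s > 1 \<longrightarrow> (\<lambda>n. chi (int (Suc n)) / of_nat (Suc n) powr s) sums L s)"
  using assms by blast
 fix M assume M: "M holomorphic_on UNIV \<and> (\<forall>s. Re s > 1 \<longrightarrow> (\<lambda>n. chi (int (Suc n)) / of_nat (Suc n) powr s) sums M s)"
 have eq: "M s = L s" if "Re s > 1" for s
  by (rule sums_unique2[OF _ assms(2)[OF that]]) (use M that in blast)
 show "M = L"
 proof (rule ext)
  fix s
  show "M s = L s"
   by (rule analytic_continuation_open[of "{s. Re s > 1}" UNIV M L])
     (use M assms eq in \<open>auto simp: open_halfspace_Re_gt intro: exI[of _ 2]\<close>)
 qed
qed

lemma xi_gamma_factor_sums:
 assumes s: "Re s > 1"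
 shows "(\<lambda>n. chi (int (Suc n)) / of_nat (Suc n) powr s) sums (xi s * gamma_factor s)"
proof -
 define E where "E = exp (of_real (ln (real q / pi)) * ((s + of_nat a) / 2)) * Gamma ((s + of_nat a) / 2)"
 have 1: "E * gamma_factor s = 1"
 proof -
  have "rGamma ((s + of_nat a) / 2) \<noteq> 0" using gamma_factor_nonzero[of s] s by (auto simp: gamma_factor_def)
  hence G: "Gamma ((s + of_nat a) / 2) * rGamma ((s + of_nat a) / 2) = 1" by (simp add: Gamma_def)
  have e: "exp w * exp (- w) = (1 :: complex)" for w by (simp add: exp_add[symmetric])
  have "E * gamma_factor s = (exp (of_real (ln (real q / pi)) * ((s + of_nat a) / 2)) * exp (- (of_real (ln (real q / pi)) * ((s + of_nat a) / 2)))) *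
    (Gamma ((s + of_nat a) / 2) * rGamma ((s + of_nat a) / 2))"
   unfolding E_def gamma_factor_def mult_minus_left by (simp only: mult_ac)
  thus ?thesis unfolding e G by simp
 qed
 have "(\<lambda>n. E * (chi (int (Suc n)) / of_nat (Suc n) powr s) * gamma_factor s) sums (xi s * gamma_factor s)"
  unfolding E_def by (intro sums_mult2 xi_eq_series s)
 moreover have "E * w * gamma_factor s = w" for w
 proof -
  have "E * w * gamma_factor s = w * (E * gamma_factor s)" by (simp only: mult_ac)
  thus ?thesis unfolding 1 by simp
 qed
 ultimately show ?thesis by (simp only:)
qed

lemma dirichlet_L_eq: "dirichlet_L chi = (\<lambda>s. xi s * gamma_factor s)"
 by (rule dirichlet_L_unique)
   (intro holomorphic_intros gamma_factor_holomorphic xi_entire xi_gamma_factor_sums; assumption)+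

lemma dirichlet_L_holomorphic: "dirichlet_L chi holomorphic_on S"
 unfolding dirichlet_L_eq
 by (intro holomorphic_intros gamma_factor_holomorphic holomorphic_on_subset[OF xi_entire]) auto

lemma dirichlet_L_sums: "Re s > 1 \<Longrightarrow> (\<lambda>n. chi (int (Suc n)) / of_nat (Suc n) powr s) sums dirichlet_L chi s"
 unfolding dirichlet_L_eq by (rule xi_gamma_factor_sums)

end

lemma parity_character_exists:
 assumes q: "prime q" and chi: "chi \<in> nontrivial_characters q"
 obtains a where "parity_character q a chi"
proof -
 have "chi (- 1) = 1 \<or> chi (- 1) = - 1" using dchar_minus_1[OF q nontriv_dchar[OF q chi]] .
 thus ?thesis
 proof
  assume "chi (- 1) = 1" thus ?thesis using q chi by (intro that[of 0] parity_character.intro) auto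
 next
  assume "chi (- 1) = - 1" thus ?thesis using q chi by (intro that[of 1] parity_character.intro) auto
 qed
qed

section \<open>Non-vanishing on the line of real part 1\<close>

text \<open>The index starts at 0, whose term is 0: \<open>0 powr s = 0\<close>, and division by 0
  gives 0.\<close>

definition dseries :: "(nat \<Rightarrow> complex) \<Rightarrow> complex \<Rightarrow> complex" where
 "dseries c s = (\<Sum>n. c n / of_nat n powr s)"

definition dconv :: "(nat \<Rightarrow> complex) \<Rightarrow> bool" where
 "dconv c \<longleftrightarrow> (\<forall>\<sigma>>1. summable (\<lambda>n. norm (c n) * real n powr (- \<sigma>)))"

lemma norm_dterm: "norm (c / of_nat n powr s) = norm c * real n powr (- Re s)" for c s :: complex
proof -
 have "norm (of_nat n powr s :: complex) = real n powr Re s"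
  using norm_powr_real_powr[of "of_nat n" s] by simp
 thus ?thesis unfolding norm_divide powr_minus by (simp add: divide_inverse)
qed

lemma dconv_summable: "dconv c \<Longrightarrow> Re s > 1 \<Longrightarrow> summable (\<lambda>n. norm (c n / of_nat n powr s))"
 unfolding norm_dterm dconv_def by simp

lemma dseries_sums: "dconv c \<Longrightarrow> Re s > 1 \<Longrightarrow> (\<lambda>n. c n / of_nat n powr s) sums dseries c s"
 unfolding dseries_def by (rule summable_sums[OF summable_norm_cancel[OF dconv_summable]])

lemma dseries_has_sum: "dconv c \<Longrightarrow> Re s > 1 \<Longrightarrow> ((\<lambda>n. c n / of_nat n powr s) has_sum dseries c s) UNIV"
 by (rule norm_summable_imp_has_sum[OF dconv_summable dseries_sums])

lemma dconv_mono:
 assumes "dconv c" "\<And>n. norm (d n) \<le> norm (c n)"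
 shows "dconv d"
 unfolding dconv_def
proof (intro allI impI)
 fix \<sigma> :: real assume "\<sigma> > 1"
 hence "summable (\<lambda>n. norm (c n) * real n powr (- \<sigma>))" using assms(1) by (simp add: dconv_def)
 thus "summable (\<lambda>n. norm (d n) * real n powr (- \<sigma>))"
  by (rule summable_comparison_test'[where N = 0]) (use assms(2) in \<open>auto intro!: mult_right_mono\<close>)
qed

lemma dconv_bounded:
 assumes "\<And>n. norm (c n) \<le> K"
 shows "dconv c"
proof (rule dconv_mono)
 show "dconv (\<lambda>_. of_real K)"
  unfolding dconv_def by (intro allI impI summable_mult) (simp add: summable_real_powr_iff)
 show "norm (c n) \<le> norm (of_real K :: complex)" for n
  using assms[of n] by simp
qed

lemma dconv_ln:
 assumes c: "dconv c"
 shows "dconv (\<lambda>n. of_real (ln (real n)) * c n)"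
 unfolding dconv_def
proof (intro allI impI)
 fix \<sigma> :: real assume \<sigma>: "\<sigma> > 1"
 define eps where "eps = (\<sigma> - 1) / 2"
 have e: "eps > 0" "\<sigma> - eps > 1" using \<sigma> by (auto simp: eps_def field_simps)
 have "summable (\<lambda>n. (1 / eps) * (norm (c n) * real n powr (- (\<sigma> - eps))))"
  using c e(2) unfolding dconv_def by (intro summable_mult) blast
 thus "summable (\<lambda>n. norm (of_real (ln (real n)) * c n) * real n powr (- \<sigma>))"
 proof (rule summable_comparison_test'[where N = 1])
  fix n :: nat assume n: "n \<ge> 1"
  have "ln (real n) \<le> real n powr eps / eps" using n e by (intro ln_powr_bound) auto
  hence "ln (real n) * (norm (c n) * real n powr (- \<sigma>)) \<le> (real n powr eps / eps) * (norm (c n) * real n powr (- \<sigma>))"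
   by (intro mult_right_mono) auto
  also have "\<dots> = (1 / eps) * (norm (c n) * (real n powr eps * real n powr (- \<sigma>)))" by simp
  also have "real n powr eps * real n powr (- \<sigma>) = real n powr (- (\<sigma> - eps))" by (simp add: powr_add[symmetric])
  finally show "norm (norm (of_real (ln (real n)) * c n) * real n powr (- \<sigma>)) \<le> (1 / eps) * (norm (c n) * real n powr (- (\<sigma> - eps)))"
   using n by (simp add: norm_mult mult.assoc)
 qed
qed

lemma dconv_mangoldt:
 assumes c: "dconv c"
 shows "dconv (\<lambda>n. of_real (mang n) * c n)"
proof (rule dconv_mono[OF dconv_ln[OF c]])
 fix n
 have "\<bar>mang n\<bar> \<le> \<bar>ln (real n)\<bar>"
  using mangoldt_le_ln[of n] mangoldt_nonneg[of n] by (cases "n = 0") auto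
 thus "norm (of_real (mang n) * c n) \<le> norm (of_real (ln (real n)) * c n)"
  unfolding norm_mult norm_of_real by (intro mult_right_mono) auto
qed

section \<open>Derivatives and logarithmic derivatives of Dirichlet series\<close>

lemma powr_nat_derivative:
 "((\<lambda>s. c / of_nat n powr s) has_field_derivative (- (of_real (ln (real n)) * c) / of_nat n powr s)) (at s within S)" for c :: complex
proof (cases "n = 0")
 case False
 have l: "Ln (of_nat n) = complex_of_real (ln (real n))" using False Ln_of_real[of "real n"] by simp
 have e: "c / of_nat n powr s = c * exp (- s * of_real (ln (real n)))" for s :: complex
  using False by (simp add: powr_def l exp_minus divide_inverse)
 have d: "((\<lambda>s. c * exp (- s * of_real (ln (real n)))) has_field_derivative
   - (of_real (ln (real n)) * (c * exp (- s * of_real (ln (real n)))))) (at s within S)"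
  by (auto intro!: derivative_eq_intros simp: mult_ac)
 have "- (of_real (ln (real n)) * c) / of_nat n powr s = - (of_real (ln (real n)) * (c / of_nat n powr s))" by simp
 with d show ?thesis unfolding e by (simp only:)
qed simp

lemma dseries_has_field_derivative:
 assumes c: "dconv c" and s: "Re s > 1"
 shows "(dseries c has_field_derivative - dseries (\<lambda>n. of_real (ln (real n)) * c n) s) (at s)"
proof -
 define \<sigma> where "\<sigma> = (1 + Re s) / 2"
 have \<sigma>: "\<sigma> > 1" "\<sigma> < Re s" using s by (auto simp: \<sigma>_def)
 define S where "S = {z. Re z \<ge> \<sigma>}"
 define d where "d = (\<lambda>n z. - (of_real (ln (real n)) * c n) / of_nat n powr z)"
 have dc: "dconv (\<lambda>n. of_real (ln (real n)) * c n)" by (rule dconv_ln[OF c])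
 have u: "uniformly_convergent_on S (\<lambda>n z. \<Sum>i<n. d i z)"
 proof (rule Weierstrass_m_test')
  show "summable (\<lambda>n. norm (of_real (ln (real n)) * c n) * real n powr (- \<sigma>))"
   using dc \<sigma>(1) unfolding dconv_def by blast
  fix n z assume "z \<in> S"
  hence z: "Re z \<ge> \<sigma>" by (simp add: S_def)
  have "real n powr (- Re z) \<le> real n powr (- \<sigma>)"
   using z by (cases "n = 0") (auto intro!: powr_mono)
  thus "norm (d n z) \<le> norm (of_real (ln (real n)) * c n) * real n powr (- \<sigma>)"
   unfolding d_def norm_dterm norm_minus_cancel by (intro mult_left_mono) auto
 qed
 have int: "s \<in> interior S"
  by (rule interiorI[of "{z. Re z > \<sigma>}"]) (use \<sigma> in \<open>auto simp: S_def open_halfspace_Re_gt\<close>)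
 hence sS: "s \<in> S" using interior_subset by blast
 have "((\<lambda>z. \<Sum>n. c n / of_nat n powr z) has_field_derivative (\<Sum>n. d n s)) (at s)"
 proof (rule has_field_derivative_series'(2)[OF _ _ u sS _ int])
  show "convex S" unfolding S_def by (rule convex_halfspace_Re_ge)
  show "((\<lambda>z. c n / of_nat n powr z) has_field_derivative d n z) (at z within S)" for n z
   unfolding d_def by (rule powr_nat_derivative)
  show "summable (\<lambda>n. c n / of_nat n powr s)" using dseries_sums[OF c s] by (simp add: sums_iff)
 qed
 moreover have "(\<Sum>n. d n s) = - dseries (\<lambda>n. of_real (ln (real n)) * c n) s"
  using sums_minus[OF dseries_sums[OF dc s]] unfolding d_def minus_divide_left[symmetric] by (simp add: sums_iff)
 ultimately show ?thesis unfolding dseries_def[abs_def] by (simp only:)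
qed

lemma dseries_holomorphic: "dconv c \<Longrightarrow> dseries c holomorphic_on {s. Re s > 1}"
 using dseries_has_field_derivative by (auto simp: holomorphic_on_open open_halfspace_Re_gt)

text \<open>The identity that \<open>ln n\<close> is the sum of \<open>mang d\<close> over the
  divisors of \<open>n\<close>, twisted by the completely multiplicative \<open>w\<close>. Absolute
  convergence allows the product of the two series to be regrouped along
  \<open>n = d * m\<close>.\<close>

lemma dseries_mangoldt_mult:
 assumes w: "\<And>n. norm (w n) \<le> 1" and wm: "\<And>m n. w (m * n) = w m * w n" and s: "Re s > 1"
 shows "dseries (\<lambda>n. of_real (ln (real n)) * w n) s = dseries (\<lambda>n. of_real (mang n) * w n) s * dseries w s"
proof -
 define a where "a = (\<lambda>n. of_real (mang n) * w n / of_nat n powr s)"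
 define b where "b = (\<lambda>n. w n / of_nat n powr s)"
 define f where "f = (\<lambda>(d, m). a d * b m)"
 have cw: "dconv w" by (rule dconv_bounded[OF w])
 have cm: "dconv (\<lambda>n. of_real (mang n) * w n)" by (rule dconv_mangoldt[OF cw])
 have a: "(a has_sum dseries (\<lambda>n. of_real (mang n) * w n) s) UNIV"
  unfolding a_def by (rule dseries_has_sum[OF cm s])
 have b: "(b has_sum dseries w s) UNIV" unfolding b_def by (rule dseries_has_sum[OF cw s])
 have an: "(\<lambda>n. norm (a n)) summable_on UNIV"
  using dconv_summable[OF cm s] unfolding a_def by (subst summable_on_UNIV_nonneg_real_iff) auto
 have bn: "(\<lambda>n. norm (b n)) summable_on UNIV"
  using dconv_summable[OF cw s] unfolding b_def by (subst summable_on_UNIV_nonneg_real_iff) auto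
 have "(\<lambda>x. norm (f x)) summable_on (UNIV \<times> UNIV)"
 proof (subst Infinite_Sum.abs_summable_on_Sigma_iff, intro conjI ballI)
  show "(\<lambda>m. norm (f (d, m))) summable_on UNIV" for d
   unfolding f_def prod.case norm_mult by (intro summable_on_cmult_right bn)
  have "(\<Sum>\<^sub>\<infinity>m. norm (f (d, m))) = norm (a d) * (\<Sum>\<^sub>\<infinity>m. norm (b m))" for d
   unfolding f_def prod.case norm_mult by (rule infsum_cmult_right')
  moreover have "(\<Sum>\<^sub>\<infinity>m. norm (b m)) \<ge> 0" by (rule infsum_nonneg) simp
  ultimately show "(\<lambda>d. norm (\<Sum>\<^sub>\<infinity>m. norm (f (d, m)))) summable_on UNIV"
   using summable_on_cmult_left[OF an, of "\<Sum>\<^sub>\<infinity>m. norm (b m)"] by simp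
 qed
 hence fs: "f summable_on (UNIV \<times> UNIV)" by (rule abs_summable_summable)
 define T where "T = infsum f (UNIV \<times> UNIV)"
 have fT: "(f has_sum T) (UNIV \<times> UNIV)" unfolding T_def by (rule has_sum_infsum[OF fs])
 have "((\<lambda>d. a d * dseries w s) has_sum T) UNIV"
  by (rule has_sum_SigmaD[OF fT]) (simp add: f_def has_sum_cmult_right b)
 moreover have "((\<lambda>d. a d * dseries w s) has_sum (dseries (\<lambda>n. of_real (mang n) * w n) s * dseries w s)) UNIV"
  by (rule has_sum_cmult_left[OF a])
 ultimately have T: "T = dseries (\<lambda>n. of_real (mang n) * w n) s * dseries w s" by (rule has_sum_unique)
 define P where "P = (\<lambda>n. {(d, m). d * m = (n :: nat)})"
 have "snd ` (SIGMA n:UNIV. P n) = UNIV \<times> UNIV" unfolding P_def by (auto simp: image_iff)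
 moreover have "inj_on snd (SIGMA n:UNIV. P n)" unfolding P_def by (auto simp: inj_on_def)
 ultimately have "((f \<circ> snd) has_sum T) (SIGMA n:UNIV. P n)" using fT has_sum_reindex[of snd "SIGMA n:UNIV. P n" f T] by simp
 hence "((\<lambda>n. of_real (ln (real n)) * w n / of_nat n powr s) has_sum T) UNIV"
 proof (rule has_sum_SigmaD)
  fix n :: nat
  show "((\<lambda>y. (f \<circ> snd) (n, y)) has_sum (of_real (ln (real n)) * w n / of_nat n powr s)) (P n)"
  \<comment> \<open>The fibre over 0 is infinite, but each of its pairs has an index 0 and
    contributes 0.\<close>
  proof (cases "n = 0")
   case True
   have "f y = 0" if "y \<in> P n" for y
    using that True by (auto simp: P_def f_def a_def b_def)
   thus ?thesis using True has_sum_0[of "P n" f] by (simp add: o_def)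
  next
   case False
   have im: "P n = (\<lambda>d. (d, n div d)) ` {d. d dvd n}" using False by (auto simp: P_def image_iff)
   have fin: "finite {d. d dvd n}" using False by simp
   have inj: "inj_on (\<lambda>d. (d, n div d)) {d. d dvd n}" by (auto simp: inj_on_def)
   have "sum f (P n) = (\<Sum>d | d dvd n. f (d, n div d))"
    unfolding im by (subst sum.reindex[OF inj]) (simp add: o_def)
   also have "\<dots> = (\<Sum>d | d dvd n. of_real (mang d) * (w n / of_nat n powr s))"
   proof (intro sum.cong refl)
    fix d assume "d \<in> {d. d dvd n}"
    then obtain m where m: "n = d * m" by auto
    with False have d: "d > 0" by auto
    have "of_nat n powr s = of_nat d powr s * (of_nat m powr s :: complex)"
     unfolding m of_nat_mult by (rule powr_times_real) auto
    moreover have "w n = w d * w m" unfolding m by (rule wm)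
    ultimately show "f (d, n div d) = of_real (mang d) * (w n / of_nat n powr s)"
     using d by (simp add: f_def a_def b_def m del: of_real_mangoldt)
   qed
   also have "\<dots> = (\<Sum>d | d dvd n. of_real (mang d)) * (w n / of_nat n powr s)"
    by (simp only: sum_distrib_right)
   also have "(\<Sum>d | d dvd n. complex_of_real (mang d)) = of_real (ln (real n))"
    using mangoldt_sum[of n, where ?'a = complex] False by simp
   finally have "sum f (P n) = of_real (ln (real n)) * w n / of_nat n powr s" by simp
   moreover have "finite (P n)" unfolding im using fin by simp
   ultimately show ?thesis using has_sum_finite[of "P n" f] by (simp add: o_def)
  qed
 qed
 moreover have "((\<lambda>n. of_real (ln (real n)) * w n / of_nat n powr s) has_sum dseries (\<lambda>n. of_real (ln (real n)) * w n) s) UNIV"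
  by (rule dseries_has_sum[OF dconv_ln[OF cw] s])
 ultimately show ?thesis unfolding T by (rule has_sum_unique[symmetric])
qed

lemma dseries_logderiv:
 assumes "\<And>n. norm (w n) \<le> 1" "\<And>m n. w (m * n) = w m * w n" "Re s > 1"
 shows "(dseries w has_field_derivative - (dseries (\<lambda>n. of_real (mang n) * w n) s * dseries w s)) (at s)"
 using dseries_has_field_derivative[OF dconv_bounded assms(3), of w] assms(1)
 unfolding dseries_mangoldt_mult[OF assms] by blast

text \<open>In place of an Euler product: the negative of the logarithmic derivative has a primitive
  \<open>P\<close> on the half-plane, so \<open>dseries w * exp P\<close> is constant there and one
  zero would force a zero at 3. At 3 the terms from \<open>n = 2\<close> on sum to less than 1 in
  modulus.\<close>

lemma dseries_nonzero:
 assumes w: "\<And>n. norm (w n) \<le> 1" and wm: "\<And>m n. w (m * n) = w m * w n" and w1: "w 1 = 1" and s: "Re s > 1"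
 shows "dseries w s \<noteq> 0"
proof
 assume z: "dseries w s = 0"
 define U where "U = {s :: complex. Re s > 1}"
 define D where "D = dseries (\<lambda>n. of_real (mang n) * w n)"
 have cw: "dconv w" by (rule dconv_bounded[OF w])
 have U: "convex U" "open U" unfolding U_def by (auto simp: convex_halfspace_Re_gt open_halfspace_Re_gt)
 have "D holomorphic_on U" unfolding U_def D_def by (intro dseries_holomorphic dconv_mangoldt cw)
 then obtain P where P: "\<And>x. x \<in> U \<Longrightarrow> (P has_field_derivative D x) (at x within U)"
  using holomorphic_convex_primitive'[OF U] by blast
 have "((\<lambda>x. dseries w x * exp (P x)) has_field_derivative 0) (at x within U)" if x: "x \<in> U" for x
 proof -
  have d: "(dseries w has_field_derivative - (D x * dseries w x)) (at x)"
   unfolding D_def by (rule dseries_logderiv[OF w wm]) (use x in \<open>auto simp: U_def\<close>)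
  have "(P has_field_derivative D x) (at x)" using P[OF x] at_within_open[OF x U(2)] by simp
  from DERIV_mult[OF d DERIV_fun_exp[OF this]]
  have "((\<lambda>x. dseries w x * exp (P x)) has_field_derivative 0) (at x)" by (simp add: mult_ac)
  thus ?thesis by (rule has_field_derivative_at_within)
 qed
 hence c: "\<exists>c. \<forall>x\<in>U. dseries w x * exp (P x) = c"
  by (intro has_field_derivative_zero_constant[OF U(1)]) blast
 have "s \<in> U" "3 \<in> U" using s by (auto simp: U_def)
 hence "dseries w 3 * exp (P 3) = dseries w s * exp (P s)" using c by metis
 hence z3: "dseries w 3 = 0" using z by simp
 have sm: "(\<lambda>n. w (Suc (Suc n)) / of_nat (Suc (Suc n)) powr 3) sums (- 1)"
 proof -
  have "(\<lambda>n. w n / of_nat n powr 3) sums 0" using dseries_sums[OF cw, of 3] z3 by simp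
  hence "(\<lambda>n. w (n + 2) / of_nat (n + 2) powr 3) sums (0 - (\<Sum>i<2. w i / of_nat i powr 3))"
   by (rule sums_split_initial_segment)
  moreover have "(\<Sum>i<2. w i / of_nat i powr 3) = (1 :: complex)" using w1 by (simp add: numeral_2_eq_2)
  ultimately show ?thesis by simp
 qed
 have "(\<lambda>n. 1 / real ((n + 1)\<^sup>2)) sums (pi\<^sup>2 / 6)" by (rule inverse_squares_sums)
 hence "(\<lambda>n. 1 / real ((n + 1 + 1)\<^sup>2)) sums (pi\<^sup>2 / 6 - (\<Sum>i<1. 1 / real ((i + 1)\<^sup>2)))"
  by (rule sums_split_initial_segment)
 hence sq: "(\<lambda>n. 1 / 2 * (1 / real ((n + 1 + 1)\<^sup>2))) sums (1 / 2 * (pi\<^sup>2 / 6 - 1))"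
  by (intro sums_mult) simp
 have "norm (- 1 :: complex) \<le> 1 / 2 * (pi\<^sup>2 / 6 - 1)"
 proof (rule norm_sums_le[OF sm sq])
  fix n
  define x where "x = real (Suc (Suc n))"
  have x: "x \<ge> 2" by (simp add: x_def)
  have "norm (w (Suc (Suc n)) / of_nat (Suc (Suc n)) powr 3) \<le> 1 * x powr (- 3)"
   unfolding norm_dterm x_def by (intro mult_mono w) auto
  also have "x powr (- 3) = 1 / (x * x\<^sup>2)"
   using x by (simp add: powr_minus divide_inverse power3_eq_cube power2_eq_square powr_numeral)
  also have "1 * (1 / (x * x\<^sup>2)) \<le> 1 / (2 * x\<^sup>2)" using x by (simp add: frac_le mult_right_mono)
  finally show "norm (w (Suc (Suc n)) / of_nat (Suc (Suc n)) powr 3) \<le> 1 / 2 * (1 / real ((n + 1 + 1)\<^sup>2))"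
   by (simp add: x_def)
 qed
 \<comment> \<open>With \<open>pi < 4\<close> the bound \<open>1 / 2 * (pi\<^sup>2 / 6 - 1)\<close>
   is below 5/6.\<close>
 moreover have "pi\<^sup>2 < 4\<^sup>2" using pi_less_4 by (intro power_strict_mono) auto
 ultimately show False by simp
qed

text \<open>Landau's argument without division by \<open>A\<close>. In \<open>y = 2 - s\<close> the
  differential equation reads \<open>\<alpha>' = D * \<alpha>\<close>, and the Taylor coefficients
  of \<open>D\<close> are nonnegative; so those of \<open>\<alpha>\<close> are nonnegative too, and
  \<open>d k \<le> (k + 1) * b (k + 1)\<close>. As \<open>A\<close> is holomorphic on
  \<open>Re s > 0\<close>, the series of \<open>\<alpha>\<close> converges for
  \<open>norm y < 2\<close>, hence that of \<open>D\<close> at \<open>y = 3 / 2\<close>, that is at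
  \<open>s = 1 / 2\<close>, whether or not \<open>A\<close> has zeros.\<close>

lemma landau_nonneg_coeffs:
 fixes c :: "nat \<Rightarrow> real"
 assumes c0: "\<And>n. c n \<ge> 0" and c: "dconv (\<lambda>n. of_real (c n))"
  and A: "A holomorphic_on {s. Re s > 0}" and A2: "A 2 \<noteq> 0"
  and dA: "\<And>s. Re s > 1 \<Longrightarrow> (A has_field_derivative - (dseries (\<lambda>n. of_real (c n)) s * A s)) (at s)"
 obtains K where "\<And>N. (\<Sum>n\<in>{1..N}. c n / sqrt (real n)) \<le> K"
proof -
 define D where "D = (\<lambda>y. dseries (\<lambda>n. of_real (c n)) (2 - y))"
 \<comment> \<open>The Taylor coefficients of \<open>c n / n powr s\<close> at \<open>s = 2\<close>;
   in the variable \<open>y = 2 - s\<close> they are nonnegative.\<close>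
 define e where "e = (\<lambda>n k. c n * real n powr (-2) * ln (real n) ^ k / fact k)"
 have e0: "e n k \<ge> 0" for n k
  by (cases "n = 0") (auto simp: e_def intro!: mult_nonneg_nonneg c0 zero_le_power divide_nonneg_nonneg)
 have e_sums: "(\<lambda>k. e n k * y ^ k) sums (c n * real n powr (y - 2))" if "n > 0" for n and y :: real
 proof -
  have "(\<lambda>k. (y * ln (real n)) ^ k /\<^sub>R fact k) sums exp (y * ln (real n))" by (rule exp_converges)
  hence "(\<lambda>k. c n * real n powr (-2) * ((y * ln (real n)) ^ k /\<^sub>R fact k)) sums (c n * real n powr (-2) * exp (y * ln (real n)))"
   by (rule sums_mult)
  moreover have "exp (y * ln (real n)) = real n powr y" using that by (simp add: powr_def)
  moreover have "real n powr (-2) * real n powr y = real n powr (y - 2)" by (simp add: powr_add[symmetric])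
  moreover have "c n * real n powr (-2) * ((y * ln (real n)) ^ k /\<^sub>R fact k) = e n k * y ^ k" for k
   by (simp add: e_def power_mult_distrib divide_inverse mult_ac)
  ultimately show ?thesis by (simp add: mult.assoc)
 qed
 have e_sums_c: "(\<lambda>k. of_real (e n k) * y ^ k) sums (of_real (c n) / of_nat n powr (2 - y))" if n: "n > 0" for n and y :: complex
 proof -
  have l: "Ln (of_nat n) = complex_of_real (ln (real n))" using n Ln_of_real[of "real n"] by simp
  have "(\<lambda>k. (y * of_real (ln (real n))) ^ k /\<^sub>R fact k) sums exp (y * of_real (ln (real n)))" by (rule exp_converges)
  hence "(\<lambda>k. of_real (c n * real n powr (-2)) * ((y * of_real (ln (real n))) ^ k /\<^sub>R fact k)) sums (of_real (c n * real n powr (-2)) * exp (y * of_real (ln (real n))))"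
   by (rule sums_mult)
  moreover have "of_real (c n * real n powr (-2)) * exp (y * of_real (ln (real n))) = of_real (c n) / of_nat n powr (2 - y)"
  proof -
   have "complex_of_real (real n powr (-2)) = exp (- 2 * of_real (ln (real n)))"
    using n by (simp add: powr_def exp_of_real[symmetric])
   moreover have "1 / of_nat n powr (2 - y) = exp (- (2 - y) * of_real (ln (real n)))"
    unfolding mult_minus_left exp_minus using n by (simp add: powr_def l divide_inverse)
   moreover have "exp (- 2 * of_real (ln (real n))) * exp (y * of_real (ln (real n))) = exp (- (2 - y) * complex_of_real (ln (real n)))"
    by (simp add: exp_add[symmetric] algebra_simps)
   ultimately show ?thesis by (simp add: mult.assoc divide_inverse)
  qed
  moreover have "of_real (c n * real n powr (-2)) * ((y * of_real (ln (real n))) ^ k /\<^sub>R fact k) = of_real (e n k) * y ^ k" for k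
   by (simp add: e_def power_mult_distrib divide_inverse scaleR_conv_of_real mult_ac)
  ultimately show ?thesis by simp
 qed
 have e_z: "e 0 k = 0" for k by (simp add: e_def)
 have cs: "summable (\<lambda>n. c n * real n powr (- \<sigma>))" if "\<sigma> > 1" for \<sigma>
  using c that c0 unfolding dconv_def by simp
 have es: "(\<lambda>n. e n k) summable_on UNIV" for k
 proof -
  have "e n k \<le> 2 ^ k * (c n * real n powr (- (3 / 2)))" if n: "n > 0" for n
  proof -
   have "(\<Sum>i\<in>{k}. e n i * (1/2) ^ i) \<le> c n * real n powr (1/2 - 2)"
    using e_sums[OF n, of "1/2"] e0 by (intro order_trans[OF sum_le_suminf]) (auto simp: sums_iff intro!: mult_nonneg_nonneg)
   thus ?thesis by (simp add: power_divide field_simps)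
  qed
  moreover have "e n k \<le> 2 ^ k * (c n * real n powr (- (3 / 2)))" if "n = 0" for n using that by (simp add: e_z)
  ultimately have le: "e n k \<le> 2 ^ k * (c n * real n powr (- (3 / 2)))" for n by blast
  have "summable (\<lambda>n. e n k)"
   by (rule summable_comparison_test'[OF summable_mult[OF cs[of "3/2"], of "2 ^ k"], of 0]) (use le e0 in auto)
  thus ?thesis using e0 by (subst summable_on_UNIV_nonneg_real_iff)
 qed
 define d where "d = (\<lambda>k. \<Sum>\<^sub>\<infinity>n. e n k)"
 have d0: "d k \<ge> 0" for k unfolding d_def by (intro infsum_nonneg e0)
 have D_sums: "(\<lambda>k. of_real (d k) * y ^ k) sums D y" if y: "norm y < 1" for y
 proof -
  define g where "g = (\<lambda>(n, k). of_real (e n k) * y ^ k :: complex)"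
  have inner: "((\<lambda>k. norm (g (n, k))) has_sum (if n = 0 then 0 else c n * real n powr (- (2 - norm y)))) UNIV" for n
  proof (cases "n = 0")
   case True
   thus ?thesis by (simp add: g_def e_z)
  next
   case False
   have "norm (g (n, k)) = e n k * norm y ^ k" for k using e0[of n k] by (simp add: g_def norm_mult norm_power)
   moreover have "((\<lambda>k. e n k * norm y ^ k) has_sum (c n * real n powr (norm y - 2))) UNIV"
    using e_sums[of n "norm y"] False e0 by (intro norm_summable_imp_has_sum) (auto simp: sums_iff)
   ultimately show ?thesis using False by simp
  qed
  have "(\<lambda>x. norm (g x)) summable_on (UNIV \<times> UNIV)"
  proof (subst Infinite_Sum.abs_summable_on_Sigma_iff, intro conjI ballI)
   show "(\<lambda>k. norm (g (n, k))) summable_on UNIV" for n using inner has_sum_imp_summable by blast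
   have "norm (\<Sum>\<^sub>\<infinity>k. norm (g (n, k))) = (if n = 0 then 0 else c n * real n powr (- (2 - norm y)))" for n
    using infsumI[OF inner[of n]] c0[of n] by simp
   moreover have "(if n = 0 then 0 else c n * real n powr (- (2 - norm y))) = c n * real n powr (- (2 - norm y))" for n by simp
   moreover have "(\<lambda>n. c n * real n powr (- (2 - norm y))) summable_on UNIV"
    using cs[of "2 - norm y"] y c0 by (subst summable_on_UNIV_nonneg_real_iff) auto
   ultimately show "(\<lambda>n. norm (\<Sum>\<^sub>\<infinity>k. norm (g (n, k)))) summable_on UNIV" by (simp only:)
  qed
  hence gs: "(\<lambda>x. norm (g x)) summable_on (UNIV \<times> UNIV)" .
  have gT: "(g has_sum infsum g (UNIV \<times> UNIV)) (UNIV \<times> UNIV)" by (rule has_sum_infsum[OF abs_summable_summable[OF gs]])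
  have "((\<lambda>n. of_real (c n) / of_nat n powr (2 - y)) has_sum infsum g (UNIV \<times> UNIV)) UNIV"
  proof (rule has_sum_SigmaD[OF gT])
   fix n :: nat
   show "((\<lambda>k. g (n, k)) has_sum of_real (c n) / of_nat n powr (2 - y)) UNIV"
   proof (cases "n = 0")
    case True thus ?thesis by (simp add: g_def e_z)
   next
    case False
    have "summable (\<lambda>k. norm (g (n, k)))"
     using has_sum_imp_summable[OF inner[of n]] by (subst (asm) summable_on_UNIV_nonneg_real_iff) auto
    thus ?thesis
     by (rule norm_summable_imp_has_sum) (use e_sums_c[of n y] False in \<open>simp add: g_def\<close>)
   qed
  qed
  moreover have "((\<lambda>n. of_real (c n) / of_nat n powr (2 - y)) has_sum D y) UNIV"
   unfolding D_def using y abs_Re_le_cmod[of y] by (intro dseries_has_sum[OF c]) auto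
  ultimately have T: "infsum g (UNIV \<times> UNIV) = D y" by (rule has_sum_unique)
  have sw: "prod.swap ` (UNIV \<times> UNIV) = (UNIV \<times> UNIV :: (nat \<times> nat) set)" by auto
  have "((g \<circ> prod.swap) has_sum D y) (UNIV \<times> UNIV)"
   using gT has_sum_reindex[of prod.swap "UNIV \<times> UNIV" g "D y"] unfolding T sw by simp
  hence "((\<lambda>k. of_real (d k) * y ^ k) has_sum D y) UNIV"
  proof (rule has_sum_SigmaD)
   fix k
   have "((\<lambda>n. complex_of_real (e n k)) has_sum of_real (d k)) UNIV"
    unfolding d_def by (intro has_sum_of_real has_sum_infsum es)
   thus "((\<lambda>n. (g \<circ> prod.swap) (k, n)) has_sum of_real (d k) * y ^ k) UNIV"
    unfolding o_def g_def prod.swap_def fst_conv snd_conv prod.case by (rule has_sum_cmult_left)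
  qed
  thus ?thesis by (rule has_sum_imp_sums)
 qed
 have D_fps: "D has_fps_expansion Abs_fps (\<lambda>k. of_real (d k))"
 proof (rule has_fps_expansionI)
  have "eventually (\<lambda>y :: complex. y \<in> ball 0 1) (nhds 0)" by (intro eventually_nhds_in_open) auto
  thus "eventually (\<lambda>y. (\<lambda>n. fps_nth (Abs_fps (\<lambda>k. of_real (d k))) n * y ^ n) sums D y) (nhds 0)"
   by eventually_elim (simp add: D_sums)
 qed
 define \<alpha> where "\<alpha> = (\<lambda>y. A (2 - y) / A 2)"
 have \<alpha>_hol: "\<alpha> holomorphic_on ball 0 2"
 proof -
  have "(A \<circ> (\<lambda>y. 2 - y)) holomorphic_on ball 0 2"
  proof (rule holomorphic_on_compose_gen[OF _ A])
   show "(\<lambda>y. 2 - y) ` ball 0 2 \<subseteq> {s :: complex. 0 < Re s}"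
   proof clarsimp
    fix y :: complex assume "norm y < 2" thus "Re y < 2" using complex_Re_le_cmod[of y] by simp
   qed
  qed (intro holomorphic_intros)
  thus ?thesis unfolding \<alpha>_def o_def by (intro holomorphic_intros) (use A2 in auto)
 qed
 define \<beta> where "\<beta> = fps_expansion \<alpha> 0"
 have \<alpha>_fps: "\<alpha> has_fps_expansion \<beta>"
  unfolding \<beta>_def by (rule has_fps_expansion_fps_expansion[OF _ _ \<alpha>_hol]) auto
 have "deriv \<alpha> has_fps_expansion fps_deriv \<beta>" by (rule has_fps_expansion_deriv[OF \<alpha>_fps])
 moreover have "(\<lambda>y. D y * \<alpha> y) has_fps_expansion (Abs_fps (\<lambda>k. of_real (d k)) * \<beta>)"
  by (rule has_fps_expansion_mult[OF D_fps \<alpha>_fps])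
 moreover have "eventually (\<lambda>y. deriv \<alpha> y = D y * \<alpha> y) (nhds 0)"
 proof -
  have "eventually (\<lambda>y :: complex. y \<in> ball 0 1) (nhds 0)" by (intro eventually_nhds_in_open) auto
  thus ?thesis
  proof eventually_elim
   fix y :: complex assume "y \<in> ball 0 1"
   hence y: "Re (2 - y) > 1" using complex_Re_le_cmod[of y] by simp
   have "((\<lambda>y. 2 - y) has_field_derivative - 1) (at y)" by (auto intro!: derivative_eq_intros)
   from DERIV_chain2[OF dA[OF y] this]
   have "((\<lambda>y. A (2 - y)) has_field_derivative D y * A (2 - y)) (at y)" by (simp add: D_def)
   from DERIV_cdivide[OF this, of "A 2"] show "deriv \<alpha> y = D y * \<alpha> y"
    unfolding \<alpha>_def by (intro DERIV_imp_deriv) simp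
  qed
 qed
 ultimately have "deriv \<alpha> has_fps_expansion fps_deriv \<beta>" "deriv \<alpha> has_fps_expansion (Abs_fps (\<lambda>k. of_real (d k)) * \<beta>)"
  by (auto simp: has_fps_expansion_cong)
 hence fps_eq: "fps_deriv \<beta> = Abs_fps (\<lambda>k. of_real (d k)) * \<beta>" by (rule fps_expansion_unique_complex)
 have \<beta>_rec: "of_nat (Suc k) * fps_nth \<beta> (Suc k) = (\<Sum>i=0..k. of_real (d i) * fps_nth \<beta> (k - i))" for k
  using arg_cong[OF fps_eq, of "\<lambda>F. fps_nth F k"] by (simp add: fps_mult_nth)
 have \<beta>0: "fps_nth \<beta> 0 = 1" unfolding \<beta>_def fps_expansion_def \<alpha>_def using A2 by simp
 have \<beta>_nonneg: "\<exists>b\<ge>0. fps_nth \<beta> k = of_real b" for k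
 proof (induction k rule: less_induct)
  case (less k)
  show ?case
  proof (cases k)
   case 0 thus ?thesis using \<beta>0 by (auto intro!: exI[of _ 1])
  next
   case (Suc m)
   define b where "b = (\<lambda>j. Re (fps_nth \<beta> j))"
   have b: "fps_nth \<beta> j = of_real (b j)" "b j \<ge> 0" if "j \<le> m" for j
    using less[of j] that Suc by (auto simp: b_def)
   have "of_nat (Suc m) * fps_nth \<beta> (Suc m) = of_real (\<Sum>i=0..m. d i * b (m - i))"
    unfolding \<beta>_rec of_real_sum by (intro sum.cong refl) (simp add: b)
   hence "fps_nth \<beta> k = of_real ((\<Sum>i=0..m. d i * b (m - i)) / real (Suc m))"
    unfolding Suc by (simp add: field_simps del: of_nat_Suc)
   moreover have "(\<Sum>i=0..m. d i * b (m - i)) / real (Suc m) \<ge> 0"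
    by (intro divide_nonneg_nonneg sum_nonneg mult_nonneg_nonneg d0 b) auto
   ultimately show ?thesis by blast
  qed
 qed
 define b where "b = (\<lambda>j. Re (fps_nth \<beta> j))"
 have b: "fps_nth \<beta> j = of_real (b j)" "b j \<ge> 0" for j
  using \<beta>_nonneg[of j] by (auto simp: b_def)
 \<comment> \<open>Only the summand \<open>i = k\<close> of the recursion is kept, with
   \<open>b 0 = 1\<close>.\<close>
 have db: "d k \<le> real (Suc k) * b (Suc k)" for k
 proof -
  have "of_real (real (Suc k) * b (Suc k)) = complex_of_real (\<Sum>i=0..k. d i * b (k - i))"
   using \<beta>_rec[of k] unfolding b by simp
  hence eq: "real (Suc k) * b (Suc k) = (\<Sum>i=0..k. d i * b (k - i))" by (simp only: of_real_eq_iff)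
  have "(\<Sum>i\<in>{k}. d i * b (k - i)) \<le> (\<Sum>i=0..k. d i * b (k - i))"
   by (intro sum_mono2 mult_nonneg_nonneg d0 b) auto
  moreover have "b 0 = 1" using \<beta>0 by (simp add: b_def)
  ultimately show ?thesis unfolding eq by simp
 qed
 have "ereal 2 \<le> fps_conv_radius \<beta>"
  unfolding \<beta>_def by (rule conv_radius_fps_expansion) (use \<alpha>_hol in \<open>simp add: eball_def ball_def\<close>)
 also have "\<dots> \<le> fps_conv_radius (fps_deriv \<beta>)" by (rule fps_conv_radius_deriv)
 finally have "ereal (norm (3 / 2 :: complex)) < fps_conv_radius (fps_deriv \<beta>)"
  by (rule less_le_trans[rotated]) simp
 hence "summable (\<lambda>k. norm (fps_nth (fps_deriv \<beta>) k * (3 / 2) ^ k))"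
  by (rule norm_summable_fps)
 moreover have "norm (fps_nth (fps_deriv \<beta>) k * (3 / 2) ^ k) = real (Suc k) * b (Suc k) * (3 / 2) ^ k" for k
  using b[of "Suc k"] by (simp add: norm_mult norm_power norm_divide del: of_nat_Suc)
 ultimately have bs: "summable (\<lambda>k. real (Suc k) * b (Suc k) * (3 / 2) ^ k)" by simp
 have ds: "summable (\<lambda>k. d k * (3 / 2) ^ k)"
  by (rule summable_comparison_test'[OF bs, of 0]) (use d0 db in \<open>auto intro!: mult_right_mono simp del: of_nat_Suc\<close>)
 have "(\<Sum>n\<in>{1..N}. c n / sqrt (real n)) \<le> (\<Sum>k. d k * (3 / 2) ^ k)" for N
 proof -
  have "(\<lambda>k. \<Sum>n\<in>{1..N}. e n k * (3 / 2) ^ k) sums (\<Sum>n\<in>{1..N}. c n * real n powr (3 / 2 - 2))"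
   by (intro sums_sum e_sums) auto
  moreover have "c n * real n powr (3 / 2 - 2) = c n / sqrt (real n)" for n
  proof -
   have "real n powr (3 / 2 - 2) = real n powr - (1 / 2)" by (rule arg_cong[of _ _ "(powr) (real n)"]) simp
   thus ?thesis by (simp only: powr_minus_divide powr_half_sqrt of_nat_0_le_iff times_divide_eq_right mult_1_right)
  qed
  ultimately have s: "(\<lambda>k. \<Sum>n\<in>{1..N}. e n k * (3 / 2) ^ k) sums (\<Sum>n\<in>{1..N}. c n / sqrt (real n))" by simp
  show ?thesis
  proof (rule sums_le[OF _ s summable_sums[OF ds]])
   fix k
   have "(\<Sum>n\<in>{1..N}. e n k) \<le> d k"
    unfolding d_def by (intro finite_sum_le_infsum es e0) auto
   hence "(\<Sum>n\<in>{1..N}. e n k) * (3 / 2) ^ k \<le> d k * (3 / 2) ^ k" by (intro mult_right_mono) auto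
   thus "(\<Sum>n\<in>{1..N}. e n k * (3 / 2) ^ k) \<le> d k * (3 / 2) ^ k" by (simp only: sum_distrib_right)
  qed
 qed
 thus ?thesis by (rule that)
qed

text \<open>The product of \<open>s - 1\<close> and the Riemann zeta function, for
  \<open>Re s > 0\<close>. Each term of the series is corrected by a telescoping difference, with
  total \<open>- 1\<close> where \<open>Re s > 1\<close>, hence the leading 1; this leaves summands
  of order \<open>n powr (- Re s - 1)\<close>.\<close>

definition zeta_cont :: "complex \<Rightarrow> complex" where
 "zeta_cont s = 1 + (\<Sum>n. (s - 1) / of_nat (Suc n) powr s - of_nat (Suc n) powr (1 - s) + of_nat (Suc (Suc n)) powr (1 - s))"

text \<open>The summand is the first-order Taylor remainder of \<open>x powr (1 - s)\<close> between
  two consecutive integers.\<close>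

lemma zeta_cont_term_bound:
 assumes s: "Re s > 0"
 shows "norm ((s - 1) / of_nat (Suc n) powr s - of_nat (Suc n) powr (1 - s) + of_nat (Suc (Suc n)) powr (1 - s))
  \<le> norm (1 - s) * norm s * real (Suc n) powr (- Re s - 1)"
proof -
 define m where "m = real (Suc n)"
 have m: "m \<ge> 1" by (simp add: m_def)
 \<comment> \<open>A real half-line viewed as a convex complex set: on it the modulus of
   \<open>x powr (- s - 1)\<close> is largest at the left end.\<close>
 define S where "S = {z. Re z \<ge> m} \<inter> {z. Im z = 0}"
 define f where "f = (\<lambda>(i::nat) x. if i = 0 then x powr (1 - s) else if i = 1 then (1 - s) * x powr (- s) else (1 - s) * (- s * x powr (- s - 1)))"
 have S_nonpos: "x \<notin> \<real>\<^sub>\<le>\<^sub>0" if "x \<in> S" for x using that m by (auto simp: S_def complex_nonpos_Reals_iff)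
 have "norm (f 0 (of_real (m + 1)) - (\<Sum>i\<le>1. f i (of_real m) * (of_real (m + 1) - of_real m) ^ i / fact i))
   \<le> (norm (1 - s) * norm s * m powr (- Re s - 1)) * norm (complex_of_real (m + 1) - of_real m) ^ Suc 1 / fact 1"
 proof (rule field_Taylor[where S = S])
  show "convex S" unfolding S_def by (intro convex_Int convex_halfspace_Re_ge) (simp add: convex_alt)
  show "complex_of_real m \<in> S" "complex_of_real (m + 1) \<in> S" by (auto simp: S_def)
  fix x assume x: "x \<in> S"
  show "(f i has_field_derivative f (Suc i) x) (at x within S)" if "i \<le> 1" for i
  proof (cases "i = 0")
   case True
   have "((\<lambda>x. x powr (1 - s)) has_field_derivative (1 - s) * x powr (1 - s - 1)) (at x within S)"
    by (rule has_field_derivative_at_within[OF has_field_derivative_powr[OF S_nonpos[OF x]]])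
   thus ?thesis using True by (simp add: f_def)
  next
   case False
   hence i: "i = 1" using that by simp
   have "((\<lambda>x. (1 - s) * x powr (- s)) has_field_derivative (1 - s) * (- s * x powr (- s - 1))) (at x within S)"
    by (rule DERIV_cmult[OF has_field_derivative_at_within[OF has_field_derivative_powr[OF S_nonpos[OF x]]]])
   thus ?thesis using i by (simp add: f_def)
  qed
  have xr: "x \<in> \<real>" "Re x \<ge> m" using x by (auto simp: S_def complex_is_Real_iff)
  have "norm (x powr (- s - 1)) = Re x powr (- Re s - 1)"
   using norm_powr_real_powr[of x "- s - 1"] xr m by simp
  also have "\<dots> \<le> m powr (- Re s - 1)" using xr m s by (intro powr_mono2') auto
  finally show "norm (f (Suc 1) x) \<le> norm (1 - s) * norm s * m powr (- Re s - 1)"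
   by (simp add: f_def norm_mult mult.assoc mult_left_mono)
 qed
 moreover have "f 0 (of_real (m + 1)) - (\<Sum>i\<le>1. f i (of_real m) * (of_real (m + 1) - of_real m) ^ i / fact i) =
   (s - 1) / of_nat (Suc n) powr s - of_nat (Suc n) powr (1 - s) + of_nat (Suc (Suc n)) powr (1 - s)"
 proof -
  have 1: "complex_of_real m = of_nat (Suc n)" "complex_of_real (m + 1) = of_nat (Suc (Suc n))" by (simp_all add: m_def)
  have 2: "of_nat (Suc (Suc n)) - of_nat (Suc n) = (1 :: complex)" by simp
  have "(\<Sum>i\<le>1. f i (of_real m) * (of_real (m + 1) - of_real m) ^ i / fact i) = of_nat (Suc n) powr (1 - s) + (1 - s) * of_nat (Suc n) powr (- s)"
   unfolding 1 2 by (simp add: f_def)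
  thus ?thesis unfolding 1 by (simp add: f_def powr_minus divide_inverse algebra_simps del: of_nat_Suc)
 qed
 ultimately show ?thesis by (simp add: m_def del: of_nat_Suc)
qed

lemma zeta_cont_holomorphic: "zeta_cont holomorphic_on {s. Re s > 0}"
proof (rule holomorphic_uniform_sequence)
 define t where "t = (\<lambda>n s. (s - 1) / of_nat (Suc n) powr s - of_nat (Suc n) powr (1 - s) + of_nat (Suc (Suc n)) powr (1 - s) :: complex)"
 show "open {s. Re s > 0}" by (rule open_halfspace_Re_gt)
 show "(\<lambda>s. 1 + (\<Sum>n<N. t n s)) holomorphic_on {s. Re s > 0}" for N
  unfolding t_def by (intro holomorphic_intros) (auto simp del: of_nat_Suc)
 fix s0 :: complex assume "s0 \<in> {s. Re s > 0}"
 hence s0: "Re s0 > 0" by simp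
 define d where "d = Re s0 / 2"
 define R where "R = norm s0 + d"
 have d: "d > 0" using s0 by (simp add: d_def)
 have cb: "Re s \<ge> d" "norm s \<le> R" if "s \<in> cball s0 d" for s
 proof -
  have n: "norm (s0 - s) \<le> d" using that by (simp add: dist_norm)
  have "Re s0 - Re s \<le> norm (s0 - s)" using complex_Re_le_cmod[of "s0 - s"] by simp
  thus "Re s \<ge> d" using n by (simp add: d_def)
  show "norm s \<le> R" using norm_triangle_ineq4[of s0 "s0 - s"] n by (simp add: R_def)
 qed
 have "uniform_limit (cball s0 d) (\<lambda>N s. \<Sum>n<N. t n s) (\<lambda>s. \<Sum>n. t n s) sequentially"
 proof (rule Weierstrass_m_test)
  have "summable (\<lambda>n. real n powr (- d - 1))" using d by (simp add: summable_real_powr_iff)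
  hence "summable (\<lambda>n. real (Suc n) powr (- d - 1))" by (subst summable_Suc_iff)
  thus "summable (\<lambda>n. (1 + R) * R * real (Suc n) powr (- d - 1))" by (rule summable_mult)
  fix n s assume s: "s \<in> cball s0 d"
  have "norm (t n s) \<le> norm (1 - s) * norm s * real (Suc n) powr (- Re s - 1)"
   unfolding t_def by (rule zeta_cont_term_bound) (use cb(1)[OF s] d in simp)
  also have "\<dots> \<le> (1 + R) * R * real (Suc n) powr (- d - 1)"
  proof -
   have "R \<ge> 0" using cb(2)[OF s] norm_ge_zero[of s] by linarith
   thus ?thesis using cb[OF s] norm_triangle_ineq4[of 1 s]
    by (intro mult_mono powr_mono mult_nonneg_nonneg) auto
  qed
  finally show "norm (t n s) \<le> (1 + R) * R * real (Suc n) powr (- d - 1)" .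
 qed
 hence "uniform_limit (cball s0 d) (\<lambda>N s. 1 + (\<Sum>n<N. t n s)) zeta_cont sequentially"
  unfolding zeta_cont_def t_def by (intro uniform_limit_intros)
 thus "\<exists>d>0. cball s0 d \<subseteq> {s. Re s > 0} \<and> uniform_limit (cball s0 d) (\<lambda>N s. 1 + (\<Sum>n<N. t n s)) zeta_cont sequentially"
  using d cb(1) by (intro exI[of _ d]) fastforce
qed

lemma zeta_cont_eq:
 assumes s: "Re s > 1"
 shows "zeta_cont s = (s - 1) * dseries (\<lambda>_. 1) s"
proof -
 have "(\<lambda>n. 1 / of_nat (n + 1) powr s) sums (dseries (\<lambda>_. 1) s - (\<Sum>i<1. 1 / of_nat i powr s))"
  by (rule sums_split_initial_segment, rule dseries_sums[OF _ s], rule dconv_bounded[of _ 1]) simp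
 hence "(\<lambda>n. (s - 1) * (1 / of_nat (Suc n) powr s)) sums ((s - 1) * dseries (\<lambda>_. 1) s)"
  by (intro sums_mult) simp
 moreover have "(\<lambda>n. of_nat (Suc n) powr (1 - s) :: complex) \<longlonglongrightarrow> 0"
 proof (rule tendsto_norm_zero_cancel)
  have "(\<lambda>n. real n powr (1 - Re s)) \<longlonglongrightarrow> 0"
   using s by (intro tendsto_neg_powr filterlim_real_sequentially) auto
  hence "(\<lambda>n. real (Suc n) powr (1 - Re s)) \<longlonglongrightarrow> 0" by (rule LIMSEQ_Suc)
  moreover have "norm (of_nat (Suc n) powr (1 - s) :: complex) = real (Suc n) powr (1 - Re s)" for n
   using norm_powr_real_powr[of "of_nat (Suc n)" "1 - s"] by (simp del: of_nat_Suc)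
  ultimately show "(\<lambda>n. norm (of_nat (Suc n) powr (1 - s) :: complex)) \<longlonglongrightarrow> 0" by (simp only:)
 qed
 hence "(\<lambda>n. of_nat (Suc (Suc n)) powr (1 - s) - of_nat (Suc n) powr (1 - s) :: complex) sums (0 - of_nat (Suc 0) powr (1 - s))"
  by (rule telescope_sums)
 ultimately have sm: "(\<lambda>n. (s - 1) * (1 / of_nat (Suc n) powr s) + (of_nat (Suc (Suc n)) powr (1 - s) - of_nat (Suc n) powr (1 - s))) sums
   ((s - 1) * dseries (\<lambda>_. 1) s + (0 - of_nat (Suc 0) powr (1 - s)))"
  by (rule sums_add)
 have eq: "(s - 1) * (1 / of_nat (Suc n) powr s) + (of_nat (Suc (Suc n)) powr (1 - s) - of_nat (Suc n) powr (1 - s)) =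
   (s - 1) / of_nat (Suc n) powr s - of_nat (Suc n) powr (1 - s) + of_nat (Suc (Suc n)) powr (1 - s)" for n
  by simp
 show ?thesis unfolding zeta_cont_def sums_unique[OF sm[unfolded eq], symmetric] by simp
qed

lemma cnj_powr_of_nat: "cnj (of_nat n powr s) = of_nat n powr cnj s"
proof (cases "n = 0")
 case False
 hence "Ln (of_nat n) = complex_of_real (ln (real n))" using Ln_of_real[of "real n"] by simp
 thus ?thesis using False by (simp add: powr_def exp_cnj)
qed simp

lemma dseries_cnj:
 assumes c: "dconv c" and s: "Re s > 1"
 shows "dseries (\<lambda>n. cnj (c n)) s = cnj (dseries c (cnj s))"
proof -
 have "(\<lambda>n. cnj (c n / of_nat n powr cnj s)) sums cnj (dseries c (cnj s))"
  using dseries_sums[OF c, of "cnj s"] s by (subst sums_cnj) simp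
 thus ?thesis unfolding dseries_def complex_cnj_divide cnj_powr_of_nat complex_cnj_cnj by (simp add: sums_iff)
qed

text \<open>The weight \<open>2 + 2 * Re (w p)\<close> may vanish at many primes, namely where
  \<open>w p = - 1\<close>; there the squares of primes compensate. With \<open>x = Re (w p)\<close>
  one has \<open>Re (w (p\<^sup>2)) = 2 * x\<^sup>2 - 1\<close>, and
  \<open>(2 + 2 * x) + 4 * x\<^sup>2 \<ge> 1\<close>. A bounded sum would therefore bound the sum of
  \<open>mang p / p\<close> over the primes, against Mertens. The prime \<open>q\<close> is exempt,
  as \<open>w q\<close> may be 0.\<close>

lemma prime_weights_unbounded:
 fixes w :: "nat \<Rightarrow> complex"
 assumes w: "\<And>n. norm (w n) \<le> 1" and wp: "\<And>p. prime p \<Longrightarrow> p \<noteq> q \<Longrightarrow> norm (w p) = 1" and wm: "\<And>m n. w (m * n) = w m * w n"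
  and K: "\<And>N. (\<Sum>n\<in>{1..N}. mang n * (2 + 2 * Re (w n)) / sqrt (real n)) \<le> K"
 shows False
proof -
 define c where "c = (\<lambda>n. mang n * (2 + 2 * Re (w n)))"
 have c0: "c n \<ge> 0" for n
  using abs_Re_le_cmod[of "w n"] w[of n] unfolding c_def by (intro mult_nonneg_nonneg mangoldt_nonneg) auto
 obtain C where C: "\<And>N. (\<Sum>n\<in>{n\<in>{1..N}. primepow n \<and> \<not> prime n}. (ln (real n))\<^sup>2 / real n) \<le> C"
  by (rule prime_powers_ln_sum_bounded) blast
 have bound: "ln (real N) \<le> 4 + K + mang q / real q + C" if N: "N \<ge> 1" for N :: nat
 proof -
  define P where "P = {p\<in>{1..N}. prime p \<and> p \<noteq> q}"
  define Q where "Q = {n\<in>{1..N}. primepow n \<and> \<not> prime n}"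
  have finP: "finite P" by (simp add: P_def)
  have pt: "mang p / real p \<le> c p / sqrt (real p) + c (p\<^sup>2) / sqrt (real (p\<^sup>2))" if p: "p \<in> P" for p
  proof -
   have pr: "prime p" "p \<noteq> q" using p by (auto simp: P_def)
   have p0: "real p \<ge> 1" using prime_gt_0_nat[OF pr(1)] by simp
   have l: "mang p = ln (real p)" "mang (p\<^sup>2) = ln (real p)"
    using pr(1) by (simp_all add: mangoldt_def primepow_prime_power aprimedivisor_prime_power)
   have l0: "ln (real p) \<ge> 0" using p0 by simp
   define x where "x = Re (w p)"
   have "(Re (w p))\<^sup>2 + (Im (w p))\<^sup>2 = 1" using wp[OF pr] cmod_power2[of "w p"] by simp
   hence re: "Re (w (p\<^sup>2)) = 2 * x\<^sup>2 - 1" by (simp add: power2_eq_square wm x_def)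
   have x1: "2 + 2 * x \<ge> 0" using abs_Re_le_cmod[of "w p"] w[of p] by (simp add: x_def)
   have "sqrt (real p) \<le> real p" using p0 by (intro real_le_lsqrt) (auto simp: power2_eq_square)
   hence "ln (real p) * (2 + 2 * x) / real p \<le> ln (real p) * (2 + 2 * x) / sqrt (real p)"
    using p0 l0 x1 by (intro divide_left_mono mult_nonneg_nonneg) auto
   moreover have "ln (real p) * 1 / real p \<le> ln (real p) * ((2 + 2 * x) + 4 * x\<^sup>2) / real p"
   proof (intro divide_right_mono mult_left_mono l0)
    have "(2 * x + 1 / 2)\<^sup>2 \<ge> 0" by simp
    hence "0 \<le> 4 * x\<^sup>2 + 2 * x + 1 / 4" by (simp add: power2_eq_square algebra_simps)
    thus "1 \<le> (2 + 2 * x) + 4 * x\<^sup>2" by simp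
   qed (use p0 in auto)
   moreover have "c p / sqrt (real p) = ln (real p) * (2 + 2 * x) / sqrt (real p)" by (simp add: c_def l x_def)
   moreover have "c (p\<^sup>2) / sqrt (real (p\<^sup>2)) = ln (real p) * (4 * x\<^sup>2) / real p"
    unfolding c_def l re by simp
   moreover have "ln (real p) * ((2 + 2 * x) + 4 * x\<^sup>2) / real p = ln (real p) * (2 + 2 * x) / real p + ln (real p) * (4 * x\<^sup>2) / real p"
    by (simp only: add_divide_distrib[symmetric] distrib_left[symmetric])
   ultimately show ?thesis unfolding l(1) by linarith
  qed
  have inj: "inj_on (\<lambda>p::nat. p\<^sup>2) P" by (auto simp: inj_on_def power2_eq_iff)
  have disj: "P \<inter> (\<lambda>p. p\<^sup>2) ` P = {}" by (auto simp: P_def prime_power_iff)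
  have "(\<Sum>p\<in>P. mang p / real p) \<le> (\<Sum>p\<in>P. c p / sqrt (real p)) + (\<Sum>p\<in>P. c (p\<^sup>2) / sqrt (real (p\<^sup>2)))"
   unfolding sum.distrib[symmetric] by (intro sum_mono pt)
  also have "(\<Sum>p\<in>P. c (p\<^sup>2) / sqrt (real (p\<^sup>2))) = (\<Sum>n\<in>(\<lambda>p. p\<^sup>2) ` P. c n / sqrt (real n))"
   by (subst sum.reindex[OF inj]) (simp add: o_def)
  also have "(\<Sum>p\<in>P. c p / sqrt (real p)) + (\<Sum>n\<in>(\<lambda>p. p\<^sup>2) ` P. c n / sqrt (real n)) = (\<Sum>n\<in>P \<union> (\<lambda>p. p\<^sup>2) ` P. c n / sqrt (real n))"
   using finP disj by (intro sum.union_disjoint[symmetric]) auto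
  also have "\<dots> \<le> (\<Sum>n\<in>{1..N\<^sup>2}. c n / sqrt (real n))"
  proof (rule sum_mono2)
   have "p \<le> N\<^sup>2" "1 \<le> p\<^sup>2" "p\<^sup>2 \<le> N\<^sup>2" if "p \<in> P" for p
   proof -
    have "1 \<le> p" "p \<le> N" using that by (auto simp: P_def)
    thus "1 \<le> p\<^sup>2" "p\<^sup>2 \<le> N\<^sup>2" by (auto intro: power_mono)
    have "p * 1 \<le> N * N" using \<open>p \<le> N\<close> N by (intro mult_mono) auto
    thus "p \<le> N\<^sup>2" by (simp add: power2_eq_square)
   qed
   thus "P \<union> (\<lambda>p. p\<^sup>2) ` P \<subseteq> {1..N\<^sup>2}" by (auto simp: P_def)
  qed (auto intro!: divide_nonneg_nonneg c0)
  also have "\<dots> \<le> K" using K[of "N\<^sup>2"] by (simp add: c_def)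
  finally have PK: "(\<Sum>p\<in>P. mang p / real p) \<le> K" .
  have QC: "(\<Sum>n\<in>Q. mang n / real n) \<le> C"
  proof (rule order_trans[OF sum_mono C[of N, folded Q_def]])
   fix n assume n: "n \<in> Q"
   have n1: "n \<ge> 1" and np: "primepow n" "\<not> prime n" using n by (auto simp: Q_def)
   have "n \<noteq> 1" "n \<noteq> 2" "n \<noteq> 3" using np by auto
   hence "n \<ge> 4" using n1 by linarith
   have "exp 1 \<le> (3 :: real)" by (rule exp_le)
   hence "ln (exp 1) \<le> ln (real n)" using \<open>n \<ge> 4\<close> by (subst ln_le_cancel_iff) auto
   hence "ln (real n) * 1 \<le> ln (real n) * ln (real n)" by (intro mult_left_mono) auto
   moreover have "mang n \<le> ln (real n)" using n1 by (intro mangoldt_le_ln) simp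
   ultimately show "mang n / real n \<le> (ln (real n))\<^sup>2 / real n"
    by (intro divide_right_mono) (auto simp: power2_eq_square)
  qed
  have "(\<Sum>n=1..N. mang n / real n) \<le> (\<Sum>n\<in>P \<union> Q \<union> {q}. mang n / real n)"
  proof -
   have z: "mang n / real n = 0" if "n \<in> {1..N} - (P \<union> Q \<union> {q})" for n
   proof -
    have "\<not> primepow n" using that by (auto simp: P_def Q_def)
    thus ?thesis by (simp add: mangoldt_def)
   qed
   have "(\<Sum>n=1..N. mang n / real n) = (\<Sum>n\<in>{1..N} \<inter> (P \<union> Q \<union> {q}). mang n / real n)"
    by (rule sum.mono_neutral_right) (use z in auto)
   also have "\<dots> \<le> (\<Sum>n\<in>P \<union> Q \<union> {q}. mang n / real n)"
    by (rule sum_mono2) (auto simp: P_def Q_def intro!: divide_nonneg_nonneg mangoldt_nonneg)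
   finally show ?thesis .
  qed
  also have "\<dots> \<le> (\<Sum>n\<in>P. mang n / real n) + (\<Sum>n\<in>Q. mang n / real n) + (\<Sum>n\<in>{q}. mang n / real n)"
  proof -
   have nn: "mang n / real n \<ge> 0" for n by (intro divide_nonneg_nonneg mangoldt_nonneg) auto
   have fin: "finite P" "finite Q" by (auto simp: P_def Q_def)
   have "(\<Sum>n\<in>P \<union> Q \<union> {q}. mang n / real n) \<le> (\<Sum>n\<in>P \<union> Q. mang n / real n) + (\<Sum>n\<in>{q}. mang n / real n)"
    using fin nn by (subst sum_Un) (auto intro!: sum_nonneg)
   moreover have "(\<Sum>n\<in>P \<union> Q. mang n / real n) \<le> (\<Sum>n\<in>P. mang n / real n) + (\<Sum>n\<in>Q. mang n / real n)"
    using fin nn by (subst sum_Un) (auto intro!: sum_nonneg)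
   ultimately show ?thesis by linarith
  qed
  finally show ?thesis using Mertens_first[OF N] PK QC by simp
 qed
 define B where "B = 4 + K + mang q / real q + C"
 obtain N :: nat where N: "real N > exp B" using reals_Archimedean2 by blast
 hence N1: "N \<ge> 1" using exp_gt_zero[of B] by (cases N) auto
 have "ln (exp B) < ln (real N)" using N N1 by (subst ln_less_cancel_iff) auto
 thus False using bound[OF N1] by (simp add: B_def)
qed

text \<open>A zero of \<open>M\<close> at 1 is shared by the conjugate function, and together they
  cancel the double pole of the squared zeta function, so \<open>A\<close> is holomorphic on
  \<open>Re s > 0\<close>. The logarithmic derivative of \<open>A\<close> has coefficients
  \<open>- mang n * (2 + 2 * Re (w n))\<close>, all of one sign; hence
  \<open>landau_nonneg_coeffs\<close> bounds a sum that \<open>prime_weights_unbounded\<close>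
  forbids to be bounded.\<close>

lemma multiplicative_nonvanishing:
 fixes w :: "nat \<Rightarrow> complex"
 assumes w: "\<And>n. norm (w n) \<le> 1" and wm: "\<And>m n. w (m * n) = w m * w n" and w1: "w 1 = 1"
  and wp: "\<And>p. prime p \<Longrightarrow> p \<noteq> q \<Longrightarrow> norm (w p) = 1"
  and M: "M holomorphic_on UNIV" and Mw: "\<And>s. Re s > 1 \<Longrightarrow> M s = dseries w s"
 shows "M 1 \<noteq> 0"
proof
 assume M1: "M 1 = 0"
 define U where "U = {s :: complex. Re s > 1}"
 have U: "open U" unfolding U_def by (rule open_halfspace_Re_gt)
 define l where "l = (\<lambda>z. if z = 1 then deriv M 1 else M z / (z - 1))"
 have l: "l holomorphic_on UNIV"
  by (rule pole_theorem_open_0[OF M open_UNIV, where a = 1]) (auto simp: l_def M1)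
 have Ml: "M z = (z - 1) * l z" for z using M1 by (simp add: l_def)
 have l2: "(\<lambda>z. cnj (l (cnj z))) holomorphic_on UNIV"
  using holomorphic_on_compose_cnj_cnj[of l UNIV] l by (simp add: o_def holomorphic_on_subset)
 define A where "A = (\<lambda>s. (zeta_cont s)\<^sup>2 * l s * cnj (l (cnj s)))"
 define v where "v = (\<lambda>n. cnj (w n))"
 define u where "u = (\<lambda>_ :: nat. 1 :: complex)"
 have v: "norm (v n) \<le> 1" "v (m * n) = v m * v n" "v 1 = 1" for m n using w wm w1 by (auto simp: v_def)
 have u: "norm (u n) \<le> 1" "u (m * n) = u m * u n" "u 1 = 1" for m n by (auto simp: u_def)
 have cw: "dconv w" and cv: "dconv v" and cu: "dconv u"
  by (rule dconv_bounded[of _ 1]; use w v u in blast)+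
 have A_eq: "A s = (dseries u s)\<^sup>2 * dseries w s * dseries v s" if s: "s \<in> U" for s
 proof -
  have s1: "Re s > 1" "Re (cnj s) > 1" using s by (auto simp: U_def)
  have "dseries v s = cnj (M (cnj s))" unfolding v_def by (simp add: dseries_cnj[OF cw s1(1)] Mw[OF s1(2)])
  hence "dseries v s = (s - 1) * cnj (l (cnj s))" unfolding Ml by simp
  moreover have "dseries w s = (s - 1) * l s" using Mw[OF s1(1)] unfolding Ml by simp
  moreover have "zeta_cont s = (s - 1) * dseries u s" unfolding u_def by (rule zeta_cont_eq[OF s1(1)])
  ultimately show ?thesis by (simp add: A_def power2_eq_square mult_ac)
 qed
 define c where "c = (\<lambda>n. mang n * (2 + 2 * Re (w n)))"
 have c_eq: "complex_of_real (c n) = 2 * (of_real (mang n) * u n) + (of_real (mang n) * w n + of_real (mang n) * v n)" for n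
  unfolding c_def u_def v_def by (simp add: complex_eq_iff algebra_simps del: of_real_mangoldt)
 have dm: "dconv (\<lambda>n. of_real (mang n) * x n)" if "dconv x" for x by (rule dconv_mangoldt[OF that])
 have cc: "dconv (\<lambda>n. of_real (c n))"
 proof -
  have "dconv (\<lambda>n. of_real (mang n) * of_real (2 + 2 * Re (w n)))"
  proof (rule dm, rule dconv_bounded)
   fix n show "norm (complex_of_real (2 + 2 * Re (w n))) \<le> 4"
    unfolding norm_of_real using abs_Re_le_cmod[of "w n"] w[of n] by simp
  qed
  thus ?thesis unfolding c_def of_real_mult .
 qed
 have D_eq: "dseries (\<lambda>n. of_real (c n)) s = 2 * dseries (\<lambda>n. of_real (mang n) * u n) s +
   (dseries (\<lambda>n. of_real (mang n) * w n) s + dseries (\<lambda>n. of_real (mang n) * v n) s)" if s: "Re s > 1" for s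
 proof (rule sums_unique2[OF dseries_sums[OF cc s]])
  show "(\<lambda>n. of_real (c n) / of_nat n powr s) sums (2 * dseries (\<lambda>n. of_real (mang n) * u n) s +
   (dseries (\<lambda>n. of_real (mang n) * w n) s + dseries (\<lambda>n. of_real (mang n) * v n) s))"
   unfolding c_eq add_divide_distrib times_divide_eq_right[symmetric]
   by (intro sums_add sums_mult) (auto intro!: dseries_sums dm cu cw cv s simp del: of_real_mangoldt simp: times_divide_eq_right)
 qed
 obtain K where K: "\<And>N. (\<Sum>n\<in>{1..N}. c n / sqrt (real n)) \<le> K"
 proof (rule landau_nonneg_coeffs[of c A])
  show "c n \<ge> 0" for n
   using abs_Re_le_cmod[of "w n"] w[of n] unfolding c_def by (intro mult_nonneg_nonneg mangoldt_nonneg) auto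
  show "dconv (\<lambda>n. of_real (c n))" by (rule cc)
  show "A holomorphic_on {s. Re s > 0}"
   unfolding A_def using zeta_cont_holomorphic holomorphic_on_subset[OF l] holomorphic_on_subset[OF l2]
   by (intro holomorphic_intros) auto
  have "dseries u 2 \<noteq> 0" "dseries w 2 \<noteq> 0" "dseries v 2 \<noteq> 0"
   by (rule dseries_nonzero; use u w wm w1 v in auto)+
  thus "A 2 \<noteq> 0" by (subst A_eq) (auto simp: U_def)
  fix s :: complex assume s: "Re s > 1"
  have sU: "s \<in> U" using s by (simp add: U_def)
  have "((\<lambda>s. (dseries u s)\<^sup>2 * dseries w s * dseries v s) has_field_derivative - (dseries (\<lambda>n. of_real (c n)) s * A s)) (at s)"
   unfolding A_eq[OF sU] D_eq[OF s]
   by (rule derivative_eq_intros dseries_logderiv[OF u(1,2) s] dseries_logderiv[OF w wm s] dseries_logderiv[OF v(1,2) s] refl)+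
     (simp add: algebra_simps power2_eq_square del: of_real_mangoldt)
  thus "(A has_field_derivative - (dseries (\<lambda>n. of_real (c n)) s * A s)) (at s)"
   by (rule has_field_derivative_transform_within_open[OF _ U sU]) (simp add: A_eq)
 qed blast
 show False by (rule prime_weights_unbounded[OF w wp wm K[unfolded c_def]])
qed

section \<open>The explicit formula\<close>

text \<open>The zeros form a countable set without a preferred order, so the theorem on series of
  integrals is transported along \<open>from_nat_into\<close>.\<close>

lemma has_sum_lebesgue_integral:
 fixes f :: "'i \<Rightarrow> real \<Rightarrow> complex"
 assumes A: "countable A" and int: "\<And>x. x \<in> A \<Longrightarrow> integrable lborel (f x)"
  and abs: "\<And>t. (\<lambda>x. f x t) summable_on A"
  and sm: "(\<lambda>x. LBINT t. norm (f x t)) summable_on A"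
 shows "integrable lborel (\<lambda>t. \<Sum>\<^sub>\<infinity>x\<in>A. f x t)"
  "((\<lambda>x. LBINT t. f x t) has_sum (LBINT t. (\<Sum>\<^sub>\<infinity>x\<in>A. f x t))) A"
proof -
 have "integrable lborel (\<lambda>t. \<Sum>\<^sub>\<infinity>x\<in>A. f x t) \<and> ((\<lambda>x. LBINT t. f x t) has_sum (LBINT t. (\<Sum>\<^sub>\<infinity>x\<in>A. f x t))) A"
 proof (cases "finite A")
  case True
  have "(LBINT t. (\<Sum>x\<in>A. f x t)) = (\<Sum>x\<in>A. LBINT t. f x t)"
   by (rule Bochner_Integration.integral_sum) (rule int)
  moreover have "integrable lborel (\<lambda>t. \<Sum>x\<in>A. f x t)" by (rule Bochner_Integration.integrable_sum) (rule int)
  ultimately show ?thesis using True has_sum_finite[OF True, of "\<lambda>x. LBINT t. f x t"] by simp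
 next
  case False
  define e where "e = from_nat_into A"
  have e: "bij_betw e UNIV A" unfolding e_def by (rule bij_betw_from_nat_into[OF A False])
  have eA: "e n \<in> A" for n using e by (auto simp: bij_betw_def)
  have inj: "inj_on e UNIV" and im: "e ` UNIV = A" using e by (auto simp: bij_betw_def)
  have re: "(g has_sum s) A \<longleftrightarrow> ((\<lambda>n. g (e n)) has_sum s) UNIV" for g :: "'i \<Rightarrow> complex" and s
   using has_sum_reindex[OF inj, of g s] unfolding im o_def .
  have rs: "g summable_on A \<longleftrightarrow> (\<lambda>n. g (e n)) summable_on UNIV" for g :: "'i \<Rightarrow> real"
   using summable_on_reindex[OF inj, of g] unfolding im o_def .
  have pw: "summable (\<lambda>n. norm (f (e n) t))" for t
  proof -
   have "(\<lambda>x. norm (f x t)) summable_on A" by (rule iffD1[OF summable_on_iff_abs_summable_on_complex abs])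
   thus ?thesis unfolding rs by (subst (asm) summable_on_UNIV_nonneg_real_iff) auto
  qed
  have si: "summable (\<lambda>n. LBINT t. norm (f (e n) t))"
   using sm unfolding rs by (subst (asm) summable_on_UNIV_nonneg_real_iff) (auto intro: Bochner_Integration.integral_nonneg)
  have ie: "integrable lborel (f (e n))" for n by (rule int[OF eA])
  have eq: "(\<Sum>n. f (e n) t) = (\<Sum>\<^sub>\<infinity>x\<in>A. f x t)" for t
  proof -
   have "((\<lambda>n. f (e n) t) has_sum (\<Sum>n. f (e n) t)) UNIV"
    by (rule norm_summable_imp_has_sum[OF pw summable_sums[OF summable_norm_cancel[OF pw]]])
   hence "((\<lambda>x. f x t) has_sum (\<Sum>n. f (e n) t)) A" unfolding re .
   thus ?thesis by (rule infsumI[symmetric])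
  qed
  have "(\<lambda>n. LBINT t. f (e n) t) sums (LBINT t. (\<Sum>n. f (e n) t))"
   by (rule sums_integral[OF ie AE_I2[OF pw] si])
  moreover have "summable (\<lambda>n. norm (LBINT t. f (e n) t))"
   by (rule summable_comparison_test'[OF si, of 0]) (simp add: integral_norm_bound)
  ultimately have "((\<lambda>n. LBINT t. f (e n) t) has_sum (LBINT t. (\<Sum>n. f (e n) t))) UNIV"
   by (intro norm_summable_imp_has_sum)
  moreover have "integrable lborel (\<lambda>t. \<Sum>n. f (e n) t)"
   by (rule integrable_suminf[OF ie AE_I2[OF pw] si])
  ultimately show ?thesis unfolding re eq by blast
 qed
 thus "integrable lborel (\<lambda>t. \<Sum>\<^sub>\<infinity>x\<in>A. f x t)"
  "((\<lambda>x. LBINT t. f x t) has_sum (LBINT t. (\<Sum>\<^sub>\<infinity>x\<in>A. f x t))) A" by auto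
qed

section \<open>Line integrals and residues in a vertical strip\<close>

lemma integrable_line_decay:
 fixes K :: "complex \<Rightarrow> complex"
 assumes d: "delta > 0" and cont: "continuous_on UNIV (\<lambda>t. K (Complex x t))"
  and bd: "\<And>t. norm (K (Complex x t)) \<le> C * (1 + \<bar>t\<bar>) powr (- 1 - delta)"
 shows "integrable lborel (\<lambda>t. K (Complex x t))"
proof (rule Bochner_Integration.integrable_bound)
 show "integrable lborel (\<lambda>t. C * (1 + \<bar>t\<bar>) powr (- 1 - delta))"
  by (intro integrable_mult_right integrable_powr_decay d)
 show "(\<lambda>t. K (Complex x t)) \<in> borel_measurable lborel"
  using borel_measurable_continuous_onI[OF cont] by simp
 show "AE t in lborel. norm (K (Complex x t)) \<le> norm (C * (1 + \<bar>t\<bar>) powr (- 1 - delta))"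
  using bd order_trans[OF _ abs_ge_self] by (intro AE_I2) (auto simp: real_norm_def)
qed

lemma powr_decay_tendsto_0:
 assumes "delta > (0::real)"
 shows "((\<lambda>T. C * (1 + T) powr (- 1 - delta)) \<longlongrightarrow> 0) at_top"
proof -
 have "filterlim (\<lambda>T::real. 1 + T) at_top at_top" by (rule filterlim_tendsto_add_at_top[OF tendsto_const filterlim_ident])
 hence "((\<lambda>T. (1 + T) powr (- 1 - delta)) \<longlongrightarrow> 0) at_top"
  using assms by (intro tendsto_neg_powr) auto
 from tendsto_mult_left[OF this, of C] show ?thesis by simp
qed

lemma continuous_on_line: "continuous_on UNIV (\<lambda>t. Complex x t)"
 unfolding Complex_eq by (intro continuous_intros)

lemma strip_shift:
 fixes K :: "complex \<Rightarrow> complex"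
 assumes ab: "a < b" and d: "delta > 0" and U: "open U" "{s. a \<le> Re s \<and> Re s \<le> b} \<subseteq> U" and hol: "K holomorphic_on U"
  and bd: "\<And>s. a \<le> Re s \<Longrightarrow> Re s \<le> b \<Longrightarrow> norm (K s) \<le> C * (1 + \<bar>Im s\<bar>) powr (- 1 - delta)"
 shows "(LBINT t. K (Complex a t)) = (LBINT t. K (Complex b t))"
proof -
 define S where "S = {s. a \<le> Re s \<and> Re s \<le> b}"
 have cS: "convex S"
  unfolding S_def Collect_conj_eq by (intro convex_Int convex_halfspace_Re_ge convex_halfspace_Re_le)
 have holS: "K holomorphic_on S" using hol U(2) unfolding S_def by (rule holomorphic_on_subset)
 have int: "integrable lborel (\<lambda>t. K (Complex x t))" if x: "a \<le> x" "x \<le> b" for x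
 proof (rule integrable_line_decay[OF d])
  show "continuous_on UNIV (\<lambda>t. K (Complex x t))"
   by (rule continuous_on_compose2[OF holomorphic_on_imp_continuous_on[OF holS] continuous_on_line]) (use x in \<open>auto simp: S_def\<close>)
  show "norm (K (Complex x t)) \<le> C * (1 + \<bar>t\<bar>) powr (- 1 - delta)" for t
   using bd[of "Complex x t"] x by simp
 qed
 have "0 = \<i> * ((LBINT t. K (Complex b t)) - (LBINT t. K (Complex a t)))"
 proof (rule strip_contour_limit[where ?T0.0 = 0 and B = "\<lambda>T. C * (1 + T) powr (- 1 - delta)", OF ab])
  fix T :: real assume T: "T \<ge> 0"
  show "(K has_contour_integral 0) (rectpath (Complex a (- T)) (Complex b T))"
  proof (rule Cauchy_theorem_convex_simple[OF holS cS])
   have "path_image (rectpath (Complex a (- T)) (Complex b T)) \<subseteq> cbox (Complex a (- T)) (Complex b T)"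
    using ab T by (intro path_image_rectpath_subset_cbox) auto
   thus "path_image (rectpath (Complex a (- T)) (Complex b T)) \<subseteq> S" by (auto simp: S_def in_cbox_complex_iff)
  qed auto
  show "norm (K (Complex x t)) \<le> C * (1 + \<bar>t\<bar>) powr (- 1 - delta)" if "a \<le> x" "x \<le> b" for x t
   using bd[of "Complex x t"] that by simp
 qed (use ab in \<open>auto intro: int powr_decay_tendsto_0[OF d]\<close>)
 thus ?thesis by simp
qed

text \<open>One pole at a time: the rectangle only has to reach height
  \<open>\<bar>Im rho\<bar> + 1\<close>, from where on \<open>1 / (s - rho)\<close> is at most 1 in
  modulus on the horizontal sides.\<close>

lemma strip_residue:
 fixes G :: "complex \<Rightarrow> complex"
 assumes d: "delta > 0" and hol: "G holomorphic_on UNIV"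
  and bd: "\<And>s. - 1 \<le> Re s \<Longrightarrow> Re s \<le> 2 \<Longrightarrow> norm (G s) \<le> C * (1 + \<bar>Im s\<bar>) powr (- 1 - delta)"
  and r: "0 < Re rho" "Re rho < 1"
 shows "integrable lborel (\<lambda>t. G (Complex 2 t) / (Complex 2 t - rho))" "integrable lborel (\<lambda>t. G (Complex (- 1) t) / (Complex (- 1) t - rho))"
  "2 * of_real pi * G rho = (LBINT t. G (Complex 2 t) / (Complex 2 t - rho)) - (LBINT t. G (Complex (- 1) t) / (Complex (- 1) t - rho))"
proof -
 define K where "K = (\<lambda>s. G s / (s - rho))"
 have C0: "C \<ge> 0" using bd[of 0] by (intro order_trans[OF norm_ge_zero[of "G 0"]]) simp
 have Kb: "norm (K s) \<le> C * (1 + \<bar>Im s\<bar>) powr (- 1 - delta)" if "- 1 \<le> Re s" "Re s \<le> 2" "norm (s - rho) \<ge> 1" for s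
 proof -
  have "norm (K s) \<le> norm (G s) / 1" unfolding K_def norm_divide using that by (intro divide_left_mono) auto
  thus ?thesis using bd[OF that(1,2)] by simp
 qed
 have int: "integrable lborel (\<lambda>t. K (Complex x t))" if x: "x = 2 \<or> x = - 1" for x
 proof (rule integrable_line_decay[OF d])
  have 1: "1 \<le> norm (Complex x t - rho)" for t
   using abs_Re_le_cmod[of "Complex x t - rho"] x r by auto
  show "continuous_on UNIV (\<lambda>t. K (Complex x t))"
   unfolding K_def
  proof (intro continuous_intros continuous_on_line)
   show "continuous_on UNIV (\<lambda>t. G (Complex x t))"
    by (rule continuous_on_compose2[OF holomorphic_on_imp_continuous_on[OF hol] continuous_on_line]) simp
   show "\<forall>t\<in>UNIV. Complex x t - rho \<noteq> 0" using 1 by (metis norm_zero not_one_le_zero)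
  qed
  show "norm (K (Complex x t)) \<le> C * (1 + \<bar>t\<bar>) powr (- 1 - delta)" for t
   using Kb[of "Complex x t"] x 1[of t] by auto
 qed
 show "integrable lborel (\<lambda>t. G (Complex 2 t) / (Complex 2 t - rho))" "integrable lborel (\<lambda>t. G (Complex (- 1) t) / (Complex (- 1) t - rho))"
  using int[of 2] int[of "- 1"] by (auto simp: K_def)
 have "2 * of_real pi * \<i> * G rho = \<i> * ((LBINT t. K (Complex 2 t)) - (LBINT t. K (Complex (- 1) t)))"
 proof (rule strip_contour_limit[where ?T0.0 = "\<bar>Im rho\<bar> + 1" and B = "\<lambda>T. C * (1 + T) powr (- 1 - delta)"])
  fix T :: real assume T: "T \<ge> \<bar>Im rho\<bar> + 1"
  have box: "rho \<in> box (Complex (- 1) (- T)) (Complex 2 T)" using T r by (auto simp: in_box_complex_iff)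
  have "path_image (rectpath (Complex (- 1) (- T)) (Complex 2 T)) \<inter> box (Complex (- 1) (- T)) (Complex 2 T) = {}"
   using T by (intro path_image_rectpath_inter_box) auto
  hence "path_image (rectpath (Complex (- 1) (- T)) (Complex 2 T)) \<subseteq> UNIV - {rho}" using box by blast
  thus "(K has_contour_integral 2 * of_real pi * \<i> * G rho) (rectpath (Complex (- 1) (- T)) (Complex 2 T))"
   using Cauchy_integral_formula_convex_simple[OF convex_UNIV hol, of rho "rectpath (Complex (- 1) (- T)) (Complex 2 T)"]
   by (simp add: K_def winding_number_rectpath[OF box] mult_ac)
 next
  fix x t :: real assume x: "- 1 \<le> x" "x \<le> 2" "\<bar>t\<bar> \<ge> \<bar>Im rho\<bar> + 1"
  have "norm (Complex x t - rho) \<ge> 1" using abs_Im_le_cmod[of "Complex x t - rho"] x(3) by simp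
  thus "norm (K (Complex x t)) \<le> C * (1 + \<bar>t\<bar>) powr (- 1 - delta)" using Kb[of "Complex x t"] x by simp
 qed (auto intro: int powr_decay_tendsto_0[OF d])
 thus "2 * of_real pi * G rho = (LBINT t. G (Complex 2 t) / (Complex 2 t - rho)) - (LBINT t. G (Complex (- 1) t) / (Complex (- 1) t - rho))"
  by (simp add: K_def mult.assoc)
qed

text \<open>The two terms combine to \<open>(2 * s - 1) / ((s - rho) * (s - (1 - rho)))\<close>, of
  order \<open>x / (y * G)\<close>. The factor \<open>1 / G\<close> alone would leave the sum over
  zeros at the border of convergence; \<open>G \<le> x * y\<close> trades a little of the decay in
  \<open>t\<close> for an extra power \<open>eps\<close> of \<open>norm rho\<close>.\<close>

lemma zero_kernel_bound:
 fixes delta t \<gamma> :: real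
 assumes d: "delta > 0" "delta \<le> 1" and r: "0 < Re rho" "Re rho < 1"
 defines "eps \<equiv> delta / 4" and "eta \<equiv> delta / 2"
 shows "(1 + \<bar>t\<bar>) powr (- 1 - delta) * norm (1 / (Complex 2 t - rho) - 1 / (Complex (- 1) (- t) - rho)) \<le>
  48 * (1 + norm rho) powr (- 1 - eps) * ((1 + \<bar>t\<bar>) powr (- 1 - eta) + (1 + \<bar>t - Im rho\<bar>) powr (- 1 - eta) + (1 + \<bar>t + Im rho\<bar>) powr (- 1 - eta))"
proof -
 define g where "g = Im rho"
 define s where "s = Complex 2 t"
 define x where "x = 1 + \<bar>t\<bar>"
 define y where "y = 1 + \<bar>\<bar>t\<bar> - \<bar>g\<bar>\<bar>"
 define G where "G = 1 + \<bar>g\<bar>"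
 have pos: "x \<ge> 1" "y \<ge> 1" "G \<ge> 1" by (auto simp: x_def y_def G_def)
 have half: "(1 + \<bar>v\<bar>) / 2 \<le> norm z" if "Im z = v" "Re z \<ge> 1" for z v
  using that abs_Im_le_cmod[of z] complex_Re_le_cmod[of z] by (simp add: field_simps)
 have n1: "norm (s - rho) \<ge> (1 + \<bar>t - g\<bar>) / 2" by (rule half) (use r in \<open>auto simp: s_def g_def\<close>)
 have n2: "norm (s - (1 - rho)) \<ge> (1 + \<bar>t + g\<bar>) / 2" by (rule half) (use r in \<open>auto simp: s_def g_def\<close>)
 have nz: "s - rho \<noteq> 0" "s - (1 - rho) \<noteq> 0"
  using r by (auto simp: s_def complex_eq_iff)
 have m: "Complex (- 1) (- t) - rho = - (s - (1 - rho))" by (simp add: s_def complex_eq_iff)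
 have "1 / (Complex 2 t - rho) - 1 / (Complex (- 1) (- t) - rho) = 1 / (s - rho) + 1 / (s - (1 - rho))"
  unfolding m divide_minus_right s_def[symmetric] by simp
 also have "\<dots> = (2 * s - 1) / ((s - rho) * (s - (1 - rho)))" using nz by (simp add: divide_simps)
 finally have "norm (1 / (Complex 2 t - rho) - 1 / (Complex (- 1) (- t) - rho)) = norm (2 * s - 1) / (norm (s - rho) * norm (s - (1 - rho)))"
  by (simp only: norm_divide norm_mult)
 also have "\<dots> \<le> (3 * x) / ((1 + \<bar>t - g\<bar>) / 2 * ((1 + \<bar>t + g\<bar>) / 2))"
 proof (rule frac_le)
  have "norm (2 * s - 1) \<le> \<bar>Re (2 * s - 1)\<bar> + \<bar>Im (2 * s - 1)\<bar>" by (rule cmod_le)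
  thus "norm (2 * s - 1) \<le> 3 * x" by (simp add: s_def x_def)
  show "(1 + \<bar>t - g\<bar>) / 2 * ((1 + \<bar>t + g\<bar>) / 2) \<le> norm (s - rho) * norm (s - (1 - rho))"
   by (intro mult_mono n1 n2) auto
 qed (use pos in \<open>auto intro!: mult_pos_pos\<close>)
 also have "\<dots> = 12 * x / ((1 + \<bar>t - g\<bar>) * (1 + \<bar>t + g\<bar>))" by (simp add: field_simps)
 also have "(1 + \<bar>t - g\<bar>) * (1 + \<bar>t + g\<bar>) = y * (1 + \<bar>t\<bar> + \<bar>g\<bar>)"
 proof -
  have "(\<bar>t - g\<bar> = \<bar>\<bar>t\<bar> - \<bar>g\<bar>\<bar> \<and> \<bar>t + g\<bar> = \<bar>t\<bar> + \<bar>g\<bar>) \<or> (\<bar>t + g\<bar> = \<bar>\<bar>t\<bar> - \<bar>g\<bar>\<bar> \<and> \<bar>t - g\<bar> = \<bar>t\<bar> + \<bar>g\<bar>)"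
   by arith
  thus ?thesis unfolding y_def by (auto simp: algebra_simps)
 qed
 also have "12 * x / (y * (1 + \<bar>t\<bar> + \<bar>g\<bar>)) \<le> 12 * x / (y * G)"
  using pos by (intro divide_left_mono mult_left_mono mult_pos_pos) (auto simp: G_def)
 finally have k: "norm (1 / (Complex 2 t - rho) - 1 / (Complex (- 1) (- t) - rho)) \<le> 12 * x / (y * G)" .
 \<comment> \<open>The budget is \<open>delta = eta + 2 * eps\<close>: moving the power
   \<open>eps\<close> onto \<open>G\<close> costs \<open>x powr eps * y powr eps\<close>, and
   \<open>eta\<close> is left for integrability in \<open>t\<close>.\<close>
 have e: "eps > 0" "eta > 0" "delta = eta + 2 * eps" "eps \<le> 1" using d by (auto simp: eps_def eta_def)
 have "G \<le> x * y"
 proof -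
  have "G \<le> x + y - 1" unfolding G_def x_def y_def by arith
  also have "\<dots> \<le> x * y" using mult_nonneg_nonneg[of "x - 1" "y - 1"] pos by (simp add: algebra_simps)
  finally show ?thesis .
 qed
 hence "G powr eps \<le> x powr eps * y powr eps"
  using pos e powr_mono2[of eps G "x * y"] by (simp add: powr_mult)
 hence "G powr (- eps) * G powr eps \<le> G powr (- eps) * (x powr eps * y powr eps)" by (intro mult_left_mono) auto
 moreover have "G powr (- eps) * G powr eps = 1" using pos by (simp add: powr_add[symmetric])
 ultimately have one: "1 \<le> G powr (- eps) * (x powr eps * y powr eps)" by simp
 have xy: "x powr (- delta + eps) * y powr (- 1 + eps) \<le> x powr (- 1 - eta) + y powr (- 1 - eta)"
 proof (cases "x \<le> y")
  case True
  have "y powr (- 1 + eps) \<le> x powr (- 1 + eps)" using True pos e by (intro powr_mono2') auto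
  hence "x powr (- delta + eps) * y powr (- 1 + eps) \<le> x powr (- delta + eps) * x powr (- 1 + eps)" by (intro mult_left_mono) auto
  also have "\<dots> = x powr (- 1 - eta)" unfolding powr_add[symmetric] by (rule arg_cong[of _ _ "(powr) x"]) (simp add: e(3))
  finally show ?thesis by (simp add: add_increasing2)
 next
  case False
  have "x powr (- delta + eps) \<le> y powr (- delta + eps)" using False pos e by (intro powr_mono2') auto
  hence "x powr (- delta + eps) * y powr (- 1 + eps) \<le> y powr (- delta + eps) * y powr (- 1 + eps)" by (intro mult_right_mono) auto
  also have "\<dots> = y powr (- 1 - eta)" unfolding powr_add[symmetric] by (rule arg_cong[of _ _ "(powr) y"]) (simp add: e(3))
  finally show ?thesis by (simp add: add_increasing)
 qed
 have y': "y powr (- 1 - eta) \<le> (1 + \<bar>t - g\<bar>) powr (- 1 - eta) + (1 + \<bar>t + g\<bar>) powr (- 1 - eta)"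
 proof -
  have "y = 1 + \<bar>t - g\<bar> \<or> y = 1 + \<bar>t + g\<bar>" unfolding y_def by arith
  thus ?thesis by auto
 qed
 have "x powr (- 1 - delta) * (12 * x / (y * G)) = 12 * (x powr (- delta) * y powr (- 1) * G powr (- 1)) * 1"
 proof -
  have "x powr (- 1 - delta) * x = x powr (- delta)"
   using pos powr_add[of x "- 1 - delta" 1] by simp
  moreover have "y powr (- 1) = 1 / y" "G powr (- 1) = 1 / G" using pos by (simp_all add: powr_minus divide_inverse)
  moreover have "x powr (- 1 - delta) * (12 * x / (y * G)) = 12 * ((x powr (- 1 - delta) * x) * (1 / y) * (1 / G)) * 1" by simp
  ultimately show ?thesis by (simp only:)
 qed
 also have "\<dots> \<le> 12 * (x powr (- delta) * y powr (- 1) * G powr (- 1)) * (G powr (- eps) * (x powr eps * y powr eps))"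
  by (intro mult_left_mono one) auto
 also have "\<dots> = 12 * (G powr (- 1) * G powr (- eps)) * ((x powr (- delta) * x powr eps) * (y powr (- 1) * y powr eps))"
  by (simp only: mult_ac)
 also have "\<dots> = 12 * G powr (- 1 - eps) * (x powr (- delta + eps) * y powr (- 1 + eps))"
  by (simp only: powr_add[symmetric]) simp
 also have "\<dots> \<le> 12 * (4 * (1 + norm rho) powr (- 1 - eps)) * (x powr (- 1 - eta) + ((1 + \<bar>t - g\<bar>) powr (- 1 - eta) + (1 + \<bar>t + g\<bar>) powr (- 1 - eta)))"
 proof (intro mult_mono)
  have "norm rho \<le> \<bar>Re rho\<bar> + \<bar>Im rho\<bar>" by (rule cmod_le)
  hence "(1 + norm rho) / 2 \<le> G" using r by (simp add: G_def g_def)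
  hence "G powr (- 1 - eps) \<le> ((1 + norm rho) / 2) powr (- 1 - eps)" using e by (intro powr_mono2') (auto simp: add_pos_nonneg)
  also have "\<dots> = (1 + norm rho) powr (- 1 - eps) * 2 powr (1 + eps)"
   using powr_minus_divide[of 2 "1 + eps"] by (simp add: powr_divide)
  also have "\<dots> \<le> (1 + norm rho) powr (- 1 - eps) * 2 powr 2" using e by (intro mult_left_mono powr_mono) auto
  finally show "G powr (- 1 - eps) \<le> 4 * (1 + norm rho) powr (- 1 - eps)" by simp
  show "x powr (- delta + eps) * y powr (- 1 + eps) \<le> x powr (- 1 - eta) + ((1 + \<bar>t - g\<bar>) powr (- 1 - eta) + (1 + \<bar>t + g\<bar>) powr (- 1 - eta))"
   using xy y' by linarith
 qed auto
 finally have "x powr (- 1 - delta) * (12 * x / (y * G)) \<le> 12 * (4 * (1 + norm rho) powr (- 1 - eps)) * (x powr (- 1 - eta) + ((1 + \<bar>t - g\<bar>) powr (- 1 - eta) + (1 + \<bar>t + g\<bar>) powr (- 1 - eta)))" .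
 moreover have "x powr (- 1 - delta) * norm (1 / (Complex 2 t - rho) - 1 / (Complex (- 1) (- t) - rho)) \<le> x powr (- 1 - delta) * (12 * x / (y * G))"
  by (intro mult_left_mono k) auto
 ultimately show ?thesis by (simp add: x_def g_def add.assoc)
qed

text \<open>Subtracting the partial fractions at \<open>s\<close> and \<open>1 - s\<close> removes
  \<open>deriv h 0 / h 0\<close> and the terms \<open>1 / rho\<close>. Each remaining term
  integrates to a residue by \<open>strip_residue\<close>, and sum and integral are exchanged with
  the majorant of \<open>zero_kernel_bound\<close>. The symmetry of \<open>G\<close> writes both
  lines over \<open>Re s = 2\<close>.\<close>

theorem explicit_formula_entire:
 fixes h G :: "complex \<Rightarrow> complex"
 assumes h: "h holomorphic_on UNIV" and zeros: "\<And>rho. h rho = 0 \<Longrightarrow> 0 < Re rho \<and> Re rho < 1"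
  and gr: "\<And>kappa. kappa > 1 \<Longrightarrow> \<exists>C\<ge>0. \<forall>z. norm (h z) \<le> exp (C * (1 + norm z) powr kappa)"
  and d: "delta > 0" "delta \<le> 1" and G: "G holomorphic_on UNIV"
  and bd: "\<And>s. - 1 \<le> Re s \<Longrightarrow> Re s \<le> 2 \<Longrightarrow> norm (G s) \<le> C * (1 + \<bar>Im s\<bar>) powr (- 1 - delta)"
  and sym: "\<And>s. G (1 - s) = G s"
 defines "D \<equiv> \<lambda>t. G (Complex 2 t) * (deriv h (Complex 2 t) / h (Complex 2 t) - deriv h (Complex (- 1) (- t)) / h (Complex (- 1) (- t)))"
 shows "integrable lborel D"
  "((\<lambda>rho. 2 * of_real pi * (of_nat (nat (zorder h rho)) * G rho)) has_sum (LBINT t. D t)) {rho. h rho = 0}"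
proof -
 define Z where "Z = {rho. h rho = 0}"
 define eps where "eps = delta / 4"
 define eta where "eta = delta / 2"
 have e: "eps > 0" "eps < 1" "eta > 0" using d by (auto simp: eps_def eta_def)
 have h0: "h 0 \<noteq> 0" using zeros[of 0] by auto
 have C0: "C \<ge> 0" using bd[of 0] by (intro order_trans[OF norm_ge_zero[of "G 0"]]) simp
 \<comment> \<open>Strictly between 1 and \<open>1 + eps\<close>: the growth bound \<open>gr\<close>
   asks for the former, summability of \<open>(1 + norm rho) powr (- 1 - eps)\<close> over the zeros
   for the latter.\<close>
 define kappa where "kappa = 1 + eps / 2"
 have kappa: "kappa > 1" "kappa < 2" "kappa < 1 + eps" using e by (auto simp: kappa_def)
 obtain B where B: "B \<ge> 0" "\<And>z. norm (h z) \<le> exp (B * (1 + norm z) powr kappa)" using gr[OF kappa(1)] by blast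
 have k0: "kappa \<ge> 0" using kappa by simp
 obtain K where K: "K \<ge> 0" "\<And>R. R \<ge> 1 \<Longrightarrow> real (zero_sum h R) \<le> K * R powr kappa"
  by (rule zero_sum_growth[OF h h0 B(1) k0 B(2)]) blast
 have zs: "(\<lambda>rho. real (nat (zorder h rho)) * (1 + norm rho) powr (- (1 + eps))) summable_on Z"
  unfolding Z_def by (rule zeros_powr_summable[OF h h0 K kappa(3)]) (use e in auto)
 have cZ: "countable Z"
 proof -
  have "Z = (\<Union>n::nat. {rho. h rho = 0 \<and> norm rho \<le> real n})" unfolding Z_def using real_arch_simple by auto
  thus ?thesis using finite_zeros_cball[OF h h0] by (auto intro: countable_finite)
 qed
 define k where "k = (\<lambda>rho t. 1 / (Complex 2 t - rho) - 1 / (Complex (- 1) (- t) - rho))"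
 define f where "f = (\<lambda>rho t. of_nat (nat (zorder h rho)) * (G (Complex 2 t) * k rho t))"
 have refl_eq: "Complex (- 1) (- t) = 1 - Complex 2 t" for t by (simp add: complex_eq_iff)
 have fD: "((\<lambda>rho. f rho t) has_sum D t) Z" for t
 proof -
  have nz: "h (Complex 2 t) \<noteq> 0" "h (Complex (- 1) (- t)) \<noteq> 0" using zeros by fastforce+
  note l = logderiv_has_sum[OF h h0 B(1) k0 kappa(2) B(2)]
  have "((\<lambda>rho. of_nat (nat (zorder h rho)) * (1 / (Complex 2 t - rho) + 1 / rho) + - (of_nat (nat (zorder h rho)) * (1 / (Complex (- 1) (- t) - rho) + 1 / rho))) has_sum
    ((deriv h (Complex 2 t) / h (Complex 2 t) - deriv h 0 / h 0) + - (deriv h (Complex (- 1) (- t)) / h (Complex (- 1) (- t)) - deriv h 0 / h 0))) Z"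
   unfolding Z_def using l[OF nz(1)] l[OF nz(2)] by (intro has_sum_add has_sum_uminusI)
  from has_sum_cmult_right[OF this, of "G (Complex 2 t)"] show ?thesis
   by (rule back_subst[of "\<lambda>g. (g has_sum _) Z", OF back_subst[of "\<lambda>s. (_ has_sum s) Z"]])
     (auto simp: f_def k_def D_def algebra_simps)
 qed
 have G2: "norm (G (Complex 2 t)) \<le> C * (1 + \<bar>t\<bar>) powr (- 1 - delta)" for t using bd[of "Complex 2 t"] by simp
 define p where "p = (\<lambda>t::real. (1 + \<bar>t\<bar>) powr (- 1 - eta))"
 define I where "I = (LBINT t. p t)"
 have p_int: "integrable lborel p" unfolding p_def by (rule integrable_powr_decay[OF e(3)])
 have p_shift: "integrable lborel (\<lambda>t. p (t + c))" "(LBINT t. p (t + c)) = I" for c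
  using lborel_integrable_real_affine[OF p_int, of 1 c] lborel_integral_real_affine[of 1 p c] by (simp_all add: I_def add.commute)
 define P where "P = (\<lambda>rho t. p t + p (t + - Im rho) + p (t + Im rho))"
 have P: "integrable lborel (P rho)" "(LBINT t. P rho t) = 3 * I" for rho
 proof -
  show "integrable lborel (P rho)" unfolding P_def by (intro Bochner_Integration.integrable_add p_int p_shift)
  have "(LBINT t. P rho t) = I + I + I"
   unfolding P_def by (simp only: Bochner_Integration.integral_add p_int p_shift Bochner_Integration.integrable_add I_def[symmetric])
  thus "(LBINT t. P rho t) = 3 * I" by simp
 qed
 have fb: "norm (f rho t) \<le> real (nat (zorder h rho)) * (C * (48 * (1 + norm rho) powr (- 1 - eps) * P rho t))" if rho: "rho \<in> Z" for rho t
 proof -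
  have r: "0 < Re rho" "Re rho < 1" using zeros rho by (auto simp: Z_def)
  have "norm (f rho t) \<le> real (nat (zorder h rho)) * (C * (1 + \<bar>t\<bar>) powr (- 1 - delta) * norm (k rho t))"
   unfolding f_def norm_mult norm_of_nat by (intro mult_left_mono mult_right_mono G2) auto
  also have "\<dots> \<le> real (nat (zorder h rho)) * (C * (48 * (1 + norm rho) powr (- 1 - eps) * P rho t))"
   using zero_kernel_bound[OF d r, of t] C0
   unfolding k_def P_def p_def eps_def eta_def mult.assoc diff_conv_add_uminus by (intro mult_left_mono) auto
  finally show ?thesis .
 qed
 have val: "integrable lborel (f rho) \<and> (LBINT t. f rho t) = 2 * of_real pi * (of_nat (nat (zorder h rho)) * G rho)" if rho: "rho \<in> Z" for rho
 proof -
  have r: "0 < Re rho" "Re rho < 1" using zeros rho by (auto simp: Z_def)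
  note S = strip_residue[OF d(1) G bd r]
  have eq: "G (Complex (- 1) (0 + (- 1) * t)) / (Complex (- 1) (0 + (- 1) * t) - rho) = G (Complex 2 t) / (Complex (- 1) (- t) - rho)" for t
   using sym[of "Complex 2 t"] by (simp add: refl_eq)
  have i2: "integrable lborel (\<lambda>t. G (Complex 2 t) / (Complex (- 1) (- t) - rho))"
   using lborel_integrable_real_affine[OF S(2), of "- 1" 0] unfolding eq by simp
  have v2: "(LBINT t. G (Complex 2 t) / (Complex (- 1) (- t) - rho)) = (LBINT t. G (Complex (- 1) t) / (Complex (- 1) t - rho))"
   using lborel_integral_real_affine[of "- 1" "\<lambda>t. G (Complex (- 1) t) / (Complex (- 1) t - rho)" 0] unfolding eq by simp
  have f_eq: "f rho = (\<lambda>t. of_nat (nat (zorder h rho)) * (G (Complex 2 t) / (Complex 2 t - rho) - G (Complex 2 t) / (Complex (- 1) (- t) - rho)))"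
   by (rule ext) (simp add: f_def k_def right_diff_distrib)
  show ?thesis unfolding f_eq using S(1) i2 by (simp add: v2 S(3)[symmetric])
 qed
 have "(\<lambda>rho. LBINT t. norm (f rho t)) summable_on Z"
 proof (rule summable_on_comparison_test)
  show "(\<lambda>rho. (144 * C * I) * (real (nat (zorder h rho)) * (1 + norm rho) powr (- (1 + eps)))) summable_on Z"
   by (intro summable_on_cmult_right zs)
  fix rho assume rho: "rho \<in> Z"
  have "(LBINT t. norm (f rho t)) \<le> (LBINT t. real (nat (zorder h rho)) * (C * (48 * (1 + norm rho) powr (- 1 - eps) * P rho t)))"
   using val[OF rho] by (intro integral_mono fb rho integrable_mult_right P integrable_norm) auto
  thus "(LBINT t. norm (f rho t)) \<le> (144 * C * I) * (real (nat (zorder h rho)) * (1 + norm rho) powr (- (1 + eps)))"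
   by (simp add: P(2) mult_ac)
 qed (simp add: Bochner_Integration.integral_nonneg)
 note X = has_sum_lebesgue_integral[OF cZ _ has_sum_imp_summable[OF fD] this]
 have inf: "(\<Sum>\<^sub>\<infinity>rho\<in>Z. f rho t) = D t" for t by (rule infsumI[OF fD])
 have "integrable lborel (\<lambda>t. \<Sum>\<^sub>\<infinity>rho\<in>Z. f rho t)" by (rule X(1)) (use val in blast)
 thus "integrable lborel D" unfolding inf .
 have "((\<lambda>rho. LBINT t. f rho t) has_sum (LBINT t. D t)) Z" unfolding inf[symmetric] by (rule X(2)) (use val in blast)
 hence "((\<lambda>rho. 2 * of_real pi * (of_nat (nat (zorder h rho)) * G rho)) has_sum (LBINT t. D t)) Z"
  by (rule iffD1[OF has_sum_cong, rotated]) (use val in blast)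
 thus "((\<lambda>rho. 2 * of_real pi * (of_nat (nat (zorder h rho)) * G rho)) has_sum (LBINT t. D t)) {rho. h rho = 0}"
  unfolding Z_def .
qed

section \<open>Zeros and logarithmic derivative of \<open>xi\<close>\<close>

context parity_character
begin

abbreviation (input) "chin \<equiv> \<lambda>n::nat. chi (int n)"

lemma chin: "norm (chin n) \<le> 1" "chin (m * n) = chin m * chin n" "chin 1 = 1"
 using norm_dchar_le[OF q nontriv_dchar[OF q chi]] dchar_mult[OF q nontriv_dchar[OF q chi]] dchar_1[OF q nontriv_dchar[OF q chi]]
 by simp_all

lemma dconv_chin: "dconv chin" by (rule dconv_bounded[OF chin(1)])

lemma dirichlet_L_eq_dseries:
 assumes s: "Re s > 1"
 shows "dirichlet_L chi s = dseries chin s"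
proof (rule sums_unique2[OF dirichlet_L_sums[OF s]])
 show "(\<lambda>n. chi (int (Suc n)) / of_nat (Suc n) powr s) sums dseries chin s"
  using dseries_sums[OF dconv_chin s] sums_Suc_iff[of "\<lambda>n. chin n / of_nat n powr s" "dseries chin s"] by simp
qed

text \<open>On the line \<open>Re s = 1\<close> the twist by \<open>n powr (- \<i> * t)\<close>
  moves the point to 1 and preserves complete multiplicativity and modulus 1 at the primes other
  than \<open>q\<close>; so \<open>multiplicative_nonvanishing\<close> treats real and complex
  characters alike.\<close>

lemma dirichlet_L_nonzero:
 assumes s: "Re s \<ge> 1"
 shows "dirichlet_L chi s \<noteq> 0"
proof (cases "Re s > 1")
 case True
 thus ?thesis unfolding dirichlet_L_eq_dseries[OF True] by (intro dseries_nonzero chin)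
next
 case False
 hence s1: "Re s = 1" using s by simp
 define t where "t = Im s"
 define w where "w = (\<lambda>n. chin n * of_nat n powr (- \<i> * of_real t))"
 have np: "norm (of_nat n powr (- \<i> * of_real t) :: complex) = (if n = 0 then 0 else 1)" for n
  using norm_powr_real_powr[of "of_nat n" "- \<i> * of_real t"] by simp
 have "dirichlet_L chi (1 + \<i> * of_real t) \<noteq> 0"
 proof (rule multiplicative_nonvanishing[of w q "\<lambda>z. dirichlet_L chi (z + \<i> * of_real t)"])
  show "norm (w n) \<le> 1" for n using chin(1)[of n] unfolding w_def norm_mult np by simp
  show "w (m * n) = w m * w n" for m n
  proof -
   have "of_nat (m * n) powr (- \<i> * of_real t) = of_nat m powr (- \<i> * of_real t) * (of_nat n powr (- \<i> * of_real t) :: complex)"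
    unfolding of_nat_mult by (rule powr_times_real) auto
   thus ?thesis unfolding w_def chin(2) by (simp only: mult_ac)
  qed
  show "w 1 = 1" using chin(3) by (simp add: w_def)
  show "norm (w p) = 1" if p: "prime p" "p \<noteq> q" for p
  proof -
   have "coprime (int p) (int q)" using primes_coprime[OF p(1) q p(2)] by simp
   thus ?thesis using norm_dchar[OF q nontriv_dchar[OF q chi]] prime_gt_0_nat[OF p(1)] unfolding w_def norm_mult np by simp
  qed
  show "(\<lambda>z. dirichlet_L chi (z + \<i> * of_real t)) holomorphic_on UNIV"
  proof -
   have "(dirichlet_L chi \<circ> (\<lambda>z. z + \<i> * of_real t)) holomorphic_on UNIV"
    by (rule holomorphic_on_compose_gen[OF _ dirichlet_L_holomorphic[of UNIV]]) (auto intro!: holomorphic_intros)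
   thus ?thesis unfolding o_def .
  qed
  fix z :: complex assume z: "Re z > 1"
  have "chin n / of_nat n powr (z + \<i> * of_real t) = w n / of_nat n powr z" for n
   using powr_minus[of "of_nat n" "\<i> * of_real t"]
   by (simp only: w_def powr_add divide_inverse mult_minus_left inverse_mult_distrib mult_ac)
  thus "dirichlet_L chi (z + \<i> * of_real t) = dseries w z"
   using z by (simp add: dirichlet_L_eq_dseries dseries_def)
 qed
 moreover have "s = 1 + \<i> * of_real t" using s1 by (simp add: t_def complex_eq_iff)
 ultimately show ?thesis by simp
qed

lemma xi_nonzero_right: "Re s \<ge> 1 \<Longrightarrow> xi s \<noteq> 0"
 using dirichlet_L_nonzero[of s] unfolding dirichlet_L_eq by auto

text \<open>The right half comes from non-vanishing for \<open>Re s \<ge> 1\<close>, the left half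
  from the functional equation and the same fact for the conjugate character. The root number is
  nonzero, since otherwise \<open>xi 2\<close> would be 0.\<close>

lemma xi_zeros:
 assumes "xi rho = 0"
 shows "0 < Re rho \<and> Re rho < 1"
proof -
 interpret c: parity_character q a "\<lambda>n. cnj (chi n)" by (rule parity_character_cnj)
 have "Re rho < 1" using xi_nonzero_right[of rho] assms by linarith
 moreover have "0 < Re rho"
 proof (rule ccontr)
  assume "\<not> 0 < Re rho"
  hence "c.xi (1 - rho) \<noteq> 0" by (intro c.xi_nonzero_right) simp
  moreover have "wconst \<noteq> 0"
  proof
   assume "wconst = 0"
   hence "xi (1 - (1 - 2)) = 0" using xi_functional_equation[of "1 - 2"] by simp
   thus False using xi_nonzero_right[of 2] by simp
  qed
  ultimately show False using xi_functional_equation[of "1 - rho"] assms by simp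
 qed
 ultimately show ?thesis by simp
qed

lemma nontrivial_zeros_eq: "nontrivial_zeros chi = {rho. xi rho = 0}"
 unfolding nontrivial_zeros_def dirichlet_L_eq using xi_zeros gamma_factor_nonzero by auto

lemma zorder_dirichlet_L:
 assumes "xi rho = 0"
 shows "zorder (dirichlet_L chi) rho = int (nat (zorder xi rho))"
proof -
 have nz: "xi 2 \<noteq> 0" by (rule xi_nonzero_right) simp
 have r: "gamma_factor rho \<noteq> 0" using xi_zeros[OF assms] by (intro gamma_factor_nonzero) simp
 have an: "xi analytic_on {rho}" "gamma_factor analytic_on {rho}"
  by (rule analytic_on_subset[of _ UNIV]; simp add: analytic_on_open xi_entire gamma_factor_holomorphic)+
 have "eventually (\<lambda>z. gamma_factor z \<noteq> 0) (at rho)"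
  using analytic_at_neq_imp_eventually_neq[OF an(2) r] by simp
 hence "eventually (\<lambda>z. xi z * gamma_factor z \<noteq> 0) (at rho)"
  using eventually_nonzero_entire[OF xi_entire nz, of rho] by eventually_elim simp
 from zorder_times_analytic[OF an this] show ?thesis
  using zorder_eq_0I[OF an(2) r] zorder_entire_pos(1)[OF xi_entire nz, of rho] by (simp add: dirichlet_L_eq)
qed

text \<open>The logarithmic derivative of
  \<open>(q / pi) powr ((s + a) / 2) * Gamma ((s + a) / 2)\<close>.\<close>

definition gamma_logderiv :: "complex \<Rightarrow> complex" where
 "gamma_logderiv s = (of_real (ln (real q / pi)) + Digamma ((s + of_nat a) / 2)) / 2"

lemma xi_logderiv:
 assumes s: "Re s > 1"
 shows "deriv xi s / xi s = gamma_logderiv s - dseries (\<lambda>n. of_real (mang n) * chin n) s"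
proof -
 define D where "D = dseries (\<lambda>n. of_real (mang n) * chin n) s"
 have ni: "(s + of_nat a) / 2 \<notin> \<int>\<^sub>\<le>\<^sub>0"
  using s gamma_factor_nonzero[of s] by (auto simp: gamma_factor_def rGamma_eq_zero_iff)
 have g: "(gamma_factor has_field_derivative - gamma_logderiv s * gamma_factor s) (at s)"
 proof -
  have 1: "((\<lambda>s. exp (- of_real (ln (real q / pi)) * ((s + of_nat a) / 2))) has_field_derivative
    (exp (- of_real (ln (real q / pi)) * ((s + of_nat a) / 2)) * (- of_real (ln (real q / pi)) / 2))) (at s)"
   by (auto intro!: derivative_eq_intros)
  have "((\<lambda>s. (s + of_nat a) / 2) has_field_derivative 1 / 2) (at s)" by (auto intro!: derivative_eq_intros)
  from DERIV_mult[OF 1 DERIV_chain2[OF has_field_derivative_rGamma_no_nonpos_int[OF ni] this]]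
  show ?thesis unfolding gamma_factor_def[abs_def] gamma_logderiv_def
   by (rule back_subst[of "\<lambda>d. (_ has_field_derivative d) _"]) (simp add: field_simps)
 qed
 have x: "(xi has_field_derivative deriv xi s) (at s)"
  using xi_entire by (simp add: holomorphic_derivI)
 have "((\<lambda>s. xi s * gamma_factor s) has_field_derivative - (D * (xi s * gamma_factor s))) (at s)"
 proof (rule has_field_derivative_transform_within_open[where S = "{s. Re s > 1}"])
  show "(dseries chin has_field_derivative - (D * (xi s * gamma_factor s))) (at s)"
   using dseries_logderiv[of chin s] chin s dirichlet_L_eq_dseries[OF s]
   unfolding D_def by (simp add: dirichlet_L_eq del: of_real_mangoldt)
  fix z assume "z \<in> {s. Re s > 1}"
  thus "dseries chin z = xi z * gamma_factor z" using dirichlet_L_eq_dseries[of z] by (simp add: dirichlet_L_eq)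
 qed (use s in \<open>auto simp: open_halfspace_Re_gt\<close>)
 from DERIV_unique[OF this DERIV_mult[OF x g]]
 have "deriv xi s * gamma_factor s = (gamma_logderiv s - D) * xi s * gamma_factor s" by (simp add: algebra_simps)
 hence "deriv xi s = (gamma_logderiv s - D) * xi s" using gamma_factor_nonzero[of s] s by simp
 thus ?thesis using xi_nonzero_right[of s] s by (simp add: D_def)
qed

lemma xi_logderiv_reflect:
 assumes s: "Re s \<ge> 1"
 shows "deriv xi (1 - s) / xi (1 - s) =
  - (deriv (parity_character.xi q a (\<lambda>n. cnj (chi n))) s / parity_character.xi q a (\<lambda>n. cnj (chi n)) s)"
proof -
 interpret c: parity_character q a "\<lambda>n. cnj (chi n)" by (rule parity_character_cnj)
 have x: "(xi has_field_derivative deriv xi z) (at z)" "(c.xi has_field_derivative deriv c.xi z) (at z)" for z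
  using xi_entire c.xi_entire by (simp_all add: holomorphic_derivI)
 have "((\<lambda>z. 1 - z) has_field_derivative - 1) (at s)" by (auto intro!: derivative_eq_intros)
 from DERIV_chain2[OF x(1) this] have "((\<lambda>z. wconst * c.xi z) has_field_derivative deriv xi (1 - s) * - 1) (at s)"
  unfolding xi_functional_equation .
 from DERIV_unique[OF this DERIV_cmult[OF x(2)]] have "deriv xi (1 - s) = - (wconst * deriv c.xi s)"
  by (simp add: minus_equation_iff[of "deriv xi (1 - s)"])
 moreover have "wconst \<noteq> 0" using xi_functional_equation[of "- 1"] xi_nonzero_right[of 2] by auto
 ultimately show ?thesis unfolding xi_functional_equation by simp
qed

end

section \<open>The explicit formula for \<open>W_sum\<close>\<close>

locale character_test = test_function f + parity_character q a chi for f q a chi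
begin

text \<open>\<open>W_sum\<close> sums \<open>G\<close> over the zeros with multiplicity. The
  critical line corresponds to real arguments of \<open>F\<close>, and vertical strips to the
  horizontal ones of \<open>F_strip_decay\<close>.\<close>

definition G :: "complex \<Rightarrow> complex" where
 "G s = F (of_real (ln (real q) / (2 * pi)) * ((s - 1 / 2) / \<i>))"

lemma ln_q: "ln (real q) > 0" using prime_gt_1_nat[OF q] by simp

lemma G_entire: "G holomorphic_on UNIV"
proof -
 have "(F \<circ> (\<lambda>s. of_real (ln (real q) / (2 * pi)) * ((s - 1 / 2) / \<i>))) holomorphic_on UNIV"
  by (rule holomorphic_on_compose_gen[OF _ F_entire]) (auto intro!: holomorphic_intros)
 thus ?thesis unfolding o_def G_def[abs_def] .
qed

lemma G_reflect: "G (1 - s) = G s"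
proof -
 have "of_real (ln (real q) / (2 * pi)) * ((1 - s - 1 / 2) / \<i>) = - (of_real (ln (real q) / (2 * pi)) * ((s - 1 / 2) / \<i>))"
  by (simp add: field_simps)
 thus ?thesis unfolding G_def by (simp only: F_even)
qed

lemma G_decay:
 obtains delta C where "delta > 0" "delta \<le> 1" "C \<ge> 0" "\<And>s. - 1 \<le> Re s \<Longrightarrow> Re s \<le> 2 \<Longrightarrow> norm (G s) \<le> C * (1 + \<bar>Im s\<bar>) powr (- 1 - delta)"
proof -
 define c where "c = ln (real q) / (2 * pi)"
 have c: "c > 0" using ln_q by (simp add: c_def)
 obtain delta where d: "delta > 0" "delta \<le> 1"
  and F: "\<And>Y. Y \<ge> 0 \<Longrightarrow> \<exists>C\<ge>0. \<forall>z. \<bar>Im z\<bar> \<le> Y \<longrightarrow> norm (F z) \<le> C * (1 + \<bar>Re z\<bar>) powr (- 1 - delta)"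
  by (rule F_strip_decay) blast
 obtain C where C: "C \<ge> 0" "\<And>z. \<bar>Im z\<bar> \<le> 2 * c \<Longrightarrow> norm (F z) \<le> C * (1 + \<bar>Re z\<bar>) powr (- 1 - delta)"
  using F[of "2 * c"] c by auto
 \<comment> \<open>Treats \<open>c\<close> below and above 1 at once, through
   \<open>m * (1 + \<bar>Im s\<bar>) \<le> 1 + c * \<bar>Im s\<bar>\<close>.\<close>
 define m where "m = min 1 c"
 have m: "m > 0" "m \<le> 1" "m \<le> c" using c by (auto simp: m_def)
 have "norm (G s) \<le> (C * m powr (- 1 - delta)) * (1 + \<bar>Im s\<bar>) powr (- 1 - delta)" if s: "- 1 \<le> Re s" "Re s \<le> 2" for s
 proof -
  define z where "z = of_real c * ((s - 1 / 2) / \<i>)"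
  have z: "z = Complex (c * Im s) (- c * (Re s - 1 / 2))" by (simp add: z_def complex_eq_iff)
  have "\<bar>Im z\<bar> = c * \<bar>Re s - 1 / 2\<bar>" using c by (simp add: z abs_mult)
  also have "\<dots> \<le> c * 2" using s c by (intro mult_left_mono) auto
  finally have "norm (F z) \<le> C * (1 + \<bar>Re z\<bar>) powr (- 1 - delta)" by (intro C(2)) simp
  also have "\<dots> \<le> C * (m * (1 + \<bar>Im s\<bar>)) powr (- 1 - delta)"
  proof (intro mult_left_mono powr_mono2' C(1))
   have "m * \<bar>Im s\<bar> \<le> c * \<bar>Im s\<bar>" using m by (intro mult_right_mono) auto
   thus "m * (1 + \<bar>Im s\<bar>) \<le> 1 + \<bar>Re z\<bar>" using m c by (simp add: z abs_mult distrib_left)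
  qed (use m d in \<open>auto intro!: mult_pos_pos\<close>)
  also have "\<dots> = (C * m powr (- 1 - delta)) * (1 + \<bar>Im s\<bar>) powr (- 1 - delta)" using m by (simp add: powr_mult)
  finally show ?thesis by (simp add: G_def z_def c_def)
 qed
 moreover have "C * m powr (- 1 - delta) \<ge> 0" using C by simp
 ultimately show ?thesis using d by (intro that)
qed

definition prime_integral :: "(nat \<Rightarrow> complex) \<Rightarrow> complex" where
 "prime_integral c = (LBINT t. G (Complex 2 t) * dseries (\<lambda>n. of_real (mang n) * c n) (Complex 2 t))"

text \<open>\<open>explicit_formula_entire\<close> applied to \<open>xi\<close>. On the left line
  the functional equation exchanges the logarithmic derivative for that of the conjugate character
  at \<open>s\<close>, which is why both characters occur.\<close>

lemma W_sum_eq_integral: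
 defines "K \<equiv> \<lambda>t. G (Complex 2 t) * (gamma_logderiv (Complex 2 t) - dseries (\<lambda>n. of_real (mang n) * chin n) (Complex 2 t) +
   (gamma_logderiv (Complex 2 t) - dseries (\<lambda>n. of_real (mang n) * cnj (chin n)) (Complex 2 t)))"
 shows "integrable lborel K" "2 * of_real pi * W_sum f q chi = (LBINT t. K t)"
proof -
 interpret c: parity_character q a "\<lambda>n. cnj (chi n)" by (rule parity_character_cnj)
 obtain delta C where d: "delta > 0" "delta \<le> 1"
  and bd: "\<And>s. - 1 \<le> Re s \<Longrightarrow> Re s \<le> 2 \<Longrightarrow> norm (G s) \<le> C * (1 + \<bar>Im s\<bar>) powr (- 1 - delta)"
  by (rule G_decay) blast
 have gr: "\<exists>C\<ge>0. \<forall>z. norm (xi z) \<le> exp (C * (1 + norm z) powr kappa)" if "kappa > 1" for kappa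
  by (rule xi_growth[OF that]) blast
 have Keq: "G (Complex 2 t) * (deriv xi (Complex 2 t) / xi (Complex 2 t) - deriv xi (Complex (- 1) (- t)) / xi (Complex (- 1) (- t))) = K t" for t
 proof -
  have "Complex (- 1) (- t) = 1 - Complex 2 t" by (simp add: complex_eq_iff)
  hence "deriv xi (Complex (- 1) (- t)) / xi (Complex (- 1) (- t)) = - (deriv c.xi (Complex 2 t) / c.xi (Complex 2 t))"
   using xi_logderiv_reflect[of "Complex 2 t"] by simp
  thus ?thesis unfolding K_def using xi_logderiv[of "Complex 2 t"] c.xi_logderiv[of "Complex 2 t"] by (simp del: of_real_mangoldt)
 qed
 note X = explicit_formula_entire[OF xi_entire xi_zeros gr d G_entire bd G_reflect, unfolded Keq]
 show "integrable lborel K" using X(1) by simp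
 have "2 * of_real pi * (of_nat (nat (zorder xi rho)) * G rho) = 2 * of_real pi * (of_int (zorder (dirichlet_L chi) rho) * G rho)" if "xi rho = 0" for rho
  unfolding zorder_dirichlet_L[OF that] by simp
 note eq = this
 have "((\<lambda>rho. 2 * of_real pi * (of_nat (nat (zorder xi rho)) * G rho)) has_sum (LBINT t. K t)) {rho. xi rho = 0}"
  by (rule X(2); assumption)
 hence "((\<lambda>rho. 2 * of_real pi * (of_int (zorder (dirichlet_L chi) rho) * G rho)) has_sum (LBINT t. K t)) {rho. xi rho = 0}"
  by (rule iffD1[OF has_sum_cong, rotated]) (rule eq, simp)
 hence "(\<Sum>\<^sub>\<infinity>rho\<in>nontrivial_zeros chi. 2 * of_real pi * (of_int (zorder (dirichlet_L chi) rho) * G rho)) = (LBINT t. K t)"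
  unfolding nontrivial_zeros_eq by (rule infsumI)
 thus "2 * of_real pi * W_sum f q chi = (LBINT t. K t)"
  unfolding W_sum_def infsum_cmult_right' G_def .
qed

end

context character_test
begin

lemma G_line_integrable:
 assumes "- 1 \<le> x" "x \<le> 2"
 shows "integrable lborel (\<lambda>t. G (Complex x t))"
proof -
 obtain delta C where d: "delta > 0" and bd: "\<And>s. - 1 \<le> Re s \<Longrightarrow> Re s \<le> 2 \<Longrightarrow> norm (G s) \<le> C * (1 + \<bar>Im s\<bar>) powr (- 1 - delta)"
  by (rule G_decay) blast
 show ?thesis
 proof (rule integrable_line_decay[OF d])
  show "continuous_on UNIV (\<lambda>t. G (Complex x t))"
   by (rule continuous_on_compose2[OF holomorphic_on_imp_continuous_on[OF G_entire] continuous_on_line]) simp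
  show "norm (G (Complex x t)) \<le> C * (1 + \<bar>t\<bar>) powr (- 1 - delta)" for t using bd[of "Complex x t"] assms by simp
 qed
qed

lemma G_critical_line: "G (Complex (1 / 2) t) = F (of_real (ln (real q) / (2 * pi) * t))"
proof -
 have "(Complex (1 / 2) t - 1 / 2) / \<i> = of_real t" by (simp add: complex_eq_iff)
 thus ?thesis unfolding G_def by simp
qed

lemma G_critical_line_integral:
 fixes g :: "real \<Rightarrow> 'b :: {banach, second_countable_topology}"
 shows "(LBINT t. g (ln (real q) / (2 * pi) * t)) = (2 * pi / ln (real q)) *\<^sub>R (LBINT x. g x)"
 using lborel_integral_real_affine[of "ln (real q) / (2 * pi)" g 0] ln_q by simp

text \<open>\<open>G s / n powr s\<close> is entire, so the line can be moved to the critical one,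
  where \<open>F\<close> has real arguments and \<open>F_inversion\<close> applies. The real part
  1/2 yields \<open>1 / sqrt n\<close>, and the oscillation of \<open>n powr s\<close> has frequency
  \<open>ln n / ln q\<close> in the rescaled variable.\<close>

lemma G_powr_integral:
 assumes n: "n > 0"
 shows "(LBINT t. G (Complex 2 t) / of_nat n powr Complex 2 t) = of_real (2 * pi / ln (real q) / sqrt (real n)) * h (ln (real n) / ln (real q))"
proof -
 define L where "L = ln (real q)"
 have L: "L > 0" using ln_q by (simp add: L_def)
 define u where "u = ln (real n) / L"
 obtain delta C where d: "delta > 0" and C: "C \<ge> 0" and bd: "\<And>s. - 1 \<le> Re s \<Longrightarrow> Re s \<le> 2 \<Longrightarrow> norm (G s) \<le> C * (1 + \<bar>Im s\<bar>) powr (- 1 - delta)"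
  by (rule G_decay) blast
 have shift: "(LBINT t. G (Complex (1 / 2) t) / of_nat n powr Complex (1 / 2) t) = (LBINT t. G (Complex 2 t) / of_nat n powr Complex 2 t)"
 proof (rule strip_shift[OF _ d open_UNIV, where C = C])
  show "(\<lambda>s. G s / of_nat n powr s) holomorphic_on UNIV"
   using n by (intro holomorphic_intros G_entire) auto
  fix s :: complex assume s: "1 / 2 \<le> Re s" "Re s \<le> 2"
  have "norm (of_nat n powr s :: complex) = real n powr Re s" using norm_powr_real_powr[of "of_nat n" s] by simp
  moreover have "1 \<le> real n powr Re s" using n s by (intro ge_one_powr_ge_zero) auto
  ultimately have "norm (G s / of_nat n powr s) \<le> norm (G s) / 1" unfolding norm_divide using n by (intro divide_left_mono) auto
  thus "norm (G s / of_nat n powr s) \<le> C * (1 + \<bar>Im s\<bar>) powr (- 1 - delta)" using bd[of s] s by simp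
 qed auto
 have pt: "G (Complex (1 / 2) t) / of_nat n powr Complex (1 / 2) t =
   of_real (1 / sqrt (real n)) * (F (of_real (L / (2 * pi) * t)) * e2pi (of_real (- (L / (2 * pi) * t) * u)))" for t
 proof -
  have l: "Ln (of_nat n) = complex_of_real (ln (real n))" using n Ln_of_real[of "real n"] by simp
  have "1 / of_nat n powr s = exp (- s * of_real (ln (real n)))" for s :: complex
   using n by (simp add: powr_def l exp_minus divide_inverse)
  hence "1 / of_nat n powr Complex (1 / 2) t = exp (- (Complex (1 / 2) t) * of_real (ln (real n)))" .
  also have "- (Complex (1 / 2) t) * of_real (ln (real n)) = of_real (- (1 / 2) * ln (real n)) + 2 * of_real pi * \<i> * of_real (- (L / (2 * pi) * t) * u)"
   using L by (simp add: complex_eq_iff u_def)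
  also have "exp \<dots> = of_real (exp (- (1 / 2) * ln (real n))) * e2pi (of_real (- (L / (2 * pi) * t) * u))"
   unfolding exp_add exp_of_real e2pi_def by (simp add: mult_ac)
  also have "exp (- (1 / 2) * ln (real n)) = 1 / sqrt (real n)"
   using n powr_minus_divide[of "real n" "1 / 2"] by (simp add: powr_def powr_half_sqrt[symmetric])
  finally have "1 / of_nat n powr Complex (1 / 2) t = of_real (1 / sqrt (real n)) * e2pi (of_real (- (L / (2 * pi) * t) * u))" .
  moreover have "G (Complex (1 / 2) t) / of_nat n powr Complex (1 / 2) t = G (Complex (1 / 2) t) * (1 / of_nat n powr Complex (1 / 2) t)" by simp
  ultimately show ?thesis unfolding G_critical_line L_def by (simp only: mult_ac)
 qed
 have "(LBINT t. of_real (1 / sqrt (real n)) * (F (of_real (L / (2 * pi) * t)) * e2pi (of_real (- (L / (2 * pi) * t) * u)))) =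
   of_real (1 / sqrt (real n)) * ((2 * pi / L) *\<^sub>R h u)"
  using G_critical_line_integral[of "\<lambda>x. F (of_real x) * e2pi (of_real (- x * u))"] unfolding F_inversion L_def by (simp add: scaleR_conv_of_real)
 thus ?thesis unfolding shift[symmetric] pt by (simp add: u_def L_def scaleR_conv_of_real)
qed

text \<open>On the line of real part 2 the series converges absolutely and each term is evaluated by
  \<open>G_powr_integral\<close>; \<open>h\<close> vanishes from 1 on, so only \<open>n < q\<close>
  survive.\<close>

lemma prime_integral_eq:
 assumes c: "\<And>n. norm (c n) \<le> 1"
 shows "integrable lborel (\<lambda>t. G (Complex 2 t) * dseries (\<lambda>n. of_real (mang n) * c n) (Complex 2 t))"
  "prime_integral c = 2 * of_real pi * (\<Sum>n\<in>{1..<q}. of_real (pcoef (\<lambda>u. Re (h u)) q n) * c n)"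
proof -
 define T where "T = (\<lambda>n t. G (Complex 2 t) * (of_real (mang n) * c n / of_nat n powr Complex 2 t))"
 have dc: "dconv (\<lambda>n. of_real (mang n) * c n)" by (intro dconv_mangoldt dconv_bounded[OF c])
 define b where "b = (\<lambda>n. norm (complex_of_real (mang n) * c n) * real n powr (- 2))"
 have b: "summable b" using dc unfolding dconv_def b_def by simp
 have nT: "norm (T n t) = norm (G (Complex 2 t)) * b n" for n t
  unfolding T_def norm_mult norm_dterm[of "of_real (mang n) * c n"] b_def by simp
 have iG: "integrable lborel (\<lambda>t. G (Complex 2 t))" by (rule G_line_integrable) auto
 have iT: "integrable lborel (T n)" for n
 proof (rule Bochner_Integration.integrable_bound)
  show "integrable lborel (\<lambda>t. norm (G (Complex 2 t)) * b n)" using iG by (intro integrable_mult_left integrable_norm)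
  have "(\<lambda>t. G (Complex 2 t)) \<in> borel_measurable borel" using borel_measurable_integrable[OF iG] by simp
  moreover have "(\<lambda>t. of_nat n powr Complex 2 t :: complex) \<in> borel_measurable borel"
  proof (cases "n = 0")
   case False
   thus ?thesis by (intro borel_measurable_continuous_onI continuous_on_powr_complex continuous_intros continuous_on_line) auto
  qed simp
  ultimately show "T n \<in> borel_measurable lborel" unfolding T_def by simp
 qed (simp add: nT b_def)
 have pw: "summable (\<lambda>n. norm (T n t))" for t unfolding nT by (intro summable_mult b)
 have si: "summable (\<lambda>n. LBINT t. norm (T n t))" unfolding nT by (simp add: summable_mult b)
 have eq: "(\<Sum>n. T n t) = G (Complex 2 t) * dseries (\<lambda>n. of_real (mang n) * c n) (Complex 2 t)" for t
  unfolding T_def by (rule sums_unique[symmetric, OF sums_mult[OF dseries_sums[OF dc]]]) simp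
 show "integrable lborel (\<lambda>t. G (Complex 2 t) * dseries (\<lambda>n. of_real (mang n) * c n) (Complex 2 t))"
  using integrable_suminf[OF iT AE_I2[OF pw] si] unfolding eq .
 define \<phi> where "\<phi> = (\<lambda>u. Re (h u))"
 have val: "(LBINT t. T n t) = 2 * of_real pi * (of_real (pcoef \<phi> q n) * c n)" for n
 proof (cases "n = 0")
  case True
  thus ?thesis by (simp add: T_def pcoef_def)
 next
  case False
  have "(LBINT t. T n t) = of_real (mang n) * c n * (LBINT t. G (Complex 2 t) / of_nat n powr Complex 2 t)"
   unfolding T_def by (subst integral_mult_right_zero[symmetric]) (simp add: mult_ac)
  thus ?thesis using False G_powr_integral[of n] h_eq_Re[of "ln (real n) / ln (real q)"]
   by (simp add: pcoef_def \<phi>_def field_simps del: of_real_mangoldt)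
 qed
 have z: "of_real (pcoef \<phi> q n) * c n = 0" if "n \<notin> {1..<q}" for n
 proof (cases "n = 0")
  case False
  hence "n \<ge> q" using that by auto
  hence "ln (real q) \<le> ln (real n)" using prime_gt_0_nat[OF q] by simp
  hence "1 \<le> ln (real n) / ln (real q)" using ln_q by simp
  hence "h (ln (real n) / ln (real q)) = 0" by (intro h_zero) linarith
  thus ?thesis by (simp add: pcoef_def \<phi>_def)
 qed (simp add: pcoef_def)
 have "(\<lambda>n. LBINT t. T n t) sums prime_integral c"
  using sums_integral[OF iT AE_I2[OF pw] si] unfolding eq prime_integral_def .
 moreover have "(\<lambda>n. LBINT t. T n t) sums (2 * of_real pi * (\<Sum>n\<in>{1..<q}. of_real (pcoef \<phi> q n) * c n))"
  unfolding val by (intro sums_mult sums_finite z) auto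
 ultimately show "prime_integral c = 2 * of_real pi * (\<Sum>n\<in>{1..<q}. of_real (pcoef (\<lambda>u. Re (h u)) q n) * c n)"
  unfolding \<phi>_def by (rule sums_unique2)
qed

text \<open>No character enters, so outside the locale this is a function of \<open>f\<close>,
  \<open>q\<close> and the parity \<open>a\<close> alone; that is what makes the constants
  comparable across characters.\<close>

definition gamma_const :: complex where
 "gamma_const = (LBINT t. G (Complex 2 t) * gamma_logderiv (Complex 2 t)) / of_real pi"

theorem W_sum_eq:
 "integrable lborel (\<lambda>t. G (Complex 2 t) * gamma_logderiv (Complex 2 t))"
 "W_sum f q chi = gamma_const - (\<Sum>n\<in>{1..<q}. of_real (pcoef (\<lambda>u. Re (h u)) q n) * (chin n + cnj (chin n)))"
proof -
 define P1 where "P1 = (\<lambda>t. G (Complex 2 t) * dseries (\<lambda>n. of_real (mang n) * chin n) (Complex 2 t))"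
 define P2 where "P2 = (\<lambda>t. G (Complex 2 t) * dseries (\<lambda>n. of_real (mang n) * cnj (chin n)) (Complex 2 t))"
 define g where "g = (\<lambda>t. G (Complex 2 t) * gamma_logderiv (Complex 2 t))"
 have c2: "norm (cnj (chin n)) \<le> 1" for n using chin(1)[of n] by simp
 have i: "integrable lborel P1" "integrable lborel P2"
  unfolding P1_def P2_def by (rule prime_integral_eq(1), rule chin(1), rule prime_integral_eq(1), rule c2)
 have K: "G (Complex 2 t) * (gamma_logderiv (Complex 2 t) - dseries (\<lambda>n. of_real (mang n) * chin n) (Complex 2 t) +
   (gamma_logderiv (Complex 2 t) - dseries (\<lambda>n. of_real (mang n) * cnj (chin n)) (Complex 2 t))) = 2 * g t - (P1 t + P2 t)" for t
 proof -
  have "x * (a - b + (a - c)) = 2 * (x * a) - (x * b + x * c)" for x a b c :: complex by (simp add: algebra_simps)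
  thus ?thesis unfolding g_def P1_def P2_def .
 qed
 note W = W_sum_eq_integral[unfolded K]
 \<comment> \<open>Integrability of the Gamma part comes out by subtraction: the total is integrable
   by the explicit formula, the prime parts by \<open>prime_integral_eq\<close>.\<close>
 have "integrable lborel (\<lambda>t. (1 / 2) * (2 * g t - (P1 t + P2 t) + (P1 t + P2 t)))"
  using W(1) i by (intro integrable_mult_right Bochner_Integration.integrable_add) auto
 thus g: "integrable lborel (\<lambda>t. G (Complex 2 t) * gamma_logderiv (Complex 2 t))" by (simp add: g_def)
 hence ig: "integrable lborel g" by (simp add: g_def)
 have "2 * of_real pi * W_sum f q chi = (LBINT t. 2 * g t - (P1 t + P2 t))" by (rule W(2))
 also have "\<dots> = 2 * (LBINT t. g t) - (prime_integral chin + prime_integral (\<lambda>n. cnj (chin n)))"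
 proof -
  have "prime_integral chin = (LBINT t. P1 t)" "prime_integral (\<lambda>n. cnj (chin n)) = (LBINT t. P2 t)"
   unfolding prime_integral_def P1_def P2_def by (rule refl)+
  thus ?thesis using ig i by simp
 qed
 also have "(LBINT t. g t) = of_real pi * gamma_const" by (simp add: gamma_const_def g_def)
 also have "2 * (of_real pi * gamma_const) - (prime_integral chin + prime_integral (\<lambda>n. cnj (chin n))) =
  2 * of_real pi * (gamma_const - (\<Sum>n\<in>{1..<q}. of_real (pcoef (\<lambda>u. Re (h u)) q n) * (chin n + cnj (chin n))))"
  unfolding prime_integral_eq(2)[of chin, OF chin(1)] prime_integral_eq(2)[of "\<lambda>n. cnj (chin n)", OF c2]
  by (simp only: distrib_left right_diff_distrib sum.distrib mult.assoc)
 finally show "W_sum f q chi = gamma_const - (\<Sum>n\<in>{1..<q}. of_real (pcoef (\<lambda>u. Re (h u)) q n) * (chin n + cnj (chin n)))"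
  by simp
qed

end

text \<open>Subtracting the two series leaves terms \<open>(1/2) / ((z + k) * (z + 1/2 + k))\<close>
  up to sign; both factors of the denominator have modulus at least \<open>(k + 1) / 4\<close>,
  which gives \<open>8 / (k + 1)\<^sup>2\<close>.\<close>

lemma Digamma_half_shift_bounded:
 assumes z: "Re z \<ge> 1 / 4"
 shows "norm (Digamma z - Digamma (z + 1 / 2)) \<le> 8 * (pi\<^sup>2 / 6)"
proof -
 have nz: "z + of_nat k \<noteq> 0" "z + 1 / 2 + of_nat k \<noteq> 0" for k using z by (auto simp: complex_eq_iff)
 have nz0: "z \<noteq> 0" "z + 1 / 2 \<noteq> 0" using nz(1)[of 0] nz(2)[of 0] by simp_all
 define a where "a = (\<lambda>z::complex. \<Sum>k. inverse (of_nat (Suc k)) - inverse (z + of_nat k))"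
 have "(\<lambda>k. (inverse (of_nat (Suc k)) - inverse (z + of_nat k)) - (inverse (of_nat (Suc k)) - inverse (z + 1 / 2 + of_nat k))) sums (a z - a (z + 1 / 2))"
  unfolding a_def by (intro sums_diff summable_sums summable_Digamma nz0)
 moreover have "a z - a (z + 1 / 2) = Digamma z - Digamma (z + 1 / 2)" by (simp add: a_def Digamma_def)
 ultimately have s: "(\<lambda>k. inverse (z + 1 / 2 + of_nat k) - inverse (z + of_nat k)) sums (Digamma z - Digamma (z + 1 / 2))" by simp
 have "(\<lambda>k. 8 * (1 / real ((k + 1)\<^sup>2))) sums (8 * (pi\<^sup>2 / 6))" by (intro sums_mult inverse_squares_sums)
 thus ?thesis
 proof (rule norm_sums_le[OF s])
  fix k
  define r where "r = (real k + 1) / 4"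
  have r: "r > 0" by (simp add: r_def)
  have lb: "r \<le> norm (z + of_nat k)" "r \<le> norm (z + 1 / 2 + of_nat k)"
   using z complex_Re_le_cmod[of "z + of_nat k"] complex_Re_le_cmod[of "z + 1 / 2 + of_nat k"] by (simp_all add: r_def)
  have "inverse (z + 1 / 2 + of_nat k) - inverse (z + of_nat k) = - ((1 / 2) / ((z + of_nat k) * (z + 1 / 2 + of_nat k)))"
   using nz[of k] by (simp add: field_simps)
  hence "norm (inverse (z + 1 / 2 + of_nat k) - inverse (z + of_nat k)) = (1 / 2) / (norm (z + of_nat k) * norm (z + 1 / 2 + of_nat k))"
   by (simp add: norm_divide norm_mult)
  also have "\<dots> \<le> (1 / 2) / (r * r)" using r lb by (intro divide_left_mono mult_mono mult_pos_pos) auto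
  also have "\<dots> = 8 * (1 / real ((k + 1)\<^sup>2))"
  proof -
   have "real ((k + 1)\<^sup>2) = (real k + 1) * (real k + 1)" by (simp add: power2_eq_square algebra_simps)
   thus ?thesis unfolding r_def by simp
  qed
  finally show "norm (inverse (z + 1 / 2 + of_nat k) - inverse (z + of_nat k)) \<le> 8 * (1 / real ((k + 1)\<^sup>2))" .
 qed
qed

text \<open>In the difference the conductor terms cancel and the function \<open>E\<close> remains,
  bounded for \<open>Re s \<ge> 1/2\<close>. On the line of real part 2 the test function
  \<open>G\<close> may be as large as a power of \<open>q\<close>, so the integral is moved to the
  critical line, where rescaling \<open>t\<close> produces the factor
  \<open>1 / ln q\<close>.\<close>

lemma gamma_const_parity:
 assumes "character_test f q 0 chi0" "character_test f q 1 chi1"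
 shows "norm (character_test.gamma_const f q 0 - character_test.gamma_const f q 1) \<le>
  8 * (pi\<^sup>2 / 6) * (LBINT x. norm (entire_extension f (of_real x))) / ln (real q)"
proof -
 interpret e: character_test f q 0 chi0 by (rule assms)
 interpret o: character_test f q 1 chi1 by (rule assms)
 define J where "J = (LBINT x. norm (entire_extension f (of_real x)))"
 define B where "B = 8 * (pi\<^sup>2 / 6)"
 define E where "E = (\<lambda>s::complex. Digamma (s / 2) - Digamma (s / 2 + 1 / 2))"
 have EB: "norm (E s) \<le> B" if "Re s \<ge> 1 / 2" for s
  unfolding E_def B_def by (rule Digamma_half_shift_bounded) (use that in simp)
 have E_hol: "E holomorphic_on {s. Re s > 0}"
 proof -
  have "Re z > 0 \<Longrightarrow> z \<notin> \<int>\<^sub>\<le>\<^sub>0" for z by (auto elim!: nonpos_Ints_cases')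
  hence D: "(Polygamma 0 \<circ> g) holomorphic_on {s. Re s > 0}" if "g holomorphic_on {s. Re s > 0}" "\<And>s. Re s > 0 \<Longrightarrow> Re (g s) > 0" for g
   by (intro holomorphic_on_compose_gen[OF that(1), of _ "{s. Re s > 0}"])
     (use that(2) in \<open>auto simp: holomorphic_on_def intro!: field_differentiable_Polygamma\<close>)
  have "(Polygamma 0 \<circ> (\<lambda>s. s / 2)) holomorphic_on {s. Re s > 0}" by (rule D) (auto intro!: holomorphic_intros)
  moreover have "(Polygamma 0 \<circ> (\<lambda>s. s / 2 + 1 / 2)) holomorphic_on {s. Re s > 0}" by (rule D) (auto intro!: holomorphic_intros)
  ultimately show ?thesis unfolding E_def o_def by (intro holomorphic_on_diff)
 qed
 obtain delta C where d: "delta > 0" and C: "C \<ge> 0" and bd: "\<And>s. - 1 \<le> Re s \<Longrightarrow> Re s \<le> 2 \<Longrightarrow> norm (e.G s) \<le> C * (1 + \<bar>Im s\<bar>) powr (- 1 - delta)"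
  by (rule e.G_decay) blast
 have "e.gamma_const - o.gamma_const = (LBINT t. e.G (Complex 2 t) * e.gamma_logderiv (Complex 2 t) - e.G (Complex 2 t) * o.gamma_logderiv (Complex 2 t)) / of_real pi"
  unfolding e.gamma_const_def o.gamma_const_def diff_divide_distrib[symmetric]
  by (subst Bochner_Integration.integral_diff[OF e.W_sum_eq(1) o.W_sum_eq(1)]) (rule refl)
 also have "(\<lambda>t. e.G (Complex 2 t) * e.gamma_logderiv (Complex 2 t) - e.G (Complex 2 t) * o.gamma_logderiv (Complex 2 t)) = (\<lambda>t. (1 / 2) * (e.G (Complex 2 t) * E (Complex 2 t)))"
  unfolding E_def e.gamma_logderiv_def o.gamma_logderiv_def by (rule ext) (simp add: add_divide_distrib algebra_simps)
 also have "(LBINT t. (1 / 2) * (e.G (Complex 2 t) * E (Complex 2 t))) = (1 / 2) * (LBINT t. e.G (Complex 2 t) * E (Complex 2 t))"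
  by (rule integral_mult_right_zero)
 also have "(LBINT t. e.G (Complex 2 t) * E (Complex 2 t)) = (LBINT t. e.G (Complex (1 / 2) t) * E (Complex (1 / 2) t))"
 proof (rule strip_shift[OF _ d open_halfspace_Re_gt[of 0], where C = "C * B", symmetric])
  show "(\<lambda>s. e.G s * E s) holomorphic_on {s. Re s > 0}"
   by (intro holomorphic_on_mult E_hol holomorphic_on_subset[OF e.G_entire]) auto
  fix s :: complex assume s: "1 / 2 \<le> Re s" "Re s \<le> 2"
  have "norm (e.G s * E s) \<le> C * (1 + \<bar>Im s\<bar>) powr (- 1 - delta) * B"
   unfolding norm_mult using s C by (intro mult_mono bd EB) auto
  thus "norm (e.G s * E s) \<le> C * B * (1 + \<bar>Im s\<bar>) powr (- 1 - delta)" by (simp only: mult_ac)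
 qed auto
 finally have k: "e.gamma_const - o.gamma_const = (1 / 2) * (LBINT t. e.G (Complex (1 / 2) t) * E (Complex (1 / 2) t)) / of_real pi" .
 have "norm (LBINT t. e.G (Complex (1 / 2) t) * E (Complex (1 / 2) t)) \<le> (LBINT t. norm (e.G (Complex (1 / 2) t)) * B)"
 proof (rule norm_integral_bound)
  show "integrable lborel (\<lambda>t. norm (e.G (Complex (1 / 2) t)) * B)"
   by (intro integrable_mult_left integrable_norm e.G_line_integrable) auto
  show "norm (e.G (Complex (1 / 2) t) * E (Complex (1 / 2) t)) \<le> norm (e.G (Complex (1 / 2) t)) * B" for t
   unfolding norm_mult by (intro mult_left_mono EB) auto
 qed
 also have "\<dots> = 2 * pi / ln (real q) * J * B"
  using e.G_critical_line_integral[of "\<lambda>x. norm (entire_extension f (of_real x))"]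
  unfolding e.G_critical_line J_def by simp
 finally have "norm (LBINT t. e.G (Complex (1 / 2) t) * E (Complex (1 / 2) t)) \<le> 2 * pi / ln (real q) * J * B" .
 hence "norm (LBINT t. e.G (Complex (1 / 2) t) * E (Complex (1 / 2) t)) / (2 * pi) \<le> (2 * pi / ln (real q) * J * B) / (2 * pi)"
  by (intro divide_right_mono) auto
 moreover have "norm (e.gamma_const - o.gamma_const) = norm (LBINT t. e.G (Complex (1 / 2) t) * E (Complex (1 / 2) t)) / (2 * pi)"
  unfolding k by (simp add: norm_divide norm_mult)
 ultimately show ?thesis by (simp add: B_def J_def mult_ac)
qed

section \<open>The variance\<close>

text \<open>The constant \<open>k\<close> drops out of the variance, so \<open>W\<close> may be
  replaced by \<open>e - S\<close> with \<open>norm (e x) \<le> eta\<close>. Since \<open>S\<close>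
  is real-valued, \<open>s2\<close> is also the mean of \<open>(norm (S x))\<^sup>2\<close>, and the
  cross term is controlled by \<open>norm (S x) \<le> 1 + (norm (S x))\<^sup>2\<close>.\<close>

lemma variance_approx:
 fixes W S :: "'a \<Rightarrow> complex" and X :: "'a set"
 defines "M \<equiv> \<lambda>g. 1 / of_nat (card X) * (\<Sum>x\<in>X. g x)"
 assumes N: "card X > 0" and W: "\<And>x. x \<in> X \<Longrightarrow> norm (W x - k + S x) \<le> eta"
  and S_real: "\<And>x. cnj (S x) = S x" and S2: "M (\<lambda>x. (S x)\<^sup>2) = of_real s2" and S1: "norm (M S) \<le> s1"
 shows "norm (M (\<lambda>x. (W x - M W)\<^sup>2) - of_real s2) \<le> eta\<^sup>2 + 2 * eta * (1 + s2) + (eta + s1)\<^sup>2"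
proof -
 define n where "n = real (card X)"
 have n: "n > 0" using N by (simp add: n_def)
 have eta: "eta \<ge> 0"
 proof -
  obtain x where "x \<in> X" using N by (metis card.empty ex_in_conv less_numeral_extra(3))
  thus ?thesis using W[of x] norm_ge_zero order_trans by blast
 qed
 have M_add: "M (\<lambda>x. g x + h x) = M g + M h" and M_cmult: "M (\<lambda>x. c * g x) = c * M g"
  and M_const: "M (\<lambda>x. c) = c" for g h c
  using N by (simp_all add: M_def sum.distrib add_divide_distrib sum_distrib_left mult_ac)
 have M_norm: "norm (M g) \<le> (\<Sum>x\<in>X. norm (g x)) / n" for g
  unfolding M_def norm_mult using norm_sum[of g X] n by (simp add: norm_divide n_def divide_right_mono)
 define e where "e = (\<lambda>x. W x - k + S x)"
 define V where "V = (\<lambda>x. e x + (- 1) * S x)"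
 have WV: "W x = k + V x" for x by (simp add: V_def e_def)
 have MW: "M W = k + M V" using M_add[of "\<lambda>_. k" V] M_const unfolding WV[abs_def, symmetric] by simp
 have "M (\<lambda>x. (W x - M W)\<^sup>2) = M (\<lambda>x. (V x)\<^sup>2 + ((- 2 * M V) * V x + (M V)\<^sup>2))"
  unfolding MW WV by (simp add: power2_eq_square algebra_simps)
 also have "\<dots> = M (\<lambda>x. (V x)\<^sup>2) - (M V)\<^sup>2"
  unfolding M_add M_cmult M_const by (simp add: power2_eq_square)
 also have "M (\<lambda>x. (V x)\<^sup>2) = M (\<lambda>x. ((e x)\<^sup>2 + (- 2) * (e x * S x)) + (S x)\<^sup>2)"
  unfolding V_def by (simp add: power2_eq_square algebra_simps)
 also have "\<dots> = M (\<lambda>x. (e x)\<^sup>2 + (- 2) * (e x * S x)) + of_real s2"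
  unfolding M_add[of "\<lambda>x. (e x)\<^sup>2 + (- 2) * (e x * S x)"] S2 ..
 finally have eq: "M (\<lambda>x. (W x - M W)\<^sup>2) - of_real s2 = M (\<lambda>x. (e x)\<^sup>2 + (- 2) * (e x * S x)) - (M V)\<^sup>2" by simp
 have "complex_of_real ((norm (S x))\<^sup>2) = (S x)\<^sup>2" for x
  using complex_norm_square[of "S x"] unfolding S_real by (simp only: power2_eq_square[of "S x"])
 hence "of_real ((\<Sum>x\<in>X. (norm (S x))\<^sup>2) / n) = M (\<lambda>x. (S x)\<^sup>2)"
  unfolding M_def n_def of_real_divide of_real_sum by simp
 hence S2': "(\<Sum>x\<in>X. (norm (S x))\<^sup>2) / n = s2" unfolding S2 of_real_eq_iff .
 have pt: "norm ((e x)\<^sup>2 + (- 2) * (e x * S x)) \<le> (eta\<^sup>2 + 2 * eta) + 2 * eta * (norm (S x))\<^sup>2" if "x \<in> X" for x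
 proof -
  have e: "norm (e x) \<le> eta" using W[OF that] by (simp add: e_def)
  have "norm (S x) \<le> 1 + (norm (S x))\<^sup>2"
   using zero_le_power2[of "norm (S x) - 1 / 2"] by (simp add: power2_eq_square algebra_simps)
  hence "norm (e x) * norm (S x) \<le> eta * (1 + (norm (S x))\<^sup>2)" using e eta by (intro mult_mono) auto
  moreover have "(norm (e x))\<^sup>2 \<le> eta\<^sup>2" using e by (intro power_mono) auto
  moreover have "norm ((e x)\<^sup>2 + (- 2) * (e x * S x)) \<le> (norm (e x))\<^sup>2 + 2 * (norm (e x) * norm (S x))"
   using norm_triangle_ineq[of "(e x)\<^sup>2" "(- 2) * (e x * S x)"] by (simp add: norm_mult norm_power)
  ultimately show ?thesis by (simp add: distrib_left)
 qed
 have "norm (M (\<lambda>x. (e x)\<^sup>2 + (- 2) * (e x * S x))) \<le> (\<Sum>x\<in>X. (eta\<^sup>2 + 2 * eta) + 2 * eta * (norm (S x))\<^sup>2) / n"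
  using n by (intro order_trans[OF M_norm] divide_right_mono sum_mono pt) auto
 also have "\<dots> = (eta\<^sup>2 + 2 * eta) + 2 * eta * ((\<Sum>x\<in>X. (norm (S x))\<^sup>2) / n)"
  using n by (simp add: sum.distrib sum_distrib_left[symmetric] n_def add_divide_distrib)
 finally have 1: "norm (M (\<lambda>x. (e x)\<^sup>2 + (- 2) * (e x * S x))) \<le> eta\<^sup>2 + 2 * eta * (1 + s2)"
  unfolding S2' by (simp add: distrib_left)
 have "norm (M e) \<le> (\<Sum>x\<in>X. eta) / n"
  using n W by (intro order_trans[OF M_norm] divide_right_mono sum_mono) (auto simp: e_def)
 hence "norm (M e) \<le> eta" using n by (simp add: n_def)
 moreover have "M V = M e + (- 1) * M S" unfolding V_def M_add M_cmult ..
 ultimately have "norm (M V) \<le> eta + s1" using S1 norm_triangle_ineq[of "M e" "- 1 * M S"] by simp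
 hence "norm ((M V)\<^sup>2) \<le> (eta + s1)\<^sup>2" unfolding norm_power by (intro power_mono) auto
 thus ?thesis unfolding eq using 1 norm_triangle_ineq4[of "M (\<lambda>x. (e x)\<^sup>2 + (- 2) * (e x * S x))" "(M V)\<^sup>2"] by linarith
qed

definition char_sum :: "nat \<Rightarrow> (nat \<Rightarrow> real) \<Rightarrow> (int \<Rightarrow> complex) \<Rightarrow> complex" where
 "char_sum q p chi = (\<Sum>n\<in>{1..<q}. of_real (p n) * (chi (int n) + cnj (chi (int n))))"

lemma cnj_char_sum: "cnj (char_sum q p chi) = char_sum q p chi"
 unfolding char_sum_def by (simp add: add.commute)

section \<open>First and second moments of the prime sum over characters\<close>

context
 fixes q :: nat
 assumes q: "prime q"
begin

lemma coprime_less: "n \<in> {1..<q} \<Longrightarrow> coprime (int n) (int q)"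
 using prime_nat_iff''[of q] q prime_imp_coprime[of q n] by (auto simp: coprime_commute dest: dvd_imp_le)

lemma nontrivial_characters_eq: "nontrivial_characters q = dchars q - {trivial_character q}"
 by (auto simp: nontrivial_characters_def dchars_def)

lemma sum_nontrivial_characters:
 "(\<Sum>chi\<in>nontrivial_characters q. g chi) = (\<Sum>chi\<in>dchars q. g chi) - (g (trivial_character q) :: complex)"
 unfolding nontrivial_characters_eq
 using trivial_character_dchar[of q] by (subst sum_diff1[OF finite_dchars[OF q]]) (simp add: dchars_def)

lemma card_nontrivial_characters: "card (nontrivial_characters q) = q - 2"
 unfolding nontrivial_characters_eq
 using card_Diff_singleton[of "trivial_character q" "dchars q"] trivial_character_dchar[of q] card_dchars[OF q]
 by (simp add: dchars_def)

text \<open>Conjugation at \<open>m\<close> is evaluation at an inverse of \<open>m\<close> modulo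
  \<open>q\<close>, so both formulas reduce to \<open>sum_dchars\<close>. Below \<open>q\<close>,
  congruence is equality.\<close>

lemma sum_dchars_less:
 assumes "n \<in> {1..<q}" "m \<in> {1..<q}"
 shows "(\<Sum>chi\<in>dchars q. chi (int n) * chi (int m)) = (if [n * m = 1] (mod q) then of_nat (q - 1) else 0)"
  "(\<Sum>chi\<in>dchars q. chi (int n) * cnj (chi (int m))) = (if n = m then of_nat (q - 1) else 0)"
proof -
 have c: "coprime (int n) (int q)" "coprime (int m) (int q)" using coprime_less assms by auto
 have "(\<Sum>chi\<in>dchars q. chi (int n) * chi (int m)) = (\<Sum>chi\<in>dchars q. chi (int (n * m)))"
  by (rule sum.cong) (simp_all add: dchars_def dchar_mult[OF q])
 also have "\<dots> = (if [int (n * m) = 1] (mod int q) then of_nat (q - 1) else 0)"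
  using c by (intro sum_dchars[OF q]) simp
 also have "[int (n * m) = 1] (mod int q) \<longleftrightarrow> [n * m = 1] (mod q)"
  using cong_int_iff[of "n * m" 1 q] by simp
 finally show "(\<Sum>chi\<in>dchars q. chi (int n) * chi (int m)) = (if [n * m = 1] (mod q) then of_nat (q - 1) else 0)" .
 obtain x where x: "[int m * x = 1] (mod int q)" using cong_solve_coprime_int[OF c(2)] by blast
 have xc: "coprime x (int q)" using x c(2) by (metis coprime_iff_invertible_int mult.commute)
 have cx: "chi (int n) * cnj (chi (int m)) = chi (int n * x)" if "chi \<in> dchars q" for chi
 proof -
  have chi: "dirichlet_character q chi" using that by (simp add: dchars_def)
  have "chi (int m) * chi x = 1"
   using dchar_cong[OF q chi x] dchar_mult[OF q chi] dchar_1[OF q chi] by simp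
  hence "cnj (chi (int m)) * (chi (int m) * chi x) = cnj (chi (int m))" by simp
  hence "chi x = cnj (chi (int m))"
   using dchar_cnj_mult[OF q chi c(2)] by (simp add: mult.assoc[symmetric] mult.commute[of "cnj _"])
  thus ?thesis by (simp add: dchar_mult[OF q chi])
 qed
 have "(\<Sum>chi\<in>dchars q. chi (int n) * cnj (chi (int m))) = (\<Sum>chi\<in>dchars q. chi (int n * x))"
  by (rule sum.cong[OF refl cx])
 also have "\<dots> = (if [int n * x = 1] (mod int q) then of_nat (q - 1) else 0)"
  using c xc by (intro sum_dchars[OF q]) simp
 also have "[int n * x = 1] (mod int q) \<longleftrightarrow> n = m"
 proof
  assume "[int n * x = 1] (mod int q)"
  hence "[int n * x = int m * x] (mod int q)" using x cong_sym cong_trans by blast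
  hence "[int n = int m] (mod int q)" using xc by (simp add: cong_mult_rcancel)
  hence "[n = m] (mod q)" by (simp add: cong_int_iff)
  thus "n = m" using assms by (simp add: cong_def)
 qed (use x in simp)
 finally show "(\<Sum>chi\<in>dchars q. chi (int n) * cnj (chi (int m))) = (if n = m then of_nat (q - 1) else 0)" .
qed

lemma char_sum_trivial: "char_sum q p (trivial_character q) = of_real (2 * (\<Sum>n\<in>{1..<q}. p n))"
 unfolding char_sum_def sum_distrib_left of_real_sum
proof (rule sum.cong[OF refl])
 fix n assume "n \<in> {1..<q}"
 thus "of_real (p n) * (trivial_character q (int n) + cnj (trivial_character q (int n))) = of_real (2 * p n)"
  using coprime_less[of n] by (simp add: trivial_character_def)
qed

text \<open>Over the full group only \<open>n = 1\<close> could survive, and its coefficient is 0;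
  what remains is minus the contribution of the trivial character.\<close>

lemma sum_char_sum:
 assumes "p 1 = 0"
 shows "(\<Sum>chi\<in>nontrivial_characters q. char_sum q p chi) = of_real (- 2 * (\<Sum>n\<in>{1..<q}. p n))"
proof -
 have z: "of_real (p n) * (\<Sum>chi\<in>dchars q. chi (int n)) = 0" if n: "n \<in> {1..<q}" for n
 proof (cases "n = 1")
  case False
  hence "\<not> [int n = 1] (mod int q)" using n cong_int_iff[of n 1 q] by (simp add: cong_def)
  thus ?thesis using sum_dchars[OF q coprime_less[OF n]] by simp
 qed (use assms in simp)
 have "(\<Sum>chi\<in>dchars q. char_sum q p chi) = (\<Sum>n\<in>{1..<q}. \<Sum>chi\<in>dchars q. of_real (p n) * (chi (int n) + cnj (chi (int n))))"
  unfolding char_sum_def by (rule sum.swap)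
 also have "\<dots> = (\<Sum>n\<in>{1..<q}. of_real (p n) * (\<Sum>chi\<in>dchars q. chi (int n)) + cnj (of_real (p n) * (\<Sum>chi\<in>dchars q. chi (int n))))"
  by (simp add: sum_distrib_left sum.distrib distrib_left)
 also have "\<dots> = 0" by (rule sum.neutral) (simp add: z)
 finally show ?thesis unfolding sum_nontrivial_characters char_sum_trivial by simp
qed

text \<open>Of the four products in \<open>(chi n + cnj (chi n)) * (chi m + cnj (chi m))\<close>,
  two detect \<open>n * m\<close> congruent to 1 and two detect \<open>n = m\<close>, whence the
  factors 2; the last term removes the trivial character.\<close>

lemma sum_char_sum_square:
 "(\<Sum>chi\<in>nontrivial_characters q. (char_sum q p chi)\<^sup>2) =
   of_real (real (q - 1) * (2 * (\<Sum>n\<in>{1..<q}. (p n)\<^sup>2) + 2 * (\<Sum>(n, m)\<in>{(n, m)\<in>{1..<q} \<times> {1..<q}. [n * m = 1] (mod q)}. p n * p m)) - 4 * (\<Sum>n\<in>{1..<q}. p n)\<^sup>2)"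
proof -
 define A where "A = {1..<q}"
 define u where "u = (\<lambda>n m. (if [n * m = 1] (mod q) then of_nat (q - 1) else 0) + (if n = m then of_nat (q - 1) else 0) :: real)"
 have inner: "(\<Sum>chi\<in>dchars q. (chi (int n) + cnj (chi (int n))) * (chi (int m) + cnj (chi (int m)))) = of_real (2 * u n m)"
  if "n \<in> A" "m \<in> A" for n m
 proof -
  have "(\<Sum>chi\<in>dchars q. (chi (int n) + cnj (chi (int n))) * (chi (int m) + cnj (chi (int m)))) =
   ((\<Sum>chi\<in>dchars q. chi (int n) * chi (int m)) + (\<Sum>chi\<in>dchars q. chi (int n) * cnj (chi (int m)))) +
   (cnj (\<Sum>chi\<in>dchars q. chi (int n) * cnj (chi (int m))) + cnj (\<Sum>chi\<in>dchars q. chi (int n) * chi (int m)))"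
   by (simp add: sum.distrib[symmetric] algebra_simps)
  thus ?thesis unfolding sum_dchars_less[OF that[unfolded A_def]] u_def by simp
 qed
 have "(\<Sum>chi\<in>dchars q. (char_sum q p chi)\<^sup>2) =
   (\<Sum>chi\<in>dchars q. \<Sum>n\<in>A. \<Sum>m\<in>A. of_real (p n * p m) * ((chi (int n) + cnj (chi (int n))) * (chi (int m) + cnj (chi (int m)))))"
  unfolding char_sum_def power2_eq_square sum_product A_def[symmetric] by (intro sum.cong refl) simp
 also have "\<dots> = (\<Sum>n\<in>A. \<Sum>m\<in>A. \<Sum>chi\<in>dchars q. of_real (p n * p m) * ((chi (int n) + cnj (chi (int n))) * (chi (int m) + cnj (chi (int m)))))"
  by (subst sum.swap, intro sum.cong refl, rule sum.swap)
 also have "\<dots> = (\<Sum>n\<in>A. \<Sum>m\<in>A. of_real (p n * p m * (2 * u n m)))"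
  by (intro sum.cong refl) (simp only: sum_distrib_left[symmetric] inner of_real_mult)
 also have "\<dots> = of_real (\<Sum>n\<in>A. \<Sum>m\<in>A. p n * p m * (2 * u n m))" by simp
 also have "(\<Sum>n\<in>A. \<Sum>m\<in>A. p n * p m * (2 * u n m)) =
   real (q - 1) * (2 * (\<Sum>n\<in>A. \<Sum>m\<in>A. if n = m then p n * p m else 0) + 2 * (\<Sum>n\<in>A. \<Sum>m\<in>A. if [n * m = 1] (mod q) then p n * p m else 0))"
  unfolding sum_distrib_left sum.distrib[symmetric] by (intro sum.cong refl) (simp add: u_def)
 also have "(\<Sum>n\<in>A. \<Sum>m\<in>A. if n = m then p n * p m else 0) = (\<Sum>n\<in>A. (p n)\<^sup>2)"
  by (intro sum.cong refl) (simp add: A_def power2_eq_square)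
 also have "(\<Sum>n\<in>A. \<Sum>m\<in>A. if [n * m = 1] (mod q) then p n * p m else 0) =
   (\<Sum>(n, m)\<in>{(n, m)\<in>A \<times> A. [n * m = 1] (mod q)}. p n * p m)"
  unfolding sum.cartesian_product by (rule sum.mono_neutral_cong_right) (auto simp: A_def split: if_splits)
 finally show ?thesis
  unfolding sum_nontrivial_characters char_sum_trivial A_def by (simp add: power_mult_distrib)
qed

end

section \<open>Assembly of the limit\<close>

context test_function
begin

definition phi :: "real \<Rightarrow> real" where "phi u = Re (h u)"

lemma phi: "continuous_on S phi" "phi 1 = 0"
 unfolding phi_def by (auto intro!: continuous_intros continuous_on_h simp: h_zero)

lemma W_sum_approx:
 assumes q: "prime q"
 shows "\<exists>k. \<forall>chi\<in>nontrivial_characters q. norm (W_sum f q chi - k + char_sum q (pcoef phi q) chi) \<le>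
  8 * (pi\<^sup>2 / 6) * (LBINT x. norm (F (of_real x))) / ln (real q)"
proof -
 define E where "E = 8 * (pi\<^sup>2 / 6) * (LBINT x. norm (F (of_real x))) / ln (real q)"
 have E: "E \<ge> 0" using prime_gt_1_nat[OF q] unfolding E_def
  by (intro divide_nonneg_nonneg mult_nonneg_nonneg Bochner_Integration.integral_nonneg) auto
 \<comment> \<open>\<open>gamma_const_parity\<close> takes a nontrivial character of each parity as
   witness. For \<open>q = 3\<close> there is no even one, and \<open>k\<close> falls back on the
   odd constant.\<close>
 define k where "k = character_test.gamma_const f q (if \<exists>chi. parity_character q 0 chi then 0 else 1)"
 have "norm (W_sum f q chi - k + char_sum q (pcoef phi q) chi) \<le> E" if chi: "chi \<in> nontrivial_characters q" for chi
 proof -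
  obtain a where a: "parity_character q a chi" by (rule parity_character_exists[OF q chi])
  have ct: "character_test f q b psi" if "parity_character q b psi" for b psi
   using that test_function_axioms by (intro character_test.intro)
  have "W_sum f q chi + char_sum q (pcoef phi q) chi = character_test.gamma_const f q a"
   unfolding character_test.W_sum_eq(2)[OF ct[OF a]] char_sum_def phi_def[abs_def] by simp
  hence eq: "W_sum f q chi - k + char_sum q (pcoef phi q) chi = character_test.gamma_const f q a - k" by (simp add: algebra_simps)
  have "a = 0 \<or> a = 1" using parity_character.a[OF a] by linarith
  thus ?thesis
  proof
   assume "a = 0"
   thus ?thesis unfolding eq using a E by (auto simp: k_def)
  next
   assume a1: "a = 1"
   show ?thesis
   proof (cases "\<exists>chi. parity_character q 0 chi")
    case True
    then obtain chi0 where "parity_character q 0 chi0" by blast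
    from gamma_const_parity[OF ct[OF this] ct[OF a[unfolded a1]]] show ?thesis
     unfolding eq using True by (simp add: k_def a1 E_def norm_minus_commute)
   next
    case False
    thus ?thesis unfolding eq using E a1 by (simp add: k_def)
   qed
  qed
 qed
 thus ?thesis unfolding E_def by blast
qed

lemma variance_limit_eq:
 "(LBINT u:{-1..1}. of_real \<bar>u\<bar> * (h u)\<^sup>2) = of_real (2 * integral {0..1} (\<lambda>u. u * (phi u)\<^sup>2))"
proof -
 define g where "g = (\<lambda>u. \<bar>u\<bar> * (phi u)\<^sup>2)"
 have g_cont: "continuous_on S g" for S unfolding g_def by (intro continuous_intros phi(1))
 have hg: "of_real \<bar>u\<bar> * (h u)\<^sup>2 = complex_of_real (g u)" for u
 proof -
  have "(h u)\<^sup>2 = of_real ((Re (h u))\<^sup>2)" unfolding of_real_power by (rule arg_cong[OF h_eq_Re])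
  thus ?thesis by (simp only: g_def phi_def of_real_mult)
 qed
 have "(LBINT u:{-1..1}. of_real \<bar>u\<bar> * (h u)\<^sup>2) = of_real (LBINT u:{-1..1}. g u)"
  unfolding hg by (rule set_integral_complex_of_real)
 also have "(LBINT u:{-1..1}. g u) = integral {-1..1} g"
  by (intro set_borel_integral_eq_integral(2) borel_integrable_atLeastAtMost' g_cont)
 also have "\<dots> = integral {-1..0} g + integral {0..1} g"
  by (rule Henstock_Kurzweil_Integration.integral_combine[symmetric]) (auto intro: integrable_continuous_real g_cont)
 also have "integral {-1..0} g = integral {0..1} g"
  using Henstock_Kurzweil_Integration.integral_reflect_real[of 1 0 g] by (simp add: g_def phi_def h_even)
 also have "integral {0..1} g = integral {0..1} (\<lambda>u. u * (phi u)\<^sup>2)"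
  by (rule integral_cong) (simp add: g_def)
 finally show ?thesis by simp
qed

text \<open>\<open>s2\<close> is the mean square of the prime sum: diagonal and inverse pairs, minus
  the share of the trivial character. That share is of order \<open>(T q)\<^sup>2 / q\<close> and
  tends to 0, as \<open>T q\<close> is of smaller order than \<open>sqrt q\<close>. The diagonal
  occurs with factor 2, from \<open>chi\<close> and its conjugate, which matches the two halves of
  \<open>[-1, 1]\<close> in the limit.\<close>

lemma variance_tendsto:
 "((\<lambda>q::nat. character_mean q (\<lambda>chi. (W_sum f q chi - character_mean q (W_sum f q))\<^sup>2))
   \<longlongrightarrow> of_real (2 * integral {0..1} (\<lambda>u. u * (phi u)\<^sup>2))) (inf at_top (principal {q. prime q \<and> odd q}))"
proof -
 define p where "p = pcoef phi"
 define I where "I = integral {0..1} (\<lambda>u. u * (phi u)\<^sup>2)"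
 define E where "E = 8 * (pi\<^sup>2 / 6) * (LBINT x. norm (F (of_real x)))"
 define eta where "eta = (\<lambda>q. E / ln (real q))"
 define P where "P = (\<lambda>q. \<Sum>(n, m)\<in>{(n, m)\<in>{1..<q} \<times> {1..<q}. [n * m = 1] (mod q)}. p q n * p q m)"
 define T where "T = (\<lambda>q. \<Sum>n\<in>{1..<q}. p q n)"
 define s1 where "s1 = (\<lambda>q. 2 * \<bar>T q\<bar> / real (q - 2))"
 define s2 where "s2 = (\<lambda>q. (real (q - 1) * (2 * (\<Sum>n\<in>{1..<q}. (p q n)\<^sup>2) + 2 * P q) - 4 * (T q)\<^sup>2) / real (q - 2))"
 define err where "err = (\<lambda>q. (eta q)\<^sup>2 + 2 * eta q * (1 + s2 q) + (eta q + s1 q)\<^sup>2)"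
 define V where "V = (\<lambda>q. character_mean q (\<lambda>chi. (W_sum f q chi - character_mean q (W_sum f q))\<^sup>2))"
 have bound: "norm (V q - of_real (s2 q)) \<le> err q" if q: "prime q" "odd q" for q
 proof -
  have q3: "q \<ge> 3" using q prime_ge_2_nat[of q] by (cases "q = 2") auto
  have c: "card (nontrivial_characters q) = q - 2" by (rule card_nontrivial_characters[OF q(1)])
  have cm: "character_mean q g = 1 / of_nat (card (nontrivial_characters q)) * (\<Sum>chi\<in>nontrivial_characters q. g chi)" for g
   using q3 by (simp add: character_mean_def c of_nat_diff)
  obtain k where k: "\<And>chi. chi \<in> nontrivial_characters q \<Longrightarrow> norm (W_sum f q chi - k + char_sum q (p q) chi) \<le> eta q"
   using W_sum_approx[OF q(1)] unfolding p_def eta_def E_def by blast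
  have p1: "p q 1 = 0" by (simp add: p_def pcoef_def)
  show ?thesis
   unfolding V_def cm err_def
  proof (rule variance_approx[OF _ k cnj_char_sum])
   show "1 / of_nat (card (nontrivial_characters q)) * (\<Sum>chi\<in>nontrivial_characters q. (char_sum q (p q) chi)\<^sup>2) = of_real (s2 q)"
    unfolding sum_char_sum_square[OF q(1)] c s2_def P_def T_def by simp
   show "norm (1 / of_nat (card (nontrivial_characters q)) * (\<Sum>chi\<in>nontrivial_characters q. char_sum q (p q) chi)) \<le> s1 q"
    unfolding sum_char_sum[OF q(1), of "p q", OF p1] c s1_def T_def norm_mult norm_of_real
    by (simp add: norm_divide abs_mult)
  qed (use q3 c in auto)
 qed
 have eta0: "eta \<longlonglongrightarrow> 0" unfolding eta_def by real_asymp
 have P0: "P \<longlonglongrightarrow> 0"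
 proof (rule Lim_null_comparison[OF always_eventually])
  show "(\<lambda>q. \<Sum>(n, m)\<in>{(n, m)\<in>{1..<q} \<times> {1..<q}. [n * m = 1] (mod q)}. \<bar>p q n\<bar> * \<bar>p q m\<bar>) \<longlonglongrightarrow> 0"
   unfolding p_def by (rule pcoef_inverse_pairs_tendsto[OF phi])
  show "\<forall>q. norm (P q) \<le> (\<Sum>(n, m)\<in>{(n, m)\<in>{1..<q} \<times> {1..<q}. [n * m = 1] (mod q)}. \<bar>p q n\<bar> * \<bar>p q m\<bar>)"
   unfolding P_def by (intro allI order_trans[OF norm_sum] sum_mono) (auto simp: abs_mult)
 qed
 have T0: "(\<lambda>q. T q / sqrt (real q)) \<longlonglongrightarrow> 0"
 proof (rule Lim_null_comparison[OF always_eventually])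
  show "(\<lambda>q. (\<Sum>n\<in>{1..<q}. \<bar>p q n\<bar>) / sqrt (real q)) \<longlonglongrightarrow> 0"
   unfolding p_def by (rule pcoef_abs_sum_tendsto[OF phi])
  show "\<forall>q. norm (T q / sqrt (real q)) \<le> (\<Sum>n\<in>{1..<q}. \<bar>p q n\<bar>) / sqrt (real q)"
   unfolding T_def real_norm_def abs_divide abs_of_nonneg[OF real_sqrt_ge_zero[OF of_nat_0_le_iff]]
   by (intro allI divide_right_mono sum_abs) simp
 qed
 have r: "(\<lambda>q. real (q - 1) / real (q - 2)) \<longlonglongrightarrow> 1" "(\<lambda>q. real q / real (q - 2)) \<longlonglongrightarrow> 1" "(\<lambda>q. sqrt (real q) / real (q - 2)) \<longlonglongrightarrow> 0"
  by real_asymp+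
 have "(\<lambda>q. real (q - 1) / real (q - 2) * (2 * (\<Sum>n\<in>{1..<q}. (p q n)\<^sup>2) + 2 * P q) - 4 * (T q / sqrt (real q))\<^sup>2 * (real q / real (q - 2)))
   \<longlonglongrightarrow> 1 * (2 * I + 2 * 0) - 4 * 0\<^sup>2 * 1"
  unfolding I_def p_def using r P0 T0 pcoef_square_sum_tendsto[OF phi] unfolding p_def by (intro tendsto_intros) auto
 moreover have "real (q - 1) / real (q - 2) * (2 * (\<Sum>n\<in>{1..<q}. (p q n)\<^sup>2) + 2 * P q) - 4 * (T q / sqrt (real q))\<^sup>2 * (real q / real (q - 2)) = s2 q" for q
 proof (cases "q = 0")
  case False
  have "a / d * A - 4 * (t / sqrt r)\<^sup>2 * (r / d) = (a * A - 4 * t\<^sup>2) / d" if "r > 0" for a d A t r :: real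
   using that by (simp add: power_divide diff_divide_distrib)
  thus ?thesis unfolding s2_def using False by simp
 qed (simp add: s2_def)
 ultimately have s2: "s2 \<longlonglongrightarrow> 2 * I" by simp
 have "(\<lambda>q. 2 * \<bar>T q / sqrt (real q)\<bar> * (sqrt (real q) / real (q - 2))) \<longlonglongrightarrow> 2 * \<bar>0\<bar> * 0"
  by (intro tendsto_intros T0 r)
 moreover have "2 * \<bar>T q / sqrt (real q)\<bar> * (sqrt (real q) / real (q - 2)) = s1 q" for q
  by (cases "q = 0") (simp_all add: s1_def)
 ultimately have s1: "s1 \<longlonglongrightarrow> 0" by simp
 have "err \<longlonglongrightarrow> 0\<^sup>2 + 2 * 0 * (1 + 2 * I) + (0 + 0)\<^sup>2"
  unfolding err_def by (intro tendsto_intros eta0 s1 s2)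
 hence err: "err \<longlonglongrightarrow> 0" by simp
 define \<F> where "\<F> = inf at_top (principal {q :: nat. prime q \<and> odd q})"
 have le: "\<F> \<le> at_top" by (simp add: \<F>_def)
 have "eventually (\<lambda>q. norm (V q - of_real (s2 q)) \<le> err q) \<F>"
  unfolding \<F>_def eventually_inf_principal using bound by (intro always_eventually) simp
 hence "((\<lambda>q. V q - of_real (s2 q)) \<longlongrightarrow> 0) \<F>"
  by (rule Lim_null_comparison) (rule tendsto_mono[OF le err])
 moreover have "((\<lambda>q. complex_of_real (s2 q)) \<longlongrightarrow> of_real (2 * I)) \<F>"
  by (intro tendsto_of_real tendsto_mono[OF le s2])
 ultimately have "((\<lambda>q. V q - of_real (s2 q) + of_real (s2 q)) \<longlongrightarrow> 0 + of_real (2 * I)) \<F>"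
  by (rule tendsto_add)
 thus ?thesis unfolding V_def I_def \<F>_def by simp
qed

end

theorem theorem4p1:
 fixes f :: "real \<Rightarrow> real"
 assumes "admissible f"
  and "supp (fourier f) \<subseteq> {-1..1}"
 shows "((\<lambda>q::nat. character_mean q (\<lambda>chi. (W_sum f q chi - character_mean q (W_sum f q))\<^sup>2))
      \<longlongrightarrow> (LBINT u:{-1..1}. of_real \<bar>u\<bar> * (fourier f u)\<^sup>2))
     (inf at_top (principal {q. prime q \<and> odd q}))"
proof -
 interpret test_function f using assms by unfold_locales
 show ?thesis unfolding variance_limit_eq by (rule variance_tendsto)
qed

end
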